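(* Let $h\in\{0,1\}$, let $k\ge 2$ be an integer, and let $n_1,n_2,n_3,n_4$ be positive integers with $\sum_{j=1}^4 n_j=2k+h$. Then there exists on the Hirzebruch surface $\mathbb{F}_h$ a real rational cuspidal curve of type $(k+1-h,3)$ with exactly four cusps, with cuspidal configuration $[2_{n_1}],[2_{n_2}],[2_{n_3}],[2_{n_4}]$, such that all four cusps have real coordinates.
   Context: For $e\ge 0$, $\mathbb{F}_e=\mathbb{P}(\mathscr{O}\oplus\mathscr{O}(-e))$ over $\mathbb{C}$, regarded as a toric surface with coordinate ring $\mathbb{C}[x_0,x_1,y_0,y_1]$ graded by $\mathbb{Z}^2$ with $\deg x_0=\deg x_1=(1,0)$, $\deg y_0=(0,1)$, $\deg y_1=(-e,1)$; points are written $(x_0:x_1;y_0:y_1)$ with $(x_0,x_1)\ne(0,0)$, $(y_0,y_1)\neq(0,0)$, modulo the corresponding $(\mathbb{C}^* )^2$-action. A curve of type $(a,b)$ is the zero set of a reduced and irreducible polynomial $F$ that is homogeneous of bidegree $(a,b)$. The curve is called real if the polynomial $F$ has real coefficients; a point has real coordinates if it can be written $(x_0:x_1;y_0:y_1)$ with all entries real. A cusp is a singular point at which the germ of the curve is (analytically) irreducible over $\mathbb{C}$; a curve is cuspidal if all its singularities are cusps, and rational if its geometric genus is $0$. The multiplicity sequence of a cusp is $[m,m_1,\ldots,m_{t-1}]$, where $m$ is its multiplicity, $t$ is the number of blowing ups in the local minimal embedded resolution of the cusp, and $m_i$ is the multiplicity of the strict transform at the $i$-th infinitely near point; ending $1$s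 are omitted, and a subscript denotes repetition, so $[2_n]$ is the sequence with $n$ entries equal to $2$ followed by omitted $1$s. The cuspidal configuration is the collection of multiplicity sequences of the cusps. *)

theory Defs
  imports
    "HOL-Library.Multiset"
    "HOL-Computational_Algebra.Computational_Algebra"
    "HOL-Algebra.Embedded_Algebras"
begin

section \<open>The Cox ring of a Hirzebruch surface\<close>

text \<open>
  Polynomials in \<open>x0, x1, y0, y1\<close> over the complex numbers; \<open>x0\<close> is the outermost variable
  and \<open>y1\<close> the innermost one.
\<close>

type_synonym cox_poly = "complex poly poly poly poly"

definition cox_coeff :: "cox_poly \<Rightarrow> nat \<Rightarrow> nat \<Rightarrow> nat \<Rightarrow> nat \<Rightarrow> complex" where
  "cox_coeff F i0 i1 j0 j1 =
     poly.coeff (poly.coeff (poly.coeff (poly.coeff F i0) i1) j0) j1"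

text \<open>The image of \<open>F\<close> under \<open>x0 \<mapsto> a0, x1 \<mapsto> a1, y0 \<mapsto> b0, y1 \<mapsto> b1\<close>, where the
  coefficients are mapped by \<open>\<phi>\<close>.\<close>

definition cox_subst ::
  "(complex \<Rightarrow> 'r::comm_ring_1) \<Rightarrow> 'r \<Rightarrow> 'r \<Rightarrow> 'r \<Rightarrow> 'r \<Rightarrow> cox_poly \<Rightarrow> 'r" where
  "cox_subst \<phi> a0 a1 b0 b1 F =
     poly (map_poly (\<lambda>G. poly (map_poly (\<lambda>H. poly (map_poly (\<lambda>L.
       poly (map_poly \<phi> L) b1) H) b0) G) a1) F) a0"

definition bihomogeneous :: "nat \<Rightarrow> int \<Rightarrow> int \<Rightarrow> cox_poly \<Rightarrow> bool" where
  "bihomogeneous e a b F \<longleftrightarrow>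
     (\<forall>i0 i1 j0 j1. cox_coeff F i0 i1 j0 j1 \<noteq> 0 \<longrightarrow>
        int i0 + int i1 - int e * int j1 = a \<and> int j0 + int j1 = b)"

text \<open>A curve is given by its defining polynomial, which is determined up to a nonzero constant;
  irreducible polynomials are in particular reduced.\<close>

definition curve_of_type :: "nat \<Rightarrow> int \<Rightarrow> int \<Rightarrow> cox_poly \<Rightarrow> bool" where
  "curve_of_type e a b F \<longleftrightarrow> Factorial_Ring.irreducible F \<and> bihomogeneous e a b F"

definition real_curve :: "cox_poly \<Rightarrow> bool" where
  "real_curve F \<longleftrightarrow> (\<forall>i0 i1 j0 j1. cox_coeff F i0 i1 j0 j1 \<in> \<real>)"


section \<open>Points\<close>

type_synonym cox_point = "complex \<times> complex \<times> complex \<times> complex"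

definition cox_points :: "cox_point set" where
  "cox_points = {(x0, x1, y0, y1). (x0, x1) \<noteq> (0, 0) \<and> (y0, y1) \<noteq> (0, 0)}"

definition torus_rel :: "nat \<Rightarrow> (cox_point \<times> cox_point) set" where
  "torus_rel e = {((x0, x1, y0, y1), (x0', x1', y0', y1')).
     (x0, x1, y0, y1) \<in> cox_points \<and> (x0', x1', y0', y1') \<in> cox_points \<and>
     (\<exists>l m. l \<noteq> 0 \<and> m \<noteq> 0 \<and>
        x0' = l * x0 \<and> x1' = l * x1 \<and> y0' = m * y0 \<and> y1' = m * y1 / l ^ e)}"

definition hirzebruch :: "nat \<Rightarrow> cox_point set set" where
  "hirzebruch e = cox_points // torus_rel e"

definition has_real_coordinates :: "cox_point set \<Rightarrow> bool" where
  "has_real_coordinates p \<longleftrightarrow>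
     (\<exists>(x0, x1, y0, y1) \<in> p. x0 \<in> \<real> \<and> x1 \<in> \<real> \<and> y0 \<in> \<real> \<and> y1 \<in> \<real>)"

definition curve_points :: "nat \<Rightarrow> cox_poly \<Rightarrow> cox_point set set" where
  "curve_points e F =
     {p \<in> hirzebruch e. \<exists>(x0, x1, y0, y1) \<in> p. cox_subst id x0 x1 y0 y1 F = 0}"


section \<open>Germs of plane curves\<close>

text \<open>Polynomials in two local coordinates \<open>s, t\<close>, with \<open>s\<close> the outer variable; such a polynomial
  represents its germ at the origin.\<close>

type_synonym local_poly = "complex poly poly"

definition cst :: "complex \<Rightarrow> local_poly" where "cst c = [:[:c:]:]"
definition var_s :: local_poly where "var_s = [:0, 1:]"
definition var_t :: local_poly where "var_t = [:[:0, 1:]:]"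

definition local_subst :: "local_poly \<Rightarrow> local_poly \<Rightarrow> local_poly \<Rightarrow> local_poly" where
  "local_subst a b f = poly (map_poly (\<lambda>q. poly (map_poly cst q) b) f) a"

text \<open>
  If \<open>x_i \<noteq> 0\<close> and \<open>y_j \<noteq> 0\<close> at a representative of a point, then keeping these two entries
  fixed and letting the other two vary gives a plane in the space of Cox coordinates which maps
  isomorphically onto the affine chart where \<open>x_i\<close> and \<open>y_j\<close> do not vanish. Restricting the
  defining polynomial to this plane therefore gives a local equation, centred at the point.
\<close>

fun local_equation :: "cox_poly \<Rightarrow> cox_point \<Rightarrow> local_poly" where
  "local_equation F (x0, x1, y0, y1) =
     (let (a0, a1) = (if x0 \<noteq> 0 then (cst x0, cst x1 + var_s) else (cst x0 + var_s, cst x1));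
          (b0, b1) = (if y0 \<noteq> 0 then (cst y0, cst y1 + var_t) else (cst y0 + var_t, cst y1))
      in cox_subst cst a0 a1 b0 b1 F)"

definition local_mult :: "local_poly \<Rightarrow> nat" where
  "local_mult f = (LEAST d. \<exists>i j. i + j = d \<and> poly.coeff (poly.coeff f i) j \<noteq> 0)"

text \<open>Irreducibility in the ring of formal power series in \<open>s, t\<close>, i.e. the completed local ring
  of the curve at the point is a domain.\<close>

definition analytically_irreducible :: "local_poly \<Rightarrow> bool" where
  "analytically_irreducible f \<longleftrightarrow>
     Factorial_Ring.irreducible (fps_of_poly (map_poly fps_of_poly f) :: complex fps fps)"


section \<open>Blowing up and multiplicity sequences\<close>

text \<open>
  Points of the exceptional curve of the blowing up of the origin: \<open>Some c\<close> is the direction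
  \<open>t = c * s\<close>, with local coordinates given by \<open>(s, t) = (s', s' * (t' + c))\<close>, and \<open>None\<close> is the
  direction \<open>s = 0\<close>, with \<open>(s, t) = (s' * t', t')\<close>.
\<close>

fun total_transform :: "complex option \<Rightarrow> local_poly \<Rightarrow> local_poly" where
  "total_transform (Some c) f = local_subst var_s (var_s * (var_t + cst c)) f"
| "total_transform None f = local_subst (var_s * var_t) var_t f"

fun exceptional :: "complex option \<Rightarrow> local_poly" where
  "exceptional (Some c) = var_s"
| "exceptional None = var_t"

definition strict_transform :: "complex option \<Rightarrow> local_poly \<Rightarrow> local_poly" where
  "strict_transform d f = total_transform d f div exceptional d ^ local_mult f"

text \<open>\<open>f\<close> is the strict transform of the curve and \<open>E\<close> a reduced equation of the exceptional
  divisor, both at a point of the strict transform.\<close>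

definition simple_normal_crossing :: "local_poly \<Rightarrow> local_poly \<Rightarrow> bool" where
  "simple_normal_crossing f E \<longleftrightarrow> local_mult f = 1 \<and>
     (local_mult E = 0 \<or>
      local_mult E = 1 \<and>
        poly.coeff (poly.coeff f 1) 0 * poly.coeff (poly.coeff E 0) 1 \<noteq>
        poly.coeff (poly.coeff f 0) 1 * poly.coeff (poly.coeff E 1) 0)"

text \<open>The multiplicities of the successive strict transforms that are blown up in the minimal
  embedded resolution of a unibranch germ. Such a germ has exactly one point infinitely near to it
  in each step.\<close>

inductive resolution_multiplicities :: "local_poly \<Rightarrow> local_poly \<Rightarrow> nat list \<Rightarrow> bool" where
  resolved: "simple_normal_crossing f E \<Longrightarrow> resolution_multiplicities f E []"
| blow_up: "\<not> simple_normal_crossing f E \<Longrightarrow>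
    poly.coeff (poly.coeff (strict_transform d f) 0) 0 = 0 \<Longrightarrow>
    resolution_multiplicities (strict_transform d f) (exceptional d * strict_transform d E) ms \<Longrightarrow>
    resolution_multiplicities f E (local_mult f # ms)"

definition omit_ending_ones :: "nat list \<Rightarrow> nat list" where
  "omit_ending_ones ms = rev (dropWhile (\<lambda>m. m = 1) (rev ms))"

definition has_multiplicity_sequence :: "cox_poly \<Rightarrow> cox_point set \<Rightarrow> nat list \<Rightarrow> bool" where
  "has_multiplicity_sequence F p ms \<longleftrightarrow>
     (\<exists>P\<in>p. \<exists>ns. resolution_multiplicities (local_equation F P) 1 ns \<and> ms = omit_ending_ones ns)"


section \<open>Cuspidal curves\<close>

definition singular_points :: "nat \<Rightarrow> cox_poly \<Rightarrow> cox_point set set" where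
  "singular_points e F = {p \<in> curve_points e F. \<exists>P\<in>p. 2 \<le> local_mult (local_equation F P)}"

definition cusps :: "nat \<Rightarrow> cox_poly \<Rightarrow> cox_point set set" where
  "cusps e F =
     {p \<in> singular_points e F. \<exists>P\<in>p. analytically_irreducible (local_equation F P)}"

definition cuspidal_curve :: "nat \<Rightarrow> cox_poly \<Rightarrow> bool" where
  "cuspidal_curve e F \<longleftrightarrow> singular_points e F \<subseteq> cusps e F"

definition has_cuspidal_configuration :: "nat \<Rightarrow> cox_poly \<Rightarrow> nat list multiset \<Rightarrow> bool" where
  "has_cuspidal_configuration e F M \<longleftrightarrow> finite (cusps e F) \<and>
     (\<exists>ms. (\<forall>p\<in>cusps e F. has_multiplicity_sequence F p (ms p)) \<and>
           M = image_mset ms (mset_set (cusps e F)))"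


section \<open>The genus of a function field\<close>

text \<open>
  Here \<open>K\<close> is a function field in one variable over an algebraically closed field \<open>k\<close> of
  constants. A place is represented by its normalised valuation, given on nonzero elements and set
  to 0 elsewhere; all places have degree 1. The genus is the maximum of \<open>deg D + 1 - dim L(D)\<close> over
  all divisors \<open>D\<close>, which exists by Riemann's theorem.
\<close>

definition places :: "('a, 'm) ring_scheme \<Rightarrow> 'a set \<Rightarrow> ('a \<Rightarrow> int) set" where
  "places K k = {v.
     (\<forall>x\<in>carrier K - {\<zero>\<^bsub>K\<^esub>}. \<forall>y\<in>carrier K - {\<zero>\<^bsub>K\<^esub>}.
        v (x \<otimes>\<^bsub>K\<^esub> y) = v x + v y \<and>
        (x \<oplus>\<^bsub>K\<^esub> y \<noteq> \<zero>\<^bsub>K\<^esub> \<longrightarrow> min (v x) (v y) \<le> v (x \<oplus>\<^bsub>K\<^esub> y))) \<and>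
     (\<forall>c\<in>k - {\<zero>\<^bsub>K\<^esub>}. v c = 0) \<and>
     (\<exists>x\<in>carrier K - {\<zero>\<^bsub>K\<^esub>}. v x = 1) \<and>
     (\<forall>x. x \<notin> carrier K - {\<zero>\<^bsub>K\<^esub>} \<longrightarrow> v x = 0)}"

definition divisors :: "('a, 'm) ring_scheme \<Rightarrow> 'a set \<Rightarrow> (('a \<Rightarrow> int) \<Rightarrow> int) set" where
  "divisors K k = {D. finite {v. D v \<noteq> 0} \<and> {v. D v \<noteq> 0} \<subseteq> places K k}"

definition divisor_degree :: "(('a \<Rightarrow> int) \<Rightarrow> int) \<Rightarrow> int" where
  "divisor_degree D = (\<Sum>v | D v \<noteq> 0. D v)"

definition riemann_roch_space ::
  "('a, 'm) ring_scheme \<Rightarrow> 'a set \<Rightarrow> (('a \<Rightarrow> int) \<Rightarrow> int) \<Rightarrow> 'a set" where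
  "riemann_roch_space K k D =
     {x \<in> carrier K. x = \<zero>\<^bsub>K\<^esub> \<or> (\<forall>v\<in>places K k. - D v \<le> v x)}"

definition function_field_genus :: "('a, 'm) ring_scheme \<Rightarrow> 'a set \<Rightarrow> int" where
  "function_field_genus K k =
     (SUP D\<in>divisors K k.
        divisor_degree D + 1 - int (ring.dim K k (riemann_roch_space K k D)))"


section \<open>The geometric genus of a curve\<close>

text \<open>
  Rational functions on the curve \<open>F = 0\<close> are fractions of bihomogeneous polynomials of the same
  bidegree whose denominator does not vanish identically on the curve, up to equality on the curve.
  The geometric genus, being the genus of the normalisation, is the genus of this field.
\<close>

definition fractions :: "nat \<Rightarrow> cox_poly \<Rightarrow> (cox_poly \<times> cox_poly) set" where
  "fractions e F = {(G, H).
     (\<exists>a b. bihomogeneous e a b G \<and> bihomogeneous e a b H) \<and> \<not> F dvd H}"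

definition fraction_rel ::
  "nat \<Rightarrow> cox_poly \<Rightarrow> ((cox_poly \<times> cox_poly) \<times> (cox_poly \<times> cox_poly)) set" where
  "fraction_rel e F = {((G, H), (G', H')).
     (G, H) \<in> fractions e F \<and> (G', H') \<in> fractions e F \<and> F dvd G * H' - G' * H}"

definition function_field :: "nat \<Rightarrow> cox_poly \<Rightarrow> (cox_poly \<times> cox_poly) set ring" where
  "function_field e F =
     \<lparr>carrier = fractions e F // fraction_rel e F,
      monoid.mult = (\<lambda>X Y. \<Union>(G, H)\<in>X. \<Union>(G', H')\<in>Y. fraction_rel e F `` {(G * G', H * H')}),
      one = fraction_rel e F `` {(1, 1)},
      zero = fraction_rel e F `` {(0, 1)},
      add = (\<lambda>X Y. \<Union>(G, H)\<in>X. \<Union>(G', H')\<in>Y.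
               fraction_rel e F `` {(G * H' + G' * H, H * H')})\<rparr>"

definition constants :: "nat \<Rightarrow> cox_poly \<Rightarrow> (cox_poly \<times> cox_poly) set set" where
  "constants e F = {fraction_rel e F `` {([:[:[:[:c:]:]:]:], 1)} | c. True}"

definition geometric_genus :: "nat \<Rightarrow> cox_poly \<Rightarrow> int" where
  "geometric_genus e F = function_field_genus (function_field e F) (constants e F)"

definition rational_curve :: "nat \<Rightarrow> cox_poly \<Rightarrow> bool" where
  "rational_curve e F \<longleftrightarrow> geometric_genus e F = 0"

end

theory Submission
  imports Defs "HOL-Computational_Algebra.Field_as_Ring"
begin

text \<open>
  The curve of type \<open>(1, 3)\<close> on the product of two projective lines given by \<open>pencil\<close> is the graph of
  a rational function \<open>z = P(t) / Q(t)\<close> of degree 3 with four real critical values \<open>z j\<close>. Over each \<open>z j\<close>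
  it has an unramified branch through \<open>t = q j\<close> and a branch which is simply tangent to the fibre.
  Performing \<open>n j\<close> elementary transformations along the unramified branch over \<open>z j\<close>, for all \<open>j\<close>,
  turns the tangent branch into a cusp \<open>[2_n]\<close> with \<open>n = n j\<close>, and creates no other singularities. The
  composition of the elementary transformations is a \<open>2 \<times> 2\<close> matrix \<open>N\<close> over the real polynomials in \<open>z\<close> with
  determinant \<open>\<delta> * (\<Prod>j<4. (z - z j) ^ n j)\<close>, whose degrees decide on which Hirzebruch surface the image lies.
  That the surface is the balanced one, \<open>h \<le> 1\<close>, is a nondegeneracy property of an interpolation
  problem. It is obtained for critical values close to a degenerate configuration, where two pairs of
  the \<open>q j\<close> collide and the interpolation problem becomes Pade approximation of a square root.
\<close>

section \<open>Evaluation homomorphisms\<close>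

text \<open>A row of \<open>N\<close> is a combination \<open>\<alpha>(z) + \<beta>(z) t\<close>
  vanishing to order \<open>n j\<close> at \<open>q j\<close>. For an even total \<open>2k\<close>
  the surface is balanced once no nonzero row has degree below \<open>k\<close>: as many linear
  conditions as unknowns. The determinant of this system is never computed; nonzero solutions are
  excluded in the limit \<open>a = 1\<close>. There the cubic map loses the factor
  \<open>t - 1\<close> and becomes \<open>1 / (t^2 + 1)\<close>, so the conditions at the merging
  points \<open>a\<close> and \<open>1\<close> would be lost. They are kept in a coordinate that
  fixes these points at 0 and 1. What remains is a pair \<open>A, B\<close> with
  \<open>A(t^2) + t B(t^2)\<close> of high order at -1 and \<open>A + B\<close> vanishing at 0 and
  at infinity. The Euler operators \<open>t d/dt - 2l\<close> remove the even powers of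
  \<open>t\<close>, each at the cost of one order, and leave an odd polynomial with more zeros than
  its degree. This count needs the exponents of the pair merging at 1 to have sum at most
  \<open>k\<close>, hence the sorting in the final proof. Geometry of the image curve
  \<open>F\<close> is read off from the single identity \<open>F(N Y) = det(N)^2 pencil(Y)\<close>:
  smoothness off the four fibres, the normal form of the cusps, irreducibility and the
  parametrisation.\<close>

definition rhom :: "('a::comm_ring_1 \<Rightarrow> 'b::comm_ring_1) \<Rightarrow> bool" where
  "rhom f \<longleftrightarrow> f 1 = 1 \<and> (\<forall>x y. f (x + y) = f x + f y) \<and> (\<forall>x y. f (x * y) = f x * f y)"

lemma rhom_1: "rhom f \<Longrightarrow> f 1 = 1"
  and rhom_add: "rhom f \<Longrightarrow> f (x + y) = f x + f y"
  and rhom_mult: "rhom f \<Longrightarrow> f (x * y) = f x * f y"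
  by (auto simp: rhom_def)

lemma rhom_0: assumes "rhom f" shows "f 0 = 0"
  using rhom_add[OF assms, of 0 0] by simp

lemma rhom_uminus: assumes "rhom f" shows "f (- x) = - f x"
  using rhom_add[OF assms, of x "- x"] rhom_0[OF assms] by (simp add: eq_neg_iff_add_eq_0 add.commute)

lemma rhom_diff: "rhom f \<Longrightarrow> f (x - y) = f x - f y"
  using rhom_add[of f x "- y"] rhom_uminus[of f y] by simp

lemma rhom_power: "rhom f \<Longrightarrow> f (x ^ n) = f x ^ n"
  by (induct n) (simp_all add: rhom_1 rhom_mult)

lemma rhom_sum: "rhom f \<Longrightarrow> f (sum g A) = (\<Sum>x\<in>A. f (g x))"
  by (induct A rule: infinite_finite_induct) (simp_all add: rhom_0 rhom_add)

lemma rhom_prod: "rhom f \<Longrightarrow> f (prod g A) = (\<Prod>x\<in>A. f (g x))"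
  by (induct A rule: infinite_finite_induct) (simp_all add: rhom_1 rhom_mult)

lemma rhom_dvd: "rhom f \<Longrightarrow> x dvd y \<Longrightarrow> f x dvd f y"
  by (auto simp: rhom_mult elim!: dvdE)

lemmas rhom_simps = rhom_0 rhom_1 rhom_add rhom_diff rhom_uminus rhom_mult rhom_power rhom_sum rhom_prod

lemma rhom_id [simp]: "rhom id" "rhom (\<lambda>x. x)"
  by (auto simp: rhom_def)

lemma rhom_comp: "rhom f \<Longrightarrow> rhom g \<Longrightarrow> rhom (\<lambda>x. g (f x))"
  by (auto simp: rhom_def)

lemma rhom_const_poly: "rhom f \<Longrightarrow> rhom (\<lambda>c. [:f c:])"
  by (auto simp: rhom_def one_pCons)

lemma rhom_map_poly: assumes "rhom f" shows "rhom (map_poly f)"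
proof -
  have c: "poly.coeff (map_poly f p) i = f (poly.coeff p i)" for p i
    by (simp add: coeff_map_poly rhom_0[OF assms])
  show ?thesis unfolding rhom_def
    by (auto simp: poly_eq_iff c coeff_mult rhom_simps[OF assms] map_poly_1')
qed

lemma rhom_poly: "rhom (\<lambda>p. poly p a)"
  by (auto simp: rhom_def)

lemma rhom_eval: "rhom f \<Longrightarrow> rhom (\<lambda>p. poly (map_poly f p) a)"
  by (rule rhom_comp[OF rhom_map_poly rhom_poly])

lemma map_poly_pCons_rhom: "rhom f \<Longrightarrow> map_poly f (pCons c p) = pCons (f c) (map_poly f p)"
  by (rule poly_eqI) (auto simp: coeff_map_poly rhom_0 coeff_pCons split: nat.split)

lemma poly_map_poly_bound:
  assumes "rhom f" "degree p \<le> n"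
  shows "poly (map_poly f p) a = (\<Sum>i\<le>n. f (poly.coeff p i) * a ^ i)"
proof -
  have "degree (map_poly f p) \<le> n"
    using assms degree_map_poly[of f p] map_poly_degree_leq[of f p] by (simp add: rhom_0)
  then have "poly (map_poly f p) a = (\<Sum>i\<le>n. poly.coeff (map_poly f p) i * a ^ i)"
    unfolding poly_altdef by (intro sum.mono_neutral_left) (auto simp: coeff_eq_0)
  then show ?thesis
    by (simp add: coeff_map_poly rhom_0[OF assms(1)])
qed

lemma rhom_cox_subst: assumes "rhom f" shows "rhom (cox_subst f a0 a1 b0 b1)"
proof -
  have 1: "rhom (\<lambda>L. poly (map_poly f L) b1)" by (rule rhom_eval[OF assms])
  have 2: "rhom (\<lambda>H. poly (map_poly (\<lambda>L. poly (map_poly f L) b1) H) b0)" by (rule rhom_eval[OF 1])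
  have 3: "rhom (\<lambda>G. poly (map_poly (\<lambda>H. poly (map_poly (\<lambda>L. poly (map_poly f L) b1) H) b0) G) a1)"
    by (rule rhom_eval[OF 2])
  show ?thesis unfolding cox_subst_def[abs_def] by (rule rhom_eval[OF 3])
qed

section \<open>Generators of the Cox ring and identities between substitutions\<close>

definition ck :: "complex \<Rightarrow> cox_poly" where "ck c = [:[:[:[:c:]:]:]:]"
definition cx0 :: cox_poly where "cx0 = [:0, 1:]"
definition cx1 :: cox_poly where "cx1 = [:[:0, 1:]:]"
definition cy0 :: cox_poly where "cy0 = [:[:[:0, 1:]:]:]"
definition cy1 :: cox_poly where "cy1 = [:[:[:[:0, 1:]:]:]:]"

lemma cox_subst_gens:
  assumes "rhom f"
  shows "cox_subst f a0 a1 b0 b1 (ck c) = f c" "cox_subst f a0 a1 b0 b1 cx0 = a0"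
    "cox_subst f a0 a1 b0 b1 cx1 = a1" "cox_subst f a0 a1 b0 b1 cy0 = b0"
    "cox_subst f a0 a1 b0 b1 cy1 = b1"
  by (simp_all add: cox_subst_def ck_def cx0_def cx1_def cy0_def cy1_def map_poly_pCons
      rhom_simps[OF assms])

lemma rhom_ck: "rhom ck"
  unfolding ck_def[abs_def] by (intro rhom_const_poly rhom_id)

lemma poly_ring_induct:
  fixes p :: "'a::comm_ring_1 poly"
  assumes "\<And>c. P [:c:]" "P [:0, 1:]" "\<And>p q. P p \<Longrightarrow> P q \<Longrightarrow> P (p + q)"
    "\<And>p q. P p \<Longrightarrow> P q \<Longrightarrow> P (p * q)"
  shows "P p"
proof (induct p)
  case 0 show ?case using assms(1)[of 0] by simp
next
  case (pCons a p)
  have "pCons a p = [:a:] + [:0, 1:] * p" by simp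
  then show ?case using assms pCons by metis
qed

text \<open>The Cox ring is generated by the constants and the four variables, so identities between
  substitutions are checked on generators, without touching the nested coefficients.\<close>

lemma cox_poly_induct [case_names ck cx0 cx1 cy0 cy1 add mult]:
  assumes k: "\<And>c. P (ck c)" and x: "P cx0" "P cx1" "P cy0" "P cy1"
    and add: "\<And>p q. P p \<Longrightarrow> P q \<Longrightarrow> P (p + q)" and mult: "\<And>p q. P p \<Longrightarrow> P q \<Longrightarrow> P (p * q)"
  shows "P F"
proof -
  have 1: "P [:[:[:p:]:]:]" for p
  proof (induct p rule: poly_ring_induct)
    case (3 p q) from add[OF 3] show ?case by simp
  next
    case (4 p q) from mult[OF 4] show ?case by (simp add: mult.commute)
  qed (use k x in \<open>auto simp: ck_def cy1_def\<close>)
  have 2: "P [:[:p:]:]" for p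
  proof (induct p rule: poly_ring_induct)
    case (3 p q) from add[OF 3] show ?case by simp
  next
    case (4 p q) from mult[OF 4] show ?case by (simp add: mult.commute)
  qed (use 1 x in \<open>auto simp: cy0_def\<close>)
  have 3: "P [:p:]" for p
  proof (induct p rule: poly_ring_induct)
    case (3 p q) from add[OF 3] show ?case by simp
  next
    case (4 p q) from mult[OF 4] show ?case by (simp add: mult.commute)
  qed (use 2 x in \<open>auto simp: cx1_def\<close>)
  show ?thesis
    by (induct F rule: poly_ring_induct) (use 3 x add mult in \<open>auto simp: cx0_def\<close>)
qed

text \<open>This transports identities to any ring: they are proved once with indeterminates, where
  nonzero factors can be cancelled, and then evaluated where such a factor may vanish.\<close>

lemma rhom_cox_subst_comp:
  assumes "rhom f" "rhom g"
  shows "g (cox_subst f a0 a1 b0 b1 F) = cox_subst (\<lambda>c. g (f c)) (g a0) (g a1) (g b0) (g b1) F"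
  by (induct F rule: cox_poly_induct)
    (simp_all add: cox_subst_gens assms rhom_comp[OF assms] rhom_simps[OF assms(2)]
      rhom_simps[OF rhom_cox_subst[OF assms(1)]] rhom_simps[OF rhom_cox_subst[OF rhom_comp[OF assms]]])

lemma cox_subst_self: "cox_subst ck cx0 cx1 cy0 cy1 F = F"
  by (induct F rule: cox_poly_induct)
    (simp_all add: cox_subst_gens rhom_ck rhom_simps[OF rhom_cox_subst[OF rhom_ck]])

text \<open>Substitution is polynomial in the four entries and so respects congruences. It serves
  with \<open>d\<close> the square of a parameter, for first order computations along arcs, and with
  \<open>d\<close> a generator of the kernel of a substitution.\<close>

lemma cox_subst_cong_dvd:
  fixes d :: "'r::comm_ring_1"
  assumes f: "rhom f" and d: "d dvd a0 - a0'" "d dvd a1 - a1'" "d dvd b0 - b0'" "d dvd b1 - b1'"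
  shows "d dvd cox_subst f a0 a1 b0 b1 F - cox_subst f a0' a1' b0' b1' F"
proof (induct F rule: cox_poly_induct)
  case (add p q)
  then have "d dvd (cox_subst f a0 a1 b0 b1 p - cox_subst f a0' a1' b0' b1' p) +
    (cox_subst f a0 a1 b0 b1 q - cox_subst f a0' a1' b0' b1' q)" by (rule dvd_add)
  then show ?case by (simp add: rhom_add[OF rhom_cox_subst[OF f]] algebra_simps)
next
  case (mult p q)
  then have "d dvd (cox_subst f a0 a1 b0 b1 p - cox_subst f a0' a1' b0' b1' p) * cox_subst f a0 a1 b0 b1 q +
    cox_subst f a0' a1' b0' b1' p * (cox_subst f a0 a1 b0 b1 q - cox_subst f a0' a1' b0' b1' q)" by simp
  then show ?case by (simp add: rhom_mult[OF rhom_cox_subst[OF f]] algebra_simps)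
qed (use d in \<open>simp_all add: cox_subst_gens f\<close>)

text \<open>The complex numbers are infinite, so vanishing for all values of one variable kills
  every coefficient; the variables are peeled off from the outside in.\<close>

lemma cox_poly_eq_0I:
  assumes "\<And>x0 x1 y0 y1. cox_subst id x0 x1 y0 y1 F = 0"
  shows "F = 0"
proof -
  define e1 where "e1 b1 L = poly L b1" for b1 :: complex and L :: "complex poly"
  define e2 where "e2 b0 b1 H = poly (map_poly (e1 b1) H) b0" for b0 b1 and H :: "complex poly poly"
  define e3 where "e3 a1 b0 b1 G = poly (map_poly (e2 b0 b1) G) a1" for a1 b0 b1 and G :: "complex poly poly poly"
  have h1: "rhom (e1 b1)" for b1 unfolding e1_def[abs_def] by (rule rhom_poly)
  have h2: "rhom (e2 b0 b1)" for b0 b1 unfolding e2_def[abs_def] by (rule rhom_eval[OF h1])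
  have h3: "rhom (e3 a1 b0 b1)" for a1 b0 b1 unfolding e3_def[abs_def] by (rule rhom_eval[OF h2])
  have z: "g (poly.coeff p i) = 0" if "\<And>x. poly (map_poly g p) x = 0" "rhom g"
    for g :: "'a::comm_ring_1 \<Rightarrow> complex" and p i
  proof -
    have "map_poly g p = 0" using that(1) poly_all_0_iff_0 by blast
    then show ?thesis using coeff_map_poly[of g p i] rhom_0[OF that(2)] by simp
  qed
  have 1: "L = 0" if "\<And>b1. e1 b1 L = 0" for L
    using that poly_all_0_iff_0 unfolding e1_def by blast
  have 2: "H = 0" if "\<And>b0 b1. e2 b0 b1 H = 0" for H
    by (rule poly_eqI) (use z[OF that[unfolded e2_def] h1] 1 in force)
  have 3: "G = 0" if "\<And>a1 b0 b1. e3 a1 b0 b1 G = 0" for G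
    by (rule poly_eqI) (use z[OF that[unfolded e3_def] h2] 2 in force)
  have 4: "cox_subst id a0 a1 b0 b1 F = poly (map_poly (e3 a1 b0 b1) F) a0" for a0 a1 b0 b1
    by (simp add: cox_subst_def e3_def[abs_def] e2_def[abs_def] e1_def[abs_def])
  show ?thesis
    by (rule poly_eqI) (use z[OF assms[unfolded 4] h3] 3 in force)
qed

section \<open>Homogeneity\<close>

lemma cox_coeff_add: "cox_coeff (F + G) i0 i1 j0 j1 = cox_coeff F i0 i1 j0 j1 + cox_coeff G i0 i1 j0 j1"
  by (simp add: cox_coeff_def)

lemma cox_coeff_0 [simp]: "cox_coeff 0 i0 i1 j0 j1 = 0"
  by (simp add: cox_coeff_def)

lemma cox_coeff_diff: "cox_coeff (F - G) i0 i1 j0 j1 = cox_coeff F i0 i1 j0 j1 - cox_coeff G i0 i1 j0 j1"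
  by (simp add: cox_coeff_def)

lemma cox_coeff_mult: "cox_coeff (F * G) i0 i1 j0 j1 =
   (\<Sum>p0\<le>i0. \<Sum>p1\<le>i1. \<Sum>q0\<le>j0. \<Sum>q1\<le>j1.
     cox_coeff F p0 p1 q0 q1 * cox_coeff G (i0 - p0) (i1 - p1) (j0 - q0) (j1 - q1))"
  by (simp add: cox_coeff_def coeff_mult coeff_sum)

lemma bihomogeneous_add: "bihomogeneous e a b F \<Longrightarrow> bihomogeneous e a b G \<Longrightarrow> bihomogeneous e a b (F + G)"
  unfolding bihomogeneous_def by (metis add.right_neutral cox_coeff_add)

lemma bihomogeneous_diff: "bihomogeneous e a b F \<Longrightarrow> bihomogeneous e a b G \<Longrightarrow> bihomogeneous e a b (F - G)"
  unfolding bihomogeneous_def by (metis diff_self cox_coeff_diff)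

lemma bihomogeneous_0 [simp]: "bihomogeneous e a b 0"
  by (simp add: bihomogeneous_def)

lemma bihomogeneous_sum: "(\<And>x. x \<in> A \<Longrightarrow> bihomogeneous e a b (g x)) \<Longrightarrow> bihomogeneous e a b (sum g A)"
  by (induct A rule: infinite_finite_induct) (auto intro: bihomogeneous_add)

lemma bihomogeneous_mult:
  assumes "bihomogeneous e a b F" "bihomogeneous e a' b' G"
  shows "bihomogeneous e (a + a') (b + b') (F * G)"
  unfolding bihomogeneous_def
proof (intro allI impI)
  fix i0 i1 j0 j1 assume "cox_coeff (F * G) i0 i1 j0 j1 \<noteq> 0"
  then obtain p0 p1 q0 q1 where le: "p0 \<le> i0" "p1 \<le> i1" "q0 \<le> j0" "q1 \<le> j1"
    and nz: "cox_coeff F p0 p1 q0 q1 * cox_coeff G (i0 - p0) (i1 - p1) (j0 - q0) (j1 - q1) \<noteq> 0"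
    unfolding cox_coeff_mult by (elim sum.not_neutral_contains_not_neutral) (simp only: atMost_iff)
  obtain r0 r1 s0 s1 where eq: "i0 = p0 + r0" "i1 = p1 + r1" "j0 = q0 + s0" "j1 = q1 + s1"
    using le by (metis le_iff_add)
  have "int p0 + int p1 - int e * int q1 = a \<and> int q0 + int q1 = b"
    by (rule assms(1)[unfolded bihomogeneous_def, rule_format]) (use nz in simp)
  moreover have "int r0 + int r1 - int e * int s1 = a' \<and> int s0 + int s1 = b'"
    by (rule assms(2)[unfolded bihomogeneous_def, rule_format]) (use nz eq in simp)
  ultimately show "int i0 + int i1 - int e * int j1 = a + a' \<and> int j0 + int j1 = b + b'"
    unfolding eq by (simp add: algebra_simps)
qed

lemma bihomogeneous_gens:
  "bihomogeneous e 0 0 (ck c)" "bihomogeneous e 0 0 1" "bihomogeneous e 1 0 cx0" "bihomogeneous e 1 0 cx1"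
  "bihomogeneous e 0 1 cy0" "bihomogeneous e (- int e) 1 cy1"
  by (auto simp: bihomogeneous_def cox_coeff_def ck_def cx0_def cx1_def cy0_def cy1_def coeff_pCons one_pCons
      split: nat.splits)

lemma bihomogeneous_power:
  "bihomogeneous e a b F \<Longrightarrow> bihomogeneous e (int n * a) (int n * b) (F ^ n)"
proof (induct n)
  case (Suc n)
  from bihomogeneous_mult[OF Suc(2) Suc(1)[OF Suc(2)]] show ?case by (simp add: algebra_simps)
qed (simp add: bihomogeneous_gens)

text \<open>The bound \<open>n\<close> depends on \<open>F\<close> only, so two different
  substitutions can be expanded over the same index set and compared term by term.\<close>

lemma cox_subst_expand:
  "\<exists>n. \<forall>(f :: complex \<Rightarrow> 'r::comm_ring_1) a0 a1 b0 b1. rhom f \<longrightarrow> cox_subst f a0 a1 b0 b1 F =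
     (\<Sum>i0\<le>n. \<Sum>i1\<le>n. \<Sum>j0\<le>n. \<Sum>j1\<le>n. f (cox_coeff F i0 i1 j0 j1) * b1 ^ j1 * b0 ^ j0 * a1 ^ i1 * a0 ^ i0)"
proof -
  have fin: "\<exists>n. \<forall>i. d (poly.coeff p i) \<le> n" for d :: "'a::comm_ring_1 \<Rightarrow> nat" and p
  proof -
    have "range (poly.coeff p) \<subseteq> insert 0 (poly.coeff p ` {..degree p})"
    proof
      fix x assume "x \<in> range (poly.coeff p)"
      then obtain i where "x = poly.coeff p i" by blast
      then show "x \<in> insert 0 (poly.coeff p ` {..degree p})"
        by (cases "i \<le> degree p") (auto simp: coeff_eq_0)
    qed
    then have "finite (range (poly.coeff p))" by (rule finite_subset) simp
    then have "finite (d ` range (poly.coeff p))" by simp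
    then obtain n where "\<forall>x\<in>d ` range (poly.coeff p). x \<le> n" using finite_nat_set_iff_bounded_le by blast
    then show ?thesis by blast
  qed
  define d1 where "d1 L = degree L" for L :: "complex poly"
  have "\<forall>H. \<exists>n. \<forall>i. d1 (poly.coeff H i) \<le> n" using fin by blast
  then obtain n1 where n1: "\<And>H i. d1 (poly.coeff H i) \<le> n1 H" by metis
  define d2 where "d2 H = max (degree H) (n1 H)" for H
  have "\<forall>G. \<exists>n. \<forall>i. d2 (poly.coeff G i) \<le> n" using fin by blast
  then obtain n2 where n2: "\<And>H i. d2 (poly.coeff H i) \<le> n2 H" by metis
  define d3 where "d3 H = max (degree H) (n2 H)" for H
  obtain n3 where n3: "\<And>i. d3 (poly.coeff F i) \<le> n3" using fin by blast
  define n where "n = max (degree F) n3"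
  have D: "degree F \<le> n" "degree (poly.coeff F i) \<le> n" "degree (poly.coeff (poly.coeff F i) j) \<le> n"
    "degree (poly.coeff (poly.coeff (poly.coeff F i) j) l) \<le> n" for i j l
  proof -
    show "degree F \<le> n" by (simp add: n_def)
    have a: "d3 (poly.coeff F i) \<le> n" for i using n3[of i] by (simp add: n_def)
    then show "degree (poly.coeff F i) \<le> n" by (simp add: d3_def)
    have b: "d2 (poly.coeff (poly.coeff F i) j) \<le> n" for i j
      using n2[of "poly.coeff F i" j] a[of i] by (simp add: d3_def)
    then show "degree (poly.coeff (poly.coeff F i) j) \<le> n" by (simp add: d2_def)
    show "degree (poly.coeff (poly.coeff (poly.coeff F i) j) l) \<le> n"
      using n1[of "poly.coeff (poly.coeff F i) j" l] b[of i j] by (simp add: d2_def d1_def)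
  qed
  show ?thesis
  proof (intro exI[of _ n] allI impI)
    fix f :: "complex \<Rightarrow> 'r" and a0 a1 b0 b1 assume f: "rhom f"
    have 1: "rhom (\<lambda>L. poly (map_poly f L) b1)" by (rule rhom_eval[OF f])
    have 2: "rhom (\<lambda>H. poly (map_poly (\<lambda>L. poly (map_poly f L) b1) H) b0)" by (rule rhom_eval[OF 1])
    have 3: "rhom (\<lambda>G. poly (map_poly (\<lambda>H. poly (map_poly (\<lambda>L. poly (map_poly f L) b1) H) b0) G) a1)"
      by (rule rhom_eval[OF 2])
    show "cox_subst f a0 a1 b0 b1 F =
     (\<Sum>i0\<le>n. \<Sum>i1\<le>n. \<Sum>j0\<le>n. \<Sum>j1\<le>n. f (cox_coeff F i0 i1 j0 j1) * b1 ^ j1 * b0 ^ j0 * a1 ^ i1 * a0 ^ i0)"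
      unfolding cox_subst_def poly_map_poly_bound[OF 3 D(1)] poly_map_poly_bound[OF 2 D(2)]
        poly_map_poly_bound[OF 1 D(3)] poly_map_poly_bound[OF f D(4)]
      by (simp add: cox_coeff_def sum_distrib_right)
  qed
qed

text \<open>The torus action divides \<open>y1\<close> by \<open>l ^ e\<close>. Multiplying
  \<open>y0\<close> by \<open>l ^ e\<close> instead avoids inverses, so the formula holds in every
  commutative ring; a monomial then has weight \<open>i0 + i1 + e j0 = a + e b\<close> in
  \<open>l\<close>.\<close>

lemma bihomogeneous_scale:
  fixes f :: "complex \<Rightarrow> 'r::comm_ring_1"
  assumes F: "bihomogeneous e a b F" and f: "rhom f"
  shows "cox_subst f (l * a0) (l * a1) (m * l ^ e * b0) (m * b1) F =
    l ^ nat (a + int e * b) * m ^ nat b * cox_subst f a0 a1 b0 b1 F"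
proof -
  obtain n where n: "\<And>(f :: complex \<Rightarrow> 'r) a0 a1 b0 b1. rhom f \<Longrightarrow> cox_subst f a0 a1 b0 b1 F =
     (\<Sum>i0\<le>n. \<Sum>i1\<le>n. \<Sum>j0\<le>n. \<Sum>j1\<le>n. f (cox_coeff F i0 i1 j0 j1) * b1 ^ j1 * b0 ^ j0 * a1 ^ i1 * a0 ^ i0)"
    using cox_subst_expand[where 'r = 'r] by blast
  have t: "f (cox_coeff F i0 i1 j0 j1) * (m * b1) ^ j1 * (m * l ^ e * b0) ^ j0 * (l * a1) ^ i1 * (l * a0) ^ i0 =
    l ^ nat (a + int e * b) * m ^ nat b * (f (cox_coeff F i0 i1 j0 j1) * b1 ^ j1 * b0 ^ j0 * a1 ^ i1 * a0 ^ i0)"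
    for i0 i1 j0 j1
  proof (cases "cox_coeff F i0 i1 j0 j1 = 0")
    case True then show ?thesis by (simp add: rhom_0[OF f])
  next
    case False
    then have "int i0 + int i1 - int e * int j1 = a" "int j0 + int j1 = b"
      using F unfolding bihomogeneous_def by blast+
    then have "a + int e * b = int (i0 + i1 + e * j0)" "b = int (j0 + j1)"
      by (auto simp: algebra_simps)
    then have "nat (a + int e * b) = i0 + i1 + e * j0" "nat b = j0 + j1"
      by (simp_all only: nat_int)
    then show ?thesis by (simp add: power_mult_distrib power_add power_mult mult_ac)
  qed
  show ?thesis
    by (subst (1 2) n[OF f]) (simp only: t sum_distrib_left)
qed

text \<open>With \<open>z = x1 / x0\<close> and \<open>t = Y1 / Y0\<close> the equation reads
  \<open>z = (t - 1) / (t^2 (t - a) + (t - 1))\<close>, or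
  \<open>1 / z - 1 = t^2 (t - a) / (t - 1)\<close>. In this form two ramified fibres are visible at
  once: \<open>t = 0\<close> is double over \<open>z = 1\<close>, and \<open>t\<close> infinite is
  double over \<open>z = 0\<close>.\<close>

definition pencil :: "'r::comm_ring_1 \<Rightarrow> 'r \<Rightarrow> 'r \<Rightarrow> 'r \<Rightarrow> 'r \<Rightarrow> 'r" where
  "pencil a x0 x1 Y0 Y1 = x0 * (Y0\<^sup>2 * (Y1 - Y0)) - x1 * (Y1\<^sup>2 * (Y1 - a * Y0) + Y0\<^sup>2 * (Y1 - Y0))"

lemma rhom_pencil: "rhom f \<Longrightarrow> f (pencil a x0 x1 Y0 Y1) = pencil (f a) (f x0) (f x1) (f Y0) (f Y1)"
  by (simp add: pencil_def rhom_simps)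

section \<open>Places of the rational function field\<close>

abbreviation (input) pf :: "complex poly \<Rightarrow> complex poly fract" where "pf p \<equiv> Fract p 1"

lemma pf_rhom: "rhom (\<lambda>p. pf p)"
  by (simp add: rhom_def One_fract_def)

lemmas pf_simps = rhom_simps[OF pf_rhom]

lemma pf_eq_iff: "pf p = pf q \<longleftrightarrow> p = q"
  by (simp add: eq_fract)

lemma pf_eq_0_iff: "pf p = 0 \<longleftrightarrow> p = 0"
  by (simp add: eq_fract Zero_fract_def)

text \<open>An integer-valued valuation of the rational function field, trivial on the constants and not
  necessarily normalised. As in the definition of \<open>places\<close> the value at 0 is irrelevant.\<close>

definition valuation :: "(complex poly fract \<Rightarrow> int) \<Rightarrow> bool" where
  "valuation w \<longleftrightarrow> (\<forall>x y. x \<noteq> 0 \<longrightarrow> y \<noteq> 0 \<longrightarrow> w (x * y) = w x + w y) \<and>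
     (\<forall>x y. x \<noteq> 0 \<longrightarrow> y \<noteq> 0 \<longrightarrow> x + y \<noteq> 0 \<longrightarrow> min (w x) (w y) \<le> w (x + y)) \<and>
     (\<forall>c. c \<noteq> 0 \<longrightarrow> w (pf [:c:]) = 0)"

text \<open>For \<open>d\<close> additive on products the difference does not depend on the chosen
  fraction. The order at a point and the degree both extend in this way.\<close>

definition lift_deg :: "(complex poly \<Rightarrow> nat) \<Rightarrow> complex poly fract \<Rightarrow> int" where
  "lift_deg d x = (if x = 0 then 0 else
     (THE n. \<exists>p q. p \<noteq> 0 \<and> q \<noteq> 0 \<and> x = Fract p q \<and> n = int (d p) - int (d q)))"

lemma lift_deg_Fract:
  assumes d: "\<And>p q. p \<noteq> 0 \<Longrightarrow> q \<noteq> 0 \<Longrightarrow> d (p * q) = d p + d q" and "p \<noteq> 0" "q \<noteq> 0"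
  shows "lift_deg d (Fract p q) = int (d p) - int (d q)"
proof -
  have "(THE n. \<exists>p' q'. p' \<noteq> 0 \<and> q' \<noteq> 0 \<and> Fract p q = Fract p' q' \<and> n = int (d p') - int (d q')) = int (d p) - int (d q)"
  proof (rule the_equality)
    fix n assume "\<exists>p' q'. p' \<noteq> 0 \<and> q' \<noteq> 0 \<and> Fract p q = Fract p' q' \<and> n = int (d p') - int (d q')"
    then obtain p' q' where h: "p' \<noteq> 0" "q' \<noteq> 0" "p * q' = p' * q" "n = int (d p') - int (d q')"
      using assms(3) by (auto simp: eq_fract)
    have "d p + d q' = d p' + d q" using d[of p q'] d[of p' q] h assms by simp
    then show "n = int (d p) - int (d q)" using h(4) by simp
  qed (use assms in blast)
  moreover have "Fract p q \<noteq> 0" using assms by (simp add: Zero_fract_def eq_fract)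
  ultimately show ?thesis by (simp add: lift_deg_def)
qed

definition ordp :: "complex \<Rightarrow> complex poly fract \<Rightarrow> int" where "ordp a = lift_deg (Polynomial.order a)"
definition ordi :: "complex poly fract \<Rightarrow> int" where "ordi x = - lift_deg degree x"

lemma ordp_Fract: "p \<noteq> 0 \<Longrightarrow> q \<noteq> 0 \<Longrightarrow> ordp a (Fract p q) = int (Polynomial.order a p) - int (Polynomial.order a q)"
  unfolding ordp_def by (rule lift_deg_Fract) (simp_all add: order_mult)

lemma ordi_Fract: "p \<noteq> 0 \<Longrightarrow> q \<noteq> 0 \<Longrightarrow> ordi (Fract p q) = int (degree q) - int (degree p)"
  unfolding ordi_def by (subst lift_deg_Fract) (simp_all add: degree_mult_eq)

lemma fract_cases_nz:
  fixes x :: "complex poly fract"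
  assumes "x \<noteq> 0" obtains p q where "x = Fract p q" "p \<noteq> 0" "q \<noteq> 0"
  using assms by (cases x rule: Fract_cases_nonzero) auto

lemma order_plus: "p \<noteq> 0 \<Longrightarrow> q \<noteq> 0 \<Longrightarrow> p + q \<noteq> 0 \<Longrightarrow> min (Polynomial.order a p) (Polynomial.order a q) \<le> Polynomial.order a (p + q)"
  for p q :: "complex poly"
  using order_divides[of a "min (Polynomial.order a p) (Polynomial.order a q)"] by (metis dvd_add min.cobounded1 min.cobounded2)

lemma valuation_ordp: "valuation (ordp a)"
  unfolding valuation_def
proof (intro conjI allI impI)
  fix x y :: "complex poly fract" assume xy: "x \<noteq> 0" "y \<noteq> 0"
  obtain p q where x: "x = Fract p q" "p \<noteq> 0" "q \<noteq> 0" using fract_cases_nz xy by metis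
  obtain r s where y: "y = Fract r s" "r \<noteq> 0" "s \<noteq> 0" using fract_cases_nz xy by metis
  show "ordp a (x * y) = ordp a x + ordp a y"
    by (simp add: x y ordp_Fract order_mult)
  assume nz: "x + y \<noteq> 0"
  then have "p * s + r * q \<noteq> 0" using x y by (auto simp: Zero_fract_def eq_fract)
  then show "min (ordp a x) (ordp a y) \<le> ordp a (x + y)"
    using order_plus[of "p * s" "r * q" a] x y by (simp add: ordp_Fract order_mult min_def split: if_splits)
next
  fix c :: complex assume "c \<noteq> 0"
  then show "ordp a (pf [:c:]) = 0" by (simp add: ordp_Fract order_0I)
qed

lemma valuation_ordi: "valuation ordi"
  unfolding valuation_def
proof (intro conjI allI impI)
  fix x y :: "complex poly fract" assume xy: "x \<noteq> 0" "y \<noteq> 0"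
  obtain p q where x: "x = Fract p q" "p \<noteq> 0" "q \<noteq> 0" using fract_cases_nz xy by metis
  obtain r s where y: "y = Fract r s" "r \<noteq> 0" "s \<noteq> 0" using fract_cases_nz xy by metis
  show "ordi (x * y) = ordi x + ordi y"
    by (simp add: x y ordi_Fract degree_mult_eq)
  assume nz: "x + y \<noteq> 0"
  then have "p * s + r * q \<noteq> 0" using x y by (auto simp: Zero_fract_def eq_fract)
  moreover have "degree (p * s + r * q) \<le> max (degree (p * s)) (degree (r * q))" by (rule degree_add_le_max)
  ultimately show "min (ordi x) (ordi y) \<le> ordi (x + y)"
    using x y by (simp add: ordi_Fract degree_mult_eq)
next
  fix c :: complex assume "c \<noteq> 0"
  then show "ordi (pf [:c:]) = 0" by (simp add: ordi_Fract)
qed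

lemma ordp_linear: "ordp a (pf [:- b, 1:]) = (if a = b then 1 else 0)"
  using order_power_n_n[of b 1] by (auto simp: ordp_Fract order_0I)

lemma ordi_linear: "ordi (pf [:b, 1:]) = - 1"
  by (simp add: ordi_Fract)

lemma ord_0 [simp]: "ordp a 0 = 0" "ordi 0 = 0"
  by (simp_all add: ordp_def ordi_def lift_deg_def)

context
  fixes w assumes w: "valuation w"
begin

lemma val_mult: "x \<noteq> 0 \<Longrightarrow> y \<noteq> 0 \<Longrightarrow> w (x * y) = w x + w y"
  and val_add: "x \<noteq> 0 \<Longrightarrow> y \<noteq> 0 \<Longrightarrow> x + y \<noteq> 0 \<Longrightarrow> min (w x) (w y) \<le> w (x + y)"
  and val_const: "c \<noteq> 0 \<Longrightarrow> w (pf [:c:]) = 0"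
  using w unfolding valuation_def by blast+

lemma val_1: "w 1 = 0"
  using val_mult[of 1 1] by simp

lemma val_uminus: "x \<noteq> 0 \<Longrightarrow> w (- x) = w x"
proof -
  assume "x \<noteq> 0"
  moreover have "pf [:-1:] = - 1" unfolding One_fract_def minus_fract by (simp add: eq_fract one_pCons)
  then have "pf [:-1:] * x = - x" by simp
  ultimately show ?thesis using val_mult[of "pf [:-1:]" x] val_const[of "-1"] by (simp add: pf_eq_0_iff)
qed

lemma val_inverse: "x \<noteq> 0 \<Longrightarrow> w (inverse x) = - w x"
  using val_mult[of x "inverse x"] val_1 by simp

lemma val_divide: "x \<noteq> 0 \<Longrightarrow> y \<noteq> 0 \<Longrightarrow> w (x / y) = w x - w y"
  using val_mult[of x "inverse y"] val_inverse[of y] by (simp add: divide_inverse)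

lemma val_power: "x \<noteq> 0 \<Longrightarrow> w (x ^ n) = int n * w x"
  by (induct n) (simp_all add: val_1 val_mult algebra_simps)

lemma val_power_int: "x \<noteq> 0 \<Longrightarrow> w (x powi n) = n * w x"
  by (auto simp: power_int_def val_power val_inverse)

lemma val_prod: "(\<And>i. i \<in> A \<Longrightarrow> f i \<noteq> 0) \<Longrightarrow> w (prod f A) = (\<Sum>i\<in>A. w (f i))"
  by (induct A rule: infinite_finite_induct) (simp_all add: val_1 val_mult)

lemma val_add_eq: assumes "x \<noteq> 0" "y \<noteq> 0" "w x < w y" shows "x + y \<noteq> 0 \<and> w (x + y) = w x"
proof -
  have nz: "x + y \<noteq> 0"
  proof
    assume "x + y = 0"
    then have "x = - y" by (simp add: eq_neg_iff_add_eq_0)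
    then show False using assms val_uminus[of y] by simp
  qed
  have "min (w (x + y)) (w y) \<le> w x" using val_add[of "x + y" "- y"] nz assms val_uminus[of y] by simp
  moreover have "w x \<le> w (x + y)" using val_add[of x y] nz assms by simp
  ultimately show ?thesis using nz assms by linarith
qed

lemma val_split: "\<lbrakk>\<And>p. p \<noteq> 0 \<Longrightarrow> w (pf p) = e * (int (d p))\<rbrakk> \<Longrightarrow> p \<noteq> 0 \<Longrightarrow> q \<noteq> 0 \<Longrightarrow>
    w (Fract p q) = e * (int (d p) - int (d q))"
  using val_divide[of "pf p" "pf q"] by (simp add: pf_eq_0_iff algebra_simps)

text \<open>If \<open>t\<close> has nonnegative value, so has every polynomial, and \<open>w\<close>
  is a multiple of the order at the one point \<open>a\<close> whose linear factor has positive
  value. If \<open>t\<close> has negative value, the leading term dominates and \<open>w\<close> is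
  a multiple of the order at infinity. In both cases the attained value 1 fixes the
  multiple.\<close>

lemma valuation_cases:
  assumes one: "\<exists>x. x \<noteq> 0 \<and> w x = 1"
  shows "(\<exists>a. \<forall>x. x \<noteq> 0 \<longrightarrow> w x = ordp a x) \<or> (\<forall>x. x \<noteq> 0 \<longrightarrow> w x = ordi x)"
proof (cases "0 \<le> w (pf [:0, 1:])")
  case True
  have nn: "0 \<le> w (pf p)" if "p \<noteq> 0" for p
    using that
  proof (induct p)
    case (pCons c p)
    have e: "pf (pCons c p) = pf [:c:] + pf [:0, 1:] * pf p" by simp
    show ?case
    proof (cases "p = 0")
      case True then show ?thesis using pCons by (simp add: val_const)
    next
      case False
      then have 1: "pf [:0, 1:] * pf p \<noteq> 0" "0 \<le> w (pf [:0, 1:] * pf p)"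
        using \<open>0 \<le> w (pf [:0, 1:])\<close> pCons val_mult[of "pf [:0, 1:]" "pf p"]
        by (simp_all only: pf_eq_0_iff mult_eq_0_iff) auto
      show ?thesis
      proof (cases "c = 0")
        case True
        then have "pf (pCons c p) = pf [:0, 1:] * pf p" by simp
        then show ?thesis using 1 by (simp only:)
      next
        case c: False
        have "min (w (pf [:c:])) (w (pf [:0, 1:] * pf p)) \<le> w (pf (pCons c p))"
          unfolding e by (rule val_add) (use 1 c pCons in \<open>auto simp: pf_eq_0_iff\<close>)
        then show ?thesis using 1 val_const[OF c] by simp
      qed
    qed
  qed simp
  \<comment> \<open>Otherwise every polynomial, being a product of linear factors, and hence every
    fraction would have value 0.\<close>
  have "\<exists>a. w (pf [:- a, 1:]) \<noteq> 0"
  proof (rule ccontr)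
    assume z: "\<not> ?thesis"
    have "w (pf p) = 0" if "p \<noteq> 0" for p
      using that
    proof (induct "degree p" arbitrary: p)
      case 0
      then obtain c where "p = [:c:]" by (metis degree_0_id degree_eq_zeroE)
      then show ?case using 0 val_const by simp
    next
      case (Suc n)
      then have "\<not> constant (poly p)" by (simp add: constant_degree)
      then obtain a where "poly p a = 0" using fundamental_theorem_of_algebra by blast
      then obtain q where q: "p = [:- a, 1:] * q" by (metis dvdE poly_eq_0_iff_dvd)
      then have "q \<noteq> 0" using Suc by auto
      then have "degree p = Suc (degree q)" unfolding q by (subst degree_mult_eq) auto
      then have "w (pf q) = 0" using Suc \<open>q \<noteq> 0\<close> by simp
      then show ?case using z \<open>q \<noteq> 0\<close> val_mult[of "pf [:- a, 1:]" "pf q"] unfolding q by (simp add: pf_eq_0_iff)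
    qed
    moreover obtain x where "x \<noteq> 0" "w x = 1" using one by blast
    ultimately show False using fract_cases_nz[of x] val_split[of 0 degree] by (metis mult_zero_left zero_neq_one)
  qed
  then obtain a where a: "w (pf [:- a, 1:]) \<noteq> 0" by blast
  define e where "e = w (pf [:- a, 1:])"
  have e: "0 < e" using a nn[of "[:- a, 1:]"] unfolding e_def by simp
  \<comment> \<open>The difference of two linear factors is a nonzero constant and has value 0, so
    at most one of them has positive value.\<close>
  have other: "w (pf [:- b, 1:]) = 0" if "b \<noteq> a" for b
  proof (rule ccontr)
    assume "w (pf [:- b, 1:]) \<noteq> 0"
    then have "0 < w (pf [:- b, 1:])" using nn[of "[:- b, 1:]"] by simp
    moreover have "min (w (pf [:- a, 1:])) (w (- pf [:- b, 1:])) \<le> w (pf [:- a, 1:] + - pf [:- b, 1:])"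
      by (rule val_add) (use that in \<open>auto simp: pf_eq_0_iff\<close>)
    moreover have "pf [:- a, 1:] + - pf [:- b, 1:] = pf [:b - a:]" by simp
    ultimately show False using e val_const[of "b - a"] val_uminus[of "pf [:- b, 1:]"] that
      by (simp add: pf_eq_0_iff e_def)
  qed
  have W: "w (pf p) = e * int (Polynomial.order a p)" if "p \<noteq> 0" for p
    using that
  proof (induct "degree p" arbitrary: p)
    case 0
    then obtain c where "p = [:c:]" by (metis degree_0_id degree_eq_zeroE)
    then show ?case using 0 val_const by (simp add: order_0I)
  next
    case (Suc n)
    then have "\<not> constant (poly p)" by (simp add: constant_degree)
    then obtain b where "poly p b = 0" using fundamental_theorem_of_algebra by blast
    then obtain q where q: "p = [:- b, 1:] * q" by (metis dvdE poly_eq_0_iff_dvd)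
    then have q0: "q \<noteq> 0" using Suc by auto
    then have "degree p = Suc (degree q)" unfolding q by (subst degree_mult_eq) auto
    then have "w (pf q) = e * int (Polynomial.order a q)" using Suc q0 by simp
    moreover have "w (pf p) = w (pf [:- b, 1:]) + w (pf q)"
      using val_mult[of "pf [:- b, 1:]" "pf q"] q0 unfolding q by (simp add: pf_eq_0_iff)
    moreover have "Polynomial.order a p = Polynomial.order a [:- b, 1:] + Polynomial.order a q" unfolding q by (rule order_mult) (use q0 in \<open>simp del: mult_pCons_left\<close>)
    moreover have "Polynomial.order a [:- b, 1:] = (if a = b then 1 else 0)" using order_power_n_n[of b 1] by (auto simp: order_0I)
    ultimately show ?case using other[of b] by (auto simp: e_def algebra_simps)
  qed
  have W': "w x = e * ordp a x" if "x \<noteq> 0" for x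
    using that val_split[OF W] by (elim fract_cases_nz) (simp add: ordp_Fract)
  moreover obtain x where "x \<noteq> 0" "w x = 1" using one by blast
  ultimately have "e * ordp a x = 1" by simp
  then have "e = 1" using e by (simp add: zmult_eq_1_iff)
  then show ?thesis using W' by auto
next
  case False
  define e where "e = w (pf [:0, 1:])"
  have e: "e < 0" using False by (simp add: e_def)
  have W: "w (pf p) = e * int (degree p)" if "p \<noteq> 0" for p
    using that
  proof (induct p)
    case (pCons c p)
    have eq: "pf (pCons c p) = pf [:0, 1:] * pf p + pf [:c:]" by simp
    show ?case
    proof (cases "p = 0")
      case True then show ?thesis using pCons by (simp add: val_const)
    next
      case False
      then have 1: "pf [:0, 1:] * pf p \<noteq> 0" "w (pf [:0, 1:] * pf p) = e * int (degree (pCons c p))"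
        using pCons val_mult[of "pf [:0, 1:]" "pf p"]
        by (simp_all only: pf_eq_0_iff mult_eq_0_iff e_def) (auto simp: algebra_simps)
      show ?thesis
      proof (cases "c = 0")
        case True
        then have "pf (pCons c p) = pf [:0, 1:] * pf p" by simp
        then show ?thesis using 1 by (simp only:)
      next
        case c: False
        have "e * int (degree (pCons c p)) < 0" using e False by (simp add: mult_less_0_iff)
        then have "w (pf [:0, 1:] * pf p + pf [:c:]) = w (pf [:0, 1:] * pf p)"
          using val_add_eq[of "pf [:0, 1:] * pf p" "pf [:c:]"] 1 val_const[OF c] c by (simp add: pf_eq_0_iff)
        then show ?thesis unfolding eq using 1 by simp
      qed
    qed
  qed simp
  have W': "w x = - e * ordi x" if "x \<noteq> 0" for x
    using that val_split[OF W] by (elim fract_cases_nz) (simp add: ordi_Fract algebra_simps)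
  moreover obtain x where "x \<noteq> 0" "w x = 1" using one by blast
  ultimately have "(- e) * ordi x = 1" by simp
  then have "- e = 1 \<or> - e = - 1" using zmult_eq_1_iff by blast
  then have "- e = 1" using e by simp
  then show ?thesis using W' by auto
qed

end

text \<open>A zero of the reduced denominator would be a pole at a finite point, so the denominator
  is constant; the order at infinity then bounds the degree.\<close>

lemma fract_poly_iff:
  fixes y :: "complex poly fract"
  assumes "y \<noteq> 0"
  shows "(\<forall>a. 0 \<le> ordp a y) \<and> - d \<le> ordi y \<longleftrightarrow> (\<exists>p. p \<noteq> 0 \<and> y = pf p \<and> int (degree p) \<le> d)"
proof
  assume L: "(\<forall>a. 0 \<le> ordp a y) \<and> - d \<le> ordi y"
  obtain p q where y: "y = Fract p q" and pq: "coprime p q" "q \<noteq> 0"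
    using coprime_quot_of_fract[of y] quot_to_fract_quot_of_fract[of y] snd_quot_of_fract_nonzero[of y]
    by (metis quot_to_fract_def prod.collapse case_prod_conv)
  have p: "p \<noteq> 0" using assms y pq by (auto simp: Zero_fract_def eq_fract)
  have "constant (poly q)"
  proof (rule ccontr)
    assume "\<not> constant (poly q)"
    then obtain a where a: "poly q a = 0" using fundamental_theorem_of_algebra by blast
    then have "poly p a \<noteq> 0" using pq by (metis coprime_poly_0)
    then have "Polynomial.order a p = 0" by (rule order_0I)
    moreover have "Polynomial.order a q \<noteq> 0" using a pq order_root by blast
    ultimately have "ordp a y < 0" using p pq y by (simp add: ordp_Fract)
    then show False using L by (metis not_le)
  qed
  then obtain c where c: "q = [:c:]" by (metis constant_degree degree_eq_zeroE)
  then have c0: "c \<noteq> 0" using pq by auto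
  have "y = pf (Polynomial.smult (1 / c) p)" using c0 by (simp add: y c eq_fract)
  moreover have "int (degree p) \<le> d" using L p pq y c by (simp add: ordi_Fract)
  ultimately show "\<exists>p. p \<noteq> 0 \<and> y = pf p \<and> int (degree p) \<le> d"
    using p c0 by (intro exI[of _ "Polynomial.smult (1 / c) p"]) auto
next
  assume "\<exists>p. p \<noteq> 0 \<and> y = pf p \<and> int (degree p) \<le> d"
  then show "(\<forall>a. 0 \<le> ordp a y) \<and> - d \<le> ordi y" by (auto simp: ordp_Fract ordi_Fract order_0I)
qed

section \<open>The genus of the rational function field\<close>

text \<open>The function field of the curve is a record of equivalence classes, not the type of
  fractions. The locale collects what is needed to carry the genus computation over to such a copy
  along \<open>\<kappa>\<close>.\<close>

locale rational_field =
  fixes K :: "('a, 'm) ring_scheme" (structure) and \<kappa> :: "complex poly fract \<Rightarrow> 'a"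
  assumes bij: "bij_betw \<kappa> UNIV (carrier K)"
    and mult: "\<And>x y. \<kappa> x \<otimes>\<^bsub>K\<^esub> \<kappa> y = \<kappa> (x * y)"
    and add: "\<And>x y. \<kappa> x \<oplus>\<^bsub>K\<^esub> \<kappa> y = \<kappa> (x + y)"
    and one: "\<one>\<^bsub>K\<^esub> = \<kappa> 1" and zero: "\<zero>\<^bsub>K\<^esub> = \<kappa> 0"
begin

lemma inj: "\<kappa> x = \<kappa> y \<longleftrightarrow> x = y"
  using bij by (auto simp: bij_betw_def inj_on_def)

lemma carr: "carrier K = range \<kappa>"
  using bij by (simp add: bij_betw_def)

lemma field_K: "field K"
proof -
  have "abelian_group K"
  proof (rule abelian_groupI)
    fix x assume "x \<in> carrier K"
    then obtain r where "x = \<kappa> r" unfolding carr by blast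
    then show "\<exists>y\<in>carrier K. y \<oplus>\<^bsub>K\<^esub> x = \<zero>\<^bsub>K\<^esub>" unfolding carr
      by (intro bexI[of _ "\<kappa> (- r)"]) (simp_all add: add zero)
  qed (auto simp: carr add zero ac_simps)
  moreover have "comm_monoid K"
    by (rule comm_monoidI) (auto simp: carr mult one ac_simps)
  ultimately interpret cring K
    by (rule cringI) (auto simp: carr add mult distrib_right)
  show ?thesis
  proof (rule cring_fieldI2)
    fix a assume "a \<in> carrier K" "a \<noteq> \<zero>"
    then obtain r where "a = \<kappa> r" "r \<noteq> 0" unfolding carr zero by blast
    then show "\<exists>b\<in>carrier K. a \<otimes> b = \<one>" unfolding carr
      by (intro bexI[of _ "\<kappa> (inverse r)"]) (simp_all add: mult one)
  qed (simp add: zero one inj)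
qed

definition kk :: "'a set" where "kk = {\<kappa> (pf [:c:]) | c. True}"

lemma kk_subfield: "subfield kk K"
proof -
  interpret field K by (rule field_K)
  have inv: "inv \<kappa> r = \<kappa> (inverse r)" if "r \<noteq> 0" for r
    using that by (intro comm_inv_char) (auto simp: carr mult one)
  have neg: "\<ominus> \<kappa> r = \<kappa> (- r)" for r
    by (rule sum_zero_eq_neg[symmetric]) (auto simp: carr add zero)
  show ?thesis
  proof (rule subfieldI', rule subringI)
    show "kk \<subseteq> carrier K" by (auto simp: kk_def carr)
    show "\<one> \<in> kk" unfolding kk_def one One_fract_def one_pCons by blast
    show "\<ominus> x \<in> kk" if "x \<in> kk" for x
    proof -
      from that obtain c where "x = \<kappa> (pf [:c:])" unfolding kk_def by blast
      then have "\<ominus> x = \<kappa> (pf [:- c:])" by (simp add: neg)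
      then show ?thesis unfolding kk_def by blast
    qed
    show "x \<otimes> y \<in> kk" "x \<oplus> y \<in> kk" if xy: "x \<in> kk" "y \<in> kk" for x y
    proof -
      obtain c d where "x = \<kappa> (pf [:c:])" "y = \<kappa> (pf [:d:])" using xy unfolding kk_def by blast
      then have "x \<otimes> y = \<kappa> (pf [:c * d:])" "x \<oplus> y = \<kappa> (pf [:c + d:])" by (simp_all add: mult add mult.commute)
      then show "x \<otimes> y \<in> kk" "x \<oplus> y \<in> kk" unfolding kk_def by blast+
    qed
    show "inv x \<in> kk" if "x \<in> kk - {\<zero>}" for x
    proof -
      from that obtain c where c: "x = \<kappa> (pf [:c:])" unfolding kk_def by blast
      have "c \<noteq> 0" using that c by (auto simp: zero Zero_fract_def)
      then have "inverse (pf [:c:]) = pf [:1 / c:]" by (simp add: eq_fract one_pCons)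
      then have "inv x = \<kappa> (pf [:1 / c:])" using c inv[of "pf [:c:]"] \<open>c \<noteq> 0\<close> by (simp add: pf_eq_0_iff)
      then show ?thesis unfolding kk_def by blast
    qed
  qed
qed

text \<open>A place must take the value 0 outside the nonzero elements of the carrier; the default
  enforces this, so that equality of places is equality of functions.\<close>

definition lft :: "(complex poly fract \<Rightarrow> int) \<Rightarrow> 'a \<Rightarrow> int" where
  "lft w x = (if x \<in> carrier K - {\<zero>\<^bsub>K\<^esub>} then w (inv_into UNIV \<kappa> x) else 0)"

lemma inv_kappa: "inv_into UNIV \<kappa> (\<kappa> r) = r"
  by (rule inv_into_f_f) (auto simp: inj_on_def inj)

lemma lft_kappa: "w 0 = 0 \<Longrightarrow> lft w (\<kappa> r) = w r"
  by (auto simp: lft_def carr zero inj inv_kappa)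

lemma lft_place:
  assumes w: "valuation w" "w 0 = 0" "\<exists>x. x \<noteq> 0 \<and> w x = 1"
  shows "lft w \<in> places K kk"
  unfolding places_def
proof (intro CollectI conjI ballI allI impI)
  fix x y assume xy: "x \<in> carrier K - {\<zero>\<^bsub>K\<^esub>}" "y \<in> carrier K - {\<zero>\<^bsub>K\<^esub>}"
  then obtain r s where e: "x = \<kappa> r" "y = \<kappa> s" "r \<noteq> 0" "s \<noteq> 0" unfolding carr zero by blast
  show "lft w (x \<otimes>\<^bsub>K\<^esub> y) = lft w x + lft w y"
    using e w by (simp add: mult lft_kappa valuation_def)
  assume "x \<oplus>\<^bsub>K\<^esub> y \<noteq> \<zero>\<^bsub>K\<^esub>"
  then show "min (lft w x) (lft w y) \<le> lft w (x \<oplus>\<^bsub>K\<^esub> y)"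
    using e w by (simp add: add zero inj lft_kappa valuation_def)
next
  fix c assume "c \<in> kk - {\<zero>\<^bsub>K\<^esub>}"
  then obtain d where d: "c = \<kappa> (pf [:d:])" "c \<noteq> \<zero>\<^bsub>K\<^esub>" unfolding kk_def by blast
  then have "d \<noteq> 0" by (auto simp: zero Zero_fract_def)
  note d this
  then show "lft w c = 0" using w by (simp add: lft_kappa valuation_def)
next
  obtain x where "x \<noteq> 0" "w x = 1" using w by blast
  then show "\<exists>x\<in>carrier K - {\<zero>\<^bsub>K\<^esub>}. lft w x = 1"
    by (intro bexI[of _ "\<kappa> x"]) (auto simp: carr zero inj lft_kappa w)
next
  fix x assume "x \<notin> carrier K - {\<zero>\<^bsub>K\<^esub>}"
  then show "lft w x = 0" unfolding lft_def by (rule if_not_P)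
qed

definition vp :: "complex \<Rightarrow> 'a \<Rightarrow> int" where "vp a = lft (ordp a)"
definition vi :: "'a \<Rightarrow> int" where "vi = lft ordi"

lemma places_eq: "places K kk = insert vi (range vp)"
proof
  have one: "\<exists>x. x \<noteq> 0 \<and> ordp a x = 1" for a
    by (intro exI[of _ "pf [:- a, 1:]"]) (simp add: ordp_linear pf_eq_0_iff)
  have onei: "\<exists>x. x \<noteq> 0 \<and> ordi x = 1"
    by (intro exI[of _ "inverse (pf [:0, 1:])"])
      (simp add: ordi_Fract Zero_fract_def eq_fract)
  show "insert vi (range vp) \<subseteq> places K kk"
    unfolding vi_def vp_def using lft_place[OF valuation_ordp _ one] lft_place[OF valuation_ordi _ onei] by auto
  show "places K kk \<subseteq> insert vi (range vp)"
  proof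
    fix v assume v: "v \<in> places K kk"
    define w where "w r = v (\<kappa> r)" for r
    have cr: "\<kappa> r \<in> carrier K - {\<zero>\<^bsub>K\<^esub>} \<longleftrightarrow> r \<noteq> 0" for r by (auto simp: carr zero inj)
    have v1: "\<And>x y. x \<in> carrier K - {\<zero>\<^bsub>K\<^esub>} \<Longrightarrow> y \<in> carrier K - {\<zero>\<^bsub>K\<^esub>} \<Longrightarrow> v (x \<otimes>\<^bsub>K\<^esub> y) = v x + v y \<and>
        (x \<oplus>\<^bsub>K\<^esub> y \<noteq> \<zero>\<^bsub>K\<^esub> \<longrightarrow> min (v x) (v y) \<le> v (x \<oplus>\<^bsub>K\<^esub> y))"
      and v2: "\<And>c. c \<in> kk - {\<zero>\<^bsub>K\<^esub>} \<Longrightarrow> v c = 0"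
      and v3: "\<exists>x\<in>carrier K - {\<zero>\<^bsub>K\<^esub>}. v x = 1" and v4: "\<And>x. x \<notin> carrier K - {\<zero>\<^bsub>K\<^esub>} \<Longrightarrow> v x = 0"
      using v unfolding places_def by blast+
    have "valuation w" unfolding valuation_def
    proof (intro conjI allI impI)
      fix x y :: "complex poly fract" assume xy: "x \<noteq> 0" "y \<noteq> 0"
      show "w (x * y) = w x + w y" using v1[of "\<kappa> x" "\<kappa> y"] xy unfolding cr w_def mult by blast
      assume "x + y \<noteq> 0"
      moreover have "\<kappa> x \<in> carrier K - {\<zero>\<^bsub>K\<^esub>}" "\<kappa> y \<in> carrier K - {\<zero>\<^bsub>K\<^esub>}" using xy cr by auto
      ultimately show "min (w x) (w y) \<le> w (x + y)"
        using v1[of "\<kappa> x" "\<kappa> y"] by (simp add: w_def add zero inj)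
    next
      fix c :: complex assume "c \<noteq> 0"
      then have "\<kappa> (pf [:c:]) \<in> kk - {\<zero>\<^bsub>K\<^esub>}" unfolding kk_def zero by (auto simp: inj pf_eq_0_iff)
      then show "w (pf [:c:]) = 0" unfolding w_def by (rule v2)
    qed
    moreover have "\<exists>x. x \<noteq> 0 \<and> w x = 1" using v3 cr unfolding w_def carr by blast
    ultimately consider a where "\<And>x. x \<noteq> 0 \<Longrightarrow> w x = ordp a x" | "\<And>x. x \<noteq> 0 \<Longrightarrow> w x = ordi x"
      using valuation_cases by blast
    moreover have "v = lft u" if "\<And>x. x \<noteq> 0 \<Longrightarrow> w x = u x" "u 0 = 0" for u
    proof
      fix x show "v x = lft u x"
      proof (cases "x \<in> carrier K - {\<zero>\<^bsub>K\<^esub>}")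
        case True
        then obtain r where "x = \<kappa> r" "r \<noteq> 0" unfolding carr zero by blast
        then show ?thesis using that by (simp add: lft_kappa w_def[symmetric])
      next
        case False then show ?thesis using v4[OF False] unfolding lft_def by (simp only: if_False)
      qed
    qed
    ultimately show "v \<in> insert vi (range vp)" unfolding vi_def vp_def by (metis insert_iff ord_0 rangeI)
  qed
qed

lemma vp_inj: "vp a = vp b \<longleftrightarrow> a = b"
proof
  assume "vp a = vp b"
  then have "vp a (\<kappa> (pf [:- a, 1:])) = vp b (\<kappa> (pf [:- a, 1:]))" by simp
  then show "a = b" by (simp add: vp_def lft_kappa ordp_linear split: if_splits)
qed simp

lemma vp_neq_vi: "vp a \<noteq> vi"
proof
  assume "vp a = vi"
  then have "vp a (\<kappa> (pf [:- a, 1:])) = vi (\<kappa> (pf [:- a, 1:]))" by simp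
  then show False by (simp add: vp_def vi_def lft_kappa ordp_linear ordi_linear)
qed

text \<open>A bound on coefficients rather than on the degree lets \<open>N = 0\<close> describe the
  zero space, which occurs for divisors of negative degree.\<close>

definition polys_below :: "complex poly fract \<Rightarrow> nat \<Rightarrow> 'a set" where
  "polys_below g N = {\<kappa> (pf p * g) | p. \<forall>i\<ge>N. poly.coeff p i = 0}"

lemma dimension_polys_below:
  assumes "g \<noteq> 0" shows "ring.dimension K N kk (polys_below g N)"
proof -
  interpret field K by (rule field_K)
  show ?thesis
  proof (induct N)
    case 0
    have "polys_below g 0 = {\<zero>}"
      by (auto simp: polys_below_def zero poly_eq_iff[of _ 0, symmetric] Zero_fract_def[symmetric] intro!: exI[of _ 0])
        (metis mult_zero_left pf_simps(1) poly_eq_iff coeff_0)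
    then show ?case by simp
  next
    case (Suc N)
    define v where "v = \<kappa> (pf (Polynomial.monom 1 N) * g)"
    have "v \<in> carrier K" by (simp add: v_def carr)
    moreover have "v \<notin> polys_below g N"
    proof
      assume "v \<in> polys_below g N"
      then obtain p where "\<forall>i\<ge>N. poly.coeff p i = 0" "pf (Polynomial.monom 1 N) * g = pf p * g"
        unfolding polys_below_def v_def by (auto simp: inj)
      then have "Polynomial.monom 1 N = p" "poly.coeff p N = 0" using assms by (auto simp: pf_eq_iff)
      then show False by auto
    qed
    have m: "pf [:c:] * pf (Polynomial.monom 1 N) = pf (Polynomial.monom c N)" for c by (simp add: smult_monom)
    from \<open>v \<in> carrier K\<close> \<open>v \<notin> polys_below g N\<close> have "dimension (Suc N) kk (line_extension kk v (polys_below g N))"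
      using Suc by (rule Suc_dim)
    moreover have "line_extension kk v (polys_below g N) = polys_below g (Suc N)"
    proof
      show "line_extension kk v (polys_below g N) \<subseteq> polys_below g (Suc N)"
      proof
        fix x assume "x \<in> line_extension kk v (polys_below g N)"
        then obtain c p where x: "x = \<kappa> (pf [:c:]) \<otimes> v \<oplus> \<kappa> (pf p * g)" and p: "\<forall>i\<ge>N. poly.coeff p i = 0"
          unfolding line_extension_def set_add_def' r_coset_def kk_def polys_below_def by blast
        have "x = \<kappa> (pf (Polynomial.monom c N + p) * g)"
          unfolding x v_def mult add
          by (rule arg_cong[of _ _ \<kappa>]) (simp only: pf_simps(3) m[of c, symmetric] distrib_right mult.assoc)
        moreover have "\<forall>i\<ge>Suc N. poly.coeff (Polynomial.monom c N + p) i = 0" using p by simp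
        ultimately show "x \<in> polys_below g (Suc N)" unfolding polys_below_def by blast
      qed
      show "polys_below g (Suc N) \<subseteq> line_extension kk v (polys_below g N)"
      proof
        fix x assume "x \<in> polys_below g (Suc N)"
        then obtain p where x: "x = \<kappa> (pf p * g)" and p: "\<forall>i\<ge>Suc N. poly.coeff p i = 0"
          unfolding polys_below_def by blast
        define c where "c = poly.coeff p N" define q where "q = p - Polynomial.monom c N"
        have q: "\<forall>i\<ge>N. poly.coeff q i = 0" unfolding q_def c_def using p by (metis Polynomial.coeff_diff Polynomial.coeff_monom Suc_leI diff_self diff_zero le_neq_implies_less)
        have pq: "p = Polynomial.monom c N + q" by (simp add: q_def)
        have "x = \<kappa> (pf [:c:]) \<otimes> v \<oplus> \<kappa> (pf q * g)"
          unfolding x v_def mult add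
          by (rule arg_cong[of _ _ \<kappa>], subst pq) (simp only: pf_simps(3) m[of c, symmetric] distrib_right mult.assoc)
        then show "x \<in> line_extension kk v (polys_below g N)"
          unfolding line_extension_def set_add_def' r_coset_def kk_def polys_below_def using q by blast
      qed
    qed
    ultimately show ?case by simp
  qed
qed

text \<open>On the projective line a divisor of degree \<open>d\<close> is equivalent to
  \<open>d\<close> times the point at infinity: multiplication by \<open>g\<close>, the product of
  the powers \<open>(t - a) ^ D(a)\<close>, clears the finite part and turns the space into the
  polynomials of degree at most \<open>d\<close>.\<close>

lemma riemann_roch_dim:
  assumes D: "D \<in> divisors K kk"
  shows "ring.dim K kk (riemann_roch_space K kk D) = nat (divisor_degree D + 1)"
proof -
  interpret field K by (rule field_K)
  define S where "S = {a. D (vp a) \<noteq> 0}"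
  define d where "d = divisor_degree D"
  have fin: "finite {v. D v \<noteq> 0}" and sub: "{v. D v \<noteq> 0} \<subseteq> insert vi (range vp)"
    using D unfolding divisors_def places_eq by auto
  have "vp ` S \<subseteq> {v. D v \<noteq> 0}" by (auto simp: S_def)
  then have "finite (vp ` S)" using fin finite_subset by blast
  then have finS: "finite S" by (rule finite_imageD) (simp add: inj_on_def vp_inj)
  have "d = (\<Sum>v\<in>insert vi (vp ` S). D v)"
    unfolding d_def divisor_degree_def
    by (rule sum.mono_neutral_left) (use finS sub in \<open>auto simp: S_def\<close>)
  also have "\<dots> = D vi + (\<Sum>a\<in>S. D (vp a))"
  proof -
    have "vi \<notin> vp ` S" using vp_neq_vi by (metis imageE)
    then show ?thesis using finS by (simp add: sum.reindex inj_on_def vp_inj)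
  qed
  finally have d: "d = D vi + (\<Sum>a\<in>S. D (vp a))" .
  define g where "g = (\<Prod>a\<in>S. pf [:- a, 1:] powi D (vp a))"
  have nz: "pf [:- a, 1:] powi n \<noteq> 0" for a n by (simp add: pf_eq_0_iff)
  then have g: "g \<noteq> 0" unfolding g_def using finS by (simp add: prod_zero_iff del: power_int_eq_0_iff)
  have og: "ordp b g = D (vp b)" for b
  proof -
    have "ordp b g = (\<Sum>a\<in>S. ordp b (pf [:- a, 1:] powi D (vp a)))"
      unfolding g_def by (rule val_prod[OF valuation_ordp]) (rule nz)
    also have "\<dots> = (\<Sum>a\<in>S. if a = b then D (vp b) else 0)"
      by (rule sum.cong) (auto simp: val_power_int[OF valuation_ordp] pf_eq_0_iff ordp_linear)
    also have "\<dots> = D (vp b)" using finS by (auto simp: S_def)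
    finally show ?thesis .
  qed
  have oi: "ordi g = - (\<Sum>a\<in>S. D (vp a))"
  proof -
    have "ordi g = (\<Sum>a\<in>S. ordi (pf [:- a, 1:] powi D (vp a)))"
      unfolding g_def by (rule val_prod[OF valuation_ordi]) (rule nz)
    also have "\<dots> = (\<Sum>a\<in>S. - D (vp a))"
      by (rule sum.cong) (auto simp: val_power_int[OF valuation_ordi] pf_eq_0_iff ordi_linear)
    finally show ?thesis by (simp add: sum_negf)
  qed
  have "riemann_roch_space K kk D = polys_below (inverse g) (nat (d + 1))"
  proof -
    have "\<kappa> r \<in> riemann_roch_space K kk D \<longleftrightarrow> \<kappa> r \<in> polys_below (inverse g) (nat (d + 1))" for r
    proof (cases "r = 0")
      case True
      then show ?thesis using \<open>r = 0\<close> unfolding riemann_roch_space_def polys_below_def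
        by (auto simp: carr zero inj intro!: exI[of _ 0] simp: Zero_fract_def[symmetric])
    next
      case False
      have "\<kappa> r \<in> riemann_roch_space K kk D \<longleftrightarrow> (\<forall>a. - D (vp a) \<le> ordp a r) \<and> - D vi \<le> ordi r"
        using False unfolding riemann_roch_space_def places_eq
        by (auto simp: carr zero inj vp_def vi_def lft_kappa)
      also have "\<dots> \<longleftrightarrow> (\<forall>a. 0 \<le> ordp a (r * g)) \<and> - d \<le> ordi (r * g)"
        using False g by (auto simp: val_mult[OF valuation_ordp] val_mult[OF valuation_ordi] og oi d algebra_simps)
          (metis add.commute add_le_cancel_left add_0 add.right_inverse uminus_add_conv_diff le_diff_eq diff_0 minus_le_iff)+
      also have "\<dots> \<longleftrightarrow> (\<exists>p. p \<noteq> 0 \<and> r * g = pf p \<and> int (degree p) \<le> d)"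
        by (rule fract_poly_iff) (use False g in simp)
      also have "\<dots> \<longleftrightarrow> (\<exists>p. r = pf p * inverse g \<and> (\<forall>i\<ge>nat (d + 1). poly.coeff p i = 0))"
      proof (intro iffI; elim exE conjE)
        fix p assume p: "p \<noteq> 0" "r * g = pf p" "int (degree p) \<le> d"
        have "r = pf p * inverse g" using g by (simp add: p(2)[symmetric])
        moreover have "poly.coeff p i = 0" if "nat (d + 1) \<le> i" for i using that p by (intro coeff_eq_0) linarith
        ultimately show "\<exists>p. r = pf p * inverse g \<and> (\<forall>i\<ge>nat (d + 1). poly.coeff p i = 0)" by blast
      next
        fix p assume p: "r = pf p * inverse g" "\<forall>i\<ge>nat (d + 1). poly.coeff p i = 0"
        have p0: "p \<noteq> 0" using False p by (auto simp: Zero_fract_def[symmetric])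
        then have "\<not> nat (d + 1) \<le> degree p" using p by (metis leading_coeff_0_iff)
        then have "int (degree p) \<le> d" by linarith
        moreover have "r * g = pf p" using g by (simp add: p(1))
        ultimately show "\<exists>p. p \<noteq> 0 \<and> r * g = pf p \<and> int (degree p) \<le> d" using p0 by blast
      qed
      also have "\<dots> \<longleftrightarrow> \<kappa> r \<in> polys_below (inverse g) (nat (d + 1))"
        unfolding polys_below_def by (auto simp: inj)
      finally show ?thesis .
    qed
    moreover have "riemann_roch_space K kk D \<subseteq> range \<kappa>" "polys_below (inverse g) (nat (d + 1)) \<subseteq> range \<kappa>"
      unfolding riemann_roch_space_def polys_below_def carr by auto
    ultimately show ?thesis by blast
  qed
  then show ?thesis using dimI[OF kk_subfield dimension_polys_below, of "inverse g" "nat (d + 1)"] g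
    by (simp add: over_def d_def)
qed

text \<open>With \<open>e\<close> the degree plus one, the expression is \<open>e - max 0 e\<close>:
  never positive, and 0 for the zero divisor.\<close>

lemma genus_0: "function_field_genus K kk = 0"
  unfolding function_field_genus_def
proof (rule cSup_eq_maximum)
  have "(\<lambda>v. 0) \<in> divisors K kk" by (simp add: divisors_def)
  from riemann_roch_dim[OF this]
  have "divisor_degree (\<lambda>v. 0) + 1 - int (ring.dim K kk (riemann_roch_space K kk (\<lambda>v. 0))) = 0"
    by (simp add: divisor_degree_def)
  with \<open>(\<lambda>v. 0) \<in> divisors K kk\<close>
  show "0 \<in> (\<lambda>D. divisor_degree D + 1 - int (ring.dim K kk (riemann_roch_space K kk D))) ` divisors K kk"
    by (metis (mono_tags, lifting) image_eqI)
next
  fix x assume "x \<in> (\<lambda>D. divisor_degree D + 1 - int (ring.dim K kk (riemann_roch_space K kk D))) ` divisors K kk"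
  then show "x \<le> 0" using riemann_roch_dim by auto
qed

end

section \<open>Pade approximation of the square root\<close>

text \<open>The operator \<open>t d/dt - 2l\<close>. It is diagonal on monomials, annihilates only
  \<open>t ^ (2 l)\<close>, and costs at most one order of vanishing at any point.\<close>

definition euler_op :: "nat \<Rightarrow> real poly \<Rightarrow> real poly" where
  "euler_op l p = [:0, 1:] * pderiv p - Polynomial.smult (2 * real l) p"

lemma coeff_euler_op: "poly.coeff (euler_op l p) i = (real i - 2 * real l) * poly.coeff p i"
  by (cases i) (simp_all add: euler_op_def coeff_pderiv algebra_simps)

lemma dvd_euler_op:
  assumes "[:c, 1:] ^ Suc r dvd p" shows "[:c, 1:] ^ r dvd euler_op l p"
proof -
  obtain q where q: "p = [:c, 1:] ^ Suc r * q" using assms by blast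
  have "pderiv p = [:c, 1:] ^ r * ([:c, 1:] * pderiv q + Polynomial.smult (of_nat (Suc r)) q)"
    unfolding q pderiv_mult pderiv_power_Suc by (simp add: pderiv_pCons algebra_simps)
  then have "euler_op l p = [:c, 1:] ^ r * ([:0, 1:] * ([:c, 1:] * pderiv q + Polynomial.smult (of_nat (Suc r)) q)
      - Polynomial.smult (2 * real l) ([:c, 1:] * q))"
    unfolding euler_op_def q by (simp add: algebra_simps)
  then show ?thesis by simp
qed

lemma euler_op_iterate:
  assumes "[:c, 1:] ^ (r + K) dvd p"
  shows "\<exists>G. [:c, 1:] ^ r dvd G \<and> (\<forall>i. poly.coeff G i = (\<Prod>l<K. real i - 2 * real l) * poly.coeff p i)"
  using assms
proof (induct K arbitrary: r)
  case 0 then show ?case by (intro exI[of _ p]) simp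
next
  case (Suc K)
  from Suc(1)[of "Suc r"] Suc(2) obtain G where G: "[:c, 1:] ^ Suc r dvd G"
    "\<And>i. poly.coeff G i = (\<Prod>l<K. real i - 2 * real l) * poly.coeff p i" by auto
  show ?case
    by (intro exI[of _ "euler_op K G"]) (use dvd_euler_op[OF G(1)] G(2) in \<open>auto simp: coeff_euler_op\<close>)
qed

text \<open>The reflection \<open>t\<close> to \<open>-t\<close> exchanges the points 1 and -1 and
  changes \<open>G\<close> by a sign at most; parity thus doubles the number of known zeros.\<close>

lemma flip_dvd:
  fixes G :: "real poly"
  assumes "[:1, 1:] ^ r dvd G" and G: "pcompose G [:0, -1:] = G \<or> pcompose G [:0, -1:] = - G"
  shows "[:-1, 1:] ^ r dvd G"
proof -
  obtain q where q: "G = [:1, 1:] ^ r * q" using assms(1) by blast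
  have hom_pow: "pcompose (p ^ r) [:0, -1:] = pcompose p [:0, -1:] ^ r" for p :: "real poly"
    by (induct r) (simp_all add: pcompose_mult pcompose_1)
  have e: "pcompose [:1, 1:] [:0, -1:] = - [:-1, 1::real:]" by (simp add: pcompose_pCons)
  have "pcompose G [:0, -1:] = (- [:-1, 1:]) ^ r * pcompose q [:0, -1:]"
    unfolding q pcompose_mult hom_pow e ..
  also have "\<dots> = [:-1, 1:] ^ r * ((-1) ^ r * pcompose q [:0, -1:])"
    by (subst power_minus) (simp add: mult_ac)
  finally have "[:-1, 1:] ^ r dvd pcompose G [:0, -1:]" by simp
  with G show ?thesis by auto
qed

lemma three_orders_le_degree:
  fixes G :: "real poly"
  assumes "[:1, 1:] ^ r dvd G" "[:-1, 1:] ^ r dvd G" "[:0, 1:] ^ s dvd G" "G \<noteq> 0"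
  shows "2 * r + s \<le> degree G"
proof -
  have "r \<le> Polynomial.order (-1) G" "r \<le> Polynomial.order 1 G" "s \<le> Polynomial.order 0 G"
    using assms order_divides[of "-1" r G] order_divides[of 1 r G] order_divides[of 0 s G] by auto
  moreover have "(\<Sum>x\<in>{-1, 1, 0}. Polynomial.order x G) \<le> degree G"
  proof -
    have "(\<Sum>x\<in>{-1, 1, 0}. Polynomial.order x G) = (\<Sum>x\<in>{-1, 1, 0} \<inter> {x. poly G x = 0}. Polynomial.order x G)"
      by (rule sum.mono_neutral_right) (auto simp: order_root assms(4))
    also have "\<dots> \<le> (\<Sum>x | poly G x = 0. Polynomial.order x G)"
      by (rule sum_mono2) (auto simp: poly_roots_finite assms(4))
    finally show ?thesis using sum_order_le_degree[OF assms(4)] by linarith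
  qed
  ultimately show ?thesis by simp
qed

definition psquare :: "real poly \<Rightarrow> real poly" where "psquare p = pcompose p [:0, 0, 1:]"

lemma coeff_psquare: "poly.coeff (psquare p) n = (if even n then poly.coeff p (n div 2) else 0)"
proof (induct p arbitrary: n)
  case 0 then show ?case by (simp add: psquare_def)
next
  case (pCons a p)
  have "psquare (pCons a p) = pCons a (pCons 0 (psquare p))"
    by (simp add: psquare_def pcompose_pCons)
  then show ?case by (auto simp: coeff_pCons pCons split: nat.split)
qed

lemma pcompose_even_odd:
  fixes p :: "real poly"
  shows "(\<And>i. odd i \<Longrightarrow> poly.coeff p i = 0) \<Longrightarrow> pcompose p [:0, -1:] = p"
    and "(\<And>i. even i \<Longrightarrow> poly.coeff p i = 0) \<Longrightarrow> pcompose p [:0, -1:] = - p"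
proof -
  have c: "poly.coeff (pcompose p [:0, -1:]) i = (-1) ^ i * poly.coeff p i" for i
    using coeff_pcompose_linear[of p "-1" i] by simp
  { assume a: "\<And>i. odd i \<Longrightarrow> poly.coeff p i = 0"
    show "pcompose p [:0, -1:] = p"
      by (rule poly_eqI, unfold c) (use a in \<open>auto simp: minus_one_power_iff\<close>) }
  { assume a: "\<And>i. even i \<Longrightarrow> poly.coeff p i = 0"
    show "pcompose p [:0, -1:] = - p"
      by (rule poly_eqI, unfold coeff_minus c) (use a in \<open>auto simp: minus_one_power_iff\<close>) }
qed

text \<open>Modulo \<open>(1 + t) ^ M\<close> the pair \<open>A, B\<close> approximates the square
  root of \<open>x = t^2\<close> near \<open>t = -1\<close>. After the even powers are removed by
  Euler operators, the remaining odd polynomial has support in a short interval and zeros of known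
  order at -1, 1 and 0, too many for its degree.\<close>

lemma sqrt_pade:
  fixes A B S \<gamma> :: "real poly"
  assumes kn: "M + n1 + n2 = 2 * k" "n1 + n2 \<le> k"
    and A: "\<And>i. k \<le> i \<Longrightarrow> poly.coeff A i = 0"
    and S: "A + B = [:0, 1:] ^ n1 * \<gamma>" and g: "\<And>i. k \<le> i + n1 + n2 \<Longrightarrow> poly.coeff \<gamma> i = 0"
    and d: "[:1, 1:] ^ M dvd psquare A + [:0, 1:] * psquare B"
  shows "A = 0 \<and> B = 0"
proof -
  define S where "S = A + B"
  \<comment> \<open>Here \<open>R = A + x B\<close>, so that
    \<open>p = (1 + t) (A(t^2) + t B(t^2))\<close>. The additional factor is chosen to make
    \<open>S = A + B\<close>, whose support is restricted at both ends, the odd part.\<close>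
  define R where "R = [:1, -1:] * A + [:0, 1:] * S"
  define p where "p = psquare R + [:0, 1:] * psquare S"
  have "p = [:1, 1:] * (psquare A + [:0, 1:] * psquare B)"
    unfolding p_def R_def S_def psquare_def pcompose_add pcompose_mult
    by (simp add: pcompose_pCons algebra_simps)
  then have dp: "[:1, 1:] ^ Suc M dvd p" using d by (simp only: power_Suc mult_dvd_mono dvd_refl)
  have Sc: "poly.coeff S i = (if i < n1 then 0 else poly.coeff \<gamma> (i - n1))" for i
    unfolding S_def S
    using coeff_monom_mult[of 1 n1 \<gamma> i] by (simp add: monom_altdef not_less)
  have S0: "poly.coeff S i = 0" if "i < n1 \<or> k \<le> i + n2" for i
    using that g[of "i - n1"] unfolding Sc by auto
  have R0: "poly.coeff R i = 0" if "k < i" for i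
    using that A S0 by (cases i) (auto simp: R_def coeff_pCons)
  have pe: "poly.coeff p (2 * i) = poly.coeff R i" for i
    by (cases i) (auto simp: p_def coeff_psquare coeff_pCons)
  have po: "poly.coeff p (2 * i + 1) = poly.coeff S i" for i
    by (auto simp: p_def coeff_psquare coeff_pCons)
  have "k \<le> M" using kn by linarith
  then obtain r where r: "M = r + k" by (metis le_iff_add add.commute)
  \<comment> \<open>The \<open>k + 1\<close> operators remove all even powers up to
    \<open>t ^ (2 k)\<close>, which is the whole even part, and use up \<open>k + 1\<close> of the
    \<open>M + 1\<close> zeros at -1.\<close>
  have "Suc M = r + Suc k" using r by simp
  with euler_op_iterate[of 1 r "Suc k" p] dp obtain G where G: "[:1, 1:] ^ r dvd G"
    and Gc: "\<And>i. poly.coeff G i = (\<Prod>l<Suc k. real i - 2 * real l) * poly.coeff p i" by auto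
  have Ge: "poly.coeff G i = 0" if "even i" for i
  proof -
    from that obtain j where j: "i = 2 * j" by (rule evenE)
    show ?thesis
    proof (cases "j \<le> k")
      case True
      then have "(\<Prod>l<Suc k. real i - 2 * real l) = 0" unfolding j by (intro prod_zero) auto
      then show ?thesis by (simp add: Gc)
    next
      case False then show ?thesis unfolding Gc j pe using R0[of j] by simp
    qed
  qed
  have Go: "poly.coeff G (2 * i + 1) = 0 \<longleftrightarrow> poly.coeff S i = 0" for i
  proof -
    have "real (2 * i + 1) - 2 * real l \<noteq> 0" for l
    proof
      assume "real (2 * i + 1) - 2 * real l = 0"
      then have "real (2 * i + 1) = real (2 * l)" by simp
      then have "2 * i + 1 = 2 * l" by (simp only: of_nat_eq_iff)
      then show False by presburger
    qed
    then show ?thesis unfolding Gc po by (auto simp: prod_zero_iff)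
  qed
  have "[:-1, 1:] ^ r dvd G" using flip_dvd[OF G] pcompose_even_odd(2)[of G] Ge by blast
  moreover have "[:0, 1:] ^ (2 * n1 + 1) dvd G"
  proof -
    have "poly.coeff G i = 0" if "i < 2 * n1 + 1" for i
    proof (cases "even i")
      case False then obtain j where "i = 2 * j + 1" by (auto elim: oddE)
      then show ?thesis using that Go[of j] S0[of j] by simp
    qed (use Ge in simp)
    then show ?thesis using monom_1_dvd_iff'[of "2 * n1 + 1" G] by (simp add: monom_altdef)
  qed
  \<comment> \<open>The largest exponent is at most \<open>2 (k - n2 - 1) + 1\<close>, while
    \<open>r = k - n1 - n2\<close>, so the zeros at -1, 1 and 0 exceed the degree.\<close>
  moreover have "degree G < 2 * r + (2 * n1 + 1)"
  proof -
    have "degree G \<le> 2 * r + 2 * n1"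
    proof (rule degree_le, intro allI impI)
      fix i assume i: "2 * r + 2 * n1 < i"
      show "poly.coeff G i = 0"
      proof (cases "even i")
        case False then obtain j where j: "i = 2 * j + 1" by (auto elim: oddE)
        then show ?thesis using i Go[of j] S0[of j] r kn by simp
      qed (use Ge in simp)
    qed
    then show ?thesis by simp
  qed
  ultimately have "G = 0" using three_orders_le_degree[OF G] by (metis not_le)
  then have S0': "S = 0" using Go by (simp add: poly_eq_iff)
  then have p: "p = psquare R" by (simp add: p_def psquare_def)
  \<comment> \<open>Now \<open>p\<close> is even and has \<open>M + 1\<close> zeros at each of 1 and
    -1, against a degree of at most \<open>2 k\<close>, which is at most \<open>2 M\<close>.\<close>
  have "[:-1, 1:] ^ Suc M dvd p" by (rule flip_dvd[OF dp]) (simp add: p pcompose_even_odd(1) coeff_psquare)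
  moreover have "degree p \<le> 2 * k"
    by (rule degree_le) (use R0 in \<open>auto simp: p coeff_psquare\<close>)
  ultimately have "p = 0" using three_orders_le_degree[OF dp _ , of 0] r by force
  then have "R = 0" using pe by (simp add: poly_eq_iff)
  then have "[:1, -1:] * A = 0" using S0' by (simp add: R_def del: mult_pCons_left)
  then have "A = 0" by (simp only: mult_eq_0_iff pCons_eq_0_iff) simp
  then show ?thesis using S0' by (simp add: S_def)
qed

section \<open>Limits of polynomials\<close>

text \<open>Convergence in a space of polynomials of bounded degree; the common bound is where the
  recursion for the coefficients of a quotient starts.\<close>

definition pconv :: "(nat \<Rightarrow> real poly) \<Rightarrow> real poly \<Rightarrow> bool" where
  "pconv w v \<longleftrightarrow> (\<forall>i. (\<lambda>l. poly.coeff (w l) i) \<longlonglongrightarrow> poly.coeff v i) \<and> (\<exists>n. \<forall>l. degree (w l) \<le> n)"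

lemma pconv_const: "pconv (\<lambda>l. p) p"
  by (auto simp: pconv_def)

lemma pconv_add: "pconv w v \<Longrightarrow> pconv w' v' \<Longrightarrow> pconv (\<lambda>l. w l + w' l) (v + v')"
  unfolding pconv_def by (auto intro!: tendsto_add) (metis degree_add_le le_max_iff_disj max.cobounded1 order_trans nle_le)

lemma pconv_mult: assumes "pconv w v" "pconv w' v'" shows "pconv (\<lambda>l. w l * w' l) (v * v')"
proof -
  obtain n n' where "\<And>l. degree (w l) \<le> n" "\<And>l. degree (w' l) \<le> n'" using assms by (auto simp: pconv_def)
  then have "\<And>l. degree (w l * w' l) \<le> n + n'" by (meson add_mono degree_mult_le order_trans)
  moreover have "(\<lambda>l. poly.coeff (w l * w' l) i) \<longlonglongrightarrow> poly.coeff (v * v') i" for i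
    using assms unfolding coeff_mult pconv_def by (auto intro!: tendsto_sum tendsto_mult)
  ultimately show ?thesis unfolding pconv_def by blast
qed

lemma pconv_power: "pconv w v \<Longrightarrow> pconv (\<lambda>l. w l ^ n) (v ^ n)"
  by (induct n) (simp_all add: pconv_const pconv_mult)

lemma pconv_sum: "(\<And>i. i \<in> I \<Longrightarrow> pconv (\<lambda>l. w l i) (v i)) \<Longrightarrow> pconv (\<lambda>l. \<Sum>i\<in>I. w l i) (\<Sum>i\<in>I. v i)"
  by (induct I rule: infinite_finite_induct) (simp_all add: pconv_const pconv_add)

lemma pconv_pCons: assumes "x \<longlonglongrightarrow> y" "pconv w v" shows "pconv (\<lambda>l. pCons (x l) (w l)) (pCons y v)"
proof -
  obtain n where n: "\<And>l. degree (w l) \<le> n" using assms by (auto simp: pconv_def)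
  then have "degree (pCons (x l) (w l)) \<le> Suc n" for l
    using degree_pCons_le[of "x l" "w l"] n[of l] by linarith
  moreover have "(\<lambda>l. poly.coeff (pCons (x l) (w l)) i) \<longlonglongrightarrow> poly.coeff (pCons y v) i" for i
    using assms by (cases i) (auto simp: pconv_def)
  ultimately show ?thesis unfolding pconv_def by blast
qed

text \<open>Synthetic division computes the coefficients of the quotient from the top down by a
  recursion that is continuous in \<open>w\<close> and \<open>q\<close>, so the quotients converge
  as well.\<close>

lemma pconv_root:
  assumes w: "pconv w v" and q: "q \<longlonglongrightarrow> q0" and e: "\<And>l. w l = [:- q l, 1:] * u l"
  shows "\<exists>u0. pconv u u0 \<and> v = [:- q0, 1:] * u0"
proof -
  obtain n where n: "\<And>l. degree (w l) \<le> n" using w by (auto simp: pconv_def)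
  have du: "degree (u l) \<le> n" for l
  proof (cases "u l = 0")
    case False
    then have "degree (w l) = Suc (degree (u l))" unfolding e by (subst degree_mult_eq) auto
    then show ?thesis using n[of l] by simp
  qed simp
  have rec: "poly.coeff (u l) i = poly.coeff (w l) (Suc i) + q l * poly.coeff (u l) (Suc i)" for l i
    unfolding e by (simp add: coeff_pCons)
  have conv: "\<exists>y. (\<lambda>l. poly.coeff (u l) i) \<longlonglongrightarrow> y" for i
  proof (induct "Suc n - i" arbitrary: i)
    case 0
    then have "poly.coeff (u l) i = 0" for l using du[of l] by (intro coeff_eq_0) simp
    then show ?case by auto
  next
    case (Suc m)
    then have "m = Suc n - Suc i" by simp
    from Suc(1)[OF this] obtain y where y: "(\<lambda>l. poly.coeff (u l) (Suc i)) \<longlonglongrightarrow> y" by blast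
    have "(\<lambda>l. poly.coeff (u l) i) \<longlonglongrightarrow> poly.coeff v (Suc i) + q0 * y"
      unfolding rec[of _ i] using w by (intro tendsto_add tendsto_mult q y) (auto simp: pconv_def)
    then show ?case by blast
  qed
  define y where "y i = lim (\<lambda>l. poly.coeff (u l) i)" for i
  have y: "(\<lambda>l. poly.coeff (u l) i) \<longlonglongrightarrow> y i" for i
    using conv[of i] unfolding y_def by (auto simp: limI)
  have y0: "y i = 0" if "n < i" for i
  proof -
    have "poly.coeff (u l) i = 0" for l using du[of l] that by (intro coeff_eq_0) simp
    then have "(\<lambda>l. 0) \<longlonglongrightarrow> y i" using y[of i] by simp
    then show ?thesis by (simp add: LIMSEQ_const_iff)
  qed
  define u0 where "u0 = Abs_poly y"
  have cu0: "poly.coeff u0 i = y i" for i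
    unfolding u0_def by (subst coeff_Abs_poly[of n]) (use y0 in auto)
  have u0: "pconv u u0" using y du cu0 by (auto simp: pconv_def)
  have "v = [:- q0, 1:] * u0"
  proof (rule poly_eqI)
    fix i
    have "w = (\<lambda>l. [:- q l, 1:] * u l)" using e by blast
    then have "pconv w ([:- q0, 1:] * u0)"
      by (simp only:) (intro pconv_mult pconv_pCons tendsto_minus q pconv_const u0 tendsto_const)
    then show "poly.coeff v i = poly.coeff ([:- q0, 1:] * u0) i"
      using w LIMSEQ_unique unfolding pconv_def by blast
  qed
  with u0 show ?thesis by blast
qed

lemma pconv_root_power:
  assumes "pconv w v" and q: "q \<longlonglongrightarrow> q0" and "\<And>l. [:- q l, 1:] ^ n * d l dvd w l"
  shows "\<exists>u u0. (\<forall>l. d l dvd u l) \<and> pconv u u0 \<and> v = [:- q0, 1:] ^ n * u0"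
  using assms(1,3)
proof (induct n arbitrary: w v)
  case 0 then show ?case by (intro exI[of _ w] exI[of _ v]) simp
next
  case (Suc n)
  then have "\<forall>l. \<exists>c. w l = [:- q l, 1:] ^ Suc n * d l * c" by (simp add: dvd_def)
  then obtain c where c: "\<And>l. w l = [:- q l, 1:] ^ Suc n * d l * c l" by metis
  define u where "u l = [:- q l, 1:] ^ n * d l * c l" for l
  have "w l = [:- q l, 1:] * u l" for l by (simp only: c u_def power_Suc mult.assoc)
  from pconv_root[OF Suc(2) q this] obtain u0 where u0: "pconv u u0" "v = [:- q0, 1:] * u0" by blast
  from Suc(1)[OF u0(1)] obtain u' u0' where "\<forall>l. d l dvd u' l" "pconv u' u0'" "u0 = [:- q0, 1:] ^ n * u0'"
    unfolding u_def by auto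
  then show ?case using u0(2) by (intro exI[of _ u'] exI[of _ u0']) (simp del: mult_pCons_left add: mult.assoc)
qed

text \<open>The limits \<open>q0\<close> and \<open>q0'\<close> may coincide. Dividing out one
  linear factor at a time makes the multiplicities of colliding roots add up.\<close>

lemma pconv_dvd2:
  assumes "pconv w v" "q \<longlonglongrightarrow> q0" "q' \<longlonglongrightarrow> q0'"
    and "\<And>l. [:- q l, 1:] ^ n * [:- q' l, 1:] ^ n' dvd w l"
  shows "[:- q0, 1:] ^ n * [:- q0', 1:] ^ n' dvd v"
proof -
  obtain u u0 where u: "\<And>l. [:- q' l, 1:] ^ n' dvd u l" "pconv u u0" "v = [:- q0, 1:] ^ n * u0"
    using pconv_root_power[OF assms(1,2,4)] by blast
  have "\<exists>u' u0'. (\<forall>l. 1 dvd u' l) \<and> pconv u' u0' \<and> u0 = [:- q0', 1:] ^ n' * u0'"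
    by (rule pconv_root_power[OF u(2) assms(3)]) (use u(1) in simp)
  then show ?thesis using u(3) by auto
qed

lemma convergent_subseq_finite:
  fixes X :: "nat \<Rightarrow> nat \<Rightarrow> real"
  assumes "\<And>l i. \<bar>X l i\<bar> \<le> C"
  shows "\<exists>r x. strict_mono (r :: nat \<Rightarrow> nat) \<and> (\<forall>i<m. (\<lambda>l. X (r l) i) \<longlonglongrightarrow> x i)"
proof (induct m)
  case 0 show ?case by (intro exI[of _ id]) (simp add: strict_mono_def)
next
  case (Suc m)
  then obtain r x where r: "strict_mono r" "\<And>i. i < m \<Longrightarrow> (\<lambda>l. X (r l) i) \<longlonglongrightarrow> x i" by blast
  obtain s where s: "strict_mono s" "monoseq (\<lambda>l. X (r (s l)) m)"
    using seq_monosub[of "\<lambda>l. X (r l) m"] by blast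
  have "Bseq (\<lambda>l. X (r (s l)) m)" by (rule BseqI'[of _ C]) (use assms in auto)
  then obtain y where y: "(\<lambda>l. X (r (s l)) m) \<longlonglongrightarrow> y"
    using Bseq_monoseq_convergent[OF _ s(2)] by (auto simp: convergent_def)
  have "(\<lambda>l. X (r (s l)) i) \<longlonglongrightarrow> x i" if "i < m" for i
    using LIMSEQ_subseq_LIMSEQ[OF r(2)[OF that] s(1)] by (simp add: o_def)
  then show ?case
    using y r(1) s(1) by (intro exI[of _ "\<lambda>l. r (s l)"] exI[of _ "x(m := y)"]) (auto simp: strict_mono_def less_Suc_eq)
qed


section \<open>Nondegeneracy of the interpolation problem\<close>

text \<open>With \<open>P = t - 1\<close> and \<open>Q = t^2 (t - a) + (t - 1)\<close> this is
  \<open>Q ^ (k - 1) (\<alpha>(z) + \<beta>(z) t)\<close> at \<open>z = P / Q\<close>, for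
  polynomials \<open>\<alpha>\<close>, \<open>\<beta>\<close> of degree less than
  \<open>k\<close>.\<close>

definition interp :: "real \<Rightarrow> nat \<Rightarrow> (nat \<Rightarrow> real) \<Rightarrow> (nat \<Rightarrow> real) \<Rightarrow> real poly" where
  "interp a k \<alpha> \<beta> = (\<Sum>i<k. [:\<alpha> i, \<beta> i:] * [:-1, 1:] ^ i * [:-1, 1, -a, 1:] ^ (k - 1 - i))"

text \<open>Apart from 0, the finite critical points of \<open>t^2 (t - a) / (t - 1)\<close> are the
  roots of \<open>2 t^2 - (a + 3) t + 2 a\<close>. For this value of \<open>a\<close> they are
  \<open>2 - m\<close> and \<open>2 - 1 / m\<close>, so all data become rational functions of
  \<open>m\<close>; the degenerate configuration is \<open>m = 1\<close>.\<close>

definition pa :: "real \<Rightarrow> real" where "pa m = (2 - m) * (2 - 1 / m)"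

lemma linear_power_dvd_cancel:
  fixes p q :: "'a::field poly"
  assumes "[:- x, 1:] ^ n dvd q * p" "poly q x \<noteq> 0"
  shows "[:- x, 1:] ^ n dvd p"
proof (cases "p = 0")
  case False
  have q: "q \<noteq> 0" using assms(2) by auto
  have "n \<le> Polynomial.order x (q * p)" using assms(1) False q order_divides[of x n "q * p"] by simp
  also have "\<dots> = Polynomial.order x p" using assms(2) False q by (simp add: order_mult order_0I)
  finally show ?thesis by (simp add: order_divides)
qed simp

lemma smult_sum_distrib: "Polynomial.smult c (sum f A) = (\<Sum>i\<in>A. Polynomial.smult c (f i))"
  by (induct A rule: infinite_finite_induct) (simp_all add: smult_add_right)

lemma pcompose_power: "pcompose (p ^ n) q = pcompose p q ^ n" for p q :: "'a::comm_ring_1 poly"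
  by (induct n) (simp_all add: pcompose_mult pcompose_1)

text \<open>In the coordinate \<open>t = a + (1 - a) * \<theta>\<close> the two roots \<open>a, 1\<close> that collide in the limit stay apart.\<close>

definition interp' :: "real \<Rightarrow> nat \<Rightarrow> (nat \<Rightarrow> real) \<Rightarrow> (nat \<Rightarrow> real) \<Rightarrow> real poly" where
  "interp' a k \<alpha> \<beta> = (\<Sum>i<k. [:\<alpha> i + \<beta> i * a, \<beta> i * (1 - a):] * [:-1, 1:] ^ i *
     ([:a, 1 - a:]\<^sup>2 * [:0, 1:] + [:-1, 1:]) ^ (k - 1 - i))"

text \<open>In the new coordinate \<open>P\<close> and \<open>Q\<close> are both divisible by
  \<open>1 - a\<close>. The common factor \<open>(1 - a) ^ (k - 1)\<close> must be split off before
  the limit, since it tends to 0 for \<open>k > 1\<close>.\<close>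

lemma pcompose_interp: "pcompose (interp a k \<alpha> \<beta>) [:a, 1 - a:] = Polynomial.smult ((1 - a) ^ (k - 1)) (interp' a k \<alpha> \<beta>)"
proof -
  have t: "pcompose ([:\<alpha> i, \<beta> i:] * [:-1, 1:] ^ i * [:-1, 1, -a, 1:] ^ (k - 1 - i)) [:a, 1 - a:] =
     Polynomial.smult ((1 - a) ^ (k - 1)) ([:\<alpha> i + \<beta> i * a, \<beta> i * (1 - a):] * [:-1, 1:] ^ i *
     ([:a, 1 - a:]\<^sup>2 * [:0, 1:] + [:-1, 1:]) ^ (k - 1 - i))" if "i < k" for i
  proof -
    have 1: "pcompose [:\<alpha> i, \<beta> i:] [:a, 1 - a:] = [:\<alpha> i + \<beta> i * a, \<beta> i * (1 - a):]"
      by (simp add: pcompose_pCons algebra_simps)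
    have 2: "pcompose [:-1, 1:] [:a, 1 - a:] = Polynomial.smult (1 - a) [:-1, 1:]"
      by (simp add: pcompose_pCons)
    have 3: "pcompose [:-1, 1, -a, 1:] [:a, 1 - a:] = Polynomial.smult (1 - a) ([:a, 1 - a:]\<^sup>2 * [:0, 1:] + [:-1, 1:])"
      by (simp add: pcompose_pCons power2_eq_square algebra_simps)
    have "(1 - a) ^ (k - 1) = (1 - a) ^ i * (1 - a) ^ (k - 1 - i)"
      using that by (simp add: power_add[symmetric])
    then show ?thesis
      unfolding pcompose_mult pcompose_power 1 2 3 smult_power
      by (simp only: mult_smult_left mult_smult_right smult_smult mult_ac)
  qed
  have "pcompose (interp a k \<alpha> \<beta>) [:a, 1 - a:] =
    (\<Sum>i<k. pcompose ([:\<alpha> i, \<beta> i:] * [:-1, 1:] ^ i * [:-1, 1, -a, 1:] ^ (k - 1 - i)) [:a, 1 - a:])"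
    unfolding interp_def by (rule pcompose_sum)
  also have "\<dots> = Polynomial.smult ((1 - a) ^ (k - 1)) (interp' a k \<alpha> \<beta>)"
    unfolding interp'_def smult_sum_distrib by (rule sum.cong) (use t in auto)
  finally show ?thesis .
qed

lemma infinite_neq_1: "infinite {x::real. x \<noteq> 1}"
proof -
  have "{x::real. x \<noteq> 1} = UNIV - {1}" by auto
  then show ?thesis by (simp add: infinite_UNIV_char_0)
qed

text \<open>For \<open>\<theta> = x / (x - 1)\<close> one has
  \<open>\<theta> - 1 = 1 / (x - 1)\<close> and \<open>2 \<theta> - 1 = (x + 1) / (x - 1)\<close>,
  so clearing denominators leaves powers of \<open>1 + x\<close> only. The points 0 and 1 for
  \<open>\<theta>\<close> correspond to 0 and infinity for \<open>x\<close>.\<close>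

lemma poly_theta:
  fixes x :: real
  assumes "x \<noteq> 1"
  shows "(x - 1) ^ (k - 1) * poly (\<Sum>i<k. Polynomial.smult (\<gamma> i) ([:-1, 1:] ^ i * [:-1, 2:] ^ (k - 1 - i))) (x / (x - 1)) =
    poly (\<Sum>i<k. Polynomial.smult (\<gamma> i) ([:1, 1:] ^ (k - 1 - i))) x"
  unfolding poly_sum sum_distrib_left
proof (rule sum.cong)
  fix i assume "i \<in> {..<k}"
  then have e: "(x - 1) ^ (k - 1) = (x - 1) ^ i * (x - 1) ^ (k - 1 - i)" by (simp add: power_add[symmetric])
  define \<theta> where "\<theta> = x / (x - 1)"
  have "(x - 1) * (\<theta> - 1) = 1" "(x - 1) * (2 * \<theta> - 1) = x + 1" using assms by (auto simp: \<theta>_def field_simps)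
  then have "(x - 1) ^ i * (\<theta> - 1) ^ i = 1" "(x - 1) ^ (k - 1 - i) * (2 * \<theta> - 1) ^ (k - 1 - i) = (x + 1) ^ (k - 1 - i)"
    by (simp_all add: power_mult_distrib[symmetric])
  moreover have "(x - 1) ^ (k - 1) * poly (Polynomial.smult (\<gamma> i) ([:-1, 1:] ^ i * [:-1, 2:] ^ (k - 1 - i))) \<theta>
    = \<gamma> i * ((x - 1) ^ i * (\<theta> - 1) ^ i) * ((x - 1) ^ (k - 1 - i) * (2 * \<theta> - 1) ^ (k - 1 - i))"
    unfolding e by (simp add: poly_power algebra_simps)
  ultimately show "(x - 1) ^ (k - 1) * poly (Polynomial.smult (\<gamma> i) ([:-1, 1:] ^ i * [:-1, 2:] ^ (k - 1 - i))) (x / (x - 1))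
    = poly (Polynomial.smult (\<gamma> i) ([:1, 1:] ^ (k - 1 - i))) x"
    by (simp add: poly_power add.commute \<theta>_def)
qed simp

text \<open>At \<open>a = 1\<close> the denominator is \<open>(t - 1) (t^2 + 1)\<close>, so
  \<open>interp\<close> becomes \<open>(t - 1) ^ (k - 1) (A(t^2) + t B(t^2))\<close>, and
  \<open>d2\<close> is the approximation condition at -1. In the coordinate \<open>x\<close> of
  \<open>poly_theta\<close> the condition \<open>d1\<close> says that \<open>A + B\<close> vanishes
  to order \<open>n1\<close> at 0 and drops its degree by \<open>n2\<close>.\<close>

lemma interp_limit_zero:
  assumes kn: "n1 + n2 + n3 + n4 = 2 * k" "n1 + n2 \<le> k"
    and d1: "[:0, 1:] ^ n1 * [:-1, 1:] ^ n2 dvd interp' 1 k \<alpha> \<beta>"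
    and d2: "[:1, 1:] ^ n3 * [:1, 1:] ^ n4 dvd interp 1 k \<alpha> \<beta>"
    and i: "i < k"
  shows "\<alpha> i = 0 \<and> \<beta> i = 0"
proof -
  define A where "A = (\<Sum>i<k. Polynomial.smult (\<alpha> i) ([:1, 1:] ^ (k - 1 - i)))"
  define B where "B = (\<Sum>i<k. Polynomial.smult (\<beta> i) ([:1, 1:] ^ (k - 1 - i)))"
  have deg: "poly.coeff (\<Sum>i<k. Polynomial.smult (\<gamma> i) ([:1, 1:] ^ (k - 1 - i))) j = 0" if "k \<le> j" for \<gamma> :: "nat \<Rightarrow> real" and j
  proof -
    have "poly.coeff ([:1, 1::real:] ^ (k - 1 - i)) j = 0" if "i < k" for i
      by (rule coeff_eq_0) (use \<open>k \<le> j\<close> that in \<open>simp add: degree_power_eq\<close>)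
    then show ?thesis by (simp add: coeff_sum)
  qed
  \<comment> \<open>The powers of \<open>1 + x\<close> are linearly independent, as the shift by -1
    shows.\<close>
  have zero: "\<gamma> i = 0" if "(\<Sum>i<k. Polynomial.smult (\<gamma> i) ([:1, 1:] ^ (k - 1 - i))) = 0" for \<gamma> :: "nat \<Rightarrow> real"
  proof -
    have "0 = pcompose (\<Sum>i<k. Polynomial.smult (\<gamma> i) ([:1, 1:] ^ (k - 1 - i))) [:-1, 1:]" unfolding that by simp
    also have "\<dots> = (\<Sum>i<k. Polynomial.smult (\<gamma> i) (Polynomial.monom 1 (k - 1 - i)))"
      unfolding pcompose_sum pcompose_smult pcompose_power by (simp add: pcompose_pCons monom_altdef)
    finally have "0 = poly.coeff (\<Sum>i<k. Polynomial.smult (\<gamma> i) (Polynomial.monom 1 (k - 1 - i))) (k - 1 - i)" by simp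
    also have "\<dots> = (\<Sum>j<k. if j = i then \<gamma> j else 0)"
      unfolding coeff_sum by (rule sum.cong) (use i in \<open>auto simp: coeff_smult\<close>)
    finally show ?thesis using i by simp
  qed
  have AB: "A + B = (\<Sum>i<k. Polynomial.smult (\<alpha> i + \<beta> i) ([:1, 1:] ^ (k - 1 - i)))"
    unfolding A_def B_def by (simp add: sum.distrib smult_add_left)
  have pq: "psquare (\<Sum>i<k. Polynomial.smult (\<gamma> i) ([:1, 1:] ^ (k - 1 - i))) = (\<Sum>i<k. Polynomial.smult (\<gamma> i) ([:1, 0, 1:] ^ (k - 1 - i)))"
    for \<gamma> :: "nat \<Rightarrow> real"
    unfolding psquare_def pcompose_sum pcompose_smult pcompose_power by (simp add: pcompose_pCons)
  have w: "interp 1 k \<alpha> \<beta> = [:-1, 1:] ^ (k - 1) * (psquare A + [:0, 1:] * psquare B)"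
  proof -
    have t: "[:\<alpha> i, \<beta> i:] * [:-1, 1:] ^ i * [:-1, 1, -1, 1:] ^ (k - 1 - i) =
      [:-1, 1:] ^ (k - 1) * (Polynomial.smult (\<alpha> i) ([:1, 0, 1:] ^ (k - 1 - i)) + [:0, 1:] * Polynomial.smult (\<beta> i) ([:1, 0, 1:] ^ (k - 1 - i)))"
      if "i < k" for i
    proof -
      have e: "[:-1, 1, -1, 1:] = [:-1, 1:] * [:1, 0, 1::real:]" by simp
      have "[:-1, 1::real:] ^ (k - 1) = [:-1, 1:] ^ i * [:-1, 1:] ^ (k - 1 - i)"
        using that by (simp only: power_add[symmetric]) simp
      note pw = this
      have lin: "Polynomial.smult (\<alpha> i) p + [:0, 1:] * Polynomial.smult (\<beta> i) p = [:\<alpha> i, \<beta> i:] * p" for p :: "real poly"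
        by simp
      show ?thesis unfolding e power_mult_distrib lin pw by (simp only: mult_ac)
    qed
    show ?thesis
      unfolding interp_def A_def B_def pq sum_distrib_left sum.distrib[symmetric]
      by (rule sum.cong) (use t in auto)
  qed
  have "[:- (-1), 1:] ^ (n3 + n4) dvd psquare A + [:0, 1:] * psquare B"
    by (rule linear_power_dvd_cancel[of "-1::real" _ "[:-1, 1:] ^ (k - 1)"])
      (use d2 in \<open>simp only: w power_add minus_minus\<close>, simp add: poly_power)
  then have "[:1, 1:] ^ (n3 + n4) dvd psquare A + [:0, 1:] * psquare B" by simp
  moreover obtain \<gamma> where "A + B = [:0, 1:] ^ n1 * \<gamma>" "\<And>i. k \<le> i + n1 + n2 \<Longrightarrow> poly.coeff \<gamma> i = 0"
  proof -
    obtain G where G: "interp' 1 k \<alpha> \<beta> = [:0, 1:] ^ n1 * [:-1, 1:] ^ n2 * G" using d1 by blast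
    have w': "interp' 1 k \<alpha> \<beta> = (\<Sum>i<k. Polynomial.smult (\<alpha> i + \<beta> i) ([:-1, 1:] ^ i * [:-1, 2:] ^ (k - 1 - i)))"
    proof -
      have "[:x, 0:] * p * q = Polynomial.smult x (p * q)" for x and p q :: "real poly" by simp
      moreover have "[:1, 0:]\<^sup>2 * [:0, 1:] + [:-1, 1:] = [:-1, 2::real:]" by (simp add: power2_eq_square)
      ultimately show ?thesis unfolding interp'_def by simp
    qed
    have degw: "degree (interp' 1 k \<alpha> \<beta>) \<le> k - 1"
      unfolding w'
    proof (rule degree_sum_le)
      fix i assume "i \<in> {..<k}"
      moreover have "degree ([:-1, 1:] ^ i * [:-1, 2::real:] ^ (k - 1 - i)) \<le> i + (k - 1 - i)"
        by (rule order.trans[OF degree_mult_le]) (simp add: degree_power_eq)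
      ultimately show "degree (Polynomial.smult (\<alpha> i + \<beta> i) ([:-1, 1:] ^ i * [:-1, 2:] ^ (k - 1 - i))) \<le> k - 1"
        using degree_smult_le[of "\<alpha> i + \<beta> i" "[:-1, 1:] ^ i * [:-1, 2:] ^ (k - 1 - i)"] by (auto intro: order_trans)
    qed simp
    show ?thesis
    proof (cases "G = 0")
      case True
      have "A + B = 0"
      proof -
        have "poly (A + B) x = 0" if "x \<noteq> 1" for x
        proof -
          have "0 = (x - 1) ^ (k - 1) * poly (interp' 1 k \<alpha> \<beta>) (x / (x - 1))" by (simp add: G True)
          also have "\<dots> = poly (A + B) x" unfolding w' AB by (rule poly_theta[OF that])
          finally show ?thesis by simp
        qed
        then have "{x. x \<noteq> 1} \<subseteq> {x. poly (A + B) x = 0}" by blast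
        then show ?thesis using infinite_neq_1 poly_roots_finite finite_subset by blast
      qed
      then show ?thesis using that[of 0] by simp
    next
      case False
      have "degree (interp' 1 k \<alpha> \<beta>) = n1 + n2 + degree G"
        unfolding G using False by (subst degree_mult_eq, simp, simp) (subst degree_mult_eq, auto simp: degree_power_eq)
      moreover have "0 < k" using i by simp
      ultimately have g: "n1 + n2 + degree G + 1 \<le> k" using degw by linarith
      then obtain g where g: "k = n1 + n2 + 1 + g" "degree G \<le> g" by (metis add.commute add.left_commute le_iff_add nat_add_left_cancel_le)
      \<comment> \<open>The polynomial \<open>(x - 1) ^ g G(x / (x - 1))\<close>; \<open>g\<close>
        is the degree left over after the zeros at \<open>\<theta> = 0\<close> and
        \<open>\<theta> = 1\<close>.\<close>
      define \<gamma> where "\<gamma> = (\<Sum>l\<le>g. Polynomial.smult (poly.coeff G l) ([:0, 1:] ^ l * [:-1, 1:] ^ (g - l)))"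
      have pg: "poly \<gamma> x = (x - 1) ^ g * poly G (x / (x - 1))" if "x \<noteq> 1" for x
      proof -
        have "poly G y = (\<Sum>l\<le>g. poly.coeff G l * y ^ l)" for y
          unfolding poly_altdef using g(2) by (intro sum.mono_neutral_left) (auto simp: coeff_eq_0)
        moreover have "(x - 1) ^ g * (c * (x / (x - 1)) ^ l) = c * (x ^ l * (x - 1) ^ (g - l))" if "l \<le> g" for l c
        proof -
          have "(x - 1) ^ g = (x - 1) ^ l * (x - 1) ^ (g - l)" using that by (simp add: power_add[symmetric])
          then show ?thesis using \<open>x \<noteq> 1\<close> by (simp add: power_divide)
        qed
        ultimately have "(x - 1) ^ g * poly G (x / (x - 1)) = (\<Sum>l\<le>g. poly.coeff G l * (x ^ l * (x - 1) ^ (g - l)))"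
          by (simp only: sum_distrib_left) (rule sum.cong, auto)
        then show ?thesis by (simp add: \<gamma>_def poly_sum poly_power)
      qed
      have "poly (A + B) x = poly ([:0, 1:] ^ n1 * \<gamma>) x" if "x \<noteq> 1" for x
      proof -
        define \<theta> where "\<theta> = x / (x - 1)"
        have u: "(x - 1) * (\<theta> - 1) = 1" "(x - 1) * (2 * \<theta> - 1) = x + 1" "(x - 1) * \<theta> = x"
          using that by (auto simp: \<theta>_def field_simps)
        have e: "(x - 1) ^ (k - 1) = (x - 1) ^ n1 * (x - 1) ^ n2 * (x - 1) ^ g" by (simp add: g(1) power_add)
        have "poly (A + B) x = (x - 1) ^ (k - 1) * poly (interp' 1 k \<alpha> \<beta>) \<theta>"
          unfolding w' AB \<theta>_def by (rule poly_theta[OF that, symmetric])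
        also have "\<dots> = ((x - 1) ^ n1 * \<theta> ^ n1) * ((x - 1) ^ n2 * (\<theta> - 1) ^ n2) * ((x - 1) ^ g * poly G \<theta>)"
          unfolding G e by (simp add: poly_power algebra_simps)
        also have "\<dots> = x ^ n1 * poly \<gamma> x"
          using pg[OF that] by (simp add: power_mult_distrib[symmetric] u \<theta>_def[symmetric])
        finally show ?thesis by (simp add: poly_power)
      qed
      then have "{x. x \<noteq> 1} \<subseteq> {x. poly (A + B - [:0, 1:] ^ n1 * \<gamma>) x = 0}" by auto
      then have "A + B - [:0, 1:] ^ n1 * \<gamma> = 0" using infinite_neq_1 poly_roots_finite finite_subset by blast
      moreover have "degree \<gamma> \<le> g" unfolding \<gamma>_def
      proof (rule degree_sum_le)
        fix l assume "l \<in> {..g}"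
        moreover have "degree ([:0, 1:] ^ l * [:-1, 1::real:] ^ (g - l)) \<le> l + (g - l)"
          by (rule order.trans[OF degree_mult_le]) (simp add: degree_power_eq)
        ultimately show "degree (Polynomial.smult (poly.coeff G l) ([:0, 1:] ^ l * [:-1, 1:] ^ (g - l))) \<le> g"
          using degree_smult_le[of "poly.coeff G l" "[:0, 1:] ^ l * [:-1, 1:] ^ (g - l)"] by (auto intro: order_trans)
      qed simp
      then have "poly.coeff \<gamma> i = 0" if "k \<le> i + n1 + n2" for i
        by (rule le_less_trans[THEN coeff_eq_0]) (use that g(1) in simp)
      ultimately show ?thesis using that by simp
    qed
  qed
  moreover have "poly.coeff A j = 0" if "k \<le> j" for j unfolding A_def using deg that by blast
  ultimately have "A = 0 \<and> B = 0"
    using sqrt_pade[of "n3 + n4" n1 n2 k A B \<gamma>] kn by (simp add: add.commute add.left_commute)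
  then show ?thesis using zero unfolding A_def B_def by blast
qed

text \<open>Nondegeneracy is an open condition, so it passes from the limit \<open>m = 1\<close> to
  some \<open>m\<close> above 1. Concretely, normalised nonzero solutions for parameters tending to
  1 would accumulate at a nonzero solution of the limit problem.\<close>

lemma interp_nondegenerate:
  assumes kn: "n1 + n2 + n3 + n4 = 2 * k" "n1 + n2 \<le> k"
  shows "\<exists>m. 1 < m \<and> m < 2 \<and> (\<forall>\<alpha> \<beta>.
    [:- pa m, 1:] ^ n1 * [:-1, 1:] ^ n2 * [:- (pa m - 2 * (2 - m)), 1:] ^ n3 * [:- (pa m - 2 * (2 - 1 / m)), 1:] ^ n4
      dvd interp (pa m) k \<alpha> \<beta> \<longrightarrow> (\<forall>i<k. \<alpha> i = 0 \<and> \<beta> i = 0))"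
proof (rule ccontr)
  assume neg: "\<not> ?thesis"
  define m where "m l = 1 + 1 / real (l + 2)" for l :: nat
  define D where "D l = [:- pa (m l), 1:] ^ n1 * [:-1, 1:] ^ n2 * [:- (pa (m l) - 2 * (2 - m l)), 1:] ^ n3 *
     [:- (pa (m l) - 2 * (2 - 1 / m l)), 1:] ^ n4" for l
  have m: "1 < m l" "m l < 2" for l by (auto simp: m_def field_simps)
  have "\<exists>\<alpha> \<beta>. D l dvd interp (pa (m l)) k \<alpha> \<beta> \<and> (\<exists>i<k. \<alpha> i \<noteq> 0 \<or> \<beta> i \<noteq> 0)" for l
    using neg m[of l] unfolding D_def by blast
  then obtain \<alpha>' \<beta>' where ab': "\<And>l. D l dvd interp (pa (m l)) k (\<alpha>' l) (\<beta>' l)"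
    "\<And>l. \<exists>i<k. \<alpha>' l i \<noteq> 0 \<or> \<beta>' l i \<noteq> 0" by metis
  \<comment> \<open>Normalising the sum of absolute values to 1 bounds the coefficients and keeps
    the limit away from 0.\<close>
  define s where "s l = (\<Sum>i<k. \<bar>\<alpha>' l i\<bar> + \<bar>\<beta>' l i\<bar>)" for l
  have s0: "0 < s l" for l
  proof -
    obtain i where i: "i < k" "\<alpha>' l i \<noteq> 0 \<or> \<beta>' l i \<noteq> 0" using ab'(2) by blast
    have "\<bar>\<alpha>' l i\<bar> + \<bar>\<beta>' l i\<bar> \<le> s l" unfolding s_def
      by (rule member_le_sum[of i "{..<k}"]) (use i in auto)
    then show ?thesis using i by auto
  qed
  define \<alpha> where "\<alpha> l i = \<alpha>' l i / s l" for l i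
  define \<beta> where "\<beta> l i = \<beta>' l i / s l" for l i
  have "interp (pa (m l)) k (\<alpha> l) (\<beta> l) = Polynomial.smult (1 / s l) (interp (pa (m l)) k (\<alpha>' l) (\<beta>' l))" for l
  proof -
    have "[:\<alpha> l i, \<beta> l i:] = Polynomial.smult (1 / s l) [:\<alpha>' l i, \<beta>' l i:]" for i by (simp add: \<alpha>_def \<beta>_def)
    then show ?thesis unfolding interp_def smult_sum_distrib by (simp only: mult_smult_left)
  qed
  then have dv: "D l dvd interp (pa (m l)) k (\<alpha> l) (\<beta> l)" for l using ab'(1)[of l] by (simp add: dvd_smult)
  have s1: "(\<Sum>i<k. \<bar>\<alpha> l i\<bar> + \<bar>\<beta> l i\<bar>) = 1" for l
    using s0[of l] unfolding \<alpha>_def \<beta>_def by (simp add: s_def add_divide_distrib[symmetric] sum_divide_distrib[symmetric])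
  define X where "X l i = (if i < k then \<alpha> l i else if i < 2 * k then \<beta> l (i - k) else 0)" for l i
  have "\<bar>\<alpha> l i\<bar> \<le> 1 \<and> \<bar>\<beta> l i\<bar> \<le> 1" if "i < k" for l i
  proof -
    have "\<bar>\<alpha> l i\<bar> + \<bar>\<beta> l i\<bar> \<le> 1" unfolding s1[of l, symmetric]
      by (rule member_le_sum[of i "{..<k}"]) (use that in auto)
    then show ?thesis by linarith
  qed
  then have "\<bar>X l i\<bar> \<le> 1" for l i by (auto simp: X_def)
  from convergent_subseq_finite[of X 1 "2 * k", OF this] obtain r x where r: "strict_mono r"
    "\<And>i. i < 2 * k \<Longrightarrow> (\<lambda>l. X (r l) i) \<longlonglongrightarrow> x i" by blast
  define \<alpha>0 where "\<alpha>0 i = x i" for i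
  define \<beta>0 where "\<beta>0 i = x (k + i)" for i
  have a: "(\<lambda>l. \<alpha> (r l) i) \<longlonglongrightarrow> \<alpha>0 i" if "i < k" for i using r(2)[of i] that by (simp add: X_def \<alpha>0_def)
  have b: "(\<lambda>l. \<beta> (r l) i) \<longlonglongrightarrow> \<beta>0 i" if "i < k" for i using r(2)[of "k + i"] that by (simp add: X_def \<beta>0_def)
  have "m \<longlonglongrightarrow> 1 + 0" unfolding m_def
    by (intro tendsto_add tendsto_const LIMSEQ_ignore_initial_segment[where k = 2] lim_1_over_n)
  then have lm: "(\<lambda>l. m (r l)) \<longlonglongrightarrow> 1" using LIMSEQ_subseq_LIMSEQ[OF _ r(1), of m 1] by (simp add: o_def)
  have "(\<lambda>l. pa (m (r l))) \<longlonglongrightarrow> (2 - 1) * (2 - 1 / 1)" unfolding pa_def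
    by (intro tendsto_intros lm) simp
  then have la: "(\<lambda>l. pa (m (r l))) \<longlonglongrightarrow> 1" by simp
  have "(\<lambda>l. pa (m (r l)) - 2 * (2 - m (r l))) \<longlonglongrightarrow> 1 - 2 * (2 - 1)"
    by (intro tendsto_intros lm la)
  then have lq3: "(\<lambda>l. pa (m (r l)) - 2 * (2 - m (r l))) \<longlonglongrightarrow> -1" by simp
  have "(\<lambda>l. pa (m (r l)) - 2 * (2 - 1 / m (r l))) \<longlonglongrightarrow> 1 - 2 * (2 - 1 / 1)"
    by (intro tendsto_intros lm la) simp
  then have lq4: "(\<lambda>l. pa (m (r l)) - 2 * (2 - 1 / m (r l))) \<longlonglongrightarrow> -1" by simp
  have "pconv (\<lambda>l. interp (pa (m (r l))) k (\<alpha> (r l)) (\<beta> (r l))) (interp 1 k \<alpha>0 \<beta>0)"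
    unfolding interp_def by (intro pconv_sum pconv_mult pconv_power pconv_pCons pconv_const tendsto_const tendsto_minus la)
      (use a b in auto)
  from pconv_dvd2[OF this lq3 lq4, of n3 n4] dv have d2: "[:1, 1:] ^ n3 * [:1, 1:] ^ n4 dvd interp 1 k \<alpha>0 \<beta>0"
    unfolding D_def by (simp add: mult.assoc) (meson dvd_mult_right)
  \<comment> \<open>The same coefficients are read in the coordinate in which the roots
    \<open>a\<close> and \<open>1\<close> are 0 and 1 along the whole sequence; in the coordinate
    \<open>t\<close> they would merge with the spurious factor
    \<open>(t - 1) ^ (k - 1)\<close>.\<close>
  have "pconv (\<lambda>l. interp' (pa (m (r l))) k (\<alpha> (r l)) (\<beta> (r l))) (interp' 1 k \<alpha>0 \<beta>0)"
  proof -
    have "(\<lambda>l. \<alpha> (r l) i + \<beta> (r l) i * pa (m (r l))) \<longlonglongrightarrow> \<alpha>0 i + \<beta>0 i * 1"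
      "(\<lambda>l. \<beta> (r l) i * (1 - pa (m (r l)))) \<longlonglongrightarrow> \<beta>0 i * (1 - 1)" if "i < k" for i
      by (intro tendsto_intros la a[OF that] b[OF that])+
    then show ?thesis unfolding interp'_def
      by (intro pconv_sum pconv_mult pconv_power pconv_add pconv_pCons pconv_const tendsto_const tendsto_diff la) auto
  qed
  moreover have "[:- 0, 1:] ^ n1 * [:- 1, 1:] ^ n2 dvd interp' (pa (m (r l))) k (\<alpha> (r l)) (\<beta> (r l))" for l
  proof -
    define a where "a = pa (m (r l))"
    have "a \<noteq> 1"
    proof
      assume "a = 1"
      then have "(m (r l) - 1)\<^sup>2 = 0" using m[of "r l"] unfolding a_def pa_def
        by (simp add: field_simps power2_eq_square)
      then show False using m[of "r l"] by simp
    qed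
    have e: "pcompose [:-a, 1:] [:a, 1 - a:] = Polynomial.smult (1 - a) [:0, 1:]" "pcompose [:-1, 1:] [:a, 1 - a:] = Polynomial.smult (1 - a) [:-1, 1:]"
      by (simp_all add: pcompose_pCons)
    have "[:-a, 1:] ^ n1 * [:-1, 1:] ^ n2 dvd interp a k (\<alpha> (r l)) (\<beta> (r l))"
      using dv[of "r l"] unfolding D_def a_def by (meson dvd_mult_left)
    then obtain c where "interp a k (\<alpha> (r l)) (\<beta> (r l)) = [:-a, 1:] ^ n1 * [:-1, 1:] ^ n2 * c" by blast
    then have "Polynomial.smult ((1 - a) ^ (k - 1)) (interp' a k (\<alpha> (r l)) (\<beta> (r l))) =
      pcompose ([:-a, 1:] ^ n1 * [:-1, 1:] ^ n2 * c) [:a, 1 - a:]" by (simp only: pcompose_interp[symmetric])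
    also have "\<dots> = Polynomial.smult (1 - a) [:0, 1:] ^ n1 * Polynomial.smult (1 - a) [:-1, 1:] ^ n2 * pcompose c [:a, 1 - a:]"
      unfolding pcompose_mult pcompose_power e ..
    also have "\<dots> = Polynomial.smult ((1 - a) ^ n1 * (1 - a) ^ n2) ([:0, 1:] ^ n1 * [:-1, 1:] ^ n2 * pcompose c [:a, 1 - a:])"
      by (simp only: smult_power mult_smult_left mult_smult_right smult_smult mult_ac)
    finally have "[:0, 1:] ^ n1 * [:-1, 1:] ^ n2 dvd Polynomial.smult ((1 - a) ^ (k - 1)) (interp' a k (\<alpha> (r l)) (\<beta> (r l)))"
      by (simp add: dvd_smult)
    then show ?thesis using \<open>a \<noteq> 1\<close> by (simp add: dvd_smult_iff a_def)
  qed
  ultimately have "[:- 0, 1:] ^ n1 * [:- 1, 1:] ^ n2 dvd interp' 1 k \<alpha>0 \<beta>0"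
    by (rule pconv_dvd2[OF _ tendsto_const tendsto_const])
  then have "[:0, 1:] ^ n1 * [:- 1, 1:] ^ n2 dvd interp' 1 k \<alpha>0 \<beta>0" by simp
  from interp_limit_zero[OF kn this d2] have z: "\<alpha>0 i = 0 \<and> \<beta>0 i = 0" if "i < k" for i using that .
  have "(\<lambda>l. \<Sum>i<k. \<bar>\<alpha> (r l) i\<bar> + \<bar>\<beta> (r l) i\<bar>) \<longlonglongrightarrow> (\<Sum>i<k. \<bar>\<alpha>0 i\<bar> + \<bar>\<beta>0 i\<bar>)"
    by (intro tendsto_intros a b) auto
  then have "(\<lambda>l. 1::real) \<longlonglongrightarrow> 0" unfolding s1 using z by simp
  then show False using LIMSEQ_unique[OF _ tendsto_const] by force
qed

section \<open>Construction of the matrix of the birational map\<close>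

text \<open>Gaussian elimination: a pivot clears the top coefficient of all other members of the
  family.\<close>

lemma poly_linear_dependence:
  fixes v :: "nat \<Rightarrow> 'a::field poly"
  assumes "finite I" "M < card I" "\<And>i j. i \<in> I \<Longrightarrow> M \<le> j \<Longrightarrow> poly.coeff (v i) j = 0"
  shows "\<exists>c. (\<exists>i\<in>I. c i \<noteq> 0) \<and> (\<Sum>i\<in>I. Polynomial.smult (c i) (v i)) = 0"
  using assms
proof (induct M arbitrary: I v)
  case 0
  then obtain i where "i \<in> I" by (metis all_not_in_conv card.empty less_irrefl)
  moreover have "v i = 0" if "i \<in> I" for i using 0 that by (auto simp: poly_eq_iff)
  ultimately show ?case by (intro exI[of _ "\<lambda>_. 1"]) auto
next
  case (Suc M)
  show ?case
  proof (cases "\<forall>i\<in>I. poly.coeff (v i) M = 0")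
    case True
    then have "\<And>i j. i \<in> I \<Longrightarrow> M \<le> j \<Longrightarrow> poly.coeff (v i) j = 0"
      using Suc(4) by (metis le_antisym not_less_eq_eq)
    then show ?thesis using Suc(1)[OF Suc(2), of v] Suc(3) by simp
  next
    case False
    then obtain p where p: "p \<in> I" "poly.coeff (v p) M \<noteq> 0" by blast
    define r where "r i = poly.coeff (v i) M / poly.coeff (v p) M" for i
    define v' where "v' i = v i - Polynomial.smult (r i) (v p)" for i
    have "\<exists>c. (\<exists>i\<in>I - {p}. c i \<noteq> 0) \<and> (\<Sum>i\<in>I - {p}. Polynomial.smult (c i) (v' i)) = 0"
    proof (rule Suc(1))
      fix i j assume i: "i \<in> I - {p}" "M \<le> j"
      show "poly.coeff (v' i) j = 0"
      proof (cases "j = M")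
        case True then show ?thesis using p by (simp add: v'_def r_def)
      next
        case False then show ?thesis using i p Suc(4)[of i j] Suc(4)[of p j] by (simp add: v'_def)
      qed
    qed (use Suc p in auto)
    then obtain c where c: "\<exists>i\<in>I - {p}. c i \<noteq> 0" "(\<Sum>i\<in>I - {p}. Polynomial.smult (c i) (v' i)) = 0" by blast
    define c' where "c' = c(p := - (\<Sum>i\<in>I - {p}. c i * r i))"
    have "(\<Sum>i\<in>I. Polynomial.smult (c' i) (v i)) = Polynomial.smult (c' p) (v p) + (\<Sum>i\<in>I - {p}. Polynomial.smult (c i) (v i))"
      using Suc(2) p by (subst sum.remove[of _ p]) (auto simp: c'_def intro!: sum.cong)
    also have "(\<Sum>i\<in>I - {p}. Polynomial.smult (c i) (v i)) = (\<Sum>i\<in>I - {p}. Polynomial.smult (c i) (v' i)) + Polynomial.smult (\<Sum>i\<in>I - {p}. c i * r i) (v p)"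
      by (simp add: v'_def smult_diff_right smult_sum sum_subtractf)
    finally have "(\<Sum>i\<in>I. Polynomial.smult (c' i) (v i)) = 0"
      using c by (simp add: c'_def smult_minus_left)
    moreover have "\<exists>i\<in>I. c' i \<noteq> 0" using c(1) by (auto simp: c'_def)
    ultimately show ?thesis by blast
  qed
qed

section \<open>Local branches over the critical values and the data of the four fibres\<close>

lemma pencil_shift:
  fixes a :: "'r::comm_ring_1"
  shows "pencil a x0 x1 1 (c + d) = pencil a x0 x1 1 c + d * (x0 - x1 * (3 * c\<^sup>2 - 2 * a * c + 1)) - d\<^sup>2 * (x1 * (3 * c + d - a))"
  by (simp add: pencil_def power2_eq_square algebra_simps)

text \<open>Hensel lifting of the simple root \<open>q\<close> of the cubic over \<open>z\<close>.\<close>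

lemma local_branch:
  fixes z q a :: real
  assumes "pencil a 1 z 1 q = 0" "1 - z * (3 * q\<^sup>2 - 2 * a * q + 1) \<noteq> 0"
  shows "\<exists>c. poly c z = q \<and> [:- z, 1:] ^ n dvd pencil [:a:] 1 [:0, 1:] 1 c"
proof -
  have "\<exists>c. poly c z = q \<and> [:- z, 1:] ^ Suc n dvd pencil [:a:] 1 [:0, 1:] 1 c" for n
  proof (induct n)
    case 0
    have "poly (pencil [:a:] 1 [:0, 1:] 1 [:q:]) z = 0"
      using assms(1) by (simp add: rhom_pencil[OF rhom_poly])
    then show ?case by (intro exI[of _ "[:q:]"]) (simp add: poly_eq_0_iff_dvd)
  next
    case (Suc n)
    then obtain c h where c: "poly c z = q" "pencil [:a:] 1 [:0, 1:] 1 c = [:- z, 1:] ^ Suc n * h" by blast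
    define d where "d = 1 - z * (3 * q\<^sup>2 - 2 * a * q + 1)"
    \<comment> \<open>One Newton step: \<open>D\<close> is the derivative along the fibre, a unit at
      \<open>z\<close>, and \<open>e\<close> makes \<open>h + e D\<close> vanish there, which raises
      the order by one.\<close>
    define e where "e = - poly h z / d"
    define s where "s = [:- z, 1:] ^ Suc n"
    define D where "D = 1 - [:0, 1:] * (3 * c\<^sup>2 - 2 * [:a:] * c + 1)"
    have "poly D z = d" by (simp add: D_def d_def c(1))
    then have "poly (h + [:e:] * D) z = 0" using assms(2) by (simp add: e_def d_def[symmetric])
    then have "[:- z, 1:] dvd h + [:e:] * D" by (simp only: poly_eq_0_iff_dvd)
    then obtain h' where h': "h + [:e:] * D = [:- z, 1:] * h'" by (rule dvdE)
    have "pencil [:a:] 1 [:0, 1:] 1 (c + s * [:e:]) =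
      s * h + s * [:e:] * D - (s * [:e:])\<^sup>2 * ([:0, 1:] * (3 * c + s * [:e:] - [:a:]))"
      unfolding pencil_shift c(2) D_def s_def ..
    also have "\<dots> = s * (h + [:e:] * D) - s * ([:- z, 1:] * ([:- z, 1:] ^ n * [:e:]\<^sup>2 * ([:0, 1:] * (3 * c + s * [:e:] - [:a:]))))"
      by (simp only: s_def power_Suc power2_eq_square ring_distribs mult_ac)
    also have "\<dots> = [:- z, 1:] ^ Suc (Suc n) * (h' - [:- z, 1:] ^ n * [:e:]\<^sup>2 * ([:0, 1:] * (3 * c + s * [:e:] - [:a:])))"
      unfolding h' by (simp only: s_def power_Suc ring_distribs mult_ac)
    finally have "[:- z, 1:] ^ Suc (Suc n) dvd pencil [:a:] 1 [:0, 1:] 1 (c + s * [:e:])" by simp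
    moreover have "poly (c + s * [:e:]) z = q" by (simp add: c s_def)
    ultimately show ?case by blast
  qed
  then show ?thesis by (cases n) (auto intro: exI[of _ "[:q:]"])
qed

text \<open>\<open>interp a (k + 1) \<alpha> \<beta>\<close> is the value of \<open>\<alpha> + \<beta> t\<close> on the curve, where \<open>\<alpha>, \<beta>\<close> are polynomials of
  degree at most \<open>k\<close> in \<open>z\<close>; vanishing at \<open>t = q\<close> is turned into vanishing along the local branch \<open>c\<close>.\<close>

lemma interp_local:
  fixes a z q :: real
  assumes c: "poly c z = q" "[:- z, 1:] ^ n dvd pencil [:a:] 1 [:0, 1:] 1 c"
    and Q: "poly [:-1, 1, - a, 1:] q \<noteq> 0"
    and d: "[:- q, 1:] ^ n dvd interp a (Suc k) \<alpha> \<beta>"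
  shows "[:- z, 1:] ^ n dvd (\<Sum>i\<le>k. Polynomial.monom (\<alpha> i) i) + (\<Sum>i\<le>k. Polynomial.monom (\<beta> i) i) * c"
proof -
  define P where "P = pcompose [:-1, 1:] c"
  define R where "R = pcompose [:-1, 1, - a, 1:] c"
  have "P - [:0, 1:] * R = pencil [:a:] 1 [:0, 1:] 1 c"
  proof -
    have u: "[:-1:] = (- 1 :: real poly)" "[:- a:] = - [:a:]" "[:1::real:] = 1" by (simp_all add: one_pCons)
    have "P = c - 1" "R = c\<^sup>2 * (c - [:a:]) + (c - 1)"
      unfolding P_def R_def pcompose_pCons pcompose_0 mult_zero_right add_0_right u
      by (simp_all add: power2_eq_square algebra_simps pcompose_1)
    then show ?thesis unfolding pencil_def by (simp only: mult_1 mult_1_right power_one)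
  qed
  \<comment> \<open>Along the branch \<open>P\<close> and \<open>z Q\<close> agree modulo the power,
    so each term \<open>P ^ i Q ^ (k - i)\<close> may be replaced by \<open>z ^ i Q ^ k\<close>;
    this undoes the clearing of denominators in \<open>interp\<close>.\<close>
  then have PR: "[:- z, 1:] ^ n dvd P - [:0, 1:] * R" using c(2) by simp
  have pow: "[:- z, 1:] ^ n dvd P ^ i - ([:0, 1:] * R) ^ i" for i
    by (subst power_diff_sumr2) (rule dvd_mult2[OF PR])
  have w: "pcompose (interp a (Suc k) \<alpha> \<beta>) c = (\<Sum>i\<le>k. ([:\<alpha> i:] + [:\<beta> i:] * c) * P ^ i * R ^ (k - i))"
    unfolding interp_def pcompose_sum pcompose_mult pcompose_power P_def R_def
    by (simp add: pcompose_pCons lessThan_Suc_atMost mult.commute)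
  have "poly (c - [:q:]) z = 0" using c by simp
  then have "[:- z, 1:] ^ n dvd (c - [:q:]) ^ n" by (simp only: dvd_power_same poly_eq_0_iff_dvd)
  moreover have "(c - [:q:]) ^ n = pcompose ([:- q, 1:] ^ n) c"
  proof -
    have "pcompose [:- q, 1:] c = c + - [:q:]" by (simp add: pcompose_pCons pcompose_1 pCons_one)
    then show ?thesis unfolding pcompose_power by (simp only: diff_conv_add_uminus)
  qed
  moreover obtain w' where "interp a (Suc k) \<alpha> \<beta> = [:- q, 1:] ^ n * w'" using d by blast
  ultimately have "[:- z, 1:] ^ n dvd pcompose (interp a (Suc k) \<alpha> \<beta>) c" by (simp add: pcompose_mult)
  moreover have "[:- z, 1:] ^ n dvd (\<Sum>i\<le>k. ([:\<alpha> i:] + [:\<beta> i:] * c) * R ^ (k - i) * (P ^ i - ([:0, 1:] * R) ^ i))"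
    using pow by (intro dvd_sum dvd_mult) auto
  ultimately have "[:- z, 1:] ^ n dvd pcompose (interp a (Suc k) \<alpha> \<beta>) c -
     (\<Sum>i\<le>k. ([:\<alpha> i:] + [:\<beta> i:] * c) * R ^ (k - i) * (P ^ i - ([:0, 1:] * R) ^ i))" by (rule dvd_diff)
  also have "\<dots> = (\<Sum>i\<le>k. ([:\<alpha> i:] + [:\<beta> i:] * c) * R ^ (k - i) * ([:0, 1:] * R) ^ i)"
  proof -
    have "u * p * r - u * r * (p - s) = u * r * s" for u p r s :: "real poly" by (simp add: algebra_simps)
    then show ?thesis unfolding w sum_subtractf[symmetric] by simp
  qed
  also have "\<dots> = R ^ k * ((\<Sum>i\<le>k. Polynomial.monom (\<alpha> i) i) + (\<Sum>i\<le>k. Polynomial.monom (\<beta> i) i) * c)"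
    unfolding sum_distrib_left sum_distrib_right sum.distrib[symmetric]
  proof (rule sum.cong)
    fix i assume "i \<in> {..k}"
    then have Rk: "R ^ k = R ^ (k - i) * R ^ i" by (simp add: power_add[symmetric])
    have mo: "Polynomial.monom x i = [:x:] * [:0, 1:] ^ i" for x :: real by (simp add: monom_altdef)
    show "([:\<alpha> i:] + [:\<beta> i:] * c) * R ^ (k - i) * ([:0, 1:] * R) ^ i =
      R ^ k * (Polynomial.monom (\<alpha> i) i + Polynomial.monom (\<beta> i) i * c)"
      unfolding Rk mo by (simp only: power_mult_distrib ring_distribs mult_ac)
  qed simp
  finally show ?thesis
    by (rule linear_power_dvd_cancel) (use Q c(1) in \<open>simp add: R_def poly_power poly_pcompose\<close>)
qed

text \<open>Third root of the cubic in each ramified fibre. Over the last two it follows from the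
  double root \<open>p\<close> by \<open>2 p + q = pa m\<close>, the sum of the roots.\<close>

definition qs :: "real \<Rightarrow> nat \<Rightarrow> real" where
  "qs m j = [pa m, 1, pa m - 2 * (2 - m), pa m - 2 * (2 - 1 / m)] ! j"

text \<open>In the last two fibres the product of the roots gives
  \<open>1 / z - 1 = - p^2 q\<close>, where \<open>q\<close> is \<open>- p / m\<close> for
  \<open>p = 2 - m\<close> and \<open>- p m\<close> for \<open>p = 2 - 1 / m\<close>.\<close>

definition zs :: "real \<Rightarrow> nat \<Rightarrow> real" where
  "zs m j = [1, 0, 1 / (1 + (2 - m) ^ 3 / m), 1 / (1 + (2 - 1 / m) ^ 3 * m)] ! j"

text \<open>The double root in projective form \<open>(Y0, Y1)\<close>, because over
  \<open>z = 0\<close> it lies at infinity.\<close>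

definition Ts :: "real \<Rightarrow> nat \<Rightarrow> real \<times> real" where
  "Ts m j = [(1, 0), (0, 1), (1, 2 - m), (1, 2 - 1 / m)] ! j"

text \<open>The coefficient \<open>- z\<close> of \<open>Y1 ^ 3\<close>, except over
  \<open>z = 0\<close>, where the cubic loses its leading term.\<close>

definition ks :: "real \<Rightarrow> nat \<Rightarrow> real" where
  "ks m j = [- 1, 1, - zs m 2, - zs m 3] ! j"

lemma less_4: "j < 4 \<longleftrightarrow> j = 0 \<or> j = 1 \<or> j = 2 \<or> j = (3::nat)"
  by auto

lemma less_4_E: assumes "j < (4::nat)" "P 0" "P 1" "P 2" "P 3" shows "P j"
  using assms by (auto simp: less_4)

lemmas data_defs = qs_def zs_def Ts_def ks_def numeral_2_eq_2 numeral_3_eq_3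

context
  fixes m :: real
  assumes m: "1 < m" "m < 2"
begin

lemma pa_bounds: "0 < pa m" "pa m \<noteq> 1"
proof -
  have "0 < 2 - m" "0 < 2 - 1 / m" using m by (simp_all add: field_simps)
  then show "0 < pa m" by (simp add: pa_def)
  show "pa m \<noteq> 1"
  proof
    assume "pa m = 1"
    then have "(m - 1)\<^sup>2 = 0" using m unfolding pa_def by (simp add: field_simps power2_eq_square)
    then show False using m by simp
  qed
qed

text \<open>For \<open>m = 1\<close> the last two critical values would coincide at 1 / 2; for
  \<open>m > 1\<close> they move apart to different sides of it.\<close>

lemma zs_order: "zs m 0 = 1" "zs m 1 = 0" "0 < zs m 3" "zs m 3 < 1 / 2" "1 / 2 < zs m 2" "zs m 2 < 1"
proof -
  show "zs m 0 = 1" "zs m 1 = 0" by (simp_all add: zs_def)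
  define x where "x = (2 - m) ^ 3 / m" define y where "y = (2 - 1 / m) ^ 3 * m"
  have p: "0 < (2 - m) ^ 3" "(2 - m) ^ 3 < 1" using m by (auto simp: power_less_one_iff)
  then have x: "0 < x" "x < 1" using m by (auto simp: x_def field_simps)
  have "1 / m < 1" using m by simp
  then have "1 < 2 - 1 / m" by simp
  then have "1 < (2 - 1 / m) ^ 3" by (rule one_less_power) simp
  then have "1 * 1 < y" unfolding y_def using less_1_mult[OF _ m(1)] by simp
  then show "0 < zs m 3" "zs m 3 < 1 / 2" "1 / 2 < zs m 2" "zs m 2 < 1"
  proof -
    have "zs m 2 = 1 / (1 + x)" "zs m 3 = 1 / (1 + y)" by (simp_all add: zs_def x_def y_def)
    moreover have "1 / 2 < 1 / (1 + x)" "1 / (1 + x) < 1" using x by (simp_all add: field_simps)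
    moreover have "0 < 1 / (1 + y)" "1 / (1 + y) < 1 / 2" using \<open>1 * 1 < y\<close> by (simp_all add: field_simps)
    ultimately show "0 < zs m 3" "zs m 3 < 1 / 2" "1 / 2 < zs m 2" "zs m 2 < 1" by simp_all
  qed
qed

lemma zs_inj: "i < 4 \<Longrightarrow> j < 4 \<Longrightarrow> zs m i = zs m j \<Longrightarrow> i = j"
  using zs_order unfolding less_4 by auto

lemma ks_nonzero: "j < 4 \<Longrightarrow> ks m j \<noteq> 0"
  using zs_order by (auto simp: less_4 ks_def numeral_2_eq_2[symmetric] numeral_3_eq_3[symmetric])

text \<open>A general coefficient map \<open>f\<close> is allowed because the factorisation is used
  over the reals, over constant polynomials and over the complex numbers.\<close>

lemma pencil_ramified:
  fixes f :: "real \<Rightarrow> 'r::comm_ring_1"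
  assumes f: "rhom f" and j: "j < 4"
  shows "pencil (f (pa m)) 1 (f (zs m j)) Y0 Y1 =
    f (ks m j) * (Y1 * f (fst (Ts m j)) - Y0 * f (snd (Ts m j)))\<^sup>2 * (Y1 - f (qs m j) * Y0)"
  using j
proof (rule less_4_E)
  show "pencil (f (pa m)) 1 (f (zs m 0)) Y0 Y1 =
    f (ks m 0) * (Y1 * f (fst (Ts m 0)) - Y0 * f (snd (Ts m 0)))\<^sup>2 * (Y1 - f (qs m 0) * Y0)"
    by (simp add: data_defs rhom_simps[OF f] pencil_def power2_eq_square algebra_simps)
  show "pencil (f (pa m)) 1 (f (zs m 1)) Y0 Y1 =
    f (ks m 1) * (Y1 * f (fst (Ts m 1)) - Y0 * f (snd (Ts m 1)))\<^sup>2 * (Y1 - f (qs m 1) * Y0)"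
    by (simp add: data_defs rhom_simps[OF f] pencil_def power2_eq_square algebra_simps)
  \<comment> \<open>The first two equations say that \<open>(t - p)^2 (t - q)\<close> equals
    \<open>t^2 (t - a) + p^2 q (t - 1)\<close>; the third determines the fibre in which this cubic
    occurs.\<close>
  have expand: "pencil (f (pa m)) 1 (f z) Y0 Y1 = f (- z) * (Y1 * f 1 - Y0 * f p)\<^sup>2 * (Y1 - f q * Y0)"
    if h: "pa m = 2 * p + q" "p\<^sup>2 + 2 * p * q = p\<^sup>2 * q" "1 - z = - z * (p\<^sup>2 * q)" for z p q
  proof -
    define P Q Z where "P = f p" and "Q = f q" and "Z = f z"
    have 2: "f 2 = 2" using rhom_add[OF f, of 1 1] rhom_1[OF f] by simp
    have 1: "f (pa m) = 2 * P + Q" "P\<^sup>2 + 2 * P * Q = P\<^sup>2 * Q" "1 - Z = - Z * (P\<^sup>2 * Q)"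
      unfolding P_def Q_def Z_def using h[THEN arg_cong[of _ _ f]] by (simp_all add: rhom_simps[OF f] 2)
    have "(Y1 - Y0 * P)\<^sup>2 * (Y1 - Q * Y0) =
      Y1\<^sup>2 * (Y1 - (2 * P + Q) * Y0) + (P\<^sup>2 + 2 * P * Q) * (Y0\<^sup>2 * Y1) - P\<^sup>2 * Q * (Y0\<^sup>2 * Y0)"
      by (simp add: power2_eq_square algebra_simps)
    also have "\<dots> = Y1\<^sup>2 * (Y1 - f (pa m) * Y0) + P\<^sup>2 * Q * (Y0\<^sup>2 * (Y1 - Y0))"
      unfolding 1 by (simp add: algebra_simps)
    finally have "- Z * ((Y1 - Y0 * P)\<^sup>2 * (Y1 - Q * Y0)) =
      - Z * (Y1\<^sup>2 * (Y1 - f (pa m) * Y0)) + (- Z * (P\<^sup>2 * Q)) * (Y0\<^sup>2 * (Y1 - Y0))"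
      by (simp only: distrib_left mult.assoc)
    also have "\<dots> = pencil (f (pa m)) 1 Z Y0 Y1"
      unfolding 1(3)[symmetric] pencil_def by (simp add: algebra_simps)
    finally show ?thesis unfolding P_def Q_def Z_def by (simp add: rhom_simps[OF f] mult.assoc)
  qed
  have m0: "m \<noteq> 0" using m by simp
  have zz: "1 - 1 / (1 + x) = - (1 / (1 + x)) * - x" if "0 < x" for x :: real using that by (simp add: field_simps)
  have x: "0 < (2 - m) ^ 3 / m" "0 < (2 - 1 / m) ^ 3 * m" using m by (simp_all add: field_simps)
  have "pencil (f (pa m)) 1 (f (zs m 2)) Y0 Y1 = f (- zs m 2) * (Y1 * f 1 - Y0 * f (2 - m))\<^sup>2 * (Y1 - f (pa m - 2 * (2 - m)) * Y0)"
  proof (rule expand)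
    have e: "pa m - 2 * (2 - m) = - (2 - m) / m" using m0 by (simp add: pa_def field_simps)
    have e2: "(2 - m)\<^sup>2 * (pa m - 2 * (2 - m)) = - ((2 - m) ^ 3 / m)"
    proof -
      have "P\<^sup>2 * (- P / m) = - (P ^ 3 / m)" for P :: real by (simp add: power2_eq_square power3_eq_cube)
      then show ?thesis unfolding e by this
    qed
    show "(2 - m)\<^sup>2 + 2 * (2 - m) * (pa m - 2 * (2 - m)) = (2 - m)\<^sup>2 * (pa m - 2 * (2 - m))"
      unfolding e using m0 by (simp add: power2_eq_square field_simps)
    show "1 - zs m 2 = - zs m 2 * ((2 - m)\<^sup>2 * (pa m - 2 * (2 - m)))"
      unfolding e2 using zz[OF x(1)] by (simp add: zs_def)
  qed simp
  then show "pencil (f (pa m)) 1 (f (zs m 2)) Y0 Y1 =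
    f (ks m 2) * (Y1 * f (fst (Ts m 2)) - Y0 * f (snd (Ts m 2)))\<^sup>2 * (Y1 - f (qs m 2) * Y0)"
    by (simp add: ks_def Ts_def qs_def)
  have "pencil (f (pa m)) 1 (f (zs m 3)) Y0 Y1 = f (- zs m 3) * (Y1 * f 1 - Y0 * f (2 - 1 / m))\<^sup>2 * (Y1 - f (pa m - 2 * (2 - 1 / m)) * Y0)"
  proof (rule expand)
    have e: "pa m - 2 * (2 - 1 / m) = - (2 - 1 / m) * m" using m0 by (simp add: pa_def field_simps)
    have e2: "(2 - 1 / m)\<^sup>2 * (pa m - 2 * (2 - 1 / m)) = - ((2 - 1 / m) ^ 3 * m)"
    proof -
      have "P\<^sup>2 * (- P * m) = - (P ^ 3 * m)" for P :: real by (simp add: power2_eq_square power3_eq_cube)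
      then show ?thesis unfolding e by this
    qed
    show "(2 - 1 / m)\<^sup>2 + 2 * (2 - 1 / m) * (pa m - 2 * (2 - 1 / m)) = (2 - 1 / m)\<^sup>2 * (pa m - 2 * (2 - 1 / m))"
      unfolding e using m0 by (simp add: power2_eq_square field_simps)
    show "1 - zs m 3 = - zs m 3 * ((2 - 1 / m)\<^sup>2 * (pa m - 2 * (2 - 1 / m)))"
      unfolding e2 using zz[OF x(2)] by (simp add: zs_def)
  qed simp
  then show "pencil (f (pa m)) 1 (f (zs m 3)) Y0 Y1 =
    f (ks m 3) * (Y1 * f (fst (Ts m 3)) - Y0 * f (snd (Ts m 3)))\<^sup>2 * (Y1 - f (qs m 3) * Y0)"
    by (simp add: ks_def Ts_def qs_def)
qed

lemma qs_not_ramified: "j < 4 \<Longrightarrow> snd (Ts m j) \<noteq> qs m j * fst (Ts m j)"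
proof -
  assume "j < 4"
  have m0: "m \<noteq> 0" using m by simp
  have 0: "pa m - 2 * (2 - m) = - (2 - m) / m" "pa m - 2 * (2 - 1 / m) = - (2 - 1 / m) * m" using m0 by (simp_all add: pa_def field_simps)
  have p: "2 - m > 0" "2 - 1 / m > 0" using m by (simp_all add: field_simps)
  have "0 < (2 - m) / m" "0 < (2 - 1 / m) * m" using p m by simp_all
  then have "pa m - 2 * (2 - m) < 2 - m" "pa m - 2 * (2 - 1 / m) < 2 - 1 / m" unfolding 0 minus_divide_left[symmetric] mult_minus_left using p by linarith+
  then show ?thesis using \<open>j < 4\<close> pa_bounds by (auto simp: less_4 qs_def Ts_def)
qed


end

section \<open>Rows of the matrix from the interpolation problem\<close>

lemma prod_root_power_dvd_cancel:
  fixes Q :: "'a::field poly"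
  assumes "finite A" "(\<Prod>j\<in>A. [:- q j, 1:] ^ n j) dvd Q * p" "\<And>j. j \<in> A \<Longrightarrow> poly Q (q j) \<noteq> 0"
  shows "(\<Prod>j\<in>A. [:- q j, 1:] ^ n j) dvd p"
  using assms
proof (induct A arbitrary: p rule: finite_induct)
  case (insert x A)
  have "[:- q x, 1:] ^ n x dvd p"
    by (rule linear_power_dvd_cancel[of _ _ Q]) (use insert in \<open>auto intro: dvd_mult_left\<close>)
  then obtain r where r: "p = [:- q x, 1:] ^ n x * r" by blast
  have "[:- q x, 1:] ^ n x * (\<Prod>j\<in>A. [:- q j, 1:] ^ n j) dvd [:- q x, 1:] ^ n x * (Q * r)"
    using insert(4) by (simp only: prod.insert[OF insert(1,2)] r mult.left_commute[of Q])
  then have "(\<Prod>j\<in>A. [:- q j, 1:] ^ n j) dvd Q * r" by simp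
  then have "(\<Prod>j\<in>A. [:- q j, 1:] ^ n j) dvd r" using insert by blast
  then show ?case by (simp only: prod.insert[OF insert(1,2)] r mult_dvd_mono dvd_refl)
qed simp

lemma degree_prod_linear: "degree (\<Prod>j<J. [:- q j, 1:] ^ n j) = (\<Sum>j<J. n j)" for q :: "nat \<Rightarrow> 'a::field"
  by (induct J) (auto simp: degree_mult_eq degree_power_eq)

lemma lead_coeff_prod_linear: "lead_coeff (\<Prod>j<J. [:- q j, 1:] ^ n j) = 1" for q :: "nat \<Rightarrow> 'a::field"
  by (induct J) (auto simp: lead_coeff_mult lead_coeff_power)

text \<open>A solution with vanishing top coefficients is \<open>Q\<close> times a solution for
  \<open>k\<close>, hence zero. Among \<open>2 k + 1\<close> vectors modulo \<open>R\<close>, of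
  which \<open>2 k\<close> have no top coefficients, there is a relation, and by the previous remark
  it must involve the last vector.\<close>

lemma interp_exists:
  fixes R :: "real poly"
  assumes R: "degree R = 2 * k" "R \<noteq> 0"
    and nd: "\<And>\<alpha> \<beta>. R dvd interp a k \<alpha> \<beta> \<Longrightarrow> \<forall>i<k. \<alpha> i = 0 \<and> \<beta> i = 0"
    and cancel: "\<And>p. R dvd [:-1, 1, - a, 1:] * p \<Longrightarrow> R dvd p"
  shows "\<exists>\<alpha> \<beta>. R dvd interp a (Suc k) \<alpha> \<beta> \<and> \<alpha> k = u \<and> \<beta> k = v"
proof -
  have lin: "interp a K (\<lambda>i. x * \<alpha> i + y * \<alpha>' i) (\<lambda>i. x * \<beta> i + y * \<beta>' i) =
    Polynomial.smult x (interp a K \<alpha> \<beta>) + Polynomial.smult y (interp a K \<alpha>' \<beta>')" for x y K \<alpha> \<beta> \<alpha>' \<beta>'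
  proof -
    have "[:x * \<alpha> i + y * \<alpha>' i, x * \<beta> i + y * \<beta>' i:] = Polynomial.smult x [:\<alpha> i, \<beta> i:] + Polynomial.smult y [:\<alpha>' i, \<beta>' i:]" for i
      by simp
    then show ?thesis unfolding interp_def smult_sum_distrib sum.distrib[symmetric]
      by (simp only: distrib_right mult_smult_left)
  qed
  have main: "\<exists>\<alpha> \<beta>. R dvd interp a (Suc k) \<alpha> \<beta> \<and> \<alpha> k = u \<and> \<beta> k = v" if uv: "u \<noteq> 0 \<or> v \<noteq> 0" for u v
  proof -
    \<comment> \<open>The \<open>2 k\<close> terms without top coefficients, followed by one term
      with top coefficients \<open>u\<close> and \<open>v\<close>.\<close>
    define b where "b i = (if i < k then [:1, 0:] * [:-1, 1:] ^ i * [:-1, 1, - a, 1:] ^ (k - i)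
       else if i < 2 * k then [:0, 1:] * [:-1, 1:] ^ (i - k) * [:-1, 1, - a, 1:] ^ (k - (i - k))
       else [:u, v:] * [:-1, 1:] ^ k)" for i
    have "\<exists>c. (\<exists>i\<in>{..2 * k}. c i \<noteq> 0) \<and> (\<Sum>i\<le>2 * k. Polynomial.smult (c i) (b i mod R)) = 0"
    proof (rule poly_linear_dependence[where M = "2 * k"])
      fix i j assume "2 * k \<le> j"
      then show "poly.coeff (b i mod R) j = 0"
        using degree_mod_less[of R "b i"] R by (cases "b i mod R = 0") (auto intro!: coeff_eq_0)
    qed auto
    then obtain c i0 where c: "i0 \<le> 2 * k" "c i0 \<noteq> 0" "(\<Sum>i\<le>2 * k. Polynomial.smult (c i) (b i mod R)) = 0" by auto
    have "(\<Sum>i\<le>2 * k. Polynomial.smult (c i) (b i)) =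
      (\<Sum>i\<le>2 * k. R * Polynomial.smult (c i) (b i div R)) + (\<Sum>i\<le>2 * k. Polynomial.smult (c i) (b i mod R))"
    proof -
      have "Polynomial.smult (c i) (b i) = R * Polynomial.smult (c i) (b i div R) + Polynomial.smult (c i) (b i mod R)" for i
        by (metis mult_div_mod_eq mult_smult_right smult_add_right)
      then show ?thesis by (simp add: sum.distrib)
    qed
    then have "(\<Sum>i\<le>2 * k. Polynomial.smult (c i) (b i)) = R * (\<Sum>i\<le>2 * k. Polynomial.smult (c i) (b i div R))"
      by (simp only: c(3) sum_distrib_left[symmetric] add_0_right)
    then have dv: "R dvd (\<Sum>i\<le>2 * k. Polynomial.smult (c i) (b i))" by (simp only: dvd_triv_left)
    define \<alpha> where "\<alpha> i = (if i < k then c i else c (2 * k) * u)" for i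
    define \<beta> where "\<beta> i = (if i < k then c (k + i) else c (2 * k) * v)" for i
    have interpS: "interp a (Suc k) \<alpha> \<beta> = (\<Sum>i<k. [:\<alpha> i, \<beta> i:] * [:-1, 1:] ^ i * [:-1, 1, - a, 1:] ^ (k - i)) + [:\<alpha> k, \<beta> k:] * [:-1, 1:] ^ k"
      unfolding interp_def by (simp del: mult_pCons_left mult_pCons_right)
    have "(\<Sum>i\<le>2 * k. Polynomial.smult (c i) (b i)) = interp a (Suc k) \<alpha> \<beta>"
    proof -
      have "(\<Sum>i\<le>2 * k. Polynomial.smult (c i) (b i)) = (\<Sum>i<k. Polynomial.smult (c i) (b i))
        + (\<Sum>i<k. Polynomial.smult (c (k + i)) (b (k + i))) + Polynomial.smult (c (2 * k)) (b (2 * k))"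
      proof -
        have "{..2 * k} = insert (2 * k) ({..<k} \<union> {k..<k + k})" by auto
        moreover have "(\<Sum>i\<in>{k..<k + k}. Polynomial.smult (c i) (b i)) = (\<Sum>i<k. Polynomial.smult (c (k + i)) (b (k + i)))"
          using sum.shift_bounds_nat_ivl[of "\<lambda>i. Polynomial.smult (c i) (b i)" 0 k k]
          by (simp add: atLeast0LessThan add.commute)
        moreover have "sum g ({..<k} \<union> {k..<k + k}) = sum g {..<k} + sum g {k..<k + k}" for g :: "nat \<Rightarrow> real poly"
          by (rule sum.union_disjoint) auto
        ultimately show ?thesis by (simp add: add.commute)
      qed
      also have "\<dots> = (\<Sum>i<k. [:\<alpha> i, \<beta> i:] * [:-1, 1:] ^ i * [:-1, 1, - a, 1:] ^ (k - i)) + [:\<alpha> k, \<beta> k:] * [:-1, 1:] ^ k"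
      proof -
        have lin: "[:x, y:] * p * q = Polynomial.smult x ([:1, 0:] * p * q) + Polynomial.smult y ([:0, 1:] * p * q)"
          for x y :: real and p q
        proof -
          have "[:x, y:] = Polynomial.smult x [:1, 0:] + Polynomial.smult y [:0, 1:]" by simp
          then show ?thesis by (simp only: distrib_right mult_smult_left)
        qed
        have b1: "b i = [:1, 0:] * [:-1, 1:] ^ i * [:-1, 1, - a, 1:] ^ (k - i)" if "i < k" for i
          by (simp only: b_def that if_True)
        have b2: "b (k + i) = [:0, 1:] * [:-1, 1:] ^ i * [:-1, 1, - a, 1:] ^ (k - i)" if "i < k" for i
          by (simp only: b_def that if_True if_False mult_2 nat_add_left_cancel_less diff_add_inverse not_add_less1)
        have "(\<Sum>i<k. [:\<alpha> i, \<beta> i:] * [:-1, 1:] ^ i * [:-1, 1, - a, 1:] ^ (k - i)) =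
          (\<Sum>i<k. Polynomial.smult (c i) (b i)) + (\<Sum>i<k. Polynomial.smult (c (k + i)) (b (k + i)))"
          unfolding sum.distrib[symmetric]
        proof (rule sum.cong[OF refl])
          fix i assume i: "i \<in> {..<k}"
          then have "\<alpha> i = c i" "\<beta> i = c (k + i)" by (simp_all add: \<alpha>_def \<beta>_def)
          with i show "[:\<alpha> i, \<beta> i:] * [:-1, 1:] ^ i * [:-1, 1, - a, 1:] ^ (k - i) =
            Polynomial.smult (c i) (b i) + Polynomial.smult (c (k + i)) (b (k + i))"
            by (subst lin) (simp only: b1 b2 lessThan_iff)
        qed
        moreover have "Polynomial.smult (c (2 * k)) (b (2 * k)) = [:\<alpha> k, \<beta> k:] * [:-1, 1:] ^ k"
        proof -
          have "[:\<alpha> k, \<beta> k:] = Polynomial.smult (c (2 * k)) [:u, v:]" by (simp add: \<alpha>_def \<beta>_def)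
          moreover have "b (2 * k) = [:u, v:] * [:-1, 1:] ^ k" by (simp add: b_def del: mult_pCons_left)
          ultimately show ?thesis by (simp only: mult_smult_left)
        qed
        ultimately show ?thesis by simp
      qed
      finally show ?thesis unfolding interpS .
    qed
    with dv have dv: "R dvd interp a (Suc k) \<alpha> \<beta>" by (simp only:)
    have "c (2 * k) \<noteq> 0"
    proof
      assume z: "c (2 * k) = 0"
      have "interp a (Suc k) \<alpha> \<beta> = [:-1, 1, - a, 1:] * interp a k \<alpha> \<beta>"
      proof -
        have "[:-1, 1, - a, 1:] ^ (k - i) = [:-1, 1, - a, 1:] * [:-1, 1, - a, 1:] ^ (k - 1 - i)" if "i < k" for i
        proof -
          have "k - i = Suc (k - 1 - i)" using that by simp
          then show ?thesis by (simp only: power_Suc)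
        qed
        note pw = this
        have "[:\<alpha> k, \<beta> k:] = 0" by (simp add: \<alpha>_def \<beta>_def z)
        then have "interp a (Suc k) \<alpha> \<beta> = (\<Sum>i<k. [:\<alpha> i, \<beta> i:] * [:-1, 1:] ^ i * [:-1, 1, - a, 1:] ^ (k - i))"
          unfolding interpS by (simp only: mult_zero_left add_0_right)
        also have "\<dots> = [:-1, 1, - a, 1:] * interp a k \<alpha> \<beta>"
          unfolding interp_def sum_distrib_left
          by (rule sum.cong[OF refl], subst pw) (simp_all only: lessThan_iff mult_ac)
        finally show ?thesis .
      qed
      then have "R dvd [:-1, 1, - a, 1:] * interp a k \<alpha> \<beta>" using dv by (simp only:)
      then have "R dvd interp a k \<alpha> \<beta>" by (rule cancel)
      from nd[OF this] have "\<forall>i<k. c i = 0 \<and> c (k + i) = 0" by (simp add: \<alpha>_def \<beta>_def)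
      moreover have "i0 < k \<or> (\<exists>i<k. i0 = k + i) \<or> i0 = 2 * k" using c(1)
        by (metis add_diff_inverse_nat le_neq_implies_less mult_2 nat_add_left_cancel_less)
      ultimately show False using c(2) z by auto
    qed
    moreover have "R dvd interp a (Suc k) (\<lambda>i. 1 / c (2 * k) * \<alpha> i + 0 * \<alpha> i) (\<lambda>i. 1 / c (2 * k) * \<beta> i + 0 * \<beta> i)"
      unfolding lin using dv by (simp add: dvd_smult)
    ultimately show ?thesis
      by (intro exI[of _ "\<lambda>i. 1 / c (2 * k) * \<alpha> i + 0 * \<alpha> i"] exI[of _ "\<lambda>i. 1 / c (2 * k) * \<beta> i + 0 * \<beta> i"])
        (simp add: \<alpha>_def \<beta>_def)
  qed
  show ?thesis
  proof (cases "u \<noteq> 0 \<or> v \<noteq> 0")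
    case False
    then show ?thesis by (intro exI[of _ "\<lambda>_. 0"]) (simp add: interp_def)
  qed (use main in blast)
qed


lemma prod_linear_dvd:
  fixes p :: "'a::field poly"
  assumes "finite A" "inj_on z A" "\<And>j. j \<in> A \<Longrightarrow> [:- z j, 1:] ^ n j dvd p"
  shows "(\<Prod>j\<in>A. [:- z j, 1:] ^ n j) dvd p"
  using assms
proof (induct A rule: finite_induct)
  case (insert x A)
  then obtain r where r: "p = (\<Prod>j\<in>A. [:- z j, 1:] ^ n j) * r" by (auto simp: inj_on_def)
  have "[:- z x, 1:] ^ n x dvd (\<Prod>j\<in>A. [:- z j, 1:] ^ n j) * r"
    using insert(5)[of x] unfolding r by blast
  then have "[:- z x, 1:] ^ n x dvd r"
    by (rule linear_power_dvd_cancel)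
      (use insert in \<open>auto simp: poly_prod poly_power prod_zero_iff inj_on_def\<close>)
  then show ?case by (simp only: prod.insert[OF insert(1,2)] r mult_dvd_mono dvd_refl mult.commute[of "[:- z x, 1:] ^ n x"])
qed simp

context
  fixes m :: real
  assumes m: "1 < m" "m < 2"
begin

lemma pencil_qs:
  assumes j: "j < 4"
  shows "pencil (pa m) 1 (zs m j) 1 (qs m j) = 0"
    and "1 - zs m j * (3 * (qs m j)\<^sup>2 - 2 * pa m * qs m j + 1) \<noteq> 0"
    and "poly [:-1, 1, - pa m, 1:] (qs m j) \<noteq> 0"
proof -
  define a z q where "a = pa m" and "z = zs m j" and "q = qs m j"
  show 0: "pencil (pa m) 1 (zs m j) 1 (qs m j) = 0"
    using pencil_ramified[OF m rhom_id(2) j, of 1 "qs m j"] by simp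
  define u where "u = fst (Ts m j)" define v where "v = snd (Ts m j)"
  have uv: "v \<noteq> q * u" using qs_not_ramified[OF m j] by (simp add: u_def v_def q_def)
  have f: "rhom (\<lambda>x::real. [:x:])" by (rule rhom_const_poly) simp
  have "pencil [:a:] 1 [:z:] 1 ([:q:] + [:0, 1:]) = [:ks m j:] * (([:q:] + [:0, 1:]) * [:u:] - 1 * [:v:])\<^sup>2 * (([:q:] + [:0, 1:]) - [:q:] * 1)"
    using pencil_ramified[OF m f j, of 1 "[:q:] + [:0, 1:]"] unfolding a_def z_def q_def u_def v_def by simp
  then have "[:0, 1:] * (1 - [:z:] * (3 * [:q:]\<^sup>2 - 2 * [:a:] * [:q:] + 1) - [:0, 1:] * ([:z:] * (3 * [:q:] + [:0, 1:] - [:a:]))) =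
    [:0, 1:] * ([:ks m j:] * (([:q:] + [:0, 1:]) * [:u:] - [:v:])\<^sup>2)"
  proof -
    assume h: "pencil [:a:] 1 [:z:] 1 ([:q:] + [:0, 1:]) = [:ks m j:] * (([:q:] + [:0, 1:]) * [:u:] - 1 * [:v:])\<^sup>2 * (([:q:] + [:0, 1:]) - [:q:] * 1)"
    have "pencil [:a:] 1 [:z:] 1 [:q:] = [:pencil a 1 z 1 q:]"
      using rhom_pencil[OF f, of a 1 z 1 q] by (simp add: one_pCons)
    then have p0: "pencil [:a:] 1 [:z:] 1 [:q:] = 0" using 0 by (simp add: a_def z_def q_def)
    have e: "x * (A - B) - x\<^sup>2 * C = x * (A - B - x * C)" for x A B C :: "real poly" by (simp add: power2_eq_square algebra_simps)
    have e2: "k * (y - 1 * v)\<^sup>2 * (q + x - q * 1) = x * (k * (y - v)\<^sup>2)" for x k y v q :: "real poly" by (simp add: algebra_simps)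
    show ?thesis using h unfolding pencil_shift p0 add_0_left e e2 .
  qed
  then have "1 - [:z:] * (3 * [:q:]\<^sup>2 - 2 * [:a:] * [:q:] + 1) - [:0, 1:] * ([:z:] * (3 * [:q:] + [:0, 1:] - [:a:])) =
    [:ks m j:] * (([:q:] + [:0, 1:]) * [:u:] - [:v:])\<^sup>2"
    by (subst (asm) mult_cancel_left) simp
  \<comment> \<open>After cancelling one factor of the increment, the value at 0 is the derivative
    along the fibre; it is nonzero because \<open>q\<close> differs from the double root.\<close>
  from arg_cong[OF this, of "\<lambda>p. poly p 0"]
  have "1 - z * (3 * q\<^sup>2 - 2 * a * q + 1) = ks m j * (q * u - v)\<^sup>2" by (simp add: power2_eq_square algebra_simps)
  moreover have "ks m j * (q * u - v)\<^sup>2 \<noteq> 0" using ks_nonzero[OF m j] uv by simp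
  ultimately show "1 - zs m j * (3 * (qs m j)\<^sup>2 - 2 * pa m * qs m j + 1) \<noteq> 0" by (simp add: a_def z_def q_def)
  \<comment> \<open>If the denominator vanished at \<open>q\<close>, so would the numerator by the
    equation of the fibre, which forces \<open>q = 1\<close> and \<open>a = 1\<close>.\<close>
  show "poly [:-1, 1, - pa m, 1:] (qs m j) \<noteq> 0"
  proof
    assume h: "poly [:-1, 1, - pa m, 1:] (qs m j) = 0"
    then have Q: "q\<^sup>2 * (q - a) + (q - 1) = 0" by (simp add: a_def q_def power2_eq_square algebra_simps)
    have "(q - 1) - z * (q\<^sup>2 * (q - a) + (q - 1)) = 0" using 0 by (simp add: pencil_def a_def z_def q_def)
    then have "q = 1" unfolding Q by simp
    then show False using Q pa_bounds[OF m] by (simp add: a_def)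
  qed
qed

lemma local_branch_exists:
  "j < 4 \<Longrightarrow> \<exists>c. poly c (zs m j) = qs m j \<and> [:- zs m j, 1:] ^ n dvd pencil [:pa m:] 1 [:0, 1:] 1 c"
  using local_branch pencil_qs by blast

end

text \<open>Quantifying over all approximations \<open>c\<close> lets the odd case test the same row
  along a branch that is known to a higher order.\<close>

definition branch_rows :: "real \<Rightarrow> nat \<Rightarrow> nat \<Rightarrow> real poly \<Rightarrow> real poly \<Rightarrow> bool" where
  "branch_rows m j n A B \<longleftrightarrow> (\<forall>c. poly c (zs m j) = qs m j \<longrightarrow>
     [:- zs m j, 1:] ^ n dvd pencil [:pa m:] 1 [:0, 1:] 1 c \<longrightarrow> [:- zs m j, 1:] ^ n dvd A + B * c)"

text \<open>The rows have top coefficients \<open>(1, 0)\<close> and \<open>(0, 1)\<close>, so the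
  determinant is monic of degree \<open>2 k\<close>. Both rows annihilate \<open>(1, c)\<close>
  modulo the prescribed powers, so it is divisible by a monic polynomial of the same degree and
  equals it.\<close>

lemma matrix_even:
  assumes n: "(\<Sum>j<4. n j) = 2 * k" "n 0 + n 1 \<le> k" "0 < k"
  shows "\<exists>m N00 N01 N10 N11. 1 < m \<and> m < 2 \<and> degree N00 \<le> k \<and> degree N01 \<le> k \<and> degree N10 \<le> k \<and> degree N11 \<le> k \<and>
    N00 * N11 - N01 * N10 = (\<Prod>j<4. [:- zs m j, 1:] ^ n j) \<and>
    (\<forall>j<4. branch_rows m j (n j) N00 N01 \<and> branch_rows m j (n j) N10 N11)"
proof -
  have "n 0 + n 1 + n 2 + n 3 = 2 * k" using n(1) by (simp add: numeral_eq_Suc lessThan_Suc ac_simps)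
  from interp_nondegenerate[OF this n(2)] obtain m where m: "1 < m" "m < 2" and nd': "\<And>\<alpha> \<beta>.
    [:- pa m, 1:] ^ n 0 * [:-1, 1:] ^ n 1 * [:- (pa m - 2 * (2 - m)), 1:] ^ n 2 * [:- (pa m - 2 * (2 - 1 / m)), 1:] ^ n 3
      dvd interp (pa m) k \<alpha> \<beta> \<Longrightarrow> (\<forall>i<k. \<alpha> i = 0 \<and> \<beta> i = 0)" by blast
  define R where "R = (\<Prod>j<4. [:- qs m j, 1:] ^ n j)"
  have "R = [:- pa m, 1:] ^ n 0 * [:-1, 1:] ^ n 1 * [:- (pa m - 2 * (2 - m)), 1:] ^ n 2 * [:- (pa m - 2 * (2 - 1 / m)), 1:] ^ n 3"
    unfolding R_def by (simp add: numeral_eq_Suc lessThan_Suc qs_def mult_ac)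
  then have nd: "R dvd interp (pa m) k \<alpha> \<beta> \<Longrightarrow> (\<forall>i<k. \<alpha> i = 0 \<and> \<beta> i = 0)" for \<alpha> \<beta>
    using nd' by (simp only:)
  have R: "degree R = 2 * k" unfolding R_def degree_prod_linear n(1) ..
  have R0: "R \<noteq> 0" using lead_coeff_prod_linear[of "qs m" n 4] unfolding R_def[symmetric] by auto
  have cancel: "R dvd p" if "R dvd [:-1, 1, - pa m, 1:] * p" for p
    unfolding R_def by (rule prod_root_power_dvd_cancel[OF _ that[unfolded R_def]]) (use pencil_qs[OF m] in auto)
  obtain \<alpha> \<beta> where ab: "R dvd interp (pa m) (Suc k) \<alpha> \<beta>" "\<alpha> k = 1" "\<beta> k = 0"
    using interp_exists[OF R R0 nd cancel] by blast
  obtain \<alpha>' \<beta>' where ab': "R dvd interp (pa m) (Suc k) \<alpha>' \<beta>'" "\<alpha>' k = 0" "\<beta>' k = 1"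
    using interp_exists[OF R R0 nd cancel] by blast
  define P where "P \<gamma> = (\<Sum>i\<le>k. Polynomial.monom (\<gamma> i) i)" for \<gamma> :: "nat \<Rightarrow> real"
  have rows: "branch_rows m j (n j) (P \<alpha>) (P \<beta>)" if "R dvd interp (pa m) (Suc k) \<alpha> \<beta>" "j < 4" for \<alpha> \<beta> j
    unfolding branch_rows_def
  proof (intro allI impI)
    fix c assume c: "poly c (zs m j) = qs m j" "[:- zs m j, 1:] ^ n j dvd pencil [:pa m:] 1 [:0, 1:] 1 c"
    have "[:- qs m j, 1:] ^ n j dvd R" unfolding R_def using that(2) by (intro dvd_prodI) auto
    then have "[:- qs m j, 1:] ^ n j dvd interp (pa m) (Suc k) \<alpha> \<beta>" using that(1) by (rule dvd_trans)
    from interp_local[OF c pencil_qs(3)[OF m that(2)] this]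
    show "[:- zs m j, 1:] ^ n j dvd P \<alpha> + P \<beta> * c" unfolding P_def .
  qed
  have cP: "poly.coeff (P \<gamma>) i = (if i \<le> k then \<gamma> i else 0)" for \<gamma> i
    unfolding P_def by (simp add: coeff_sum)
  have dP: "degree (P \<gamma>) \<le> k" for \<gamma> by (rule degree_le) (simp add: cP)
  have dP': "degree (P \<gamma>) < k" if "\<gamma> k = 0" for \<gamma>
    using dP[of \<gamma>] cP[of \<gamma> "degree (P \<gamma>)"] that n(3) leading_coeff_0_iff[of "P \<gamma>"]
    by (cases "degree (P \<gamma>) = k") auto
  have dP1: "degree (P \<gamma>) = k" "lead_coeff (P \<gamma>) = 1" if "\<gamma> k = 1" for \<gamma>
  proof -
    show "degree (P \<gamma>) = k" using dP[of \<gamma>] le_degree[of "P \<gamma>" k] cP[of \<gamma> k] that by simp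
    then show "lead_coeff (P \<gamma>) = 1" using cP[of \<gamma> k] that by simp
  qed
  define d where "d = P \<alpha> * P \<beta>' - P \<beta> * P \<alpha>'"
  define Z where "Z = (\<Prod>j<4. [:- zs m j, 1:] ^ n j)"
  have dZ: "degree Z = 2 * k" "lead_coeff Z = 1"
    by (simp_all only: Z_def degree_prod_linear n(1)[symmetric] lead_coeff_prod_linear[unfolded degree_prod_linear])
  have "Z dvd d" unfolding Z_def
  proof (rule prod_linear_dvd)
    fix j :: nat assume "j \<in> {..<4}"
    then have j: "j < 4" by simp
    obtain c where c: "poly c (zs m j) = qs m j" "[:- zs m j, 1:] ^ n j dvd pencil [:pa m:] 1 [:0, 1:] 1 c"
      using local_branch_exists[OF m j] by blast
    have "[:- zs m j, 1:] ^ n j dvd P \<alpha> + P \<beta> * c" "[:- zs m j, 1:] ^ n j dvd P \<alpha>' + P \<beta>' * c"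
      using rows[OF ab(1) j] rows[OF ab'(1) j] c unfolding branch_rows_def by blast+
    then have "[:- zs m j, 1:] ^ n j dvd (P \<alpha> + P \<beta> * c) * P \<beta>' - P \<beta> * (P \<alpha>' + P \<beta>' * c)"
      by (rule dvd_diff[OF dvd_mult2 dvd_mult])
    also have "\<dots> = d" unfolding d_def by (simp add: algebra_simps)
    finally show "[:- zs m j, 1:] ^ n j dvd d" .
  qed (use zs_inj[OF m] in \<open>auto simp: inj_on_def\<close>)
  then obtain r where r: "d = Z * r" by blast
  have lt: "degree (P \<beta> * P \<alpha>') < 2 * k"
    using degree_mult_le[of "P \<beta>" "P \<alpha>'"] dP'[of \<beta>] dP'[of \<alpha>'] ab ab' by simp
  have dd: "degree (P \<alpha> * P \<beta>') = 2 * k" "lead_coeff (P \<alpha> * P \<beta>') = 1"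
  proof -
    have a: "degree (P \<alpha>) = k" "lead_coeff (P \<alpha>) = 1" "degree (P \<beta>') = k" "lead_coeff (P \<beta>') = 1"
      using dP1[of \<alpha>] dP1[of \<beta>'] ab ab' by blast+
    then have "P \<alpha> \<noteq> 0" "P \<beta>' \<noteq> 0" by auto
    then show "degree (P \<alpha> * P \<beta>') = 2 * k" using a by (simp add: degree_mult_eq)
    show "lead_coeff (P \<alpha> * P \<beta>') = 1" using a by (simp only: lead_coeff_mult mult_1)
  qed
  have dd': "degree d = 2 * k" "lead_coeff d = 1"
  proof -
    have "degree (- (P \<beta> * P \<alpha>')) < degree (P \<alpha> * P \<beta>')" using lt dd by simp
    from degree_add_eq_left[OF this] show "degree d = 2 * k" using dd by (simp add: d_def)
    then show "lead_coeff d = 1" using dd coeff_eq_0[OF lt] by (simp add: d_def)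
  qed
  then have "r \<noteq> 0" "Z \<noteq> 0" using r by auto
  then have "degree r = 0" using dd' dZ degree_mult_eq[of Z r] unfolding r[symmetric] by simp
  then obtain x where x: "r = [:x:]" by (elim degree_eq_zeroE)
  moreover have "lead_coeff r = 1" using dd'(2) dZ(2) unfolding r lead_coeff_mult by simp
  ultimately have "r = 1" by (simp add: one_pCons)
  then have "P \<alpha> * P \<beta>' - P \<beta> * P \<alpha>' = Z" using r by (simp add: d_def)
  then show ?thesis using m dP rows[OF ab(1)] rows[OF ab'(1)] unfolding Z_def by blast
qed

text \<open>In the odd case one order at the last critical value is set aside, the even case is
  applied, and one elementary transformation restores it. The complementary row is multiplied by
  \<open>z - zs m 3\<close>, which is how the degree bound of the first row becomes
  \<open>k + 1\<close>.\<close>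

lemma matrix_exists:
  assumes n: "(\<Sum>j<4. n j) = 2 * k + h" "n 0 + n 1 \<le> k" "0 < k" "h = 0 \<or> h = 1 \<and> 0 < n 3"
  shows "\<exists>m N00 N01 N10 N11 \<delta>. 1 < m \<and> m < 2 \<and> degree N00 \<le> k + h \<and> degree N01 \<le> k + h \<and> degree N10 \<le> k \<and> degree N11 \<le> k \<and>
    \<delta> \<noteq> 0 \<and> N00 * N11 - N01 * N10 = Polynomial.smult \<delta> (\<Prod>j<4. [:- zs m j, 1:] ^ n j) \<and>
    (\<forall>j<4. \<exists>c. poly c (zs m j) = qs m j \<and> [:- zs m j, 1:] ^ n j dvd pencil [:pa m:] 1 [:0, 1:] 1 c \<and>
       [:- zs m j, 1:] ^ n j dvd N00 + N01 * c \<and> [:- zs m j, 1:] ^ n j dvd N10 + N11 * c)"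
proof (cases "h = 0")
  case True
  obtain m N00 N01 N10 N11 where *: "1 < m" "m < 2" "degree N00 \<le> k" "degree N01 \<le> k" "degree N10 \<le> k" "degree N11 \<le> k"
    "N00 * N11 - N01 * N10 = (\<Prod>j<4. [:- zs m j, 1:] ^ n j)"
    "\<And>j. j < 4 \<Longrightarrow> branch_rows m j (n j) N00 N01 \<and> branch_rows m j (n j) N10 N11"
    using matrix_even[of n k] n True by auto
  have "\<exists>c. poly c (zs m j) = qs m j \<and> [:- zs m j, 1:] ^ n j dvd pencil [:pa m:] 1 [:0, 1:] 1 c \<and>
       [:- zs m j, 1:] ^ n j dvd N00 + N01 * c \<and> [:- zs m j, 1:] ^ n j dvd N10 + N11 * c" if "j < 4" for j
    using *(8)[OF that] local_branch_exists[OF *(1,2) that, of "n j"] unfolding branch_rows_def by blast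
  then show ?thesis using * True
    by (intro exI[of _ m] exI[of _ N00] exI[of _ N01] exI[of _ N10] exI[of _ N11] exI[of _ 1]) simp
next
  case False
  then have h: "h = 1" "0 < n 3" using n by auto
  define n' where "n' = n(3 := n 3 - 1)"
  have "(\<Sum>j<4. n j) = n 0 + n 1 + n 2 + n 3" "(\<Sum>j<4. n' j) = n 0 + n 1 + n 2 + (n 3 - 1)"
    by (simp_all add: numeral_eq_Suc lessThan_Suc n'_def)
  then have "(\<Sum>j<4. n' j) = 2 * k" using n h by simp
  then obtain m N00 N01 N10 N11 where *: "1 < m" "m < 2" "degree N00 \<le> k" "degree N01 \<le> k" "degree N10 \<le> k" "degree N11 \<le> k"
    "N00 * N11 - N01 * N10 = (\<Prod>j<4. [:- zs m j, 1:] ^ n' j)"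
    and rows: "\<And>j. j < 4 \<Longrightarrow> branch_rows m j (n' j) N00 N01 \<and> branch_rows m j (n' j) N10 N11"
    using matrix_even[of n' k] n unfolding n'_def by auto
  define s where "s = [:- zs m 3, 1:]"
  obtain c where c: "poly c (zs m 3) = qs m 3" "s ^ n 3 dvd pencil [:pa m:] 1 [:0, 1:] 1 c"
    using local_branch_exists[OF *(1,2), of 3 "n 3"] unfolding s_def by auto
  have n3: "n 3 = Suc (n' 3)" using h by (simp add: n'_def)
  have c': "s ^ n' 3 dvd pencil [:pa m:] 1 [:0, 1:] 1 c" using c(2) unfolding n3 by (rule dvd_trans[rotated]) simp
  have "s ^ n' 3 dvd N00 + N01 * c" "s ^ n' 3 dvd N10 + N11 * c"
    using rows[of 3] c(1) c' unfolding branch_rows_def s_def by auto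
  then obtain r0 r1 where r: "N00 + N01 * c = s ^ n' 3 * r0" "N10 + N11 * c = s ^ n' 3 * r1"
    by (elim dvdE) blast
  define x0 x1 where "x0 = poly r0 (zs m 3)" and "x1 = poly r1 (zs m 3)"
  text \<open>An elementary transformation at the point \<open>q\<close> over \<open>zs m 3\<close>: the row \<open>u0 N0 + u1 N1\<close> vanishes there to
    higher order, and \<open>v0 N0 + v1 N1\<close> is a complementary row.\<close>
  obtain u0 u1 v0 v1 where u: "u0 * x0 + u1 * x1 = 0" "v0 * u1 - v1 * u0 \<noteq> 0"
  proof (cases "x1 = 0")
    case True then show ?thesis using that[of 0 1 1 0] by simp
  next
    case False then show ?thesis using that[of x1 "- x0" 0 1] by simp
  qed
  define M10 M11 M00 M01 where "M10 = [:u0:] * N00 + [:u1:] * N10" and "M11 = [:u0:] * N01 + [:u1:] * N11"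
    and "M00 = s * ([:v0:] * N00 + [:v1:] * N10)" and "M01 = s * ([:v0:] * N01 + [:v1:] * N11)"
  have lin: "degree ([:u0:] * p + [:u1:] * q) \<le> k" if "degree p \<le> k" "degree q \<le> k" for p q :: "real poly" and u0 u1
    using that by (intro degree_add_le) (auto intro: order_trans[OF degree_smult_le])
  have lin': "degree (s * p) \<le> k + 1" if "degree p \<le> k" for p
    using that degree_mult_le[of s p] by (simp add: s_def)
  have "M00 * M11 - M01 * M10 = s * [:v0 * u1 - v1 * u0:] * (N00 * N11 - N01 * N10)"
  proof -
    have "M00 * M11 - M01 * M10 = s * ([:v0:] * [:u1:] - [:v1:] * [:u0:]) * (N00 * N11 - N01 * N10)"
    proof -
      have "s * (v0 * a + v1 * b) * (u0 * c + u1 * d) - s * (v0 * c + v1 * d) * (u0 * a + u1 * b) =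
        s * (v0 * u1 - v1 * u0) * (a * d - c * b)" for s v0 v1 u0 u1 a b c d :: "real poly"
        by (simp add: algebra_simps)
      then show ?thesis unfolding M00_def M01_def M10_def M11_def .
    qed
    moreover have "[:v0:] * [:u1:] - [:v1:] * [:u0:] = [:v0 * u1 - v1 * u0:]" by simp
    ultimately show ?thesis by (simp only:)
  qed
  also have "\<dots> = [:v0 * u1 - v1 * u0:] * (s * (\<Prod>j<4. [:- zs m j, 1:] ^ n' j))" unfolding * by (simp only: mult_ac)
  also have "s * (\<Prod>j<4. [:- zs m j, 1:] ^ n' j) = (\<Prod>j<4. [:- zs m j, 1:] ^ n j)"
  proof -
    have "(\<Prod>j<4. [:- zs m j, 1:] ^ n'' j) = (\<Prod>j<3. [:- zs m j, 1:] ^ n'' j) * [:- zs m 3, 1:] ^ n'' 3" for n''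
      by (simp add: numeral_eq_Suc lessThan_Suc mult_ac)
    moreover have "(\<Prod>j<3. [:- zs m j, 1:] ^ n' j) = (\<Prod>j<3. [:- zs m j, 1:] ^ n j)"
      by (rule prod.cong) (auto simp: n'_def)
    moreover have "s * (p * [:- zs m 3, 1:] ^ n' 3) = p * [:- zs m 3, 1:] ^ n 3" for p
      unfolding n3 s_def by (simp only: power_Suc mult_ac)
    ultimately show ?thesis by (simp only:)
  qed
  finally have det: "M00 * M11 - M01 * M10 = Polynomial.smult (v0 * u1 - v1 * u0) (\<Prod>j<4. [:- zs m j, 1:] ^ n j)" by simp
  have "\<exists>c. poly c (zs m j) = qs m j \<and> [:- zs m j, 1:] ^ n j dvd pencil [:pa m:] 1 [:0, 1:] 1 c \<and>
       [:- zs m j, 1:] ^ n j dvd M00 + M01 * c \<and> [:- zs m j, 1:] ^ n j dvd M10 + M11 * c" if j: "j < 4" for j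
  proof (cases "j = 3")
    case True
    have "poly ([:u0:] * r0 + [:u1:] * r1) (zs m 3) = 0" using u by (simp add: x0_def x1_def)
    then obtain w where w: "[:u0:] * r0 + [:u1:] * r1 = s * w" unfolding s_def poly_eq_0_iff_dvd by (elim dvdE)
    have "M10 + M11 * c = [:u0:] * (N00 + N01 * c) + [:u1:] * (N10 + N11 * c)"
      unfolding M10_def M11_def by (simp only: ring_distribs mult_ac add_ac)
    also have "\<dots> = s ^ n' 3 * ([:u0:] * r0 + [:u1:] * r1)" unfolding r by (simp only: ring_distribs mult_ac)
    also have "\<dots> = s ^ n 3 * w" unfolding w n3 by (simp only: power_Suc mult_ac)
    finally have 1: "s ^ n 3 dvd M10 + M11 * c" by simp
    have "M00 + M01 * c = s * ([:v0:] * (N00 + N01 * c) + [:v1:] * (N10 + N11 * c))"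
      unfolding M00_def M01_def by (simp only: ring_distribs mult_ac add_ac)
    also have "\<dots> = s ^ n 3 * ([:v0:] * r0 + [:v1:] * r1)" unfolding r n3 by (simp only: power_Suc ring_distribs mult_ac)
    finally have "s ^ n 3 dvd M00 + M01 * c" by simp
    then show ?thesis using 1 c True unfolding s_def by blast
  next
    case False
    obtain c where c: "poly c (zs m j) = qs m j" "[:- zs m j, 1:] ^ n j dvd pencil [:pa m:] 1 [:0, 1:] 1 c"
      using local_branch_exists[OF *(1,2) j] by blast
    have d: "[:- zs m j, 1:] ^ n j dvd N00 + N01 * c" "[:- zs m j, 1:] ^ n j dvd N10 + N11 * c"
      using rows[OF j] c False unfolding branch_rows_def n'_def by auto
    have "M10 + M11 * c = [:u0:] * (N00 + N01 * c) + [:u1:] * (N10 + N11 * c)"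
      "M00 + M01 * c = (s * [:v0:]) * (N00 + N01 * c) + (s * [:v1:]) * (N10 + N11 * c)"
      unfolding M10_def M11_def M00_def M01_def by (simp_all only: ring_distribs mult_ac add_ac)
    then have "[:- zs m j, 1:] ^ n j dvd M10 + M11 * c" "[:- zs m j, 1:] ^ n j dvd M00 + M01 * c"
      using d by (simp_all only: dvd_add dvd_mult)
    then show ?thesis using c by blast
  qed
  then show ?thesis using * u(2) det lin lin' h
    by (intro exI[of _ m] exI[of _ M00] exI[of _ M01] exI[of _ M10] exI[of _ M11] exI[of _ "v0 * u1 - v1 * u0"])
      (simp add: M00_def M01_def M10_def M11_def)
qed

section \<open>The equation of the curve\<close>

lemma pencil_cong_dvd: "d dvd B - B' \<Longrightarrow> d dvd pencil a x0 x1 A B - pencil a x0 x1 A B'" for d :: "'r::comm_ring_1"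
proof -
  have "pencil a x0 x1 A B - pencil a x0 x1 A B' =
    (B - B') * (x0 * A\<^sup>2 - x1 * (B\<^sup>2 + B * B' + B'\<^sup>2 - a * A * (B + B') + A\<^sup>2))"
    by (simp add: pencil_def power2_eq_square algebra_simps)
  then show "d dvd B - B' \<Longrightarrow> ?thesis" by simp
qed

lemma pencil_homogeneous: "pencil a x0 x1 (l * Y0) (l * Y1) = l ^ 3 * pencil a x0 x1 Y0 Y1"
  by (simp add: pencil_def power2_eq_square power3_eq_cube algebra_simps)

text \<open>The shape of a form of bidegree \<open>(d, b)\<close> on the surface with index
  \<open>h\<close> after setting \<open>x0 = y0 = 1\<close>: since \<open>y1\<close> has degree
  \<open>- h\<close> in the first grading, the coefficient of its \<open>i\<close>-th power has room
  for \<open>d + h * i\<close>.\<close>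

definition coeff_bound :: "nat \<Rightarrow> nat \<Rightarrow> nat \<Rightarrow> 'a::comm_ring_1 poly poly \<Rightarrow> bool" where
  "coeff_bound h b d p \<longleftrightarrow> degree p \<le> b \<and> (\<forall>i. degree (poly.coeff p i) \<le> d + h * i)"

lemma coeff_bound_mult: "coeff_bound h b d p \<Longrightarrow> coeff_bound h b' d' q \<Longrightarrow> coeff_bound h (b + b') (d + d') (p * q)"
  unfolding coeff_bound_def
proof (intro conjI allI)
  fix i assume pq: "degree p \<le> b \<and> (\<forall>i. degree (poly.coeff p i) \<le> d + h * i)" "degree q \<le> b' \<and> (\<forall>i. degree (poly.coeff q i) \<le> d' + h * i)"
  show "degree (p * q) \<le> b + b'" using pq degree_mult_le[of p q] by linarith
  show "degree (poly.coeff (p * q) i) \<le> d + d' + h * i"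
    unfolding coeff_mult
  proof (rule degree_sum_le)
    fix j assume j: "j \<in> {..i}"
    have "degree (poly.coeff p j * poly.coeff q (i - j)) \<le> degree (poly.coeff p j) + degree (poly.coeff q (i - j))" by (rule degree_mult_le)
    also have "\<dots> \<le> (d + h * j) + (d' + h * (i - j))" using pq by (intro add_mono) auto
    also have "\<dots> = d + d' + h * (j + (i - j))" by (simp only: distrib_left add_ac)
    also have "\<dots> = d + d' + h * i" using j by simp
    finally show "degree (poly.coeff p j * poly.coeff q (i - j)) \<le> d + d' + h * i" .
  qed simp
qed

lemma coeff_bound_diff: "coeff_bound h b d p \<Longrightarrow> coeff_bound h b d q \<Longrightarrow> coeff_bound h b d (p - q)"
  unfolding coeff_bound_def by (auto intro: degree_diff_le)

lemma coeff_bound_add: "coeff_bound h b d p \<Longrightarrow> coeff_bound h b d q \<Longrightarrow> coeff_bound h b d (p + q)"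
  unfolding coeff_bound_def by (auto intro: degree_add_le)

text \<open>\<open>A\<close> and \<open>B\<close> are the adjugate of \<open>N\<close> applied to
  \<open>(1, y)\<close>. Both rows annihilate \<open>(1, c)\<close> modulo a power of
  \<open>z - z j\<close>, so \<open>B\<close> is congruent to \<open>A c\<close> and
  \<open>pencil A B\<close> to \<open>A ^ 3 pencil 1 c\<close>, which is 0. Dividing by the
  determinant lowers the degrees from \<open>3 k + 1 + h * i\<close> by
  \<open>2 k + h\<close>.\<close>

lemma equation_exists:
  fixes N00 :: "real poly" and z :: "nat \<Rightarrow> real"
  assumes deg: "degree N00 \<le> k + h" "degree N01 \<le> k + h" "degree N10 \<le> k" "degree N11 \<le> k"
    and det: "N00 * N11 - N01 * N10 = Polynomial.smult \<delta> (\<Prod>j<4. [:- z j, 1:] ^ n j)" "\<delta> \<noteq> 0"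
    and n: "(\<Sum>j<4. n j) = 2 * k + h" and h: "h \<le> k + 1" and z: "inj_on z {..<4}"
    and loc: "\<And>j. j < 4 \<Longrightarrow> \<exists>c. [:- z j, 1:] ^ n j dvd pencil [:a:] 1 [:0, 1:] 1 c \<and>
       [:- z j, 1:] ^ n j dvd N00 + N01 * c \<and> [:- z j, 1:] ^ n j dvd N10 + N11 * c"
  shows "\<exists>\<Phi>. degree \<Phi> \<le> 3 \<and> (\<forall>i. degree (poly.coeff \<Phi> i) \<le> k + 1 - h + h * i) \<and>
    pencil [:[:a:]:] 1 [:[:0, 1:]:] [:N11, - N01:] [:- N10, N00:] = [:N00 * N11 - N01 * N10:] * \<Phi>"
proof -
  define A where "A = [:N11, - N01:]"
  define B where "B = [:- N10, N00:]"
  define G where "G = pencil [:[:a:]:] 1 [:[:0, 1:]:] A B"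
  define Z where "Z = (\<Prod>j<4. [:- z j, 1:] ^ n j)"
  have "Z dvd poly.coeff G i" for i
    unfolding Z_def
  proof (rule prod_linear_dvd)
    fix j :: nat assume "j \<in> {..<4}"
    then obtain c where c: "[:- z j, 1:] ^ n j dvd pencil [:a:] 1 [:0, 1:] 1 c"
       "[:- z j, 1:] ^ n j dvd N00 + N01 * c" "[:- z j, 1:] ^ n j dvd N10 + N11 * c" using loc by auto
    define s where "s = [:- z j, 1:] ^ n j"
    obtain u v where uv: "N00 + N01 * c = s * u" "N10 + N11 * c = s * v" using c unfolding s_def by (elim dvdE) blast
    have "B - A * [:c:] = [:- (N10 + N11 * c), N00 + N01 * c:]" by (simp add: A_def B_def mult.commute)
    also have "\<dots> = [:s:] * [:- v, u:]" unfolding uv by simp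
    finally have "[:s:] dvd B - A * [:c:]" by (simp only: dvd_triv_left)
    then have 1: "[:s:] dvd G - pencil [:[:a:]:] 1 [:[:0, 1:]:] (A * 1) (A * [:c:])"
      unfolding G_def mult_1_right by (rule pencil_cong_dvd)
    have "pencil [:[:a:]:] 1 [:[:0, 1:]:] 1 [:c:] = [:pencil [:a:] 1 [:0, 1:] 1 c:]"
      using rhom_pencil[OF rhom_const_poly[OF rhom_id(2)], of "[:a:]" 1 "[:0, 1:]" 1 c] by (simp add: one_pCons)
    then have "[:s:] dvd pencil [:[:a:]:] 1 [:[:0, 1:]:] 1 [:c:]" using c(1) by (simp add: s_def)
    then have "[:s:] dvd pencil [:[:a:]:] 1 [:[:0, 1:]:] (A * 1) (A * [:c:])"
      unfolding pencil_homogeneous by (rule dvd_mult)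
    with 1 have "[:s:] dvd (G - pencil [:[:a:]:] 1 [:[:0, 1:]:] (A * 1) (A * [:c:])) + pencil [:[:a:]:] 1 [:[:0, 1:]:] (A * 1) (A * [:c:])"
      by (rule dvd_add)
    then have "[:s:] dvd G" by simp
    then show "[:- z j, 1:] ^ n j dvd poly.coeff G i" by (simp add: const_poly_dvd_iff s_def)
  qed (use z in auto)
  then have "[:Z:] dvd G" by (simp add: const_poly_dvd_iff)
  then obtain \<Phi>' where \<Phi>': "G = [:Z:] * \<Phi>'" by blast
  define \<Phi> where "\<Phi> = [:[:1 / \<delta>:]:] * \<Phi>'"
  define d where "d = N00 * N11 - N01 * N10"
  have d: "d = Polynomial.smult \<delta> Z" by (simp add: d_def det Z_def)
  have G: "G = [:d:] * \<Phi>"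
  proof -
    have "[:d:] * [:[:1 / \<delta>:]:] = [:Z:]" using det(2) by (simp add: d)
    then show ?thesis unfolding \<Phi>_def \<Phi>' by (metis mult.assoc)
  qed
  have dd: "d \<noteq> 0" "degree d = 2 * k + h"
    using det(2) lead_coeff_prod_linear[of z n 4] degree_prod_linear[of z n 4] n unfolding d Z_def by auto
  have bA: "coeff_bound h 1 k A" "coeff_bound h 1 k B"
    unfolding coeff_bound_def A_def B_def using deg by (auto simp: coeff_pCons split: nat.split)
  have bX: "coeff_bound h 0 1 [:[:0, 1:]:]" "coeff_bound h 0 0 [:[:a:]:]" "coeff_bound h 0 1 1"
    by (auto simp: coeff_bound_def coeff_pCons one_pCons split: nat.split)
  have b3: "coeff_bound h 3 (1 + 3 * k) (x * (u * (v * w)))" if "coeff_bound h 0 1 x" "coeff_bound h 1 k u" "coeff_bound h 1 k v" "coeff_bound h 1 k w" for x u v w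
    using coeff_bound_mult[OF that(1) coeff_bound_mult[OF that(2) coeff_bound_mult[OF that(3,4)]]] by (simp add: numeral_3_eq_3)
  have baA: "coeff_bound h 1 k ([:[:a:]:] * A)" using coeff_bound_mult[OF bX(2) bA(1)] by simp
  have "G = 1 * (A * (A * (B - A))) - ([:[:0, 1:]:] * (B * (B * (B - [:[:a:]:] * A))) + [:[:0, 1:]:] * (A * (A * (B - A))))"
    unfolding G_def pencil_def by (simp only: power2_eq_square mult.assoc distrib_left)
  then have bG: "coeff_bound h 3 (1 + 3 * k) G"
    by (simp only:) (intro coeff_bound_diff coeff_bound_add b3 bA bX baA)
  have "poly.coeff G i = d * poly.coeff \<Phi> i" for i by (simp add: G)
  then have "degree (poly.coeff G i) = 2 * k + h + degree (poly.coeff \<Phi> i)" if "poly.coeff \<Phi> i \<noteq> 0" for i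
    using that dd by (simp add: degree_mult_eq)
  then have deg\<Phi>: "degree (poly.coeff \<Phi> i) \<le> k + 1 - h + h * i" for i
  proof (cases "poly.coeff \<Phi> i = 0")
    case False
    then have "2 * k + h + degree (poly.coeff \<Phi> i) \<le> 1 + 3 * k + h * i"
      using bG \<open>\<And>i. poly.coeff \<Phi> i \<noteq> 0 \<Longrightarrow> degree (poly.coeff G i) = 2 * k + h + degree (poly.coeff \<Phi> i)\<close>
      unfolding coeff_bound_def by (metis (no_types))
    then show ?thesis using h by arith
  qed simp
  have "degree \<Phi> \<le> 3"
  proof (rule degree_le, intro allI impI)
    fix i :: nat assume "3 < i"
    then have "poly.coeff G i = 0" using bG by (intro coeff_eq_0) (simp add: coeff_bound_def)
    then show "poly.coeff \<Phi> i = 0" using dd by (simp add: G)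
  qed
  then show ?thesis using deg\<Phi> G unfolding G_def A_def B_def d_def by blast
qed

section \<open>Local equations\<close>

abbreviation lc :: "local_poly \<Rightarrow> nat \<Rightarrow> nat \<Rightarrow> complex" where
  "lc f i j \<equiv> poly.coeff (poly.coeff f i) j"

lemma lc_simps [simp]:
  "lc (var_s * f) 0 j = 0" "lc (var_s * f) (Suc i) j = lc f i j"
  "lc (var_t * f) i 0 = 0" "lc (var_t * f) i (Suc j) = lc f i j"
  "lc (cst c * f) i j = c * lc f i j"
  "lc (cst c) i j = (if i = 0 \<and> j = 0 then c else 0)"
  "lc var_s i j = (if i = 1 \<and> j = 0 then 1 else 0)"
  "lc var_t i j = (if i = 0 \<and> j = 1 then 1 else 0)"
  by (simp_all add: var_s_def var_t_def cst_def coeff_pCons split: nat.split)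

lemma rhom_cst: "rhom cst"
  unfolding cst_def[abs_def] by (intro rhom_const_poly rhom_id)

lemma rhom_local_subst: "rhom (local_subst a b)"
  unfolding local_subst_def[abs_def] by (intro rhom_eval rhom_cst)

lemma local_subst_gens [simp]:
  "local_subst a b (cst c) = cst c" "local_subst a b var_s = a" "local_subst a b var_t = b"
  by (simp_all add: local_subst_def cst_def var_s_def var_t_def map_poly_pCons_rhom[OF rhom_cst] map_poly_pCons_rhom[OF rhom_eval[OF rhom_cst]]
    rhom_simps[OF rhom_cst] rhom_simps[OF rhom_eval[OF rhom_cst]] rhom_1[OF rhom_map_poly[OF rhom_cst]] pCons_one)

lemmas local_subst_simps = rhom_simps[OF rhom_local_subst] local_subst_gens

lemma local_poly_induct [case_names cst var_s var_t add mult]: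
  assumes k: "\<And>c. P (cst c)" and x: "P var_s" "P var_t"
    and add: "\<And>p q. P p \<Longrightarrow> P q \<Longrightarrow> P (p + q)" and mult: "\<And>p q. P p \<Longrightarrow> P q \<Longrightarrow> P (p * q)"
  shows "P f"
proof -
  have 1: "P [:p:]" for p
  proof (induct p rule: poly_ring_induct)
    case (3 p q) from add[OF 3] show ?case by simp
  next
    case (4 p q) from mult[OF 4] show ?case by (simp add: mult.commute)
  qed (use k x in \<open>auto simp: cst_def var_t_def\<close>)
  show ?thesis
    by (induct f rule: poly_ring_induct) (use 1 x add mult in \<open>auto simp: var_s_def\<close>)
qed

lemma lc_mult: "lc (f * g) i j = (\<Sum>p\<le>i. \<Sum>q\<le>j. lc f p q * lc g (i - p) (j - q))"
  by (simp add: coeff_mult coeff_sum)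

lemma local_mult_eqI:
  assumes "i + j = d" "lc f i j \<noteq> 0" "\<And>i j. i + j < d \<Longrightarrow> lc f i j = 0"
  shows "local_mult f = d"
  unfolding local_mult_def by (rule Least_equality) (use assms not_le in blast)+

lemma local_mult_ge_2D:
  assumes "2 \<le> local_mult f" shows "lc f 0 0 = 0" "lc f 1 0 = 0" "lc f 0 1 = 0"
proof -
  have "lc f i j = 0" if "i + j < 2" for i j
  proof (rule ccontr)
    assume "lc f i j \<noteq> 0"
    then have "local_mult f \<le> i + j" unfolding local_mult_def by (intro Least_le) blast
    then show False using assms that by simp
  qed
  then show "lc f 0 0 = 0" "lc f 1 0 = 0" "lc f 0 1 = 0" by auto
qed

lemma nat_add_less_2: "i + j < 2 \<longleftrightarrow> (i = 0 \<and> j = 0) \<or> (i = 1 \<and> j = 0) \<or> (i = 0 \<and> j = (1::nat))"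
  by auto

lemma local_mult_1 [simp]: "local_mult 1 = 0"
  by (rule local_mult_eqI[of 0 0]) (simp_all add: one_pCons)

lemma local_mult_var [simp]: "local_mult var_s = 1" "local_mult var_t = 1"
  by (rule local_mult_eqI[of 1 0], simp_all) (rule local_mult_eqI[of 0 1], simp_all)

definition emb :: "complex poly \<Rightarrow> local_poly" where "emb g = map_poly (\<lambda>c. [:c:]) g"

lemma rhom_emb: "rhom emb"
  unfolding emb_def[abs_def] by (intro rhom_map_poly rhom_const_poly rhom_id)

lemmas emb_simps = rhom_simps[OF rhom_emb]

lemma lc_emb [simp]: "lc (emb g) i j = (if j = 0 then poly.coeff g i else 0)"
  by (simp add: emb_def coeff_map_poly coeff_pCons split: nat.split)

lemma emb_X: "emb [:0, 1:] = var_s"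
  by (simp add: emb_def var_s_def map_poly_pCons)

lemma emb_const: "emb [:c:] = cst c"
  by (simp add: emb_def cst_def map_poly_pCons)

lemma emb_pCons: "emb (pCons c g) = cst c + var_s * emb g"
proof -
  have "pCons c g = [:c:] + [:0, 1:] * g" by simp
  then show ?thesis by (simp only: emb_simps emb_X emb_const)
qed

lemma local_subst_emb: "local_subst var_s b (emb g) = emb g"
  by (induct g) (simp_all add: emb_pCons local_subst_simps emb_simps)

text \<open>With \<open>T = t - c s\<close>, this is a normal form of the equation of a double point of type \<open>A\<close> with
  Milnor number \<open>2 * n\<close>; a blowing up lowers \<open>n\<close> by one. For \<open>n = 0\<close> the curve is smooth and tangent to \<open>s = 0\<close>.\<close>

definition cusp_form :: "nat \<Rightarrow> local_poly \<Rightarrow> bool" where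
  "cusp_form n f \<longleftrightarrow> (\<exists>g0 g1 g2 g3 c. poly.coeff c 0 = 0 \<and> poly.coeff g0 0 \<noteq> 0 \<and> poly.coeff g2 0 \<noteq> 0 \<and>
     f = var_s ^ (2 * n + 1) * emb g0 + var_s ^ (n + 1) * emb g1 * (var_t - emb c)
       + emb g2 * (var_t - emb c)\<^sup>2 + emb g3 * (var_t - emb c) ^ 3)"

lemma cusp_form_low:
  assumes "cusp_form n f"
  shows "lc f 0 0 = 0" "lc f 0 1 = 0" "lc f 0 2 \<noteq> 0" "n = 0 \<Longrightarrow> lc f 1 0 \<noteq> 0"
    "n \<noteq> 0 \<Longrightarrow> lc f 1 0 = 0"
proof -
  obtain g0 g1 g2 g3 c where h: "poly.coeff c 0 = 0" "poly.coeff g0 0 \<noteq> 0" "poly.coeff g2 0 \<noteq> 0"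
    and f: "f = var_s ^ (2 * n + 1) * emb g0 + var_s ^ (n + 1) * emb g1 * (var_t - emb c)
       + emb g2 * (var_t - emb c)\<^sup>2 + emb g3 * (var_t - emb c) ^ 3"
    using assms unfolding cusp_form_def by blast
  obtain c' where c: "c = pCons 0 c'" using h(1) by (cases c) auto
  have T: "var_t - emb c = var_t - var_s * emb c'" by (simp add: c emb_pCons emb_simps rhom_0[OF rhom_cst])
  define T where "T = var_t - var_s * emb c'"
  define R where "R = var_s ^ (2 * n) * emb g0 + var_s ^ n * emb g1 * T - emb g2 * emb c' * (T + var_t)
    - emb g3 * emb c' * (var_t * var_t + var_t * T + T * T)"
  have f': "f = var_s * R + var_t * (var_t * emb g2) + var_t * (var_t * (var_t * emb g3))"
    unfolding f T R_def T_def by (simp add: power2_eq_square power3_eq_cube algebra_simps)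
  show "lc f 0 0 = 0" "lc f 0 1 = 0" "lc f 0 2 \<noteq> 0"
    unfolding f' using h by (simp_all add: numeral_2_eq_2 One_nat_def)
  have "lc R 0 0 = (if n = 0 then poly.coeff g0 0 else 0)"
    unfolding R_def T_def by (cases n) (simp_all add: lc_mult)
  then show "n = 0 \<Longrightarrow> lc f 1 0 \<noteq> 0" "n \<noteq> 0 \<Longrightarrow> lc f 1 0 = 0"
    unfolding f' using h by (simp_all add: One_nat_def)
qed

lemma cusp_form_mult: assumes "cusp_form (Suc n) f" shows "local_mult f = 2"
proof (rule local_mult_eqI[of 0 2])
  fix i j :: nat assume "i + j < 2"
  then show "lc f i j = 0" unfolding nat_add_less_2 using cusp_form_low[OF assms] by auto
qed (use cusp_form_low[OF assms] in auto)

text \<open>The blown up direction is the slope \<open>d\<close> of \<open>c\<close>, and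
  \<open>T = s T'\<close>. Each of the four terms then contains \<open>s^2\<close>, and what is left
  has the same shape with \<open>n\<close> lowered; the cubic term keeps a factor
  \<open>s\<close>.\<close>

lemma cusp_form_blow_up:
  assumes "cusp_form (Suc n) f"
  shows "\<exists>d f'. cusp_form n f' \<and> total_transform (Some d) f = var_s\<^sup>2 * f'"
proof -
  obtain g0 g1 g2 g3 c where h: "poly.coeff c 0 = 0" "poly.coeff g0 0 \<noteq> 0" "poly.coeff g2 0 \<noteq> 0"
    and f: "f = var_s ^ (2 * Suc n + 1) * emb g0 + var_s ^ (Suc n + 1) * emb g1 * (var_t - emb c)
       + emb g2 * (var_t - emb c)\<^sup>2 + emb g3 * (var_t - emb c) ^ 3"
    using assms unfolding cusp_form_def by blast
  obtain c' where "c = pCons 0 c'" using h(1) by (cases c) auto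
  moreover obtain d c'' where "c' = pCons d c''" by (cases c') auto
  ultimately have c: "emb c = var_s * (cst d + var_s * emb c'')" by (simp add: emb_pCons rhom_0[OF rhom_cst])
  have c0: "var_s * emb c'' = emb (pCons 0 c'')" by (simp add: emb_pCons rhom_0[OF rhom_cst])
  define T where "T = var_t - emb (pCons 0 c'')"
  have T: "local_subst var_s (var_s * (var_t + cst d)) (var_t - emb c) = var_s * T"
    by (simp add: local_subst_simps local_subst_emb c T_def c0[symmetric] algebra_simps)
  define f' where "f' = var_s ^ (2 * n + 1) * emb g0 + var_s ^ (n + 1) * emb g1 * T + emb g2 * T\<^sup>2
    + emb (pCons 0 g3) * T ^ 3"
  have "cusp_form n f'" unfolding cusp_form_def f'_def T_def
    by (intro exI[of _ g0] exI[of _ g1] exI[of _ g2] exI[of _ "pCons 0 g3"] exI[of _ "pCons 0 c''"]) (use h in simp)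
  moreover have "total_transform (Some d) f = var_s\<^sup>2 * f'"
    unfolding total_transform.simps f f'_def rhom_add[OF rhom_local_subst] rhom_mult[OF rhom_local_subst]
      rhom_power[OF rhom_local_subst] T local_subst_emb local_subst_gens
    by (simp add: emb_pCons rhom_0[OF rhom_cst] power2_eq_square power3_eq_cube algebra_simps)
  ultimately show ?thesis by blast
qed

section \<open>Minimal embedded resolution of the double points\<close>

lemma var_nonzero [simp]: "var_s \<noteq> 0" "var_t \<noteq> 0"
  by (simp_all add: var_s_def var_t_def)

lemma strict_transformI:
  "total_transform d f = exceptional d ^ local_mult f * g \<Longrightarrow> strict_transform d f = g"
  unfolding strict_transform_def by (cases d) simp_all

lemma not_snc_mult: "local_mult f \<noteq> 1 \<Longrightarrow> \<not> simple_normal_crossing f E"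
  by (simp add: simple_normal_crossing_def)

lemma local_decomp: "\<exists>g h. f = cst (lc f 0 0) + var_s * g + var_t * h"
proof -
  obtain a g where f: "f = pCons a g" by (cases f) auto
  obtain x y where a: "a = pCons x y" by (cases a) auto
  show ?thesis by (intro exI[of _ g] exI[of _ "[:y:]"]) (simp add: f a cst_def var_s_def var_t_def)
qed

lemma local_decomp':
  obtains g h where "f = cst (lc f 0 0) + var_s * g + var_t * h" "lc g 0 0 = lc f 1 0" "lc h 0 0 = lc f 0 1" "lc h 0 1 = lc f 0 2"
proof -
  obtain g h where e: "f = cst (lc f 0 0) + var_s * g + var_t * h" using local_decomp by blast
  have "lc f (Suc 0) 0 = lc g 0 0" by (subst e) simp
  moreover have "lc f 0 (Suc 0) = lc h 0 0" by (subst e) simp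
  moreover have "lc f 0 (Suc (Suc 0)) = lc h 0 (Suc 0)" by (subst e) simp
  ultimately show ?thesis using e that by (simp add: numeral_2_eq_2)
qed

text \<open>The branch is smooth but has contact of order two with the exceptional curve. One
  blowing up makes it and two exceptional curves pass through one point in three different
  directions, and another one separates them: hence two entries 1.\<close>

lemma resolution_tangent:
  assumes f: "lc f 0 0 = 0" "lc f 0 1 = 0" "lc f 0 2 \<noteq> 0" "lc f 1 0 \<noteq> 0"
  shows "resolution_multiplicities f var_s [1, 1]"
proof -
  define A where "A = lc f 1 0" define B where "B = lc f 0 2"
  obtain g h where fd: "f = cst (lc f 0 0) + var_s * g + var_t * h" "lc g 0 0 = A" "lc h 0 0 = 0" "lc h 0 1 = B"
    using local_decomp'[of f] f unfolding A_def B_def by metis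
  obtain g1 g2 where gd: "g = cst A + var_s * g1 + var_t * g2" using local_decomp[of g] fd by auto
  obtain h1 h2 where hd: "h = cst 0 + var_s * h1 + var_t * h2" "lc h2 0 0 = B" using local_decomp'[of h] fd by metis
  have m1: "local_mult f = 1"
    by (rule local_mult_eqI[of 1 0]) (use f in auto)
  define L where "L = local_subst (var_s * var_t) var_t"
  define f1 where "f1 = var_s * L g + var_t * (var_s * L h1 + L h2)"
  have "total_transform None f = var_t * f1"
    unfolding total_transform.simps L_def[symmetric] f1_def by (subst fd(1))
      (simp add: f L_def local_subst_simps rhom_0[OF rhom_cst] hd(1) algebra_simps)
  then have s1: "strict_transform None f = f1" by (intro strict_transformI) (simp add: m1)
  have Lg: "lc (L g) 0 0 = A" unfolding L_def by (subst gd) (simp add: local_subst_simps mult.assoc)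
  obtain h3 h4 where "h2 = cst B + var_s * h3 + var_t * h4" using local_decomp[of h2] hd by auto
  then have Lh: "lc (L h2) 0 0 = B" unfolding L_def by (simp add: local_subst_simps mult.assoc)
  have l1: "lc f1 0 0 = 0" "lc f1 1 0 = A" "lc f1 0 1 = B" by (simp_all add: f1_def One_nat_def Lg Lh)
  have AB: "A \<noteq> 0" "B \<noteq> 0" using f by (simp_all add: A_def B_def)
  have m2: "local_mult f1 = 1"
    by (rule local_mult_eqI[of 1 0]) (use l1 AB in auto)
  define E1 where "E1 = exceptional None * strict_transform None var_s"
  have "strict_transform None var_s = var_s" by (rule strict_transformI) simp
  then have E1: "E1 = var_t * var_s" by (simp add: E1_def)
  have mE1: "local_mult E1 = 2"
  proof (rule local_mult_eqI[of 1 1])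
    fix i j :: nat assume "i + j < 2" then show "lc E1 i j = 0"
      unfolding nat_add_less_2 E1 by (auto simp: One_nat_def)
  qed (simp_all add: E1 One_nat_def)
  \<comment> \<open>The tangent direction of \<open>A s + B t\<close>. As \<open>A\<close> and
    \<open>B\<close> are nonzero it differs from both exceptional curves \<open>s = 0\<close> and
    \<open>t = 0\<close>.\<close>
  define d where "d = - A / B"
  have d: "d \<noteq> 0" using AB by (simp add: d_def)
  define L2 where "L2 = local_subst var_s (var_s * (var_t + cst d))"
  obtain p q where pq: "f1 = cst (lc f1 0 0) + var_s * p + var_t * q" "lc p 0 0 = A" "lc q 0 0 = B"
    using local_decomp'[of f1] l1 by metis
  define f2 where "f2 = L2 p + (var_t + cst d) * L2 q"
  have "total_transform (Some d) f1 = var_s * f2"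
    unfolding total_transform.simps L2_def[symmetric] f2_def by (subst pq(1))
      (simp add: l1 L2_def local_subst_simps rhom_0[OF rhom_cst] algebra_simps)
  then have s2: "strict_transform (Some d) f1 = f2" by (intro strict_transformI) (simp add: m2)
  have L2: "lc (L2 p) 0 0 = lc p 0 0 \<and> lc (L2 p) 0 1 = 0" for p
  proof -
    obtain x u v where e: "p = cst x + var_s * u + var_t * v" using local_decomp by blast
    have "L2 p = cst x + var_s * (L2 u + (var_t + cst d) * L2 v)"
      unfolding L2_def e by (simp add: local_subst_simps algebra_simps)
    then show ?thesis by (simp add: e)
  qed
  have l2: "lc f2 0 0 = 0" "lc f2 0 1 = B"
    using L2[of p] L2[of q] pq AB by (simp_all add: f2_def distrib_right One_nat_def d_def)
  define E2 where "E2 = exceptional (Some d) * strict_transform (Some d) E1"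
  have "strict_transform (Some d) E1 = var_t + cst d"
    by (rule strict_transformI, unfold mE1) (simp add: E1 local_subst_simps power2_eq_square algebra_simps)
  \<comment> \<open>The factor \<open>var_t + cst d\<close> is a unit at the new point, so only the
    newest exceptional curve passes through it.\<close>
  then have E2: "E2 = var_s * (var_t + cst d)" by (simp add: E2_def)
  have lE2: "lc E2 0 0 = 0" "lc E2 1 0 = d" "lc E2 0 1 = 0" by (simp_all add: E2 One_nat_def)
  have "local_mult E2 = 1"
    by (rule local_mult_eqI[of 1 0]) (use lE2 d in auto)
  moreover have "local_mult f2 = 1"
    by (rule local_mult_eqI[of 0 1]) (use l2 AB in auto)
  ultimately have "simple_normal_crossing f2 E2"
    using l2 lE2 AB d by (simp add: simple_normal_crossing_def)
  then have r2: "resolution_multiplicities f2 E2 []" by (rule resolved)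
  have "resolution_multiplicities f1 E1 (local_mult f1 # [])"
    by (rule blow_up[of _ _ "Some d"])
      (use l2 r2 mE1 in \<open>simp_all add: s2 E2_def simple_normal_crossing_def\<close>)
  then have r1: "resolution_multiplicities f1 E1 [1]" by (simp add: m2)
  have "\<not> simple_normal_crossing f var_s"
    using f by (simp add: simple_normal_crossing_def)
  then have "resolution_multiplicities f var_s (local_mult f # [1])"
    by (rule blow_up[of _ _ None]) (use l1 r1 in \<open>simp_all only: s1 E1_def\<close>)
  then show ?thesis by (simp add: m1)
qed

text \<open>The direction blown up is never that of \<open>var_s = 0\<close>, so the old exceptional
  curve leaves the point every time and the divisor is again \<open>var_s\<close>.\<close>

lemma resolution_cusp_form_aux:
  "cusp_form n f \<Longrightarrow> resolution_multiplicities f var_s (replicate n 2 @ [1, 1])"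
proof (induct n arbitrary: f)
  case 0
  then show ?case using resolution_tangent cusp_form_low[OF 0] by simp
next
  case (Suc n)
  obtain d f' where f': "cusp_form n f'" "total_transform (Some d) f = var_s\<^sup>2 * f'"
    using cusp_form_blow_up[OF Suc(2)] by blast
  have s: "strict_transform (Some d) f = f'"
    by (rule strict_transformI) (simp only: f' cusp_form_mult[OF Suc(2)] exceptional.simps)
  have E: "strict_transform (Some d) var_s = 1" by (rule strict_transformI) simp
  have "resolution_multiplicities f var_s (local_mult f # (replicate n 2 @ [1, 1]))"
    by (rule blow_up[of _ _ "Some d"], rule not_snc_mult)
      (use Suc(1)[OF f'(1)] cusp_form_low(1)[OF f'(1)] cusp_form_mult[OF Suc(2)] in \<open>simp_all add: s E\<close>)
  then show ?case by (simp add: cusp_form_mult[OF Suc(2)])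
qed

lemma resolution_cusp_form:
  assumes "cusp_form n f" "0 < n"
  shows "resolution_multiplicities f 1 (replicate n 2 @ [1, 1])"
proof -
  obtain k where n: "n = Suc k" using assms(2) gr0_conv_Suc by blast
  note c = assms(1)[unfolded n]
  obtain d f' where f': "cusp_form k f'" "total_transform (Some d) f = var_s\<^sup>2 * f'"
    using cusp_form_blow_up[OF c] by blast
  have s: "strict_transform (Some d) f = f'"
    by (rule strict_transformI) (simp only: f' cusp_form_mult[OF c] exceptional.simps)
  have E: "strict_transform (Some d) 1 = 1" by (rule strict_transformI) (simp add: local_subst_simps)
  have "resolution_multiplicities f 1 (local_mult f # (replicate k 2 @ [1, 1]))"
    by (rule blow_up[of _ _ "Some d"], rule not_snc_mult)
      (use resolution_cusp_form_aux[OF f'(1)] cusp_form_low(1)[OF f'(1)] cusp_form_mult[OF c] in \<open>simp_all add: s E\<close>)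
  then show ?thesis by (simp add: cusp_form_mult[OF c] n)
qed

lemma omit_ending_ones_cusp: "omit_ending_ones (replicate n 2 @ [1, 1]) = replicate n 2"
proof -
  have "dropWhile (\<lambda>m. m = 1) (replicate n (2::nat)) = replicate n 2" by (cases n) simp_all
  then show ?thesis by (simp add: omit_ending_ones_def)
qed

section \<open>Analytic irreducibility\<close>

definition fl :: "local_poly \<Rightarrow> complex fps fps" where
  "fl f = fps_of_poly (map_poly fps_of_poly f)"

lemma fl_nth [simp]: "fl f $ i $ j = lc f i j"
  by (simp add: fl_def coeff_map_poly)

lemma rhom_fl: "rhom fl"
  unfolding rhom_def
proof (intro conjI allI)
  show "fl 1 = 1" by (simp add: fl_def)
  show "fl (x + y) = fl x + fl y" for x y by (simp add: fps_eq_iff)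
  show "fl (x * y) = fl x * fl y" for x y
    by (simp add: fps_eq_iff fps_mult_nth fps_sum_nth lc_mult atLeast0AtMost)
qed

lemma fps_fps_unit: assumes "(a :: complex fps fps) $ 0 $ 0 \<noteq> 0" shows "a dvd 1"
proof -
  have "a $ 0 * inverse (a $ 0) = 1" using assms by (simp add: inverse_mult_eq_1')
  from fps_right_inverse[OF this] show ?thesis by (metis dvd_triv_left)
qed

lemma fps_fps_not_unit: assumes "(a :: complex fps fps) $ 0 $ 0 = 0" shows "\<not> a dvd 1"
proof
  assume "a dvd 1"
  then obtain b where "1 = a * b" by blast
  then have "(1 :: complex fps fps) $ 0 $ 0 = (a * b) $ 0 $ 0" by simp
  then show False using assms by simp
qed

text \<open>The substitution of \<open>s\<close> and \<open>s (t + c)\<close> in a power series in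
  \<open>s, t\<close>. A monomial of total degree \<open>m\<close> contributes to the power
  \<open>s ^ m\<close> only, so every coefficient is a finite sum although \<open>c\<close> need not
  be 0.\<close>

definition blow :: "complex \<Rightarrow> complex fps fps \<Rightarrow> complex fps fps" where
  "blow c a = Abs_fps (\<lambda>m. \<Sum>j\<le>m. fps_const (a $ (m - j) $ j) * (fps_X + fps_const c) ^ j)"

lemma blow_add: "blow c (a + b) = blow c a + blow c b"
proof -
  have "blow c (a + b) $ m = (blow c a + blow c b) $ m" for m
    unfolding blow_def fps_nth_Abs_fps fps_add_nth
    by (simp only: fps_const_add[symmetric] distrib_right sum.distrib)
  then show ?thesis by (simp add: fps_eq_iff[where 'a = "complex fps"])
qed

lemma blow_mult: "blow c (a * b) = blow c a * blow c b"
proof -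
  define L where "L = fps_X + fps_const c"
  have "blow c (a * b) $ m = (blow c a * blow c b) $ m" for m
  proof -
    define X where "X p q r s = fps_const (a $ p $ q * b $ r $ s) * L ^ (q + s)" for p q r s
    have "blow c (a * b) $ m = (\<Sum>l\<le>m. \<Sum>p\<le>m - l. \<Sum>q\<le>l. X p q (m - l - p) (l - q))"
      unfolding blow_def L_def[symmetric] fps_nth_Abs_fps
    proof (rule sum.cong)
      fix l assume "l \<in> {..m}"
      have "fps_const ((a * b) $ (m - l) $ l) = (\<Sum>p\<le>m - l. \<Sum>q\<le>l. fps_const (a $ p $ q * b $ (m - l - p) $ (l - q)))"
        by (simp add: fps_mult_nth fps_sum_nth atLeast0AtMost fps_eq_iff)
      moreover have "fps_const x * L ^ l = fps_const x * L ^ (q + (l - q))" if "q \<le> l" for q x using that by simp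
      ultimately show "fps_const ((a * b) $ (m - l) $ l) * L ^ l = (\<Sum>p\<le>m - l. \<Sum>q\<le>l. X p q (m - l - p) (l - q))"
        unfolding X_def by (simp add: sum_distrib_right)
    qed simp
    also have "\<dots> = (\<Sum>(l, p, q)\<in>(SIGMA l:{..m}. {..m - l} \<times> {..l}). X p q (m - l - p) (l - q))"
      by (simp add: sum.Sigma[symmetric] sum.cartesian_product[symmetric])
    \<comment> \<open>The product was sorted by the exponents of \<open>t\<close> in it and of both
      variables in the factor \<open>a\<close>; now \<open>k\<close> is the total degree of the term
      of \<open>a\<close>, and \<open>i\<close>, \<open>j\<close> are the exponents of
      \<open>t\<close> in the two factors.\<close>
    also have "\<dots> = (\<Sum>(k, i, j)\<in>(SIGMA k:{..m}. {..k} \<times> {..m - k}). X (k - i) i (m - k - j) j)"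
      by (rule sum.reindex_bij_witness[where i = "\<lambda>(k, i, j). (i + j, k - i, i)" and j = "\<lambda>(l, p, q). (p + q, q, l - q)"])
        (auto intro!: arg_cong2[where f = "\<lambda>x y. X _ _ x y"])
    also have "\<dots> = (\<Sum>k\<le>m. \<Sum>i\<le>k. \<Sum>j\<le>m - k. X (k - i) i (m - k - j) j)"
      by (simp add: sum.Sigma[symmetric] sum.cartesian_product[symmetric])
    also have "\<dots> = (blow c a * blow c b) $ m"
      unfolding fps_mult_nth blow_def L_def[symmetric] fps_nth_Abs_fps atLeast0AtMost sum_product X_def
      by (intro sum.cong refl) (simp add: power_add fps_const_mult[symmetric] mult_ac del: fps_const_mult)
    finally show ?thesis .
  qed
  then show ?thesis by (simp add: fps_eq_iff[where 'a = "complex fps"])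
qed

lemma blow_fl: "blow d (fl f) = fl (total_transform (Some d) f)"
proof (induct f rule: local_poly_induct)
  case (cst c)
  have "blow d (fl (cst c)) $ m = fl (cst c) $ m" for m
    by (cases m) (auto simp: blow_def fps_eq_iff intro!: sum.neutral)
  then show ?case by (simp add: fps_eq_iff[where 'a = "complex fps"])
next
  case var_s
  have "blow d (fl var_s) $ m = fl var_s $ m" for m
  proof -
    have "blow d (fl var_s) $ m = (\<Sum>j\<le>m. if j = 0 then (if m = 1 then 1 else 0) else 0)"
      unfolding blow_def fps_nth_Abs_fps by (rule sum.cong) auto
    then show ?thesis by (auto simp: fps_eq_iff)
  qed
  then show ?case by (simp add: fps_eq_iff[where 'a = "complex fps"])
next
  case var_t
  have "blow d (fl var_t) $ m = fl (var_s * (var_t + cst d)) $ m" for m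
  proof -
    have "blow d (fl var_t) $ m = (\<Sum>j\<le>m. if j = 1 then (if m = 1 then fps_X + fps_const d else 0) else 0)"
      unfolding blow_def fps_nth_Abs_fps by (rule sum.cong) auto
    also have "\<dots> = (if m = 1 then fps_X + fps_const d else 0)" by auto
    also have "\<dots> = fl (var_s * (var_t + cst d)) $ m" by (cases m) (auto simp: fps_eq_iff)
    finally show ?thesis .
  qed
  then show ?case by (simp add: fps_eq_iff[where 'a = "complex fps"])
qed (simp_all add: blow_add blow_mult rhom_simps[OF rhom_fl] local_subst_simps)

text \<open>Nonunits \<open>a\<close>, \<open>b\<close> with product \<open>f\<close> have
  transforms divisible by \<open>s\<close>, so \<open>f' = A B\<close>. On \<open>s = 0\<close> the
  factors \<open>A\<close>, \<open>B\<close> are linear in \<open>t\<close>, and their product is a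
  nonzero multiple of \<open>t^2\<close>; hence both vanish at the origin, against irreducibility of
  \<open>f'\<close>.\<close>

lemma irreducible_blow_up:
  assumes f': "Factorial_Ring.irreducible (fl f')" and t: "total_transform (Some d) f = var_s\<^sup>2 * f'"
    and low: "lc f 0 0 = 0" "lc f' 0 0 = 0" "lc f' 0 1 = 0" "lc f' 0 2 \<noteq> 0"
  shows "Factorial_Ring.irreducible (fl f)"
proof (rule irreducibleI)
  have bf: "blow d (fl f) = fps_X ^ 2 * fl f'"
  proof -
    have "fl var_s = fps_X" by (auto simp: fps_eq_iff fps_X_nth)
    then show ?thesis unfolding blow_fl t rhom_mult[OF rhom_fl] rhom_power[OF rhom_fl] by simp
  qed
  show "fl f \<noteq> 0"
  proof
    assume "fl f = 0"
    then have "blow d (fl f) = 0" by (simp add: blow_def fps_eq_iff)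
    then have "fl f' = 0" by (simp add: bf)
    then show False using f' by simp
  qed
  show "\<not> fl f dvd 1" by (rule fps_fps_not_unit) (simp add: low)
  fix a b assume ab: "fl f = a * b"
  show "a dvd 1 \<or> b dvd 1"
  proof (rule ccontr)
    assume "\<not> ?thesis"
    then have z: "a $ 0 $ 0 = 0" "b $ 0 $ 0 = 0" using fps_fps_unit by blast+
    define A where "A = fps_shift 1 (blow d a)"
    define B where "B = fps_shift 1 (blow d b)"
    have 0: "blow d a $ 0 = 0" "blow d b $ 0 = 0" using z by (simp_all add: blow_def)
    have e: "blow d a = fps_X * A" "blow d b = fps_X * B"
      unfolding A_def B_def using 0 by (auto simp: fps_eq_iff[where 'a = "complex fps"] fps_X_mult_nth)
    have "fps_X ^ 2 * fl f' = fps_X ^ 2 * (A * B)"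
      unfolding bf[symmetric] ab blow_mult e by (simp add: power2_eq_square mult_ac)
    then have AB: "fl f' = A * B" by simp
    define u where "u = a $ 1 $ 0 + a $ 0 $ 1 * d" define v where "v = b $ 1 $ 0 + b $ 0 $ 1 * d"
    have A0: "A $ 0 = fps_const u + fps_const (a $ 0 $ 1) * fps_X"
      unfolding A_def u_def by (simp add: blow_def atMost_Suc algebra_simps fps_eq_iff)
    have B0: "B $ 0 = fps_const v + fps_const (b $ 0 $ 1) * fps_X"
      unfolding B_def v_def by (simp add: blow_def atMost_Suc algebra_simps fps_eq_iff)
    have "lc f' 0 j = (A $ 0 * B $ 0) $ j" for j using AB by (metis fl_nth fps_mult_nth_0)
    also have "A $ 0 * B $ 0 = fps_const (u * v) + fps_const (u * b $ 0 $ 1 + v * a $ 0 $ 1) * fps_X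
      + fps_const (a $ 0 $ 1 * b $ 0 $ 1) * fps_X ^ 2"
      unfolding A0 B0 by (simp add: algebra_simps power2_eq_square fps_const_mult[symmetric] fps_const_add[symmetric] del: fps_const_mult fps_const_add)
    finally have l: "lc f' 0 j = (fps_const (u * v) + fps_const (u * b $ 0 $ 1 + v * a $ 0 $ 1) * fps_X
      + fps_const (a $ 0 $ 1 * b $ 0 $ 1) * fps_X ^ 2) $ j" for j .
    have "u * v = 0" "u * b $ 0 $ 1 + v * a $ 0 $ 1 = 0" "a $ 0 $ 1 * b $ 0 $ 1 \<noteq> 0"
      using l[of 0] l[of 1] l[of 2] low by (simp_all add: fps_X_power_iff)
    then have "u = 0" "v = 0" by auto
    then have "A $ 0 $ 0 = 0" "B $ 0 $ 0 = 0" by (simp_all add: A0 B0)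
    then have "\<not> A dvd 1" "\<not> B dvd 1" by (simp_all add: fps_fps_not_unit)
    then show False using irreducibleD[OF f' AB] by blast
  qed
qed

text \<open>A product of two nonunits has no linear terms.\<close>

lemma irreducible_smooth:
  assumes "lc f 0 0 = 0" "lc f 1 0 \<noteq> 0"
  shows "Factorial_Ring.irreducible (fl f)"
proof (rule irreducibleI)
  show "fl f \<noteq> 0" using assms(2) by (metis fl_nth fps_zero_nth)
  show "\<not> fl f dvd 1" by (rule fps_fps_not_unit) (simp add: assms)
  fix a b assume ab: "fl f = a * b"
  show "a dvd 1 \<or> b dvd 1"
  proof (rule ccontr)
    assume "\<not> ?thesis"
    then have z: "a $ 0 $ 0 = 0" "b $ 0 $ 0 = 0" using fps_fps_unit by blast+
    have "lc f 1 0 = (a * b) $ 1 $ 0" by (simp add: ab[symmetric])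
    also have "\<dots> = 0" by (simp add: fps_mult_nth z)
    finally show False using assms(2) by simp
  qed
qed

lemma cusp_form_irreducible: "cusp_form n f \<Longrightarrow> analytically_irreducible f"
  unfolding analytically_irreducible_def fl_def[symmetric]
proof (induct n arbitrary: f)
  case 0 then show ?case using cusp_form_low[OF 0] by (intro irreducible_smooth) auto
next
  case (Suc n)
  obtain d f' where f': "cusp_form n f'" "total_transform (Some d) f = var_s\<^sup>2 * f'"
    using cusp_form_blow_up[OF Suc(2)] by blast
  show ?case
    by (rule irreducible_blow_up[OF Suc(1)[OF f'(1)] f'(2)]) (use cusp_form_low[OF Suc(2)] cusp_form_low[OF f'(1)] in auto)
qed

section \<open>Homogenisation\<close>

definition hmg :: "(complex \<Rightarrow> 'r::comm_ring_1) \<Rightarrow> nat \<Rightarrow> complex poly \<Rightarrow> 'r \<Rightarrow> 'r \<Rightarrow> 'r" where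
  "hmg f d p x0 x1 = (\<Sum>i\<le>d. f (poly.coeff p i) * x0 ^ (d - i) * x1 ^ i)"

lemma rhom_hmg: "rhom g \<Longrightarrow> g (hmg f d p x0 x1) = hmg (\<lambda>c. g (f c)) d p (g x0) (g x1)"
  by (simp add: hmg_def rhom_simps)

lemma hmg_scale: "hmg f d p (l * x0) (l * x1) = l ^ d * hmg f d p x0 x1"
  unfolding hmg_def sum_distrib_left
proof (rule sum.cong)
  fix i assume "i \<in> {..d}"
  then have "l ^ d = l ^ (d - i) * l ^ i" by (simp add: power_add[symmetric])
  then show "f (poly.coeff p i) * (l * x0) ^ (d - i) * (l * x1) ^ i = l ^ d * (f (poly.coeff p i) * x0 ^ (d - i) * x1 ^ i)"
    by (simp add: power_mult_distrib mult_ac)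
qed simp

lemma hmg_1: assumes "rhom g" "degree p \<le> d" shows "hmg (\<lambda>c. g [:c:]) d p 1 (g [:0, 1:]) = g p"
proof -
  have "p = (\<Sum>i\<le>d. [:poly.coeff p i:] * [:0, 1:] ^ i)"
  proof -
    have "p = (\<Sum>i\<le>d. Polynomial.monom (poly.coeff p i) i)"
      using assms(2) by (simp add: poly_eq_iff coeff_sum coeff_eq_0 not_le)
    also have "\<dots> = (\<Sum>i\<le>d. [:poly.coeff p i:] * [:0, 1:] ^ i)" by (simp add: monom_altdef)
    finally show ?thesis .
  qed
  from arg_cong[OF this, of g] show ?thesis
    by (simp only: hmg_def rhom_sum[OF assms(1)] rhom_mult[OF assms(1)] rhom_power[OF assms(1)] power_one mult_1_right)
qed

lemma hmg_eval: assumes "degree p \<le> d" "x0 \<noteq> 0" shows "hmg (\<lambda>x. x) d p x0 x1 = x0 ^ d * poly p (x1 / x0)"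
proof -
  have "hmg (\<lambda>x. x) d p (x0 * 1) (x0 * (x1 / x0)) = x0 ^ d * hmg (\<lambda>c. poly [:c:] (x1 / x0)) d p 1 (poly [:0, 1:] (x1 / x0))"
    by (simp only: hmg_scale) simp
  also have "hmg (\<lambda>c. poly [:c:] (x1 / x0)) d p 1 (poly [:0, 1:] (x1 / x0)) = poly p (x1 / x0)"
    by (rule hmg_1[OF rhom_poly assms(1)])
  finally show ?thesis using assms(2) by simp
qed

lemma bihomogeneous_hmg: "bihomogeneous e (int d) 0 (hmg ck d p cx0 cx1)"
  unfolding hmg_def
proof (rule bihomogeneous_sum)
  fix i assume "i \<in> {..d}"
  have "bihomogeneous e (0 + int (d - i) * 1 + int i * 1) (0 + int (d - i) * 0 + int i * 0)
    (ck (poly.coeff p i) * cx0 ^ (d - i) * cx1 ^ i)"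
    by (intro bihomogeneous_mult bihomogeneous_power bihomogeneous_gens)
  then show "bihomogeneous e (int d) 0 (ck (poly.coeff p i) * cx0 ^ (d - i) * cx1 ^ i)"
    using \<open>i \<in> {..d}\<close> by (simp add: of_nat_diff)
qed

lemma cox_gens_nonzero [simp]: "cx0 \<noteq> 0" "cx1 \<noteq> 0" "cy0 \<noteq> 0" "cy1 \<noteq> 0"
  by (simp_all add: cx0_def cx1_def cy0_def cy1_def)

text \<open>Multiplication by \<open>cx0 * cy0\<close> takes care of the excluded points, and the
  Cox ring is a domain.\<close>

lemma cox_poly_eqI':
  assumes "\<And>x0 x1 y0 y1. x0 \<noteq> 0 \<Longrightarrow> y0 \<noteq> 0 \<Longrightarrow> cox_subst (\<lambda>x. x) x0 x1 y0 y1 F = cox_subst (\<lambda>x. x) x0 x1 y0 y1 G"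
  shows "F = G"
proof -
  note h = rhom_simps[OF rhom_cox_subst[OF rhom_id(2)]] cox_subst_gens[OF rhom_id(2)]
  have "cx0 * cy0 * (F - G) = 0"
  proof (rule cox_poly_eq_0I, unfold id_def)
    fix x0 x1 y0 y1
    show "cox_subst (\<lambda>x. x) x0 x1 y0 y1 (cx0 * cy0 * (F - G)) = 0"
      using assms[of x0 y0 x1 y1] by (cases "x0 = 0 \<or> y0 = 0") (auto simp: h)
  qed
  then show ?thesis by simp
qed

text \<open>The polar form of the cubic, quadratic in \<open>(u0, u1)\<close> and linear in
  \<open>(v0, v1)\<close>: the coefficient of \<open>s^2 t\<close> when the cubic is restricted to
  the plane spanned by two vectors.\<close>

definition pol :: "'r::comm_ring_1 \<Rightarrow> 'r \<Rightarrow> 'r \<Rightarrow> 'r \<Rightarrow> 'r \<Rightarrow> 'r \<Rightarrow> 'r \<Rightarrow> 'r" where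
  "pol a x0 x1 u0 u1 v0 v1 = (x0 - x1) * (u0\<^sup>2 * v1 + 2 * (u0 * v0 * u1) - 3 * (u0\<^sup>2 * v0))
     - x1 * (3 * (u1\<^sup>2 * v1) - a * (v0 * u1\<^sup>2 + 2 * (u0 * u1 * v1)))"

lemma pencil_polarise:
  "pencil a x0 x1 (s * u0 + t * v0) (s * u1 + t * v1) = pencil a x0 x1 u0 u1 * s ^ 3
    + pol a x0 x1 u0 u1 v0 v1 * (s\<^sup>2 * t) + pol a x0 x1 v0 v1 u0 u1 * (s * t\<^sup>2) + pencil a x0 x1 v0 v1 * t ^ 3"
  by (simp add: pencil_def pol_def power2_eq_square power3_eq_cube algebra_simps)

lemma rhom_numeral: assumes "rhom f" shows "f 2 = 2" "f 3 = 3"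
  using rhom_add[OF assms, of 1 1] rhom_add[OF assms, of 2 1] rhom_1[OF assms] by simp_all

lemma rhom_pol: "rhom f \<Longrightarrow> f (pol a x0 x1 u0 u1 v0 v1) = pol (f a) (f x0) (f x1) (f u0) (f u1) (f v0) (f v1)"
  by (simp add: pol_def rhom_simps rhom_numeral)

text \<open>The two cubic forms that span the pencil have no common zero, so the map is of degree 3
  without base points.\<close>

lemma pencil_zero:
  fixes a :: complex
  assumes "Y0\<^sup>2 * (Y1 - Y0) = 0" "Y1\<^sup>2 * (Y1 - a * Y0) = 0" "a \<noteq> 1"
  shows "Y0 = 0 \<and> Y1 = 0"
proof (cases "Y0 = 0")
  case True then show ?thesis using assms(2) by simp
next
  case False
  then have "Y1 = Y0" using assms(1) by simp
  then have "Y0\<^sup>2 * (Y0 * (1 - a)) = 0" using assms(2) by (simp add: algebra_simps)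
  then show ?thesis using False assms(3) by simp
qed

section \<open>The curve\<close>

text \<open>The assumptions are degree bounds, nonvanishing statements, divisibilities and
  polynomial identities, all of which survive the embedding of the reals. The study of the curve is
  thus purely complex, and reality enters only at the instantiation.\<close>

locale cusp_curve =
  fixes h k :: nat and a :: complex and n :: "nat \<Rightarrow> nat" and z q T0 T1 \<kappa> :: "nat \<Rightarrow> complex"
    and cb :: "nat \<Rightarrow> complex poly" and N00 N01 N10 N11 :: "complex poly" and \<delta> :: complex
    and \<Phi> :: "complex poly poly"
  assumes h: "h \<le> k + 1" and a: "a \<noteq> 1"
    and z_inj: "\<And>i j. i < 4 \<Longrightarrow> j < 4 \<Longrightarrow> z i = z j \<Longrightarrow> i = j"
    and \<kappa>: "\<And>j. j < 4 \<Longrightarrow> \<kappa> j \<noteq> 0"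
    and ram: "\<And>j Y0 Y1. j < 4 \<Longrightarrow> pencil a 1 (z j) Y0 Y1 = \<kappa> j * (Y1 * T0 j - Y0 * T1 j)\<^sup>2 * (Y1 - q j * Y0)"
    and unram: "\<And>j. j < 4 \<Longrightarrow> T1 j \<noteq> q j * T0 j"
    and n_pos: "\<And>j. j < 4 \<Longrightarrow> 0 < n j" and n_sum: "(\<Sum>j<4. n j) = 2 * k + h"
    and degN: "degree N00 \<le> k + h" "degree N01 \<le> k + h" "degree N10 \<le> k" "degree N11 \<le> k"
    and \<delta>: "\<delta> \<noteq> 0" and det: "N00 * N11 - N01 * N10 = Polynomial.smult \<delta> (\<Prod>j<4. [:- z j, 1:] ^ n j)"
    and c: "\<And>j. j < 4 \<Longrightarrow> poly (cb j) (z j) = q j"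
    and c_pencil: "\<And>j. j < 4 \<Longrightarrow> [:- z j, 1:] ^ n j dvd pencil [:a:] 1 [:0, 1:] 1 (cb j)"
    and c_row0: "\<And>j. j < 4 \<Longrightarrow> [:- z j, 1:] ^ n j dvd N00 + N01 * cb j"
    and c_row1: "\<And>j. j < 4 \<Longrightarrow> [:- z j, 1:] ^ n j dvd N10 + N11 * cb j"
    and deg\<Phi>: "degree \<Phi> \<le> 3" "\<And>i. degree (poly.coeff \<Phi> i) \<le> k + 1 - h + h * i"
    and \<Phi>: "pencil [:[:a:]:] 1 [:[:0, 1:]:] [:N11, - N01:] [:- N10, N00:] = [:N00 * N11 - N01 * N10:] * \<Phi>"
begin

text \<open>\<open>W0\<close>, \<open>W1\<close> are the homogenised matrix \<open>N\<close> applied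
  to \<open>(Y0, Y1)\<close>, \<open>A\<close>, \<open>B\<close> its adjugate applied to
  \<open>(y0, y1)\<close>, and \<open>D\<close> its determinant. The coefficient map
  \<open>f\<close> lets the same formulas be read for numbers, Cox polynomials and local
  coordinates.\<close>

definition W0 :: "(complex \<Rightarrow> 'r::comm_ring_1) \<Rightarrow> 'r \<Rightarrow> 'r \<Rightarrow> 'r \<Rightarrow> 'r \<Rightarrow> 'r" where
  "W0 f x0 x1 Y0 Y1 = hmg f (k + h) N00 x0 x1 * Y0 + hmg f (k + h) N01 x0 x1 * Y1"

definition W1 :: "(complex \<Rightarrow> 'r::comm_ring_1) \<Rightarrow> 'r \<Rightarrow> 'r \<Rightarrow> 'r \<Rightarrow> 'r \<Rightarrow> 'r" where
  "W1 f x0 x1 Y0 Y1 = hmg f k N10 x0 x1 * Y0 + hmg f k N11 x0 x1 * Y1"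

definition A :: "(complex \<Rightarrow> 'r::comm_ring_1) \<Rightarrow> 'r \<Rightarrow> 'r \<Rightarrow> 'r \<Rightarrow> 'r \<Rightarrow> 'r" where
  "A f x0 x1 y0 y1 = hmg f k N11 x0 x1 * y0 - hmg f (k + h) N01 x0 x1 * y1"

definition B :: "(complex \<Rightarrow> 'r::comm_ring_1) \<Rightarrow> 'r \<Rightarrow> 'r \<Rightarrow> 'r \<Rightarrow> 'r \<Rightarrow> 'r" where
  "B f x0 x1 y0 y1 = hmg f (k + h) N00 x0 x1 * y1 - hmg f k N10 x0 x1 * y0"

definition D :: "(complex \<Rightarrow> 'r::comm_ring_1) \<Rightarrow> 'r \<Rightarrow> 'r \<Rightarrow> 'r" where
  "D f x0 x1 = hmg f (k + h) N00 x0 x1 * hmg f k N11 x0 x1 - hmg f (k + h) N01 x0 x1 * hmg f k N10 x0 x1"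

definition F :: cox_poly where
  "F = (\<Sum>i\<le>3. hmg ck (k + 1 - h + h * i) (poly.coeff \<Phi> i) cx0 cx1 * cy0 ^ (3 - i) * cy1 ^ i)"

lemma rhom_W:
  assumes "rhom g"
  shows "g (W0 f x0 x1 Y0 Y1) = W0 (\<lambda>c. g (f c)) (g x0) (g x1) (g Y0) (g Y1)"
    "g (W1 f x0 x1 Y0 Y1) = W1 (\<lambda>c. g (f c)) (g x0) (g x1) (g Y0) (g Y1)"
    "g (A f x0 x1 Y0 Y1) = A (\<lambda>c. g (f c)) (g x0) (g x1) (g Y0) (g Y1)"
    "g (B f x0 x1 Y0 Y1) = B (\<lambda>c. g (f c)) (g x0) (g x1) (g Y0) (g Y1)"
    "g (D f x0 x1) = D (\<lambda>c. g (f c)) (g x0) (g x1)"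
  by (simp_all add: W0_def W1_def A_def B_def D_def rhom_simps[OF assms] rhom_hmg[OF assms])

lemma cox_subst_W:
  assumes "rhom f"
  shows "cox_subst f x0 x1 y0 y1 (W0 ck cx0 cx1 Y0 Y1) = W0 f x0 x1 (cox_subst f x0 x1 y0 y1 Y0) (cox_subst f x0 x1 y0 y1 Y1)"
    "cox_subst f x0 x1 y0 y1 (W1 ck cx0 cx1 Y0 Y1) = W1 f x0 x1 (cox_subst f x0 x1 y0 y1 Y0) (cox_subst f x0 x1 y0 y1 Y1)"
    "cox_subst f x0 x1 y0 y1 (A ck cx0 cx1 Y0 Y1) = A f x0 x1 (cox_subst f x0 x1 y0 y1 Y0) (cox_subst f x0 x1 y0 y1 Y1)"
    "cox_subst f x0 x1 y0 y1 (B ck cx0 cx1 Y0 Y1) = B f x0 x1 (cox_subst f x0 x1 y0 y1 Y0) (cox_subst f x0 x1 y0 y1 Y1)"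
    "cox_subst f x0 x1 y0 y1 (D ck cx0 cx1) = D f x0 x1"
  using rhom_W[OF rhom_cox_subst[OF assms, of x0 x1 y0 y1], of ck] by (simp_all add: cox_subst_gens[OF assms])

lemma adj_W:
  "A f x0 x1 (W0 f x0 x1 Y0 Y1) (W1 f x0 x1 Y0 Y1) = D f x0 x1 * Y0"
  "B f x0 x1 (W0 f x0 x1 Y0 Y1) (W1 f x0 x1 Y0 Y1) = D f x0 x1 * Y1"
  "W0 f x0 x1 (A f x0 x1 y0 y1) (B f x0 x1 y0 y1) = D f x0 x1 * y0"
  "W1 f x0 x1 (A f x0 x1 y0 y1) (B f x0 x1 y0 y1) = D f x0 x1 * y1"
  by (simp_all add: W0_def W1_def A_def B_def D_def algebra_simps)

lemma bihomogeneous_F: "bihomogeneous h (int k + 1 - int h) 3 F"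
  unfolding F_def
proof (rule bihomogeneous_sum)
  fix i :: nat assume i: "i \<in> {..3}"
  have "bihomogeneous h (int (k + 1 - h + h * i) + int (3 - i) * 0 + int i * (- int h)) (0 + int (3 - i) * 1 + int i * 1)
     (hmg ck (k + 1 - h + h * i) (poly.coeff \<Phi> i) cx0 cx1 * cy0 ^ (3 - i) * cy1 ^ i)"
    by (intro bihomogeneous_mult bihomogeneous_hmg bihomogeneous_power bihomogeneous_gens)
  moreover have "int (k + 1 - h + h * i) + int (3 - i) * 0 + int i * (- int h) = int k + 1 - int h"
    using h by (simp add: of_nat_diff)
  moreover have "0 + int (3 - i) * 1 + int i * 1 = 3" using i by (simp add: of_nat_diff)
  ultimately show "bihomogeneous h (int k + 1 - int h) 3 (hmg ck (k + 1 - h + h * i) (poly.coeff \<Phi> i) cx0 cx1 * cy0 ^ (3 - i) * cy1 ^ i)"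
    by (simp only:)
qed

lemma bihomogeneous_AB: "bihomogeneous h (int k) 1 (A ck cx0 cx1 cy0 cy1)" "bihomogeneous h (int k) 1 (B ck cx0 cx1 cy0 cy1)"
proof -
  have 0: "bihomogeneous h (int k + 0) (0 + 1) (hmg ck k p cx0 cx1 * cy0)" for p
    by (intro bihomogeneous_mult bihomogeneous_hmg bihomogeneous_gens)
  have 1: "bihomogeneous h (int (k + h) + - int h) (0 + 1) (hmg ck (k + h) p cx0 cx1 * cy1)" for p
    by (intro bihomogeneous_mult bihomogeneous_hmg bihomogeneous_gens)
  show "bihomogeneous h (int k) 1 (A ck cx0 cx1 cy0 cy1)" "bihomogeneous h (int k) 1 (B ck cx0 cx1 cy0 cy1)"
    unfolding A_def B_def using 0 1 by (auto intro!: bihomogeneous_diff)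
qed

lemma F_eval: "rhom f \<Longrightarrow> cox_subst f x0 x1 y0 y1 F =
    (\<Sum>i\<le>3. hmg f (k + 1 - h + h * i) (poly.coeff \<Phi> i) x0 x1 * y0 ^ (3 - i) * y1 ^ i)"
  unfolding F_def
  by (simp add: rhom_simps[OF rhom_cox_subst] rhom_hmg[OF rhom_cox_subst] cox_subst_gens)

lemma F_scale_y: "rhom f \<Longrightarrow> cox_subst f x0 x1 (l * y0) (l * y1) F = l ^ 3 * cox_subst f x0 x1 y0 y1 F"
  using bihomogeneous_scale[OF bihomogeneous_F, of f 1 x0 x1 l y0 y1] by simp

definition fc :: cox_poly where "fc = pencil (ck a) cx0 cx1 cy0 cy1"

text \<open>Where \<open>x0\<close> and \<open>y0\<close> are nonzero this is the defining identity
  of \<open>\<Phi>\<close> scaled back; the powers of \<open>x0\<close> match by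
  \<open>3 k + 1 = (2 k + h) + (k + 1 - h)\<close>.\<close>

lemma pencil_adj_cox: "pencil (ck a) cx0 cx1 (A ck cx0 cx1 cy0 cy1) (B ck cx0 cx1 cy0 cy1) = D ck cx0 cx1 * F"
proof (rule cox_poly_eqI')
  fix x0 x1 y0 y1 :: complex assume x0: "x0 \<noteq> 0" and y0: "y0 \<noteq> 0"
  define x where "x = x1 / x0"
  define y where "y = x0 ^ h * y1"
  have A': "A (\<lambda>x. x) x0 x1 y0 y1 = x0 ^ k * (poly N11 x * y0 - poly N01 x * y)"
    "B (\<lambda>x. x) x0 x1 y0 y1 = x0 ^ k * (poly N00 x * y - poly N10 x * y0)"
    unfolding A_def B_def using degN x0 by (simp_all add: hmg_eval x_def y_def power_add algebra_simps)
  have D': "D (\<lambda>x. x) x0 x1 = x0 ^ (2 * k + h) * poly (N00 * N11 - N01 * N10) x"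
  proof -
    have "x0 ^ (2 * k + h) = x0 ^ (k + h) * x0 ^ k" by (simp add: power_add[symmetric] mult_2 add_ac)
    then show ?thesis unfolding D_def using degN x0 by (simp add: hmg_eval x_def algebra_simps)
  qed
  have F': "cox_subst (\<lambda>x. x) x0 x1 y0 y1 F = x0 ^ (k + 1 - h) * (\<Sum>i\<le>3. poly (poly.coeff \<Phi> i) x * y0 ^ (3 - i) * y ^ i)"
    unfolding F_eval[OF rhom_id(2)] sum_distrib_left
  proof (rule sum.cong)
    fix i :: nat
    have "x0 ^ (k + 1 - h + h * i) = x0 ^ (k + 1 - h) * (x0 ^ h) ^ i" by (simp only: power_add power_mult)
    then show "hmg (\<lambda>x. x) (k + 1 - h + h * i) (poly.coeff \<Phi> i) x0 x1 * y0 ^ (3 - i) * y1 ^ i =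
      x0 ^ (k + 1 - h) * (poly (poly.coeff \<Phi> i) x * y0 ^ (3 - i) * y ^ i)"
      unfolding hmg_eval[OF deg\<Phi>(2) x0] x_def y_def power_mult_distrib by (simp only: mult_ac)
  qed simp
  have ident: "pencil a 1 x (poly N11 x * y0 - poly N01 x * y) (poly N00 x * y - poly N10 x * y0) =
      poly (N00 * N11 - N01 * N10) x * (\<Sum>i\<le>3. poly (poly.coeff \<Phi> i) x * y0 ^ (3 - i) * y ^ i)"
  proof -
    define \<epsilon> where "\<epsilon> p t = poly (map_poly (\<lambda>p. poly p x) p) t" for p :: "complex poly poly" and t
    have r: "rhom (\<lambda>p. \<epsilon> p t)" for t unfolding \<epsilon>_def by (rule rhom_eval[OF rhom_poly])
    have e0: "\<epsilon> [:p:] t = poly p x" "\<epsilon> [:p, p':] t = poly p x + t * poly p' x" for p p' t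
      unfolding \<epsilon>_def by (simp_all add: map_poly_pCons_rhom[OF rhom_poly])
    have e1: "\<epsilon> \<Phi> t = (\<Sum>i\<le>3. poly (poly.coeff \<Phi> i) x * t ^ i)" for t
      unfolding \<epsilon>_def by (rule poly_map_poly_bound[OF rhom_poly deg\<Phi>(1)])
    have 1: "pencil a 1 x (poly N11 x - t * poly N01 x) (- poly N10 x + t * poly N00 x) =
       poly (N00 * N11 - N01 * N10) x * (\<Sum>i\<le>3. poly (poly.coeff \<Phi> i) x * t ^ i)" for t
      using arg_cong[OF \<Phi>, of "\<lambda>p. \<epsilon> p t"] unfolding rhom_pencil[OF r] rhom_mult[OF r] e1
      by (simp add: e0 rhom_1[OF r])
    have hom: "poly (N00 * N11 - N01 * N10) x * (\<Sum>i\<le>3. poly (poly.coeff \<Phi> i) x * y0 ^ (3 - i) * y ^ i) =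
      pencil a 1 x (poly N11 x * y0 - poly N01 x * y) (poly N00 x * y - poly N10 x * y0)"
    proof -
      have s: "y0 ^ 3 * (\<Sum>i\<le>3. poly (poly.coeff \<Phi> i) x * (y / y0) ^ i) = (\<Sum>i\<le>3. poly (poly.coeff \<Phi> i) x * y0 ^ (3 - i) * y ^ i)"
        unfolding sum_distrib_left
      proof (rule sum.cong)
        fix i :: nat assume "i \<in> {..3}"
        then have "y0 ^ 3 = y0 ^ (3 - i) * y0 ^ i" by (simp add: power_add[symmetric])
        then show "y0 ^ 3 * (poly (poly.coeff \<Phi> i) x * (y / y0) ^ i) = poly (poly.coeff \<Phi> i) x * y0 ^ (3 - i) * y ^ i"
          using y0 by (simp add: power_divide)
      qed simp
      have l: "y0 * (poly N11 x - (y / y0) * poly N01 x) = poly N11 x * y0 - poly N01 x * y"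
        "y0 * (- poly N10 x + (y / y0) * poly N00 x) = poly N00 x * y - poly N10 x * y0"
        using y0 by (simp_all add: field_simps)
      have "pencil a 1 x (y0 * (poly N11 x - (y / y0) * poly N01 x)) (y0 * (- poly N10 x + (y / y0) * poly N00 x)) =
        y0 ^ 3 * (poly (N00 * N11 - N01 * N10) x * (\<Sum>i\<le>3. poly (poly.coeff \<Phi> i) x * (y / y0) ^ i))"
        by (simp only: pencil_homogeneous 1)
      then show ?thesis unfolding l using s by (simp add: mult_ac)
    qed
    show ?thesis using hom by simp
  qed
  have "pencil a x0 x1 (A (\<lambda>x. x) x0 x1 y0 y1) (B (\<lambda>x. x) x0 x1 y0 y1) = x0 * (x0 ^ k) ^ 3 * pencil a 1 x (poly N11 x * y0 - poly N01 x * y) (poly N00 x * y - poly N10 x * y0)"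
  proof -
    have "pencil a x0 x1 u v = x0 * pencil a 1 x u v" for u v
      using x0 by (simp add: pencil_def x_def field_simps)
    then show ?thesis unfolding A' pencil_homogeneous by simp
  qed
  also have "x0 * (x0 ^ k) ^ 3 = x0 ^ (2 * k + h) * x0 ^ (k + 1 - h)"
    using h by (simp add: power_add[symmetric] power_mult[symmetric] flip: power_Suc) (simp add: algebra_simps)
  finally have fin: "pencil a x0 x1 (A (\<lambda>x. x) x0 x1 y0 y1) (B (\<lambda>x. x) x0 x1 y0 y1) = D (\<lambda>x. x) x0 x1 * cox_subst (\<lambda>x. x) x0 x1 y0 y1 F"
    unfolding D' F' ident by (simp only: mult_ac)
  then show "cox_subst (\<lambda>x. x) x0 x1 y0 y1 (pencil (ck a) cx0 cx1 (A ck cx0 cx1 cy0 cy1) (B ck cx0 cx1 cy0 cy1)) =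
      cox_subst (\<lambda>x. x) x0 x1 y0 y1 (D ck cx0 cx1 * F)"
    by (simp add: rhom_pencil[OF rhom_cox_subst] rhom_mult[OF rhom_cox_subst] cox_subst_W cox_subst_gens)
qed

lemma D_factor: "rhom f \<Longrightarrow> D f x0 x1 = f \<delta> * (\<Prod>j<4. (x1 - f (z j) * x0) ^ n j)"
proof -
  have "D ck cx0 cx1 = ck \<delta> * (\<Prod>j<4. (cx1 - ck (z j) * cx0) ^ n j)"
  proof (rule cox_poly_eqI')
    fix x0 x1 y0 y1 :: complex assume x0: "x0 \<noteq> 0" and y0: "y0 \<noteq> 0"
    define x where "x = x1 / x0"
    have "D (\<lambda>x. x) x0 x1 = x0 ^ (2 * k + h) * poly (N00 * N11 - N01 * N10) x"
    proof -
    have "x0 ^ (2 * k + h) = x0 ^ (k + h) * x0 ^ k" by (simp add: power_add[symmetric] mult_2 add_ac)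
    then show ?thesis unfolding D_def using degN x0 by (simp add: hmg_eval x_def algebra_simps)
  qed
    also have "x0 ^ (2 * k + h) * poly (N00 * N11 - N01 * N10) x = (\<Prod>j<4. x0 ^ n j) * (\<delta> * (\<Prod>j<4. (x - z j) ^ n j))"
      unfolding det n_sum[symmetric] power_sum by (simp add: poly_prod poly_power algebra_simps)
    also have "\<dots> = \<delta> * (\<Prod>j<4. (x1 - z j * x0) ^ n j)"
    proof -
      have "x0 ^ n j * (x - z j) ^ n j = (x1 - z j * x0) ^ n j" for j
        using x0 by (simp add: power_mult_distrib[symmetric] x_def algebra_simps)
      then show ?thesis by (simp add: prod.distrib[symmetric] mult_ac)
    qed
    finally show "cox_subst (\<lambda>x. x) x0 x1 y0 y1 (D ck cx0 cx1) = cox_subst (\<lambda>x. x) x0 x1 y0 y1 (ck \<delta> * (\<Prod>j<4. (cx1 - ck (z j) * cx0) ^ n j))"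
      by (simp add: cox_subst_W rhom_simps[OF rhom_cox_subst] cox_subst_gens)
  qed
  moreover assume "rhom f"
  ultimately show ?thesis
    using cox_subst_W(5)[OF \<open>rhom f\<close>, of x0 x1 0 0] by (simp add: rhom_simps[OF rhom_cox_subst] cox_subst_gens)
qed

lemma D_cox_nonzero: "D ck cx0 cx1 \<noteq> 0"
proof
  assume "D ck cx0 cx1 = 0"
  then have "cox_subst (\<lambda>x. x) 0 1 0 0 (D ck cx0 cx1) = 0" by (simp add: rhom_0[OF rhom_cox_subst])
  then have "D (\<lambda>x. x) 0 1 = 0" by (simp add: cox_subst_W)
  then show False using \<delta> by (simp add: D_factor)
qed

lemma pencil_adj:
  assumes "rhom f"
  shows "pencil (f a) x0 x1 (A f x0 x1 y0 y1) (B f x0 x1 y0 y1) = D f x0 x1 * cox_subst f x0 x1 y0 y1 F"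
  using arg_cong[OF pencil_adj_cox, of "cox_subst f x0 x1 y0 y1"]
  by (simp add: rhom_pencil[OF rhom_cox_subst] rhom_mult[OF rhom_cox_subst] cox_subst_W cox_subst_gens assms)

text \<open>Since \<open>N\<close> followed by its adjugate is multiplication by \<open>D\<close>,
  the previous identity at \<open>W\<close> gives \<open>D F(W) = D ^ 3 pencil\<close>. One factor
  is cancelled in the Cox ring, before the evaluation at places where \<open>D\<close> may
  vanish.\<close>

lemma F_W:
  assumes "rhom f"
  shows "cox_subst f x0 x1 (W0 f x0 x1 Y0 Y1) (W1 f x0 x1 Y0 Y1) F = (D f x0 x1)\<^sup>2 * pencil (f a) x0 x1 Y0 Y1"
proof -
  let ?D = "D ck cx0 cx1" let ?F = "cox_subst ck cx0 cx1 (W0 ck cx0 cx1 cy0 cy1) (W1 ck cx0 cx1 cy0 cy1) F"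
  have "?D * ?F = pencil (ck a) cx0 cx1 (?D * cy0) (?D * cy1)"
    unfolding pencil_adj[OF rhom_ck, symmetric] adj_W ..
  also have "\<dots> = ?D * (?D\<^sup>2 * pencil (ck a) cx0 cx1 cy0 cy1)" by (simp add: pencil_homogeneous power2_eq_square power3_eq_cube)
  finally have "?F = ?D\<^sup>2 * pencil (ck a) cx0 cx1 cy0 cy1" using D_cox_nonzero by simp
  from arg_cong[OF this, of "cox_subst f x0 x1 Y0 Y1"] show ?thesis
    by (simp add: rhom_cox_subst_comp[OF rhom_ck rhom_cox_subst[OF assms]] rhom_simps[OF rhom_cox_subst]
        rhom_pencil[OF rhom_cox_subst] cox_subst_W cox_subst_gens assms)
qed

section \<open>Smooth points\<close>

text \<open>The vector \<open>(e0, e1)\<close> is the direction of the local coordinate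
  \<open>t\<close> among the \<open>y\<close>; with it the charts \<open>y0\<close> nonzero and
  \<open>y1\<close> nonzero are treated together.\<close>

lemma local_equation_F:
  "\<exists>e0 e1. (x0, x1) \<noteq> (0, 0) \<and> (y0, y1) \<noteq> (0, 0) \<longrightarrow> y0 * e1 - y1 * e0 \<noteq> 0 \<and>
     local_equation F (x0, x1, y0, y1) = cox_subst cst (if x0 \<noteq> 0 then cst x0 else cst x0 + var_s)
        (if x0 \<noteq> 0 then cst x1 + var_s else cst x1) (cst y0 + cst e0 * var_t) (cst y1 + cst e1 * var_t) F"
  by (rule exI[of _ "if y0 \<noteq> 0 then 0 else 1"], rule exI[of _ "if y0 \<noteq> 0 then 1 else 0"])
    (auto simp: rhom_simps[OF rhom_cst] Let_def)

definition arc :: "complex poly \<Rightarrow> complex poly \<Rightarrow> local_poly \<Rightarrow> complex poly" where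
  "arc s t g = poly (map_poly (\<lambda>q. poly (map_poly (\<lambda>c. [:c:]) q) t) g) s"

lemma rhom_arc: "rhom (arc s t)"
  unfolding arc_def[abs_def] by (intro rhom_eval rhom_const_poly rhom_id)

lemma arc_gens: "arc s t var_s = s" "arc s t var_t = t" "arc s t (cst c) = [:c:]"
proof -
  have r: "rhom (\<lambda>c::complex. [:c:])" by (intro rhom_const_poly rhom_id)
  show "arc s t var_s = s" "arc s t var_t = t" "arc s t (cst c) = [:c:]"
    by (simp_all add: arc_def var_s_def var_t_def cst_def map_poly_pCons_rhom[OF r] map_poly_pCons_rhom[OF rhom_eval[OF r]]
      rhom_simps[OF rhom_eval[OF r]] rhom_1[OF rhom_map_poly[OF r]] pCons_one)
qed

lemma arc_singular:
  assumes "lc g 0 0 = 0" "lc g 1 0 = 0" "lc g 0 1 = 0" "d dvd s" "d dvd t"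
  shows "d\<^sup>2 dvd arc s t g"
proof -
  obtain u v where g: "g = cst (lc g 0 0) + var_s * u + var_t * v" "lc u 0 0 = 0" "lc v 0 0 = 0"
    using local_decomp'[of g] assms by metis
  have "d dvd arc s t w" if "lc w 0 0 = 0" for w
  proof -
    obtain p r where e: "w = cst (lc w 0 0) + var_s * p + var_t * r" using local_decomp[of w] by blast
    show ?thesis using assms by (subst e) (simp add: that rhom_simps[OF rhom_arc] arc_gens)
  qed
  then have "d * d dvd s * arc s t u" "d * d dvd t * arc s t v" using assms g by (simp_all add: mult_dvd_mono)
  moreover have "arc s t g = s * arc s t u + t * arc s t v"
    by (subst g(1)) (simp add: assms rhom_simps[OF rhom_arc] arc_gens)
  ultimately show ?thesis by (simp add: power2_eq_square)
qed

text \<open>Where \<open>D\<close> is nonzero, \<open>N\<close> identifies the curve with the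
  pencil, which is smooth because moving \<open>x\<close> with \<open>Y\<close> fixed changes the
  equation to first order. Carried to the local chart, this motion is an arc along which a singular
  equation would vanish to order two.\<close>

lemma smooth_off_fibres:
  assumes P: "(x0, x1) \<noteq> (0, 0)" "(y0, y1) \<noteq> (0, 0)" and D0: "D (\<lambda>x. x) x0 x1 \<noteq> 0"
  shows "\<not> 2 \<le> local_mult (local_equation F (x0, x1, y0, y1))"
proof
  assume "2 \<le> local_mult (local_equation F (x0, x1, y0, y1))"
  note L = local_mult_ge_2D[OF this]
  obtain e0 e1 where e: "y0 * e1 - y1 * e0 \<noteq> 0" and le: "local_equation F (x0, x1, y0, y1) = cox_subst cst (if x0 \<noteq> 0 then cst x0 else cst x0 + var_s)
        (if x0 \<noteq> 0 then cst x1 + var_s else cst x1) (cst y0 + cst e0 * var_t) (cst y1 + cst e1 * var_t) F"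
    using local_equation_F[of x0 x1 y0 y1] P by auto
  define cp where "cp = (\<lambda>c::complex. [:c:])"
  have cp: "rhom cp" unfolding cp_def by (intro rhom_const_poly rhom_id)
  define X0 where "X0 = (if x0 \<noteq> 0 then [:x0:] else [:x0, 1:])"
  define X1 where "X1 = (if x0 \<noteq> 0 then [:x1, 1:] else [:x1:])"
  define d where "d = D (\<lambda>x. x) x0 x1"
  define Y0 where "Y0 = A (\<lambda>x. x) x0 x1 y0 y1" define Y1 where "Y1 = B (\<lambda>x. x) x0 x1 y0 y1"
  define V0 where "V0 = W0 cp X0 X1 [:Y0:] [:Y1:]" define V1 where "V1 = W1 cp X0 X1 [:Y0:] [:Y1:]"
  have X00: "poly X0 0 = x0" "poly X1 0 = x1" by (simp_all add: X0_def X1_def)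
  have cp0: "(\<lambda>c. poly (cp c) 0) = (\<lambda>x. x)" by (auto simp: cp_def)
  have V00: "poly V0 0 = d * y0" "poly V1 0 = d * y1"
    unfolding V0_def V1_def rhom_W[OF rhom_poly] cp0 X00 by (simp_all add: Y0_def Y1_def adj_W d_def)
  obtain V0' where V0': "V0 = [:d * y0:] + [:0, 1:] * V0'" using V00 by (cases V0) auto
  obtain V1' where V1': "V1 = [:d * y1:] + [:0, 1:] * V1'" using V00 by (cases V1) auto
  define dd where "dd = y0 * e1 - y1 * e0"
  \<comment> \<open>The velocity of the image arc is split into a multiple \<open>l\<close> of the
    point itself and a multiple \<open>m\<close> of the chart direction. To first order the arc is
    the chart arc with slope \<open>\<tau>\<close> times the scalar \<open>\<Lambda>\<close>, which
    only contributes a cube.\<close>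
  define l where "l = (poly V0' 0 * e1 - poly V1' 0 * e0) / dd"
  define m where "m = (y0 * poly V1' 0 - y1 * poly V0' 0) / dd"
  have lm: "poly V0' 0 = l * y0 + m * e0" "poly V1' 0 = l * y1 + m * e1"
    using e unfolding l_def m_def dd_def[symmetric] by (simp_all add: field_simps) (simp_all add: dd_def algebra_simps)
  define \<tau> where "\<tau> = m / d"
  have \<tau>: "m = d * \<tau>" using D0 by (simp add: \<tau>_def d_def)
  define \<Lambda> where "\<Lambda> = [:d, l:]"
  have div2: "[:0, 1:]\<^sup>2 dvd [:d * y:] + [:0, 1:] * V - \<Lambda> * [:y, e * \<tau>:]" if v: "poly V 0 = l * y + m * e" for V y e
  proof -
    obtain V' where V': "V = [:l * y + m * e:] + [:0, 1:] * V'" using v by (cases V) auto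
    have "[:d * y:] + [:0, 1:] * V - \<Lambda> * [:y, e * \<tau>:] = [:0, 1:]\<^sup>2 * (V' - [:l * e * \<tau>:])"
      unfolding V' \<Lambda>_def \<tau> by (simp add: power2_eq_square algebra_simps)
    then show ?thesis by simp
  qed
  have c1: "[:0, 1:]\<^sup>2 dvd cox_subst cp X0 X1 V0 V1 F - cox_subst cp X0 X1 (\<Lambda> * [:y0, e0 * \<tau>:]) (\<Lambda> * [:y1, e1 * \<tau>:]) F"
    by (rule cox_subst_cong_dvd[OF cp]) (use div2[OF lm(1)] div2[OF lm(2)] in \<open>simp_all only: V0'[symmetric] V1'[symmetric] diff_self dvd_0_right\<close>)
  have "[:0, 1:]\<^sup>2 dvd arc [:0, 1:] [:0, \<tau>:] (local_equation F (x0, x1, y0, y1))"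
  proof (rule arc_singular[OF L])
    show "[:0, 1:] dvd [:0, \<tau>:]" by (intro dvdI[of _ _ "[:\<tau>:]"]) simp
  qed simp
  also have "arc [:0, 1:] [:0, \<tau>:] (local_equation F (x0, x1, y0, y1)) = cox_subst cp X0 X1 [:y0, e0 * \<tau>:] [:y1, e1 * \<tau>:] F"
    unfolding le rhom_cox_subst_comp[OF rhom_cst rhom_arc] cp_def X0_def X1_def
    by (simp add: rhom_simps[OF rhom_arc] arc_gens mult.commute)
  finally have "[:0, 1:]\<^sup>2 dvd \<Lambda> ^ 3 * cox_subst cp X0 X1 [:y0, e0 * \<tau>:] [:y1, e1 * \<tau>:] F" by (rule dvd_mult)
  then have "[:0, 1:]\<^sup>2 dvd cox_subst cp X0 X1 (\<Lambda> * [:y0, e0 * \<tau>:]) (\<Lambda> * [:y1, e1 * \<tau>:]) F"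
    unfolding F_scale_y[OF cp] .
  from dvd_add[OF c1 this] have "[:0, 1:]\<^sup>2 dvd cox_subst cp X0 X1 V0 V1 F" by simp
  also have "\<dots> = (D cp X0 X1)\<^sup>2 * pencil [:a:] X0 X1 [:Y0:] [:Y1:]"
    unfolding V0_def V1_def F_W[OF cp] by (simp add: cp_def)
  finally have "[:- 0, 1:] ^ 2 dvd (D cp X0 X1)\<^sup>2 * pencil [:a:] X0 X1 [:Y0:] [:Y1:]" by simp
  then have "[:- 0, 1:] ^ 2 dvd pencil [:a:] X0 X1 [:Y0:] [:Y1:]"
  proof (rule linear_power_dvd_cancel)
    have "poly (D cp X0 X1) 0 = d" unfolding rhom_W[OF rhom_poly] cp0 X00 d_def ..
    then show "poly ((D cp X0 X1)\<^sup>2) 0 \<noteq> 0" using D0 by (simp add: d_def)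
  qed
  then have z: "poly.coeff (pencil [:a:] X0 X1 [:Y0:] [:Y1:]) i = 0" if "i < 2" for i
    using that monom_1_dvd_iff'[of 2 "pencil [:a:] X0 X1 [:Y0:] [:Y1:]"] by (simp add: monom_altdef)
  have pe: "pencil [:a:] X0 X1 [:Y0:] [:Y1:] = X0 * [:Y0\<^sup>2 * (Y1 - Y0):] - X1 * [:Y1\<^sup>2 * (Y1 - a * Y0) + Y0\<^sup>2 * (Y1 - Y0):]"
    unfolding pencil_def by (simp add: power2_eq_square mult_ac)
  \<comment> \<open>With \<open>Y\<close> fixed the pencil is linear in the parameter, and its two
    coefficients give both cubic forms at \<open>Y\<close>.\<close>
  have "Y0\<^sup>2 * (Y1 - Y0) = 0 \<and> Y1\<^sup>2 * (Y1 - a * Y0) + Y0\<^sup>2 * (Y1 - Y0) = 0"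
    using z[unfolded pe, of 0] z[unfolded pe, of 1] P(1) unfolding X0_def X1_def by (auto split: if_splits)
  then have "Y0 = 0 \<and> Y1 = 0" using pencil_zero[OF _ _ a, of Y0 Y1] by auto
  then have "d * y0 = 0 \<and> d * y1 = 0" unfolding V00[symmetric] V0_def V1_def by (simp add: W0_def W1_def)
  then show False using D0 P(2) by (simp add: d_def)
qed

end

section \<open>The fibres through the cusps\<close>

text \<open>A truncated geometric series: a polynomial substitute for the inverse power series, as
  the normal form of the cusp is stated with polynomials.\<close>

lemma inverse_modulo_power:
  fixes \<beta> :: "'a::field poly"
  assumes "poly \<beta> 0 \<noteq> 0"
  shows "\<exists>v. [:0, 1:] ^ M dvd 1 - v * \<beta>"
proof -
  obtain b r where b: "\<beta> = pCons b r" by (cases \<beta>) auto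
  define y where "y = [:0, 1:] * Polynomial.smult (- 1 / b) r"
  define v where "v = Polynomial.smult (1 / b) (\<Sum>i<M. y ^ i)"
  have b0: "b \<noteq> 0" using assms b by simp
  have "Polynomial.smult (1 / b) \<beta> = 1 - y" using b0 by (simp add: b y_def one_pCons)
  then have "v * \<beta> = (1 - y) * (\<Sum>i<M. y ^ i)"
    unfolding v_def by (metis mult.commute mult_smult_left mult_smult_right)
  also have "\<dots> = 1 - y ^ M" by (rule one_diff_power_eq[symmetric])
  finally have "1 - v * \<beta> = y ^ M" by simp
  then have "1 - v * \<beta> = [:0, 1:] ^ M * Polynomial.smult (- 1 / b) r ^ M" unfolding y_def power_mult_distrib .
  then show ?thesis by (metis dvd_triv_left)
qed

lemma cubic_expand:
  fixes p :: "'a::comm_ring_1"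
  shows "[:p:] * [:a0, a1:] ^ 3 + [:q:] * ([:a0, a1:]\<^sup>2 * [:b0, b1:]) + [:r:] * ([:a0, a1:] * [:b0, b1:]\<^sup>2) + [:w:] * [:b0, b1:] ^ 3 =
   [:p * a0 ^ 3 + q * a0\<^sup>2 * b0 + r * a0 * b0\<^sup>2 + w * b0 ^ 3,
     3 * p * a0\<^sup>2 * a1 + q * (2 * a0 * a1 * b0 + a0\<^sup>2 * b1) + r * (a1 * b0\<^sup>2 + 2 * a0 * b0 * b1) + 3 * w * b0\<^sup>2 * b1,
     3 * p * a0 * a1\<^sup>2 + q * (a1\<^sup>2 * b0 + 2 * a0 * a1 * b1) + r * (2 * a1 * b0 * b1 + a0 * b1\<^sup>2) + 3 * w * b0 * b1\<^sup>2,
     p * a1 ^ 3 + q * a1\<^sup>2 * b1 + r * a1 * b1\<^sup>2 + w * b1 ^ 3:]"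
  by (simp add: power2_eq_square power3_eq_cube algebra_simps)

lemma rhom_pcompose: "rhom (\<lambda>p. pcompose p r)" for r :: "'a::comm_ring_1 poly"
  by (simp add: rhom_def pcompose_1 pcompose_add pcompose_mult)

context cusp_curve
begin

definition s :: "nat \<Rightarrow> complex poly" where "s j = [:- z j, 1:]"

text \<open>A basis of the rank two bundle near the fibre over \<open>z j\<close>: the first vector points to the cusp.\<close>

definition wp0 :: "nat \<Rightarrow> complex poly" where "wp0 j = N00 * [:T0 j:] + N01 * [:T1 j:]"
definition wp1 :: "nat \<Rightarrow> complex poly" where "wp1 j = N10 * [:T0 j:] + N11 * [:T1 j:]"
definition om0 :: "nat \<Rightarrow> complex poly" where "om0 j = (N00 + N01 * cb j) div s j ^ n j"
definition om1 :: "nat \<Rightarrow> complex poly" where "om1 j = (N10 + N11 * cb j) div s j ^ n j"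
definition uu :: "nat \<Rightarrow> complex poly" where "uu j = (N00 * N11 - N01 * N10) div s j ^ n j"
definition g30 :: "nat \<Rightarrow> complex poly" where
  "g30 j = [:- ((T1 j)\<^sup>2 * (T1 j - a * T0 j) + (T0 j)\<^sup>2 * (T1 j - T0 j)):]"
definition g21 :: "nat \<Rightarrow> complex poly" where "g21 j = pol [:a:] 1 [:0, 1:] [:T0 j:] [:T1 j:] 1 (cb j) div s j"
definition g12 :: "nat \<Rightarrow> complex poly" where "g12 j = pol [:a:] 1 [:0, 1:] 1 (cb j) [:T0 j:] [:T1 j:]"
definition g03 :: "nat \<Rightarrow> complex poly" where "g03 j = pencil [:a:] 1 [:0, 1:] 1 (cb j) div s j ^ n j"

lemma om: assumes "j < 4" shows "N00 + N01 * cb j = s j ^ n j * om0 j" "N10 + N11 * cb j = s j ^ n j * om1 j"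
    "pencil [:a:] 1 [:0, 1:] 1 (cb j) = s j ^ n j * g03 j"
  unfolding om0_def om1_def g03_def s_def using c_row0 c_row1 c_pencil assms by simp_all

lemma uu: assumes "j < 4" shows "N00 * N11 - N01 * N10 = s j ^ n j * uu j" "poly (uu j) (z j) \<noteq> 0"
proof -
  define p where "p = Polynomial.smult \<delta> (\<Prod>i\<in>{..<4} - {j}. [:- z i, 1:] ^ n i)"
  have "N00 * N11 - N01 * N10 = s j ^ n j * p"
    unfolding det p_def s_def using assms by (subst prod.remove[of _ j]) auto
  moreover then have "uu j = p" unfolding uu_def by (simp add: s_def)
  moreover have "poly p (z j) \<noteq> 0"
    using \<delta> z_inj[of _ j] assms by (auto simp: p_def poly_prod poly_power prod_zero_iff)
  ultimately show "N00 * N11 - N01 * N10 = s j ^ n j * uu j" "poly (uu j) (z j) \<noteq> 0" by simp_all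
qed

text \<open>Over \<open>z j\<close> the double root is \<open>T\<close> and the simple root
  \<open>q\<close>, so in the basis \<open>T\<close>, \<open>(1, q)\<close> the cubic consists of
  the single term \<open>x y^2\<close>; its coefficient is nonzero as \<open>T\<close> and
  \<open>q\<close> differ.\<close>

lemma ram_pol:
  assumes j: "j < 4"
  shows "pencil a 1 (z j) (T0 j) (T1 j) = 0" "pol a 1 (z j) (T0 j) (T1 j) 1 (q j) = 0" "pol a 1 (z j) 1 (q j) (T0 j) (T1 j) \<noteq> 0"
proof -
  show t: "pencil a 1 (z j) (T0 j) (T1 j) = 0" using ram[OF j] by (simp add: mult.commute)
  have q: "pencil a 1 (z j) 1 (q j) = 0" using ram[OF j] by simp
  define E where "E = \<kappa> j * (q j * T0 j - T1 j)\<^sup>2 * (T1 j - q j * T0 j)"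
  have e: "\<kappa> j * ((x * T1 j + y * q j) * T0 j - (x * T0 j + y * 1) * T1 j)\<^sup>2 * ((x * T1 j + y * q j) - q j * (x * T0 j + y * 1))
     = x * y\<^sup>2 * E" for x y
    by (simp add: E_def power2_eq_square algebra_simps)
  have p: "pol a 1 (z j) (T0 j) (T1 j) 1 (q j) * (x\<^sup>2 * y) + pol a 1 (z j) 1 (q j) (T0 j) (T1 j) * (x * y\<^sup>2) = x * y\<^sup>2 * E" for x y
    using pencil_polarise[of a 1 "z j" x "T0 j" y 1 "T1 j" "q j"] unfolding ram[OF j] e t q by simp
  from p[of 1 1] p[of 1 "-1"] have "pol a 1 (z j) (T0 j) (T1 j) 1 (q j) = 0" "pol a 1 (z j) 1 (q j) (T0 j) (T1 j) = E" by auto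
  moreover have "E \<noteq> 0" using \<kappa>[OF j] unram[OF j] by (auto simp: E_def)
  ultimately show "pol a 1 (z j) (T0 j) (T1 j) 1 (q j) = 0" "pol a 1 (z j) 1 (q j) (T0 j) (T1 j) \<noteq> 0" by auto
qed

lemma g_props:
  assumes j: "j < 4"
  shows "pencil [:a:] 1 [:0, 1:] [:T0 j:] [:T1 j:] = s j * g30 j" "poly (g30 j) x \<noteq> 0"
    "pol [:a:] 1 [:0, 1:] [:T0 j:] [:T1 j:] 1 (cb j) = s j * g21 j" "poly (g12 j) (z j) \<noteq> 0"
proof -
  define P Q where "P = (T0 j)\<^sup>2 * (T1 j - T0 j)" and "Q = (T1 j)\<^sup>2 * (T1 j - a * T0 j) + (T0 j)\<^sup>2 * (T1 j - T0 j)"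
  have PQ: "P = z j * Q" using ram_pol(1)[OF j] by (simp add: pencil_def P_def Q_def)
  have "Q \<noteq> 0"
  proof
    assume "Q = 0"
    then have "P = 0" using PQ by simp
    then have "(T1 j)\<^sup>2 * (T1 j - a * T0 j) = 0" using \<open>Q = 0\<close> by (simp only: P_def Q_def add_0_right)
    then have "T0 j = 0 \<and> T1 j = 0" using \<open>P = 0\<close> unfolding P_def by (intro pencil_zero[OF _ _ a])
    then show False using unram[OF j] by simp
  qed
  have g: "g30 j = [:- Q:]" unfolding g30_def Q_def ..
  show "poly (g30 j) x \<noteq> 0" using \<open>Q \<noteq> 0\<close> by (simp add: g)
  have "pencil [:a:] 1 [:0, 1:] [:T0 j:] [:T1 j:] = [:P:] - [:0, 1:] * [:Q:]"
    unfolding pencil_def P_def Q_def by (simp add: power2_eq_square mult_ac)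
  also have "\<dots> = s j * g30 j" unfolding PQ g s_def by (simp add: mult.commute)
  finally show "pencil [:a:] 1 [:0, 1:] [:T0 j:] [:T1 j:] = s j * g30 j" .
  have "poly (pol [:a:] 1 [:0, 1:] [:T0 j:] [:T1 j:] 1 (cb j)) (z j) = 0"
    using ram_pol(2)[OF j] c[OF j] by (simp add: rhom_pol[OF rhom_poly])
  then show "pol [:a:] 1 [:0, 1:] [:T0 j:] [:T1 j:] 1 (cb j) = s j * g21 j"
    unfolding g21_def s_def poly_eq_0_iff_dvd by (rule dvd_mult_div_cancel[symmetric])
  show "poly (g12 j) (z j) \<noteq> 0"
    using ram_pol(3)[OF j] c[OF j] by (simp add: g12_def rhom_pol[OF rhom_poly])
qed

text \<open>\<open>N\<close> maps \<open>T\<close> and \<open>(1, c)\<close> to \<open>wp\<close>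
  and \<open>s ^ n om\<close>. The power of \<open>s\<close> in the determinant of \<open>N\<close>
  cancels, leaving \<open>uu (T0 c - T1)\<close>, which is nonzero at \<open>z j\<close> because
  \<open>q\<close> is unramified.\<close>

lemma basis_det:
  assumes j: "j < 4"
  shows "poly (wp0 j * om1 j - wp1 j * om0 j) (z j) \<noteq> 0"
proof -
  have "s j ^ n j * (wp0 j * om1 j - wp1 j * om0 j) = wp0 j * (s j ^ n j * om1 j) - wp1 j * (s j ^ n j * om0 j)"
    by (simp only: right_diff_distrib mult_ac)
  also have "\<dots> = (N00 * N11 - N01 * N10) * ([:T0 j:] * cb j - [:T1 j:])"
    unfolding om(1,2)[OF j, symmetric] wp0_def wp1_def
  proof -
    have "(a * t + b * u) * (c + d * x) - (c * t + d * u) * (a + b * x) = (a * d - b * c) * (t * x - u)" for a b c d t u x :: "complex poly"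
      by (simp add: algebra_simps)
    then show "(N00 * [:T0 j:] + N01 * [:T1 j:]) * (N10 + N11 * cb j) - (N10 * [:T0 j:] + N11 * [:T1 j:]) * (N00 + N01 * cb j) =
      (N00 * N11 - N01 * N10) * ([:T0 j:] * cb j - [:T1 j:])" .
  qed
  also have "\<dots> = s j ^ n j * (uu j * ([:T0 j:] * cb j - [:T1 j:]))" unfolding uu(1)[OF j] by (simp only: mult_ac)
  finally have "wp0 j * om1 j - wp1 j * om0 j = uu j * ([:T0 j:] * cb j - [:T1 j:])"
    by (subst (asm) mult_cancel_left) (simp add: s_def)
  then show ?thesis using uu(2)[OF j] unram[OF j] c[OF j] by (simp add: mult.commute)
qed

text \<open>With \<open>S = s ^ n\<close>, the vector \<open>S (x wp + y om)\<close> is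
  \<open>N\<close> applied to \<open>S x T + y (1, c)\<close>. Polarising the pencil there and
  dividing by \<open>S ^ 3\<close> yields the exponents \<open>2 n + 1\<close> and
  \<open>n + 1\<close>: with \<open>x = 1\<close> this is the equation of the cusp.\<close>

lemma F_basis:
  fixes f :: "complex poly \<Rightarrow> 'r::idom"
  assumes j: "j < 4" and f: "rhom f" and fs: "f (s j) \<noteq> 0"
  shows "cox_subst (\<lambda>x. f [:x:]) 1 (f [:0, 1:]) (x * f (wp0 j) + y * f (om0 j)) (x * f (wp1 j) + y * f (om1 j)) F =
    (f (uu j))\<^sup>2 * (f (s j) ^ (2 * n j + 1) * f (g30 j) * x ^ 3 + f (s j) ^ (n j + 1) * f (g21 j) * (x\<^sup>2 * y)
      + f (g12 j) * (x * y\<^sup>2) + f (g03 j) * y ^ 3)"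
proof -
  define S where "S = f (s j) ^ n j"
  define f' where "f' x = f [:x:]" for x
  have f': "rhom f'" unfolding f'_def[abs_def] by (rule rhom_comp[OF rhom_const_poly[OF rhom_id(2)] f])
  have h1: "hmg f' d p 1 (f [:0, 1:]) = f p" if "degree p \<le> d" for d p
    unfolding f'_def[abs_def] by (rule hmg_1[OF f that])
  have W: "W0 f' 1 (f [:0, 1:]) Y0 Y1 = f N00 * Y0 + f N01 * Y1" "W1 f' 1 (f [:0, 1:]) Y0 Y1 = f N10 * Y0 + f N11 * Y1" for Y0 Y1
    unfolding W0_def W1_def using degN by (simp_all add: h1)
  have D': "D f' 1 (f [:0, 1:]) = S * f (uu j)"
    unfolding D_def S_def using degN uu(1)[OF j, THEN arg_cong[of _ _ f]] by (simp add: h1 rhom_simps[OF f])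
  have sc: "S * (x * f (wp0 j) + y * f (om0 j)) = W0 f' 1 (f [:0, 1:]) (S * x * f [:T0 j:] + y * 1) (S * x * f [:T1 j:] + y * f (cb j))"
    "S * (x * f (wp1 j) + y * f (om1 j)) = W1 f' 1 (f [:0, 1:]) (S * x * f [:T0 j:] + y * 1) (S * x * f [:T1 j:] + y * f (cb j))"
  proof -
    have e: "S * f (om0 j) = f N00 + f N01 * f (cb j)" "S * f (om1 j) = f N10 + f N11 * f (cb j)"
      unfolding S_def using om(1,2)[OF j, THEN arg_cong[of _ _ f]] by (simp_all add: rhom_simps[OF f])
    have "S * (x * w + y * o') = S * x * w + y * (S * o')" for w o' by (simp add: algebra_simps)
    note sc = this
    show "S * (x * f (wp0 j) + y * f (om0 j)) = W0 f' 1 (f [:0, 1:]) (S * x * f [:T0 j:] + y * 1) (S * x * f [:T1 j:] + y * f (cb j))"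
      "S * (x * f (wp1 j) + y * f (om1 j)) = W1 f' 1 (f [:0, 1:]) (S * x * f [:T0 j:] + y * 1) (S * x * f [:T1 j:] + y * f (cb j))"
      unfolding W wp0_def wp1_def by (simp_all only: sc e rhom_add[OF f] rhom_mult[OF f]) (simp_all add: algebra_simps)
  qed
  have p1: "f (pencil [:a:] 1 [:0, 1:] [:T0 j:] [:T1 j:]) = pencil (f' a) 1 (f [:0, 1:]) (f [:T0 j:]) (f [:T1 j:])"
    "f (pol [:a:] 1 [:0, 1:] [:T0 j:] [:T1 j:] 1 (cb j)) = pol (f' a) 1 (f [:0, 1:]) (f [:T0 j:]) (f [:T1 j:]) 1 (f (cb j))"
    "f (g12 j) = pol (f' a) 1 (f [:0, 1:]) 1 (f (cb j)) (f [:T0 j:]) (f [:T1 j:])"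
    "f (pencil [:a:] 1 [:0, 1:] 1 (cb j)) = pencil (f' a) 1 (f [:0, 1:]) 1 (f (cb j))"
    by (simp_all add: rhom_pencil[OF f] rhom_pol[OF f] g12_def f'_def rhom_1[OF f])
  have "S ^ 3 * cox_subst f' 1 (f [:0, 1:]) (x * f (wp0 j) + y * f (om0 j)) (x * f (wp1 j) + y * f (om1 j)) F =
    (S * f (uu j))\<^sup>2 * pencil (f' a) 1 (f [:0, 1:]) (S * x * f [:T0 j:] + y * 1) (S * x * f [:T1 j:] + y * f (cb j))"
    unfolding F_scale_y[OF f', symmetric] sc F_W[OF f'] D' ..
  also have "pencil (f' a) 1 (f [:0, 1:]) (S * x * f [:T0 j:] + y * 1) (S * x * f [:T1 j:] + y * f (cb j)) =
     f (s j) * f (g30 j) * (S * x) ^ 3 + f (s j) * f (g21 j) * ((S * x)\<^sup>2 * y) + f (g12 j) * (S * x * y\<^sup>2) + S * f (g03 j) * y ^ 3"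
    unfolding pencil_polarise p1(1,2,4)[symmetric] p1(3)[symmetric] g_props(1,3)[OF j] om(3)[OF j] S_def by (simp add: rhom_simps[OF f])
  also have "(S * f (uu j))\<^sup>2 * (f (s j) * f (g30 j) * (S * x) ^ 3 + f (s j) * f (g21 j) * ((S * x)\<^sup>2 * y) + f (g12 j) * (S * x * y\<^sup>2) + S * f (g03 j) * y ^ 3)
    = S ^ 3 * ((f (uu j))\<^sup>2 * (f (s j) * S\<^sup>2 * f (g30 j) * x ^ 3 + f (s j) * S * f (g21 j) * (x\<^sup>2 * y) + f (g12 j) * (x * y\<^sup>2) + f (g03 j) * y ^ 3))"
    by (simp add: power2_eq_square power3_eq_cube algebra_simps)
  finally have "cox_subst f' 1 (f [:0, 1:]) (x * f (wp0 j) + y * f (om0 j)) (x * f (wp1 j) + y * f (om1 j)) F =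
    (f (uu j))\<^sup>2 * (f (s j) * S\<^sup>2 * f (g30 j) * x ^ 3 + f (s j) * S * f (g21 j) * (x\<^sup>2 * y) + f (g12 j) * (x * y\<^sup>2) + f (g03 j) * y ^ 3)"
    using fs by (subst (asm) mult_cancel_left) (simp add: S_def)
  moreover have "f (s j) * S\<^sup>2 = f (s j) ^ (2 * n j + 1)" "f (s j) * S = f (s j) ^ (n j + 1)"
    by (simp_all add: S_def power_mult[symmetric] mult.commute)
  ultimately show ?thesis by (simp only: f'_def[abs_def])
qed

section \<open>The curve on a critical fibre and its local equation at the cusp\<close>

definition wz0 :: "nat \<Rightarrow> complex" where "wz0 j = poly (wp0 j) (z j)"
definition wz1 :: "nat \<Rightarrow> complex" where "wz1 j = poly (wp1 j) (z j)"
definition oz0 :: "nat \<Rightarrow> complex" where "oz0 j = poly (om0 j) (z j)"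
definition oz1 :: "nat \<Rightarrow> complex" where "oz1 j = poly (om1 j) (z j)"

lemma z_det: "j < 4 \<Longrightarrow> wz0 j * oz1 j - wz1 j * oz0 j \<noteq> 0"
  using basis_det[of j] by (simp add: wz0_def wz1_def oz0_def oz1_def)

lemma F_fibre:
  assumes j: "j < 4"
  shows "cox_subst (\<lambda>c. [:c:]) 1 [:z j:] (x * [:wz0 j:] + y * [:oz0 j:]) (x * [:wz1 j:] + y * [:oz1 j:]) F =
    [:poly (uu j) (z j):]\<^sup>2 * (y\<^sup>2 * ([:poly (g12 j) (z j):] * x + [:poly (g03 j) (z j):] * y))"
proof -
  \<comment> \<open>\<open>F_basis\<close> needs \<open>s j\<close> to be nonzero, so it is applied
    with \<open>z\<close> still variable, and only then \<open>g\<close> sets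
    \<open>z = z j\<close>.\<close>
  define f where "f p = [:p:]" for p :: "complex poly"
  have f: "rhom f" unfolding f_def[abs_def] by (rule rhom_const_poly) simp
  have fs: "f (s j) \<noteq> 0" by (simp add: f_def s_def)
  define g where "g = map_poly (\<lambda>p. poly p (z j))"
  have g: "rhom g" unfolding g_def by (intro rhom_map_poly rhom_poly)
  define x' where "x' = map_poly (\<lambda>c. [:c:]) x" define y' where "y' = map_poly (\<lambda>c. [:c:]) y"
  have xy: "g x' = x" "g y' = y" unfolding g_def x'_def y'_def by (simp_all add: map_poly_map_poly o_def)
  have gf: "g (f p) = [:poly p (z j):]" for p by (simp add: g_def f_def map_poly_pCons)
  have s0: "poly (s j) (z j) = 0" by (simp add: s_def)
  from arg_cong[OF F_basis[OF j f fs, of x' y'], of g]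
  have "cox_subst (\<lambda>c. [:c:]) 1 [:z j:] (x * [:wz0 j:] + y * [:oz0 j:]) (x * [:wz1 j:] + y * [:oz1 j:]) F =
    [:poly (uu j) (z j):]\<^sup>2 * ([:poly (g12 j) (z j):] * (x * y\<^sup>2) + [:poly (g03 j) (z j):] * y ^ 3)"
    unfolding rhom_cox_subst_comp[OF rhom_comp[OF rhom_const_poly[OF rhom_id(2)] f] g] rhom_simps[OF g] gf xy
    by (simp add: s0 wz0_def wz1_def oz0_def oz1_def)
  then show ?thesis by (simp add: power2_eq_square power3_eq_cube algebra_simps)
qed

lemma F_fibre_nonzero:
  assumes j: "j < 4" shows "\<exists>y0 y1. cox_subst (\<lambda>x. x) 1 (z j) y0 y1 F \<noteq> 0"
proof -
  define x where "x = (1 - poly (g03 j) (z j)) / poly (g12 j) (z j)"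
  have "x * poly (g12 j) (z j) + poly (g03 j) (z j) = 1" using g_props(4)[OF j] by (simp add: x_def)
  with arg_cong[OF F_fibre[OF j, of "[:x:]" 1], of "\<lambda>p. poly p 0"] uu(2)[OF j]
  have "cox_subst (\<lambda>x. x) 1 (z j) (wz0 j * x + oz0 j) (wz1 j * x + oz1 j) F \<noteq> 0"
    unfolding rhom_cox_subst_comp[OF rhom_const_poly[OF rhom_id(2)] rhom_poly] by simp
  then show ?thesis by blast
qed

text \<open>The fibre meets the curve twice at \<open>y = 0\<close> and once elsewhere, the latter
  since \<open>g12\<close> is nonzero at \<open>z j\<close>. A singular point must be a multiple
  zero of the equation restricted to the fibre, so it is the cusp.\<close>

lemma singular_on_fibre:
  assumes j: "j < 4" and x: "x0 \<noteq> 0" "x1 = z j * x0" and y: "(y0, y1) \<noteq> (0, 0)"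
    and m: "2 \<le> local_mult (local_equation F (x0, x1, y0, y1))"
  shows "\<exists>\<mu>. y0 = \<mu> * x0 ^ h * wz0 j \<and> y1 = \<mu> * wz1 j"
proof -
  note L = local_mult_ge_2D[OF m]
  obtain e0 e1 where e: "y0 * e1 - y1 * e0 \<noteq> 0" and le: "local_equation F (x0, x1, y0, y1) =
      cox_subst cst (cst x0) (cst x1 + var_s) (cst y0 + cst e0 * var_t) (cst y1 + cst e1 * var_t) F"
    using local_equation_F[of x0 x1 y0 y1] x y by auto
  define cp where "cp = (\<lambda>c::complex. [:c:])"
  have cp: "rhom cp" unfolding cp_def by (intro rhom_const_poly rhom_id)
  define b0 where "b0 = [:y0 / x0 ^ h, e0 / x0 ^ h:]" define b1 where "b1 = [:y1, e1:]"
  define G where "G = cox_subst cp 1 [:z j:] b0 b1 F"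
  have "[:0, 1:]\<^sup>2 dvd arc 0 [:0, 1:] (local_equation F (x0, x1, y0, y1))"
    by (rule arc_singular[OF L]) simp_all
  also have "arc 0 [:0, 1:] (local_equation F (x0, x1, y0, y1)) = cox_subst cp [:x0:] [:x1:] [:y0, e0:] [:y1, e1:] F"
    unfolding le rhom_cox_subst_comp[OF rhom_cst rhom_arc] cp_def
    by (simp add: rhom_simps[OF rhom_arc] arc_gens)
  also have "\<dots> = cox_subst cp ([:x0:] * 1) ([:x0:] * [:z j:]) (1 * [:x0:] ^ h * b0) (1 * b1) F"
  proof -
    have "[:x0:] ^ h = [:x0 ^ h:]" by (induct h) (simp_all add: one_pCons)
    then show ?thesis using x by (simp add: b0_def b1_def mult.commute)
  qed
  also have "\<dots> = [:x0:] ^ nat (int k + 1 - int h + int h * 3) * G"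
    unfolding G_def bihomogeneous_scale[OF bihomogeneous_F cp] by simp
  finally have "[:- 0, 1:] ^ 2 dvd [:x0:] ^ nat (int k + 1 - int h + int h * 3) * G" by simp
  then have G2: "[:- 0, 1:] ^ 2 dvd G" by (rule linear_power_dvd_cancel) (simp add: poly_power x)
  define \<Delta> where "\<Delta> = wz0 j * oz1 j - wz1 j * oz0 j"
  have \<Delta>: "\<Delta> \<noteq> 0" using z_det[OF j] by (simp add: \<Delta>_def)
  define \<alpha> where "\<alpha> = Polynomial.smult (1 / \<Delta>) (Polynomial.smult (oz1 j) b0 - Polynomial.smult (oz0 j) b1)"
  define \<beta> where "\<beta> = Polynomial.smult (1 / \<Delta>) (Polynomial.smult (wz0 j) b1 - Polynomial.smult (wz1 j) b0)"
  have b: "b0 = \<alpha> * [:wz0 j:] + \<beta> * [:oz0 j:]" "b1 = \<alpha> * [:wz1 j:] + \<beta> * [:oz1 j:]"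
  proof -
    have "(o1 * x - o0 * y) / \<Delta> * w0 + (w0 * y - w1 * x) / \<Delta> * o0 = x" "(o1 * x - o0 * y) / \<Delta> * w1 + (w0 * y - w1 * x) / \<Delta> * o1 = y"
      if "w0 * o1 - w1 * o0 = \<Delta>" for w0 w1 o0 o1 x y
    proof -
      have "(o1 * x - o0 * y) / \<Delta> * w0 + (w0 * y - w1 * x) / \<Delta> * o0 = (w0 * o1 - w1 * o0) * x / \<Delta>"
        "(o1 * x - o0 * y) / \<Delta> * w1 + (w0 * y - w1 * x) / \<Delta> * o1 = (w0 * o1 - w1 * o0) * y / \<Delta>"
        by (simp_all add: add_divide_distrib[symmetric] algebra_simps)
      then show "(o1 * x - o0 * y) / \<Delta> * w0 + (w0 * y - w1 * x) / \<Delta> * o0 = x" "(o1 * x - o0 * y) / \<Delta> * w1 + (w0 * y - w1 * x) / \<Delta> * o1 = y"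
        using \<Delta> by (simp_all add: that)
    qed
    note e = this[OF \<Delta>_def[symmetric]]
    have c: "poly.coeff (p * [:w:] + p' * [:w':]) i = poly.coeff p i * w + poly.coeff p' i * w'" for p p' w w' i
      by (simp add: mult.commute)
    have ab: "poly.coeff \<alpha> i = (oz1 j * poly.coeff b0 i - oz0 j * poly.coeff b1 i) / \<Delta>"
      "poly.coeff \<beta> i = (wz0 j * poly.coeff b1 i - wz1 j * poly.coeff b0 i) / \<Delta>" for i
      by (simp_all add: \<alpha>_def \<beta>_def)
    show "b0 = \<alpha> * [:wz0 j:] + \<beta> * [:oz0 j:]" "b1 = \<alpha> * [:wz1 j:] + \<beta> * [:oz1 j:]"
      by (rule poly_eqI, simp only: c ab e)+
  qed
  define r where "r = poly (g12 j) (z j)" define w where "w = poly (g03 j) (z j)"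
  have r: "r \<noteq> 0" using g_props(4)[OF j] by (simp add: r_def)
  have G: "G = ([:poly (uu j) (z j):]\<^sup>2 * \<beta>\<^sup>2) * ([:r:] * \<alpha> + [:w:] * \<beta>)"
    unfolding G_def cp_def b F_fibre[OF j] r_def w_def by (simp only: mult.assoc)
  have ab: "poly.coeff \<alpha> i = (oz1 j * poly.coeff b0 i - oz0 j * poly.coeff b1 i) / \<Delta>"
    "poly.coeff \<beta> i = (wz0 j * poly.coeff b1 i - wz1 j * poly.coeff b0 i) / \<Delta>" for i
    by (simp_all add: \<alpha>_def \<beta>_def)
  have "poly \<beta> 0 = 0"
  proof (rule ccontr)
    assume nz: "poly \<beta> 0 \<noteq> 0"
    \<comment> \<open>\<open>\<alpha>\<close> and \<open>\<beta>\<close> are linear in the fibre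
      coordinate. If their combination vanished to order two, they would be proportional, although
      \<open>(e0, e1)\<close> is transversal to \<open>(y0, y1)\<close>.\<close>
    have "[:- 0, 1:] ^ 2 dvd [:r:] * \<alpha> + [:w:] * \<beta>"
      using G2 unfolding G by (rule linear_power_dvd_cancel) (use nz uu(2)[OF j] in \<open>simp add: poly_power\<close>)
    then have "poly.coeff ([:r:] * \<alpha> + [:w:] * \<beta>) i = 0" if "i < 2" for i
      using that monom_1_dvd_iff'[of 2 "[:r:] * \<alpha> + [:w:] * \<beta>"] by (simp add: monom_altdef)
    from this[of 0] this[of 1] have rw: "r * poly.coeff \<alpha> 0 = - (w * poly.coeff \<beta> 0)" "r * poly.coeff \<alpha> 1 = - (w * poly.coeff \<beta> 1)"
      by (simp_all add: eq_neg_iff_add_eq_0)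
    have "r * (poly.coeff \<alpha> 0 * poly.coeff \<beta> 1 - poly.coeff \<alpha> 1 * poly.coeff \<beta> 0) = 0"
    proof -
      have rd: "r * (A * B' - C * E) = (r * A) * B' - (r * C) * E" for A B' C E by (simp add: algebra_simps)
      show ?thesis unfolding rd rw by simp
    qed
    then have "poly.coeff \<alpha> 0 * poly.coeff \<beta> 1 - poly.coeff \<alpha> 1 * poly.coeff \<beta> 0 = 0" using r by simp
    moreover have "\<Delta> * \<Delta> * (poly.coeff \<alpha> 0 * poly.coeff \<beta> 1 - poly.coeff \<alpha> 1 * poly.coeff \<beta> 0) =
       \<Delta> * ((y0 * e1 - y1 * e0) / x0 ^ h)"
    proof -
      have "\<Delta> * \<Delta> * (A / \<Delta> * (B / \<Delta>) - C / \<Delta> * (E / \<Delta>)) = A * B - C * E" for A B C E using \<Delta> by (simp add: field_simps)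
      then show ?thesis unfolding ab using x by (simp add: b0_def b1_def) (simp add: \<Delta>_def field_simps)
    qed
    ultimately show False using e \<Delta> x by simp
  qed
  then have "poly b0 0 = poly \<alpha> 0 * wz0 j" "poly b1 0 = poly \<alpha> 0 * wz1 j" unfolding b by simp_all
  then have "y0 / x0 ^ h = poly \<alpha> 0 * wz0 j" "y1 = poly \<alpha> 0 * wz1 j" by (simp_all add: b0_def b1_def)
  then show ?thesis using x by (intro exI[of _ "poly \<alpha> 0"]) (simp add: field_simps)
qed

text \<open>\<open>F_basis\<close> has the shape of \<open>cusp_form\<close> in terms of
  \<open>y\<close>, whereas the chart moves along \<open>(e0, e1)\<close>. Shifting the chart
  coordinate by the polynomial \<open>\<gamma>\<close>, an approximation of
  \<open>- \<alpha> / \<beta>\<close>, makes \<open>y\<close> equal to \<open>\<beta> T\<close> up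
  to a negligible error.\<close>

lemma cusp_form_local:
  assumes j: "j < 4" shows "cusp_form (n j) (local_equation F (1, z j, wz0 j, wz1 j))"
proof -
  have "(wz0 j, wz1 j) \<noteq> (0, 0)" using z_det[OF j] by auto
  then obtain e0 e1 where e: "wz0 j * e1 - wz1 j * e0 \<noteq> 0" and le: "local_equation F (1, z j, wz0 j, wz1 j) =
      cox_subst cst (cst 1) (cst (z j) + var_s) (cst (wz0 j) + cst e0 * var_t) (cst (wz1 j) + cst e1 * var_t) F"
    using local_equation_F[of 1 "z j" "wz0 j" "wz1 j"] by auto
  define sh where "sh p = pcompose p [:z j, 1:]" for p
  have sh: "rhom sh" unfolding sh_def[abs_def] by (rule rhom_pcompose)
  have sh0: "poly (sh p) 0 = poly p (z j)" for p by (simp add: sh_def poly_pcompose)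
  define f where "f p = [:sh p:]" for p
  have f: "rhom f" unfolding f_def[abs_def] by (rule rhom_const_poly[OF sh])
  have shs: "sh (s j) = [:0, 1:]" by (simp add: sh_def s_def pcompose_pCons)
  have fs: "f (s j) \<noteq> 0" by (simp add: f_def shs)
  have shc: "sh [:x:] = [:x:]" "sh [:0, 1:] = [:z j, 1:]" for x by (simp_all add: sh_def pcompose_pCons)
  \<comment> \<open>An error of this order is beyond \<open>s ^ (2 n + 1)\<close>, so it does not
    affect the leading coefficient of the first term or the divisibility of the second.\<close>
  define M where "M = 2 * n j + 2"
  define \<alpha> where "\<alpha> = sh (wp0 j) * [:wz1 j:] - sh (wp1 j) * [:wz0 j:]"
  define \<beta> where "\<beta> = sh (wp0 j) * [:e1:] - sh (wp1 j) * [:e0:]"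
  have \<alpha>0: "poly \<alpha> 0 = 0" by (simp add: \<alpha>_def sh0 wz0_def wz1_def mult.commute)
  have \<beta>0: "poly \<beta> 0 \<noteq> 0" using e by (simp add: \<beta>_def sh0 wz0_def wz1_def mult.commute)
  obtain v where v: "[:0, 1:] ^ M dvd 1 - v * \<beta>" using inverse_modulo_power[OF \<beta>0] by blast
  define \<gamma> where "\<gamma> = - \<alpha> * v"
  have \<gamma>0: "poly \<gamma> 0 = 0" by (simp add: \<gamma>_def \<alpha>0)
  have "\<alpha> + \<gamma> * \<beta> = \<alpha> * (1 - v * \<beta>)" by (simp add: \<gamma>_def algebra_simps)
  then obtain \<xi> where \<xi>: "\<alpha> + \<gamma> * \<beta> = [:0, 1:] ^ M * \<xi>" using v by (metis dvd_mult dvdE)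
  define V0 where "V0 = [:[:wz0 j:] + \<gamma> * [:e0:], [:e0:]:]"
  define V1 where "V1 = [:[:wz1 j:] + \<gamma> * [:e1:], [:e1:]:]"
  define \<Delta> where "\<Delta> = sh (wp0 j * om1 j - wp1 j * om0 j)"
  have \<Delta>0: "poly \<Delta> 0 \<noteq> 0" using basis_det[OF j] by (simp add: \<Delta>_def sh0)
  define a0 where "a0 = ([:wz0 j:] + \<gamma> * [:e0:]) * sh (om1 j) - ([:wz1 j:] + \<gamma> * [:e1:]) * sh (om0 j)"
  define a1 where "a1 = [:e0:] * sh (om1 j) - [:e1:] * sh (om0 j)"
  \<comment> \<open>Coordinates of \<open>\<Delta> V\<close> in the basis \<open>wp\<close>,
    \<open>om\<close> by Cramer's rule, as linear polynomials in \<open>T\<close>.\<close>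
  define x where "x = [:a0, a1:]" define y where "y = [:[:0, 1:] ^ M * \<xi>, \<beta>:]"
  have a00: "poly a0 0 \<noteq> 0" using z_det[OF j] by (simp add: a0_def sh0 \<gamma>0 oz0_def oz1_def)
  define G where "G = cox_subst (\<lambda>c. [:[:c:]:]) 1 [:[:z j, 1:]:] V0 V1 F"
  have xy: "x * f (wp0 j) + y * f (om0 j) = [:\<Delta>:] * V0" "x * f (wp1 j) + y * f (om1 j) = [:\<Delta>:] * V1"
  proof -
    have i0: "(u * d - w * c) * a + (a * w - b * u) * c = (a * d - b * c) * u"
      "(u * d - w * c) * b + (a * w - b * u) * d = (a * d - b * c) * w" for u w a b c d :: "complex poly"
      by (simp_all add: algebra_simps)
    define W0 W1 O0 O1 where "W0 = sh (wp0 j)" and "W1 = sh (wp1 j)" and "O0 = sh (om0 j)" and "O1 = sh (om1 j)"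
    have D': "\<Delta> = W0 * O1 - W1 * O0" by (simp add: \<Delta>_def W0_def W1_def O0_def O1_def rhom_simps[OF sh])
    have y': "y = [:W0 * ([:wz1 j:] + \<gamma> * [:e1:]) - W1 * ([:wz0 j:] + \<gamma> * [:e0:]), W0 * [:e1:] - W1 * [:e0:]:]"
      unfolding y_def \<xi>[symmetric] unfolding \<alpha>_def \<beta>_def W0_def[symmetric] W1_def[symmetric] by (simp add: algebra_simps)
    have m: "[:p1, p2:] * [:d:] + [:q1, q2:] * [:d':] = [:p1 * d + q1 * d', p2 * d + q2 * d':]"
      "[:d:] * [:p1, p2:] = [:d * p1, d * p2:]" for p1 p2 q1 q2 d d' :: "complex poly" by (simp_all add: mult.commute)
    show "x * f (wp0 j) + y * f (om0 j) = [:\<Delta>:] * V0" "x * f (wp1 j) + y * f (om1 j) = [:\<Delta>:] * V1"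
      unfolding f_def W0_def[symmetric] W1_def[symmetric] O0_def[symmetric] O1_def[symmetric] x_def y' V0_def V1_def m D'
        a0_def a1_def by (simp_all only: i0)
  qed
  define p where "p = [:0, 1:] ^ (2 * n j + 1) * sh (g30 j)"
  define q' where "q' = [:0, 1:] ^ (n j + 1) * sh (g21 j)"
  define b0 where "b0 = [:0, 1:] ^ M * \<xi>"
  define C0 where "C0 = p * a0 ^ 3 + q' * a0\<^sup>2 * b0 + sh (g12 j) * a0 * b0\<^sup>2 + sh (g03 j) * b0 ^ 3"
  define C1 where "C1 = 3 * p * a0\<^sup>2 * a1 + q' * (2 * a0 * a1 * b0 + a0\<^sup>2 * \<beta>) + sh (g12 j) * (a1 * b0\<^sup>2 + 2 * a0 * b0 * \<beta>) + 3 * sh (g03 j) * b0\<^sup>2 * \<beta>"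
  define C2 where "C2 = 3 * p * a0 * a1\<^sup>2 + q' * (a1\<^sup>2 * b0 + 2 * a0 * a1 * \<beta>) + sh (g12 j) * (2 * a1 * b0 * \<beta> + a0 * \<beta>\<^sup>2) + 3 * sh (g03 j) * b0 * \<beta>\<^sup>2"
  define C3 where "C3 = p * a1 ^ 3 + q' * a1\<^sup>2 * \<beta> + sh (g12 j) * a1 * \<beta>\<^sup>2 + sh (g03 j) * \<beta> ^ 3"
  have main: "[:\<Delta>:] ^ 3 * G = [:sh (uu j):]\<^sup>2 * [:C0, C1, C2, C3:]"
  proof -
    have r: "rhom (\<lambda>c. [:[:c::complex:]:])" by (intro rhom_const_poly rhom_id)
    have "[:\<Delta>:] ^ 3 * G = cox_subst (\<lambda>c. f [:c:]) 1 (f [:0, 1:]) (x * f (wp0 j) + y * f (om0 j)) (x * f (wp1 j) + y * f (om1 j)) F"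
      unfolding xy G_def F_scale_y[OF r, symmetric] by (simp add: f_def shc)
    also have "\<dots> = (f (uu j))\<^sup>2 * ([:p:] * x ^ 3 + [:q':] * (x\<^sup>2 * y) + [:sh (g12 j):] * (x * y\<^sup>2) + [:sh (g03 j):] * y ^ 3)"
    proof -
      have "f (s j) ^ m * f g = [:[:0, 1:] ^ m * sh g:]" for m g
      proof -
        have "f (s j) ^ m * f g = f (s j ^ m * g)" by (simp add: rhom_simps[OF f])
        then show ?thesis by (simp add: f_def rhom_simps[OF sh] shs)
      qed
      then show ?thesis unfolding F_basis[OF j f fs] p_def q'_def by (simp only: f_def)
    qed
    also have "\<dots> = [:sh (uu j):]\<^sup>2 * [:C0, C1, C2, C3:]"
      unfolding x_def y_def b0_def[symmetric] cubic_expand C0_def C1_def C2_def C3_def f_def ..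
    finally show ?thesis .
  qed
  have cp: "[:d:] ^ m = [:d ^ m:]" for d :: "complex poly" and m by (induct m) (simp_all add: one_pCons mult.commute)
  have cG: "\<Delta> ^ 3 * poly.coeff G i = (sh (uu j))\<^sup>2 * poly.coeff [:C0, C1, C2, C3:] i" for i
  proof -
    have c: "poly.coeff ([:d:] * p) i = d * poly.coeff p i" for d :: "complex poly" and p by simp
    show ?thesis using arg_cong[OF main, of "\<lambda>p. poly.coeff p i"] unfolding cp c .
  qed
  have \<Delta>n: "\<Delta> \<noteq> 0" using \<Delta>0 by auto
  have degG: "degree G \<le> 3"
  proof (rule degree_le, intro allI impI)
    fix i :: nat assume "3 < i"
    then have "poly.coeff [:C0, C1, C2, C3:] i = 0" by (intro coeff_eq_0) (auto intro: le_less_trans[OF degree_pCons_le])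
    then show "poly.coeff G i = 0" using cG[of i] \<Delta>n by simp
  qed
  \<comment> \<open>\<open>\<Delta>\<close> is only a unit at \<open>s = 0\<close>, so powers of
    \<open>s\<close> are moved across it instead of dividing by it.\<close>
  have cancel: "[:0, 1:] ^ m dvd w" if "[:0, 1:] ^ m dvd \<Delta> ^ 3 * w" for m w
    using linear_power_dvd_cancel[of 0 m "\<Delta> ^ 3" w] that \<Delta>0 by (simp add: poly_power)
  define \<Xi> where "\<Xi> = [:0, 1:] ^ (n j + 1) * sh (g21 j) * a0\<^sup>2 * \<xi> + sh (g12 j) * a0 * [:0, 1:] ^ M * \<xi>\<^sup>2 + sh (g03 j) * ([:0, 1:] ^ M)\<^sup>2 * \<xi> ^ 3"
  have XM: "[:0, 1:] ^ M = [:0, 1:] ^ (2 * n j + 1) * [:0, 1 :: complex:]" unfolding M_def by (simp only: power_add[symmetric] power_Suc2[symmetric]) simp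
  have C0: "C0 = [:0, 1:] ^ (2 * n j + 1) * (sh (g30 j) * a0 ^ 3 + [:0, 1:] * \<Xi>)"
  proof -
    define K where "K = [:0, 1 :: complex:] ^ (2 * n j + 1)"
    have "b0 = K * [:0, 1:] * \<xi>" unfolding b0_def XM K_def ..
    then show ?thesis unfolding C0_def \<Xi>_def p_def q'_def XM K_def[symmetric]
      by (simp only: power2_eq_square power3_eq_cube ring_distribs mult_ac add_ac)
  qed
  have "[:0, 1:] ^ (2 * n j + 1) dvd \<Delta> ^ 3 * poly.coeff G 0"
    unfolding cG coeff_pCons_0 C0 by (intro dvd_mult dvd_triv_left)
  then obtain g0 where g0: "poly.coeff G 0 = [:0, 1:] ^ (2 * n j + 1) * g0" using cancel by blast
  have "[:0, 1:] ^ (2 * n j + 1) * (\<Delta> ^ 3 * g0) = [:0, 1:] ^ (2 * n j + 1) * ((sh (uu j))\<^sup>2 * (sh (g30 j) * a0 ^ 3 + [:0, 1:] * \<Xi>))"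
    using cG[of 0] unfolding g0 C0 coeff_pCons_0 by (simp only: mult_ac)
  then have "\<Delta> ^ 3 * g0 = (sh (uu j))\<^sup>2 * (sh (g30 j) * a0 ^ 3 + [:0, 1:] * \<Xi>)"
    by (subst (asm) mult_cancel_left) simp
  from arg_cong[OF this, of "\<lambda>p. poly p 0"] have g00: "poly g0 0 \<noteq> 0"
    using uu(2)[OF j] g_props(2)[OF j] a00 by (auto simp: sh0 poly_power)
  have lepow: "[:0, 1:] ^ (n j + 1) dvd [:0, 1 :: complex:] ^ (2 * n j + 1)" "[:0, 1:] ^ (n j + 1) dvd b0"
    unfolding b0_def M_def by (rule le_imp_power_dvd, simp) (rule dvd_mult2[OF le_imp_power_dvd], simp)
  have "[:0, 1:] ^ (n j + 1) dvd C1"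
  proof -
    have "[:0, 1:] ^ (n j + 1) dvd p" "[:0, 1:] ^ (n j + 1) dvd q'" unfolding p_def q'_def
      by (rule dvd_mult2[OF lepow(1)], rule dvd_triv_left)
    then have "[:0, 1:] ^ (n j + 1) dvd p * (3 * a0\<^sup>2 * a1)" "[:0, 1:] ^ (n j + 1) dvd q' * (2 * a0 * a1 * b0 + a0\<^sup>2 * \<beta>)"
      "[:0, 1:] ^ (n j + 1) dvd b0 * (sh (g12 j) * (a1 * b0 + 2 * a0 * \<beta>) + 3 * sh (g03 j) * b0 * \<beta>)"
      using lepow(2) by (blast intro: dvd_mult2)+
    moreover have "C1 = p * (3 * a0\<^sup>2 * a1) + q' * (2 * a0 * a1 * b0 + a0\<^sup>2 * \<beta>) + b0 * (sh (g12 j) * (a1 * b0 + 2 * a0 * \<beta>) + 3 * sh (g03 j) * b0 * \<beta>)"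
      unfolding C1_def by (simp add: power2_eq_square algebra_simps)
    ultimately show ?thesis by (simp only: dvd_add)
  qed
  then have "[:0, 1:] ^ (n j + 1) dvd \<Delta> ^ 3 * poly.coeff G 1" unfolding cG by (simp add: dvd_mult)
  then obtain g1 where g1: "poly.coeff G 1 = [:0, 1:] ^ (n j + 1) * g1" using cancel by blast
  have z0: "poly p 0 = 0" "poly q' 0 = 0" "poly b0 0 = 0" by (simp_all add: p_def q'_def b0_def M_def)
  have "poly C2 0 = poly (g12 j) (z j) * poly a0 0 * (poly \<beta> 0)\<^sup>2"
    unfolding C2_def by (simp add: z0 sh0)
  then have "poly (\<Delta> ^ 3 * poly.coeff G 2) 0 \<noteq> 0" unfolding cG using uu(2)[OF j] g_props(4)[OF j] a00 \<beta>0
    by (simp add: poly_power sh0 numeral_2_eq_2)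
  then have g2: "poly (poly.coeff G 2) 0 \<noteq> 0" by auto
  define T where "T = var_t - emb \<gamma>"
  \<comment> \<open>Reads a polynomial in \<open>T\<close> over polynomials in \<open>s\<close> as a
    local polynomial in \<open>s, t\<close>.\<close>
  define \<chi> where "\<chi> G = poly (map_poly emb G) T" for G
  have \<chi>: "rhom \<chi>" unfolding \<chi>_def[abs_def] by (rule rhom_eval[OF rhom_emb])
  have \<chi>1: "\<chi> [:u:] = emb u" "\<chi> [:u, w:] = emb u + T * emb w" for u w
    by (simp_all add: \<chi>_def map_poly_pCons_rhom[OF rhom_emb])
  have zs: "emb [:z j, 1:] = cst (z j) + var_s" by (simp add: emb_pCons rhom_0[OF rhom_emb] rhom_1[OF rhom_cst])
  have V: "\<chi> V0 = cst (wz0 j) + cst e0 * var_t" "\<chi> V1 = cst (wz1 j) + cst e1 * var_t"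
    unfolding V0_def V1_def \<chi>1 T_def by (simp_all only: emb_simps emb_const) (simp_all add: algebra_simps)
  have "local_equation F (1, z j, wz0 j, wz1 j) = \<chi> G"
    unfolding le G_def rhom_cox_subst_comp[OF rhom_const_poly[OF rhom_const_poly[OF rhom_id(2)]] \<chi>] V
    by (simp add: \<chi>1 emb_const zs rhom_1[OF \<chi>] rhom_1[OF rhom_cst])
  also have "\<dots> = (\<Sum>i\<le>3. emb (poly.coeff G i) * T ^ i)"
    unfolding \<chi>_def by (rule poly_map_poly_bound[OF rhom_emb degG])
  also have "\<dots> = var_s ^ (2 * n j + 1) * emb g0 + var_s ^ (n j + 1) * emb g1 * T + emb (poly.coeff G 2) * T\<^sup>2 + emb (poly.coeff G 3) * T ^ 3"
    using g0 g1 by (simp add: numeral_eq_Suc atMost_Suc rhom_mult[OF rhom_emb] rhom_power[OF rhom_emb] emb_X del: power_Suc)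
  finally show ?thesis unfolding cusp_form_def T_def
    using \<gamma>0 g00 g2 unfolding poly_0_coeff_0 by blast
qed

end

section \<open>Irreducibility\<close>

text \<open>The hypotheses on \<open>\<sigma>\<close> make \<open>p\<close> a prime element.\<close>

lemma dvd_cancel_kernel:
  fixes \<sigma> :: "'a::idom \<Rightarrow> 'b::idom"
  assumes \<sigma>: "rhom \<sigma>" and p: "\<sigma> p = 0" "\<And>G. \<sigma> G = 0 \<Longrightarrow> p dvd G" "p \<noteq> 0" and f: "\<sigma> f \<noteq> 0" and d: "f dvd p * H"
  shows "f dvd H"
proof -
  obtain K where K: "p * H = f * K" using d by (elim dvdE)
  then have "\<sigma> f * \<sigma> K = 0" using p(1) by (metis rhom_mult[OF \<sigma>] mult_zero_left)
  then obtain K' where "K = p * K'" using f p(2) by (auto elim!: dvdE)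
  then have "p * H = p * (f * K')" using K by (simp add: mult_ac)
  then show ?thesis using p(3) by simp
qed

text \<open>Modulo \<open>d\<close> the substitution is the identity, so whatever it sends to 0 is
  divisible by \<open>d\<close>.\<close>

lemma cox_subst_kernel:
  assumes "d dvd cx0 - a0" "d dvd cx1 - a1" "d dvd cy0 - b0" "d dvd cy1 - b1" "cox_subst ck a0 a1 b0 b1 G = 0"
  shows "d dvd G"
  using cox_subst_cong_dvd[OF rhom_ck assms(1-4), of G] by (simp add: cox_subst_self assms(5))

lemmas cox_hom = rhom_simps[OF rhom_cox_subst] rhom_pencil[OF rhom_cox_subst] cox_subst_gens

lemma ck_eq_0_iff [simp]: "ck c = 0 \<longleftrightarrow> c = 0"
  by (simp add: ck_def)

lemma cox_gens_neq: "cy1 \<noteq> cy0" "cx1 \<noteq> ck c * cx0"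
proof -
  have "cox_subst (\<lambda>x. x) 0 1 0 1 cy1 \<noteq> cox_subst (\<lambda>x. x) 0 1 0 1 cy0"
    "cox_subst (\<lambda>x. x) 0 1 0 1 cx1 \<noteq> cox_subst (\<lambda>x. x) 0 1 0 1 (ck c * cx0)" by (simp_all add: cox_hom)
  then show "cy1 \<noteq> cy0" "cx1 \<noteq> ck c * cx0" by metis+
qed

text \<open>The equation is linear in \<open>x0\<close>, with leading coefficient \<open>p\<close>.
  Pseudo-division removes \<open>x0\<close>, and the remainder vanishes identically because
  \<open>x0\<close> can be solved for wherever \<open>p\<close> is nonzero. Finally \<open>p\<close>
  has no factor in common with the equation.\<close>

lemma pencil_nullstellensatz:
  assumes a: "a \<noteq> 1" and H: "\<And>x0 x1 Y0 Y1. pencil a x0 x1 Y0 Y1 = 0 \<Longrightarrow> Y0\<^sup>2 * (Y1 - Y0) \<noteq> 0 \<Longrightarrow> cox_subst (\<lambda>x. x) x0 x1 Y0 Y1 H = 0"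
  shows "pencil (ck a) cx0 cx1 cy0 cy1 dvd H"
proof -
  define f where "f = pencil (ck a) cx0 cx1 cy0 cy1"
  define p where "p = cy0\<^sup>2 * (cy1 - cy0)"
  define Q where "Q = cy1\<^sup>2 * (cy1 - ck a * cy0) + cy0\<^sup>2 * (cy1 - cy0)"
  have f: "f = cx0 * p - cx1 * Q" by (simp add: f_def pencil_def p_def Q_def)
  have p0: "p \<noteq> 0" using cox_gens_neq(1) by (simp add: p_def)
  \<comment> \<open>Independence of \<open>x0\<close>, expressed by values.\<close>
  define I where "I r \<longleftrightarrow> (\<forall>x0 x0' x1 y0 y1. cox_subst (\<lambda>x. x) x0 x1 y0 y1 r = cox_subst (\<lambda>x. x) x0' x1 y0 y1 r)" for r
  note hom = rhom_simps[OF rhom_cox_subst[OF rhom_id(2)]] cox_subst_gens[OF rhom_id(2)]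
  have I: "I (ck c)" "I cx1" "I cy0" "I cy1" "I u \<Longrightarrow> I v \<Longrightarrow> I (u + v)" "I u \<Longrightarrow> I v \<Longrightarrow> I (u - v)" "I u \<Longrightarrow> I v \<Longrightarrow> I (u * v)" "I u \<Longrightarrow> I (u ^ m)" for c u v m
    unfolding I_def by (simp_all add: hom) metis+
  have Ip: "I p" "I Q" unfolding p_def Q_def by (intro I)+
  have base: "\<exists>N r S. p ^ N * G = f * S + r \<and> I r" if "I G" for G
    by (rule exI[of _ 0], rule exI[of _ G], rule exI[of _ 0]) (simp add: that)
  have "\<exists>N r S. p ^ N * G = f * S + r \<and> I r" for G
  proof (induct G rule: cox_poly_induct)
    case cx0 show ?case by (rule exI[of _ 1], rule exI[of _ "cx1 * Q"], rule exI[of _ 1]) (simp add: f I Ip mult.commute)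
  next
    case (add u v)
    then obtain N r S N' r' S' where "p ^ N * u = f * S + r" "I r" "p ^ N' * v = f * S' + r'" "I r'" by blast
    then have "p ^ N' * (p ^ N * u) + p ^ N * (p ^ N' * v) = f * (p ^ N' * S + p ^ N * S') + (p ^ N' * r + p ^ N * r')" "I (p ^ N' * r + p ^ N * r')"
      by (simp_all add: algebra_simps I Ip)
    moreover have "p ^ N' * (p ^ N * u) + p ^ N * (p ^ N' * v) = p ^ (N + N') * (u + v)" by (simp add: power_add algebra_simps)
    ultimately show ?case by metis
  next
    case (mult u v)
    then obtain N r S N' r' S' where e: "p ^ N * u = f * S + r" "I r" "p ^ N' * v = f * S' + r'" "I r'" by blast
    have "p ^ (N + N') * (u * v) = (p ^ N * u) * (p ^ N' * v)" by (simp add: power_add algebra_simps)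
    also have "\<dots> = f * (S * (f * S' + r') + r * S') + r * r'" unfolding e by (simp add: algebra_simps)
    finally show ?case using e I(7) by blast
  qed (rule base, rule I)+
  then obtain N r S where e: "p ^ N * H = f * S + r" and "I r" by blast
  have "p * r = 0"
  proof (rule cox_poly_eq_0I, unfold id_def)
    fix x0 x1 y0 y1 :: complex
    define P where "P = y0\<^sup>2 * (y1 - y0)"
    define x where "x = x1 * (y1\<^sup>2 * (y1 - a * y0) + P) / P"
    have "cox_subst (\<lambda>x. x) x0 x1 y0 y1 r = 0" if "P \<noteq> 0"
    proof -
      have 0: "pencil a x x1 y0 y1 = 0" using that by (simp add: pencil_def P_def[symmetric] x_def)
      have "cox_subst (\<lambda>x. x) x x1 y0 y1 H = 0" using H[OF 0] that by (simp add: P_def)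
      then have "cox_subst (\<lambda>x. x) x x1 y0 y1 r = 0"
        using arg_cong[OF e, of "cox_subst (\<lambda>x. x) x x1 y0 y1"] 0 by (simp add: hom f_def rhom_pencil[OF rhom_cox_subst[OF rhom_id(2)]])
      then show ?thesis using \<open>I r\<close> unfolding I_def by metis
    qed
    then show "cox_subst (\<lambda>x. x) x0 x1 y0 y1 (p * r) = 0" by (cases "P = 0") (simp_all add: hom p_def P_def)
  qed
  then have d: "f dvd p ^ N * H" using p0 e by simp
  \<comment> \<open>The primes \<open>cy0\<close> and \<open>cy1 - cy0\<close> generate kernels of
    substitutions, and \<open>f\<close> survives both: the second because \<open>a\<close> is not
    1.\<close>
  have y0: "f dvd G" if "f dvd cy0 * G" for G
  proof (rule dvd_cancel_kernel[OF rhom_cox_subst[OF rhom_ck] _ _ _ _ that])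
    show "cox_subst ck cx0 cx1 0 cy1 cy0 = 0" by (simp add: cox_subst_gens rhom_ck)
    show "cox_subst ck cx0 cx1 0 cy1 f \<noteq> 0" by (simp add: f_def cox_hom rhom_ck pencil_def)
  qed (auto intro: cox_subst_kernel[of _ cx0 cx1 0 cy1])
  have y1: "f dvd G" if "f dvd (cy1 - cy0) * G" for G
  proof (rule dvd_cancel_kernel[OF rhom_cox_subst[OF rhom_ck] _ _ _ _ that])
    show "cox_subst ck cx0 cx1 cy0 cy0 (cy1 - cy0) = 0" by (simp add: cox_hom rhom_ck)
    have "cy0 - ck a * cy0 = ck (1 - a) * cy0" by (simp add: rhom_diff[OF rhom_ck] rhom_1[OF rhom_ck] algebra_simps)
    then show "cox_subst ck cx0 cx1 cy0 cy0 f \<noteq> 0" using a by (simp add: f_def cox_hom rhom_ck pencil_def)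
  qed (use cox_gens_neq(1) in \<open>auto intro: cox_subst_kernel[of _ cx0 cx1 cy0 cy0]\<close>)
  have step: "f dvd G" if "f dvd p * G" for G
  proof -
    have "p * G = cy0 * (cy0 * ((cy1 - cy0) * G))" by (simp add: p_def power2_eq_square)
    then show ?thesis using that y0 y1 by metis
  qed
  have "f dvd p ^ N * G \<Longrightarrow> f dvd G" for G
    by (induct N) (auto simp: mult.assoc dest: step)
  then show ?thesis using d f_def by blast
qed

context cusp_curve
begin

abbreviation "Dc \<equiv> D ck cx0 cx1"

text \<open>\<open>D\<close> is a product of the linear forms of the four fibres, each of which is
  prime, and \<open>F\<close> vanishes identically on none of these fibres.\<close>

lemma F_dvd_D_cancel: assumes "F dvd Dc ^ M * G" shows "F dvd G"
proof -
  define can where "can u \<longleftrightarrow> (\<forall>H. F dvd u * H \<longrightarrow> F dvd H)" for u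
  have can1: "can 1" and canm: "can u \<Longrightarrow> can v \<Longrightarrow> can (u * v)" for u v
    unfolding can_def by (simp, metis mult.assoc)
  have canp: "can u \<Longrightarrow> can (u ^ m)" for u m by (induct m) (simp_all add: can1 canm)
  have canprod: "(\<And>j. j \<in> S \<Longrightarrow> can (g j)) \<Longrightarrow> can (prod g S)" for S :: "nat set" and g
    by (induct S rule: infinite_finite_induct) (simp_all add: can1 canm)
  have c\<delta>: "can (ck \<delta>)"
  proof (unfold can_def, intro allI impI)
    fix H assume "F dvd ck \<delta> * H"
    then have "F dvd ck (1 / \<delta>) * (ck \<delta> * H)" by (rule dvd_mult)
    then show "F dvd H" using \<delta> by (simp add: mult.assoc[symmetric] rhom_mult[OF rhom_ck, symmetric] rhom_1[OF rhom_ck])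
  qed
  have cL: "can (cx1 - ck (z j) * cx0)" if j: "j < 4" for j
  proof (unfold can_def, intro allI impI)
    fix H assume "F dvd (cx1 - ck (z j) * cx0) * H"
    then show "F dvd H"
    proof (rule dvd_cancel_kernel[OF rhom_cox_subst[OF rhom_ck], rotated 4])
      show "cox_subst ck cx0 (ck (z j) * cx0) cy0 cy1 (cx1 - ck (z j) * cx0) = 0" by (simp add: cox_hom rhom_ck)
      obtain y0 y1 where y: "cox_subst (\<lambda>x. x) 1 (z j) y0 y1 F \<noteq> 0" using F_fibre_nonzero[OF j] by blast
      have "cox_subst (\<lambda>x. x) 1 0 y0 y1 (cox_subst ck cx0 (ck (z j) * cx0) cy0 cy1 F) = cox_subst (\<lambda>x. x) 1 (z j) y0 y1 F"
        by (simp add: rhom_cox_subst_comp[OF rhom_ck rhom_cox_subst] cox_hom)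
      then show "cox_subst ck cx0 (ck (z j) * cx0) cy0 cy1 F \<noteq> 0" using y by (auto simp: rhom_0[OF rhom_cox_subst])
    qed (use cox_gens_neq(2)[of "z j"] in \<open>auto intro: cox_subst_kernel[of _ cx0 "ck (z j) * cx0" cy0 cy1]\<close>)
  qed
  have "can (Dc ^ M)" unfolding D_factor[OF rhom_ck] by (intro canp canm canprod c\<delta> cL) simp
  then show ?thesis using assms unfolding can_def by blast
qed

text \<open>The parametrisation of the curve obtained from that of the pencil; \<open>l\<close> and \<open>m\<close> move the point
  in its torus orbit.\<close>

definition pt :: "(complex \<Rightarrow> 'r::comm_ring_1) \<Rightarrow> 'r \<Rightarrow> 'r \<Rightarrow> 'r \<Rightarrow> cox_poly \<Rightarrow> 'r" where
  "pt f l m t G = (let Q = t\<^sup>2 * (t - f a) + (t - 1); P = t - 1 in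
     cox_subst f (l * Q) (l * P) (m * l ^ h * W0 f Q P 1 t) (m * W1 f Q P 1 t) G)"

lemma rhom_pt: "rhom f \<Longrightarrow> rhom (pt f l m t)"
  by (simp add: pt_def[abs_def] Let_def rhom_cox_subst)

lemma pt_comp: "rhom f \<Longrightarrow> rhom g \<Longrightarrow> g (pt f l m t G) = pt (\<lambda>c. g (f c)) (g l) (g m) (g t) G"
  by (simp add: pt_def Let_def rhom_cox_subst_comp rhom_simps rhom_W)

lemma pt_scale: "rhom f \<Longrightarrow> bihomogeneous h b c G \<Longrightarrow> pt f l m t G = l ^ nat (b + int h * c) * m ^ nat c * pt f 1 1 t G"
  by (simp add: pt_def Let_def bihomogeneous_scale)

lemma pt_F: "rhom f \<Longrightarrow> pt f l m t F = 0"
proof -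
  assume f: "rhom f"
  have "pt f 1 1 t F = 0" by (simp add: pt_def Let_def F_W[OF f] pencil_def)
  then show ?thesis by (subst pt_scale[OF f bihomogeneous_F]) simp
qed

text \<open>Pulled back by \<open>W\<close>, the vanishing becomes vanishing on the pencil, hence
  divisibility by its equation; pulling back by the adjugate returns to \<open>F\<close>. Both steps
  only introduce powers of \<open>D\<close>, which can be cancelled.\<close>

lemma F_dvd_if_vanishing:
  assumes V: "\<And>l m t. pt (\<lambda>x. x) l m t G = 0"
  shows "F dvd G"
proof -
  \<comment> \<open>Clears denominators: \<open>G\<close> with \<open>y / D\<close> in place of
    \<open>y\<close>, multiplied by a power of \<open>D\<close>.\<close>
  have "\<exists>N G'. cox_subst ck cx0 cx1 (Dc * cy0) (Dc * cy1) G' = Dc ^ N * G" for G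
  proof (induct G rule: cox_poly_induct)
    case (add u v)
    then obtain N G N' G' where "cox_subst ck cx0 cx1 (Dc * cy0) (Dc * cy1) G = Dc ^ N * u" "cox_subst ck cx0 cx1 (Dc * cy0) (Dc * cy1) G' = Dc ^ N' * v" by blast
    then have "cox_subst ck cx0 cx1 (Dc * cy0) (Dc * cy1) (Dc ^ N' * G + Dc ^ N * G') = Dc ^ (N + N') * (u + v)"
      by (simp add: cox_hom rhom_ck cox_subst_W power_add algebra_simps)
    then show ?case by blast
  next
    case (mult u v)
    then obtain N G N' G' where "cox_subst ck cx0 cx1 (Dc * cy0) (Dc * cy1) G = Dc ^ N * u" "cox_subst ck cx0 cx1 (Dc * cy0) (Dc * cy1) G' = Dc ^ N' * v" by blast
    then have "cox_subst ck cx0 cx1 (Dc * cy0) (Dc * cy1) (G * G') = Dc ^ (N + N') * (u * v)"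
      by (simp add: cox_hom rhom_ck power_add algebra_simps)
    then show ?case by blast
  next
    case (ck c) show ?case by (rule exI[of _ 0], rule exI[of _ "ck c"]) (simp add: cox_hom rhom_ck)
  next
    case cx0 show ?case by (rule exI[of _ 0], rule exI[of _ cx0]) (simp add: cox_hom rhom_ck)
  next
    case cx1 show ?case by (rule exI[of _ 0], rule exI[of _ cx1]) (simp add: cox_hom rhom_ck)
  next
    case cy0 show ?case by (rule exI[of _ 1], rule exI[of _ cy0]) (simp add: cox_hom rhom_ck)
  next
    case cy1 show ?case by (rule exI[of _ 1], rule exI[of _ cy1]) (simp add: cox_hom rhom_ck)
  qed
  then obtain N G' where G': "cox_subst ck cx0 cx1 (Dc * cy0) (Dc * cy1) G' = Dc ^ N * G" by blast
  have scale: "cox_subst (\<lambda>x. x) x0 x1 (D (\<lambda>x. x) x0 x1 * u0) (D (\<lambda>x. x) x0 x1 * u1) G' =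
      D (\<lambda>x. x) x0 x1 ^ N * cox_subst (\<lambda>x. x) x0 x1 u0 u1 G" for x0 x1 u0 u1
    using arg_cong[OF G', of "cox_subst (\<lambda>x. x) x0 x1 u0 u1"]
    by (simp add: rhom_cox_subst_comp[OF rhom_ck rhom_cox_subst] cox_hom cox_subst_W)
  \<comment> \<open>The additional factor \<open>Dc\<close> covers the parameters with
    \<open>d = 0\<close>, where rescaling by \<open>m / d\<close> is impossible.\<close>
  have V': "pt (\<lambda>x. x) l m t (Dc * G') = 0" for l m t
  proof -
    define x1 where "x1 = l * (t - 1)" define x0 where "x0 = l * (t\<^sup>2 * (t - a) + (t - 1))"
    define d where "d = D (\<lambda>x. x) x0 x1"
    define w0 where "w0 = W0 (\<lambda>x. x) (t\<^sup>2 * (t - a) + (t - 1)) (t - 1) 1 t"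
    define w1 where "w1 = W1 (\<lambda>x. x) (t\<^sup>2 * (t - a) + (t - 1)) (t - 1) 1 t"
    have eqd: "d \<noteq> 0 \<Longrightarrow> d * ((m / d) * l ^ h * w0) = m * l ^ h * w0" "d \<noteq> 0 \<Longrightarrow> d * ((m / d) * w1) = m * w1" by simp_all
    have "cox_subst (\<lambda>x. x) x0 x1 ((m / d) * l ^ h * w0) ((m / d) * w1) G = 0"
      using V[of l "m / d" t] unfolding pt_def Let_def x0_def[symmetric] x1_def[symmetric] w0_def[symmetric] w1_def[symmetric] .
    then have "cox_subst (\<lambda>x. x) x0 x1 (m * l ^ h * w0) (m * w1) G' = 0" if "d \<noteq> 0"
      using scale[of x0 x1 "(m / d) * l ^ h * w0" "(m / d) * w1"] unfolding d_def[symmetric] eqd[OF that] by simp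
    then show ?thesis
      by (cases "d = 0") (simp_all add: V pt_def Let_def cox_hom cox_subst_W x0_def[symmetric] x1_def[symmetric] w0_def[symmetric] w1_def[symmetric] d_def[symmetric])
  qed
  have "fc dvd cox_subst ck cx0 cx1 (W0 ck cx0 cx1 cy0 cy1) (W1 ck cx0 cx1 cy0 cy1) (Dc * G')"
    unfolding fc_def
  proof (rule pencil_nullstellensatz[OF a])
    fix x0 x1 Y0 Y1 assume p: "pencil a x0 x1 Y0 Y1 = 0" and P: "Y0\<^sup>2 * (Y1 - Y0) \<noteq> 0"
    define t where "t = Y1 / Y0"
    define Q where "Q = t\<^sup>2 * (t - a) + (t - 1)"
    have Y: "Y0 \<noteq> 0" "Y1 = Y0 * t" "t - 1 \<noteq> 0" using P by (auto simp: t_def)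
    define l where "l = x1 / (t - 1)"
    have "pencil a x0 x1 (Y0 * 1) (Y0 * t) = Y0 ^ 3 * (x0 * (t - 1) - x1 * Q)" unfolding pencil_homogeneous by (simp add: pencil_def Q_def)
    then have "x0 * (t - 1) = x1 * Q" using p Y by simp
    then have x: "x0 = l * Q" "x1 = l * (t - 1)" using Y(3) by (simp_all add: l_def field_simps)
    have W: "W0 (\<lambda>x. x) x0 x1 Y0 Y1 = (l ^ k * Y0) * l ^ h * W0 (\<lambda>x. x) Q (t - 1) 1 t"
      "W1 (\<lambda>x. x) x0 x1 Y0 Y1 = (l ^ k * Y0) * W1 (\<lambda>x. x) Q (t - 1) 1 t"
      unfolding W0_def W1_def x hmg_scale Y(2) by (simp_all add: power_add algebra_simps)
    have "cox_subst (\<lambda>x. x) x0 x1 (W0 (\<lambda>x. x) x0 x1 Y0 Y1) (W1 (\<lambda>x. x) x0 x1 Y0 Y1) (Dc * G') = 0"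
      using V'[of l "l ^ k * Y0" t] unfolding W unfolding x by (simp add: pt_def Let_def Q_def)
    then show "cox_subst (\<lambda>x. x) x0 x1 Y0 Y1 (cox_subst ck cx0 cx1 (W0 ck cx0 cx1 cy0 cy1) (W1 ck cx0 cx1 cy0 cy1) (Dc * G')) = 0"
      unfolding rhom_cox_subst_comp[OF rhom_ck rhom_cox_subst[OF rhom_id(2)]] by (simp add: cox_subst_W cox_subst_gens)
  qed
  then have "cox_subst ck cx0 cx1 (A ck cx0 cx1 cy0 cy1) (B ck cx0 cx1 cy0 cy1) fc dvd
    cox_subst ck cx0 cx1 (A ck cx0 cx1 cy0 cy1) (B ck cx0 cx1 cy0 cy1)
      (cox_subst ck cx0 cx1 (W0 ck cx0 cx1 cy0 cy1) (W1 ck cx0 cx1 cy0 cy1) (Dc * G'))"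
    by (rule rhom_dvd[OF rhom_cox_subst[OF rhom_ck]])
  also have "\<dots> = cox_subst ck cx0 cx1 (Dc * cy0) (Dc * cy1) (Dc * G')"
    unfolding rhom_cox_subst_comp[OF rhom_ck rhom_cox_subst[OF rhom_ck]]
    by (simp only: cox_subst_gens[OF rhom_ck] cox_subst_W[OF rhom_ck] adj_W)
  also have "\<dots> = Dc ^ (N + 1) * G" by (simp add: rhom_mult[OF rhom_cox_subst] rhom_ck G' cox_subst_W)
  also have "cox_subst ck cx0 cx1 (A ck cx0 cx1 cy0 cy1) (B ck cx0 cx1 cy0 cy1) fc = Dc * F"
    unfolding fc_def pencil_adj_cox[symmetric] by (simp add: cox_hom rhom_ck)
  finally show ?thesis using F_dvd_D_cancel dvd_mult_right by blast
qed

lemma F_nonzero: "F \<noteq> 0"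
  using F_fibre_nonzero[of 0] by (auto simp: rhom_0[OF rhom_cox_subst])

text \<open>\<open>F\<close> generates the kernel of the parametrisation with indeterminate
  \<open>l\<close>, \<open>m\<close>, \<open>t\<close>, a homomorphism into a domain. The torus
  parameters are needed because the Cox cone over the curve has dimension three.\<close>

lemma F_prime: "prime_elem F"
proof (rule prime_elemI)
  define f where "f c = [:[:[:c:]:]:]" for c :: complex
  have f: "rhom f" unfolding f_def[abs_def] by (intro rhom_const_poly rhom_id)
  define \<Psi> where "\<Psi> = pt f [:[:0, 1:]:] [:0, 1:] [:[:[:0, 1:]:]:]"
  have \<Psi>: "rhom \<Psi>" unfolding \<Psi>_def by (rule rhom_pt[OF f])
  have \<Psi>F: "\<Psi> G = 0" if "F dvd G" for G
    using rhom_dvd[OF \<Psi> that] pt_F[OF f] by (simp add: \<Psi>_def)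
  have F\<Psi>: "F dvd G" if "\<Psi> G = 0" for G
  proof (rule F_dvd_if_vanishing)
    fix l m t :: complex
    define g where "g p = poly (poly (poly p [:[:m:]:]) [:l:]) t" for p
    have g: "rhom g" unfolding g_def[abs_def] by (intro rhom_comp[OF rhom_comp[OF rhom_poly rhom_poly] rhom_poly])
    have "g (\<Psi> G) = pt (\<lambda>x. x) l m t G" unfolding \<Psi>_def pt_comp[OF f g] by (simp add: g_def f_def)
    then show "pt (\<lambda>x. x) l m t G = 0" using that by (simp add: rhom_0[OF g])
  qed
  show "F \<noteq> 0" by (rule F_nonzero)
  show "\<not> F dvd 1" using \<Psi>F[of 1] rhom_1[OF \<Psi>] by auto
  fix u v assume "F dvd u * v"
  then have "\<Psi> u * \<Psi> v = 0" using \<Psi>F rhom_mult[OF \<Psi>] by metis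
  then show "F dvd u \<or> F dvd v" using F\<Psi> by auto
qed

lemma F_irreducible: "Factorial_Ring.irreducible F"
  by (rule prime_elem_imp_irreducible[OF F_prime])

section \<open>The function field\<close>

definition ev :: "cox_poly \<Rightarrow> complex poly" where "ev = pt (\<lambda>c. [:c:]) 1 1 [:0, 1:]"

lemma rhom_ev: "rhom ev"
  unfolding ev_def by (intro rhom_pt rhom_const_poly rhom_id)

text \<open>On bihomogeneous elements the torus parameters only contribute monomial factors, so the
  parameter \<open>t\<close> alone detects divisibility by \<open>F\<close>.\<close>

lemma ev_eq_0_iff: assumes G: "bihomogeneous h b c G" shows "ev G = 0 \<longleftrightarrow> F dvd G"
proof
  assume "F dvd G"
  moreover have "ev F = 0" unfolding ev_def by (rule pt_F[OF rhom_const_poly[OF rhom_id(2)]])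
  ultimately show "ev G = 0" using rhom_dvd[OF rhom_ev] by fastforce
next
  assume 0: "ev G = 0"
  show "F dvd G"
  proof (rule F_dvd_if_vanishing)
    fix l m t
    have "pt (\<lambda>x. x) 1 1 t G = poly (ev G) t"
      unfolding ev_def pt_comp[OF rhom_const_poly[OF rhom_id(2)] rhom_poly] by simp
    then show "pt (\<lambda>x. x) l m t G = 0" using 0 by (simp add: pt_scale[OF rhom_id(2) G, of l])
  qed
qed

lemma ev_D: "ev Dc \<noteq> 0"
proof -
  have r: "rhom (\<lambda>c::complex. [:c:])" by (intro rhom_const_poly rhom_id)
  define P where "P = [:0, 1:] - (1 :: complex poly)"
  define Q where "Q = [:0, 1:]\<^sup>2 * ([:0, 1:] - [:a:]) + P"
  have nz: "P - [:w:] * Q \<noteq> 0" for w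
  proof
    assume "P - [:w:] * Q = 0"
    then have "poly.coeff (P - [:w:] * Q) 1 = 0" "poly.coeff (P - [:w:] * Q) 3 = 0" by simp_all
    then show False by (simp add: P_def Q_def power2_eq_square numeral_3_eq_3)
  qed
  have "ev Dc = [:\<delta>:] * (\<Prod>j<4. (P - [:z j:] * Q) ^ n j)"
    unfolding ev_def pt_def Let_def cox_subst_W[OF r] D_factor[OF r] P_def[symmetric] Q_def[symmetric] mult_1_left ..
  moreover have "(\<Prod>j<4. (P - [:z j:] * Q) ^ n j) \<noteq> 0"
    by (rule ccontr) (use nz in \<open>simp only: prod_zero_iff finite_lessThan power_eq_0_iff, blast\<close>)
  ultimately show ?thesis using \<delta> by simp
qed

text \<open>\<open>A\<close> and \<open>B\<close> have the same bidegree, and their quotient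
  \<open>B / A\<close> restricts to \<open>t\<close>: the parametrisation is birational.\<close>

lemma ev_AB: "ev (A ck cx0 cx1 cy0 cy1) = ev Dc" "ev (B ck cx0 cx1 cy0 cy1) = ev Dc * [:0, 1:]"
  unfolding ev_def pt_def Let_def mult_1_left power_one cox_subst_W[OF rhom_const_poly[OF rhom_id(2)]]
    cox_subst_gens[OF rhom_const_poly[OF rhom_id(2)]] adj_W by (rule mult_1_right, rule refl)

lemma bihomogeneous_hmg_AB: "bihomogeneous h (int d * int k) (int d) (hmg ck d p (A ck cx0 cx1 cy0 cy1) (B ck cx0 cx1 cy0 cy1))"
  unfolding hmg_def
proof (rule bihomogeneous_sum)
  fix i assume i: "i \<in> {..d}"
  have "bihomogeneous h (0 + int (d - i) * int k + int i * int k) (0 + int (d - i) * 1 + int i * 1)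
    (ck (poly.coeff p i) * A ck cx0 cx1 cy0 cy1 ^ (d - i) * B ck cx0 cx1 cy0 cy1 ^ i)"
    by (intro bihomogeneous_mult bihomogeneous_power bihomogeneous_gens bihomogeneous_AB)
  then show "bihomogeneous h (int d * int k) (int d) (ck (poly.coeff p i) * A ck cx0 cx1 cy0 cy1 ^ (d - i) * B ck cx0 cx1 cy0 cy1 ^ i)"
    using i by (simp add: of_nat_diff algebra_simps)
qed

lemma ev_hmg_AB:
  assumes "degree p \<le> d"
  shows "ev (hmg ck d p (A ck cx0 cx1 cy0 cy1) (B ck cx0 cx1 cy0 cy1)) = ev Dc ^ d * p"
proof -
  have k: "(\<lambda>c. ev (ck c)) = (\<lambda>c. [:c:])"
    by (simp add: ev_def pt_def Let_def cox_subst_gens rhom_const_poly)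
  show ?thesis using hmg_scale[of "\<lambda>c. [:c:]" d p "ev Dc" 1 "[:0, 1:]"] hmg_1[OF rhom_id(2) assms]
    unfolding rhom_hmg[OF rhom_ev] ev_AB k by simp
qed

definition val :: "cox_poly \<times> cox_poly \<Rightarrow> complex poly fract" where "val x = Fract (ev (fst x)) (ev (snd x))"

definition cls :: "complex poly fract \<Rightarrow> (cox_poly \<times> cox_poly) set" where "cls r = {x \<in> fractions h F. val x = r}"

lemma fractions_ev:
  assumes "(G, H) \<in> fractions h F"
  obtains b c where "bihomogeneous h b c G" "bihomogeneous h b c H" "ev H \<noteq> 0"
  using assms ev_eq_0_iff unfolding fractions_def by blast

lemma fractions_evI: "bihomogeneous h b c G \<Longrightarrow> bihomogeneous h b c H \<Longrightarrow> ev H \<noteq> 0 \<Longrightarrow> (G, H) \<in> fractions h F"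
  using ev_eq_0_iff unfolding fractions_def by blast

lemma fraction_rel_val: "fraction_rel h F = {(x, y). x \<in> fractions h F \<and> y \<in> fractions h F \<and> val x = val y}"
proof -
  have "F dvd G * H' - G' * H \<longleftrightarrow> Fract (ev G) (ev H) = Fract (ev G') (ev H')"
    if GH: "(G, H) \<in> fractions h F" "(G', H') \<in> fractions h F" for G H G' H'
  proof -
    obtain b c where 1: "bihomogeneous h b c G" "bihomogeneous h b c H" "ev H \<noteq> 0" using GH(1) by (rule fractions_ev)
    obtain b' c' where 2: "bihomogeneous h b' c' G'" "bihomogeneous h b' c' H'" "ev H' \<noteq> 0" using GH(2) by (rule fractions_ev)
    have "bihomogeneous h (b + b') (c + c') (G * H' - G' * H)"
      using bihomogeneous_mult[OF 1(1) 2(2)] bihomogeneous_mult[OF 2(1) 1(2)] by (simp add: bihomogeneous_diff add.commute)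
    from ev_eq_0_iff[OF this] show ?thesis using 1(3) 2(3) by (simp add: eq_fract rhom_simps[OF rhom_ev])
  qed
  then show ?thesis unfolding fraction_rel_def val_def by auto
qed

lemma rel_cls: "x \<in> fractions h F \<Longrightarrow> fraction_rel h F `` {x} = cls (val x)"
  by (auto simp: fraction_rel_val cls_def)

text \<open>A fraction \<open>p / q\<close> in \<open>t\<close> is realised by \<open>p\<close> and
  \<open>q\<close> at \<open>B / A\<close>, with denominators cleared by a common power of
  \<open>A\<close>.\<close>

lemma cls_nonempty: "cls r \<noteq> {}"
proof (cases r)
  case (Fract p q)
  define d where "d = max (degree p) (degree q)"
  define G where "G p = hmg ck d p (A ck cx0 cx1 cy0 cy1) (B ck cx0 cx1 cy0 cy1)" for p
  have e: "ev (G p) = ev Dc ^ d * p" "ev (G q) = ev Dc ^ d * q"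
    unfolding G_def by (rule ev_hmg_AB, simp add: d_def)+
  have "(G p, G q) \<in> fractions h F"
    by (rule fractions_evI[of "int d * int k" "int d"]) (use Fract(2) ev_D in \<open>simp_all add: e, simp_all add: G_def bihomogeneous_hmg_AB\<close>)
  moreover have "val (G p, G q) = r" using Fract ev_D by (simp add: val_def e eq_fract mult_ac)
  ultimately show ?thesis by (auto simp: cls_def)
qed

lemma UN_cls:
  assumes "\<And>x. x \<in> cls r \<Longrightarrow> g x = C" shows "(\<Union>x\<in>cls r. g x) = C"
  using assms cls_nonempty[of r] by auto

lemma UN_cls_pair:
  assumes "\<And>G H G' H'. (G, H) \<in> cls r \<Longrightarrow> (G', H') \<in> cls r' \<Longrightarrow> g G H G' H' \<in> fractions h F \<and> val (g G H G' H') = v"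
  shows "(\<Union>(G, H)\<in>cls r. \<Union>(G', H')\<in>cls r'. fraction_rel h F `` {g G H G' H'}) = cls v"
proof (rule UN_cls)
  fix x assume x: "x \<in> cls r"
  obtain G H where GH: "x = (G, H)" by (cases x)
  have "(\<Union>(G', H')\<in>cls r'. fraction_rel h F `` {g G H G' H'}) = cls v"
  proof (rule UN_cls)
    fix y assume y: "y \<in> cls r'"
    obtain G' H' where "y = (G', H')" by (cases y)
    then show "(case y of (G', H') \<Rightarrow> fraction_rel h F `` {g G H G' H'}) = cls v"
      using assms[of G H G' H'] x y GH rel_cls[of "g G H G' H'"] by simp
  qed
  then show "(case x of (G, H) \<Rightarrow> \<Union>(G', H')\<in>cls r'. fraction_rel h F `` {g G H G' H'}) = cls v" by (simp add: GH)
qed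

lemma constant_fraction: "(ck c, 1) \<in> fractions h F" "val (ck c, 1) = Fract [:c:] 1"
  by (auto intro!: fractions_evI bihomogeneous_gens simp: val_def rhom_1[OF rhom_ev])
    (simp add: ev_def pt_def Let_def cox_subst_gens rhom_const_poly)

lemma function_field_rational: "rational_field (function_field h F) cls"
proof
  have fr: "cls (val x) \<in> fractions h F // fraction_rel h F" if "x \<in> fractions h F" for x
    using that rel_cls[OF that] by (metis quotientI)
  show "bij_betw cls UNIV (carrier (function_field h F))"
  proof (rule bij_betw_imageI)
    show "inj cls"
    proof (rule injI)
      fix r s assume "cls r = cls s"
      then show "r = s" using cls_nonempty[of r] by (auto simp: cls_def)
    qed
    have "cls r \<in> fractions h F // fraction_rel h F" for r
      using cls_nonempty[of r] fr by (auto simp: cls_def)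
    then show "range cls = carrier (function_field h F)"
      by (auto simp: function_field_def rel_cls elim!: quotientE)
  qed
  have m: "(G * G', H * H') \<in> fractions h F \<and> val (G * G', H * H') = r * s \<and>
      (G * H' + G' * H, H * H') \<in> fractions h F \<and> val (G * H' + G' * H, H * H') = r + s"
    if GH: "(G, H) \<in> cls r" "(G', H') \<in> cls s" for G H G' H' r s
  proof -
    have 0: "(G, H) \<in> fractions h F" "(G', H') \<in> fractions h F" "r = Fract (ev G) (ev H)" "s = Fract (ev G') (ev H')"
      using GH by (auto simp: cls_def val_def)
    obtain b c where 1: "bihomogeneous h b c G" "bihomogeneous h b c H" "ev H \<noteq> 0" using 0(1) by (rule fractions_ev)
    obtain b' c' where 2: "bihomogeneous h b' c' G'" "bihomogeneous h b' c' H'" "ev H' \<noteq> 0" using 0(2) by (rule fractions_ev)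
    have 3: "bihomogeneous h (b + b') (c + c') (H * H')" "ev (H * H') \<noteq> 0"
      using bihomogeneous_mult[OF 1(2) 2(2)] 1 2 by (simp_all add: rhom_mult[OF rhom_ev])
    have "bihomogeneous h (b + b') (c + c') (G' * H)" using bihomogeneous_mult[OF 2(1) 1(2)] by (simp add: add.commute)
    then have "(G * G', H * H') \<in> fractions h F" "(G * H' + G' * H, H * H') \<in> fractions h F"
      using bihomogeneous_mult[OF 1(1) 2(1)] bihomogeneous_mult[OF 1(1) 2(2)] 3 by (auto intro: fractions_evI bihomogeneous_add)
    then show ?thesis using 0(3,4) 1(3) 2(3) by (simp add: val_def rhom_simps[OF rhom_ev])
  qed
  fix r s
  show "cls r \<otimes>\<^bsub>function_field h F\<^esub> cls s = cls (r * s)"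
    unfolding function_field_def ring.simps monoid.simps by (rule UN_cls_pair) (use m in blast)
  show "cls r \<oplus>\<^bsub>function_field h F\<^esub> cls s = cls (r + s)"
    unfolding function_field_def ring.simps monoid.simps by (rule UN_cls_pair) (use m in blast)
next
  have k1: "ck 1 = 1" "ck 0 = 0" "[:1:] = (1 :: complex poly)" by (simp_all add: rhom_1[OF rhom_ck])
  have v: "val (1, 1) = 1" "val (0, 1) = 0" using constant_fraction(2)[of 1] constant_fraction(2)[of 0] by (simp_all add: k1 One_fract_def Zero_fract_def)
  show "\<one>\<^bsub>function_field h F\<^esub> = cls 1" "\<zero>\<^bsub>function_field h F\<^esub> = cls 0"
    using rel_cls[OF constant_fraction(1)[of 1]] rel_cls[OF constant_fraction(1)[of 0]] unfolding k1 v
    by (simp_all add: function_field_def)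
qed

lemma F_rational: "rational_curve h F"
proof -
  interpret rational_field "function_field h F" cls by (rule function_field_rational)
  have "constants h F = kk"
    unfolding constants_def kk_def ck_def[symmetric] by (simp add: rel_cls[OF constant_fraction(1)] constant_fraction(2))
  then show ?thesis unfolding rational_curve_def geometric_genus_def using genus_0 by simp
qed

end

section \<open>Points of the surface\<close>

lemma torus_relI:
  assumes "(x0, x1, y0, y1) \<in> cox_points" "(l * x0, l * x1, m * y0, m * y1 / l ^ e) \<in> cox_points" "l \<noteq> 0" "m \<noteq> 0"
  shows "((x0, x1, y0, y1), (l * x0, l * x1, m * y0, m * y1 / l ^ e)) \<in> torus_rel e"
  using assms unfolding torus_rel_def by blast

lemma torus_relE:
  assumes "(P, Q) \<in> torus_rel e"
  obtains x0 x1 y0 y1 l m where "P = (x0, x1, y0, y1)" "Q = (l * x0, l * x1, m * y0, m * y1 / l ^ e)"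
    "P \<in> cox_points" "Q \<in> cox_points" "l \<noteq> 0" "m \<noteq> 0"
  using assms unfolding torus_rel_def by blast

lemma torus_equiv: "equiv cox_points (torus_rel e)"
proof (rule equivI)
  show "torus_rel e \<subseteq> cox_points \<times> cox_points" by (auto simp: torus_rel_def)
  show "refl_on cox_points (torus_rel e)"
  proof (rule refl_onI)
    fix P :: cox_point assume P: "P \<in> cox_points"
    obtain x0 x1 y0 y1 where e: "P = (x0, x1, y0, y1)" by (cases P)
    show "(P, P) \<in> torus_rel e" using torus_relI[of x0 x1 y0 y1 1 1 e] P by (simp add: e)
  qed
  show "sym (torus_rel e)"
  proof (rule symI)
    fix P Q assume "(P, Q) \<in> torus_rel e"
    then obtain x0 x1 y0 y1 l m where P: "P = (x0, x1, y0, y1)" "Q = (l * x0, l * x1, m * y0, m * y1 / l ^ e)"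
      "P \<in> cox_points" "Q \<in> cox_points" "l \<noteq> 0" "m \<noteq> 0" by (rule torus_relE)
    have "P = (1 / l * (l * x0), 1 / l * (l * x1), 1 / m * (m * y0), 1 / m * (m * y1 / l ^ e) / (1 / l) ^ e)"
      using P(5,6) by (simp add: P(1) power_one_over)
    then show "(Q, P) \<in> torus_rel e"
      using torus_relI[of "l * x0" "l * x1" "m * y0" "m * y1 / l ^ e" "1 / l" "1 / m" e] P by simp
  qed
  show "trans (torus_rel e)"
  proof (rule transI)
    fix P Q R assume PQ: "(P, Q) \<in> torus_rel e" and QR: "(Q, R) \<in> torus_rel e"
    obtain x0 x1 y0 y1 l m where P: "P = (x0, x1, y0, y1)" "Q = (l * x0, l * x1, m * y0, m * y1 / l ^ e)"
      "P \<in> cox_points" "l \<noteq> 0" "m \<noteq> 0" using PQ by (rule torus_relE)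
    obtain u0 u1 v0 v1 l' m' where Q: "Q = (u0, u1, v0, v1)" "R = (l' * u0, l' * u1, m' * v0, m' * v1 / l' ^ e)"
      "R \<in> cox_points" "l' \<noteq> 0" "m' \<noteq> 0" using QR by (rule torus_relE)
    have R: "R = ((l' * l) * x0, (l' * l) * x1, (m' * m) * y0, (m' * m) * y1 / (l' * l) ^ e)"
      using P(2) Q(1,2) by (simp add: power_mult_distrib mult_ac)
    show "(P, R) \<in> torus_rel e" unfolding P(1) R
      by (rule torus_relI) (use P(3-5) Q(3-5) in \<open>simp_all only: P(1)[symmetric] R[symmetric], simp_all\<close>)
  qed
qed

context cusp_curve
begin

section \<open>The four cusps and the cuspidal configuration\<close>

definition cusp_rep :: "nat \<Rightarrow> cox_point" where "cusp_rep j = (1, z j, wz0 j, wz1 j)"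
definition cusp :: "nat \<Rightarrow> cox_point set" where "cusp j = torus_rel h `` {cusp_rep j}"

lemma cusp_rep_points: "j < 4 \<Longrightarrow> cusp_rep j \<in> cox_points"
  using z_det[of j] by (auto simp: cusp_rep_def cox_points_def)

lemma cusp_rep_in: "j < 4 \<Longrightarrow> cusp_rep j \<in> cusp j"
  unfolding cusp_def by (rule equiv_class_self[OF torus_equiv cusp_rep_points])

lemma F_cusp_rep: assumes "j < 4" shows "cox_subst id 1 (z j) (wz0 j) (wz1 j) F = 0"
  using arg_cong[OF F_fibre[OF assms, of 1 0], of "\<lambda>p. poly p 0"]
  unfolding rhom_cox_subst_comp[OF rhom_const_poly[OF rhom_id(2)] rhom_poly] by (simp add: id_def)

lemma cusp_in_cusps: assumes j: "j < 4" shows "cusp j \<in> cusps h F"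
proof -
  have f: "cusp_form (n j) (local_equation F (cusp_rep j))" unfolding cusp_rep_def by (rule cusp_form_local[OF j])
  obtain m where "n j = Suc m" using n_pos[OF j] gr0_conv_Suc by blast
  then have "local_mult (local_equation F (cusp_rep j)) = 2" using f cusp_form_mult by metis
  moreover have "cusp j \<in> hirzebruch h" unfolding cusp_def hirzebruch_def by (rule quotientI[OF cusp_rep_points[OF j]])
  moreover have "\<exists>(x0, x1, y0, y1)\<in>cusp j. cox_subst id x0 x1 y0 y1 F = 0"
    using cusp_rep_in[OF j] F_cusp_rep[OF j] unfolding cusp_rep_def by fast
  ultimately show ?thesis unfolding cusps_def singular_points_def curve_points_def
    using cusp_rep_in[OF j] cusp_form_irreducible[OF f] by (metis (no_types, lifting) le_refl mem_Collect_eq)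
qed

lemma singular_point_cusp: assumes p: "p \<in> singular_points h F" shows "\<exists>j<4. p = cusp j"
proof -
  obtain P where P: "P \<in> p" "2 \<le> local_mult (local_equation F P)" and "p \<in> hirzebruch h"
    using p unfolding singular_points_def curve_points_def by blast
  then obtain R where R: "R \<in> cox_points" "p = torus_rel h `` {R}" unfolding hirzebruch_def by (auto elim: quotientE)
  then have "(R, P) \<in> torus_rel h" using P(1) by simp
  then have PP: "P \<in> cox_points" and pP: "p = torus_rel h `` {P}"
    using equiv_class_eq[OF torus_equiv] R(2) by (auto simp: torus_rel_def)
  obtain x0 x1 y0 y1 where xy: "P = (x0, x1, y0, y1)" by (cases P)
  have nz: "(x0, x1) \<noteq> (0, 0)" "(y0, y1) \<noteq> (0, 0)" using PP by (auto simp: xy cox_points_def)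
  have "D (\<lambda>x. x) x0 x1 = 0" using smooth_off_fibres[OF nz] P(2) by (auto simp: xy)
  then obtain j where j: "j < 4" "x1 = z j * x0" using \<delta> by (auto simp: D_factor)
  have x0: "x0 \<noteq> 0" using j nz by auto
  obtain \<mu> where \<mu>: "y0 = \<mu> * x0 ^ h * wz0 j" "y1 = \<mu> * wz1 j"
    using singular_on_fibre[OF j(1) x0 j(2) nz(2)] P(2) by (auto simp: xy)
  have "(cusp_rep j, P) \<in> torus_rel h"
    using torus_relI[of 1 "z j" "wz0 j" "wz1 j" x0 "\<mu> * x0 ^ h" h] x0 nz \<mu> j PP cusp_rep_points[OF j(1)]
    by (auto simp: xy cusp_rep_def mult.commute)
  then have "p = cusp j" unfolding pP cusp_def by (rule equiv_class_eq[OF torus_equiv, symmetric])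
  then show ?thesis using j(1) by blast
qed

lemma cusps_F: "cusps h F = cusp ` {..<4}"
  using singular_point_cusp cusp_in_cusps unfolding cusps_def by blast

lemma cuspidal_F: "cuspidal_curve h F"
  unfolding cuspidal_curve_def using singular_point_cusp cusp_in_cusps by blast

lemma inj_cusp: "inj_on cusp {..<4}"
proof (rule inj_onI)
  fix i j :: nat assume "i \<in> {..<4}" "j \<in> {..<4}" and eq: "cusp i = cusp j"
  then have ij: "i < 4" "j < 4" by auto
  have "(cusp_rep i, cusp_rep j) \<in> torus_rel h"
    using eq cusp_rep_in[OF ij(2)] unfolding cusp_def by auto
  then have "z i = z j" by (auto simp: torus_rel_def cusp_rep_def)
  then show "i = j" by (rule z_inj[OF ij])
qed

lemma card_cusps: "card (cusps h F) = 4"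
  unfolding cusps_F by (simp add: card_image[OF inj_cusp])

lemma configuration_F:
  "has_cuspidal_configuration h F {#replicate (n 0) 2, replicate (n 1) 2, replicate (n 2) 2, replicate (n 3) 2#}"
proof -
  define ms where "ms p = replicate (n (inv_into {..<4} cusp p)) (2 :: nat)" for p
  have ms: "ms (cusp j) = replicate (n j) 2" if "j < 4" for j
    using inv_into_f_f[OF inj_cusp, of j] that by (simp add: ms_def)
  have "has_multiplicity_sequence F (cusp j) (ms (cusp j))" if j: "j < 4" for j
    unfolding has_multiplicity_sequence_def ms[OF j]
    using resolution_cusp_form[OF cusp_form_local[OF j] n_pos[OF j]] cusp_rep_in[OF j] omit_ending_ones_cusp[of "n j"]
    unfolding cusp_rep_def by metis
  moreover have "image_mset ms (mset_set (cusps h F)) = image_mset (\<lambda>j. ms (cusp j)) (mset_set {..<4})"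
    unfolding cusps_F by (simp add: image_mset_mset_set[OF inj_cusp, symmetric] multiset.map_comp o_def)
  moreover have "mset_set {..<4::nat} = {#0, 1, 2, 3#}" by (simp add: numeral_eq_Suc lessThan_Suc)
  ultimately show ?thesis unfolding has_cuspidal_configuration_def cusps_F using ms by (intro conjI exI[of _ ms]) auto
qed

lemma F_curve: "curve_of_type h (int k + 1 - int h) 3 F"
  unfolding curve_of_type_def using F_irreducible bihomogeneous_F by blast

end

section \<open>The real curve\<close>

lemma cox_coeff_sum: "cox_coeff (sum g A) i0 i1 j0 j1 = (\<Sum>x\<in>A. cox_coeff (g x) i0 i1 j0 j1)"
  by (simp add: cox_coeff_def coeff_sum)

lemma real_curve_mult: assumes "real_curve F" "real_curve G" shows "real_curve (F * G)"
  using assms unfolding real_curve_def by (simp add: cox_coeff_mult)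

lemma real_curve_sum: "(\<And>x. x \<in> A \<Longrightarrow> real_curve (g x)) \<Longrightarrow> real_curve (sum g A)"
  unfolding real_curve_def by (auto simp: cox_coeff_sum)

lemma real_curve_gens: "c \<in> \<real> \<Longrightarrow> real_curve (ck c)" "real_curve 1" "real_curve cx0" "real_curve cx1" "real_curve cy0" "real_curve cy1"
  by (simp_all add: real_curve_def cox_coeff_def ck_def cx0_def cx1_def cy0_def cy1_def coeff_pCons split: nat.split)

lemma real_curve_power: "real_curve F \<Longrightarrow> real_curve (F ^ m)"
  by (induct m) (simp_all add: real_curve_gens real_curve_mult)

lemma (in cusp_curve) real_F: "(\<And>i j. poly.coeff (poly.coeff \<Phi> i) j \<in> \<real>) \<Longrightarrow> real_curve F"
  unfolding F_def hmg_def by (intro real_curve_sum real_curve_mult real_curve_power real_curve_gens)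

text \<open>The real data are mapped coefficientwise to the complex numbers by \<open>r\<close>,
  \<open>R\<close> and \<open>S\<close>. The curve and the cusp vectors \<open>wz0\<close>,
  \<open>wz1\<close> are images of real polynomials and values, which gives the reality
  statements.\<close>

theorem cusp_curve_exists:
  fixes n :: "nat \<Rightarrow> nat"
  assumes h: "h = 0 \<or> h = 1" and k: "0 < k" and pos: "\<And>j. j < 4 \<Longrightarrow> 0 < n j"
    and n: "(\<Sum>j<4. n j) = 2 * k + h" "n 0 + n 1 \<le> k"
  shows "\<exists>F. curve_of_type h (int k + 1 - int h) 3 F \<and> real_curve F \<and>
           rational_curve h F \<and> cuspidal_curve h F \<and> card (cusps h F) = 4 \<and>
           has_cuspidal_configuration h F
             {#replicate (n 0) 2, replicate (n 1) 2, replicate (n 2) 2, replicate (n 3) 2#} \<and>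
           (\<forall>p\<in>cusps h F. has_real_coordinates p)"
proof -
  have "h = 0 \<or> h = 1 \<and> 0 < n 3" using h pos[of 3] by auto
  from matrix_exists[OF n k this] obtain m N00 N01 N10 N11 \<delta> where m: "1 < m" "m < 2"
    and deg: "degree N00 \<le> k + h" "degree N01 \<le> k + h" "degree N10 \<le> k" "degree N11 \<le> k"
    and \<delta>: "\<delta> \<noteq> 0" and det: "N00 * N11 - N01 * N10 = Polynomial.smult \<delta> (\<Prod>j<4. [:- zs m j, 1:] ^ n j)"
    and "\<forall>j<4. \<exists>c. poly c (zs m j) = qs m j \<and> [:- zs m j, 1:] ^ n j dvd pencil [:pa m:] 1 [:0, 1:] 1 c \<and>
       [:- zs m j, 1:] ^ n j dvd N00 + N01 * c \<and> [:- zs m j, 1:] ^ n j dvd N10 + N11 * c"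
    by blast
  then have "\<forall>j. \<exists>c. j < 4 \<longrightarrow> poly c (zs m j) = qs m j \<and> [:- zs m j, 1:] ^ n j dvd pencil [:pa m:] 1 [:0, 1:] 1 c \<and>
       [:- zs m j, 1:] ^ n j dvd N00 + N01 * c \<and> [:- zs m j, 1:] ^ n j dvd N10 + N11 * c" by blast
  from choice[OF this] obtain c where c: "\<And>j. j < 4 \<Longrightarrow> poly (c j) (zs m j) = qs m j"
      "\<And>j. j < 4 \<Longrightarrow> [:- zs m j, 1:] ^ n j dvd pencil [:pa m:] 1 [:0, 1:] 1 (c j)"
      "\<And>j. j < 4 \<Longrightarrow> [:- zs m j, 1:] ^ n j dvd N00 + N01 * c j" "\<And>j. j < 4 \<Longrightarrow> [:- zs m j, 1:] ^ n j dvd N10 + N11 * c j"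
    by blast
  have hk: "h \<le> k + 1" using h by auto
  have inj: "inj_on (zs m) {..<4}" using zs_inj[OF m] by (auto simp: inj_on_def)
  have "\<exists>\<Phi>. degree \<Phi> \<le> 3 \<and> (\<forall>i. degree (poly.coeff \<Phi> i) \<le> k + 1 - h + h * i) \<and>
    pencil [:[:pa m:]:] 1 [:[:0, 1:]:] [:N11, - N01:] [:- N10, N00:] = [:N00 * N11 - N01 * N10:] * \<Phi>"
    by (rule equation_exists[OF deg det \<delta> n(1) hk inj]) (use c in blast)
  then obtain \<Phi> where \<Phi>: "degree \<Phi> \<le> 3" "\<And>i. degree (poly.coeff \<Phi> i) \<le> k + 1 - h + h * i"
    "pencil [:[:pa m:]:] 1 [:[:0, 1:]:] [:N11, - N01:] [:- N10, N00:] = [:N00 * N11 - N01 * N10:] * \<Phi>" by blast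
  define r where "r = complex_of_real"
  have r: "rhom r" by (simp add: r_def rhom_def)
  define R where "R = map_poly r"
  have R: "rhom R" unfolding R_def by (rule rhom_map_poly[OF r])
  define S where "S = map_poly R"
  have S: "rhom S" unfolding S_def by (rule rhom_map_poly[OF R])
  have RS: "R (pCons x p) = pCons (r x) (R p)" "S (pCons p P) = pCons (R p) (S P)" for x p P
    unfolding S_def R_def by (rule map_poly_pCons_rhom, fact r, rule map_poly_pCons_rhom, fact R[unfolded R_def])
  have Rs: "R (Polynomial.smult x p) = Polynomial.smult (r x) (R p)" for x p
    using rhom_mult[OF R, of "[:x:]" p] by (simp add: RS rhom_0[OF R])
  have Rdeg: "degree (R p) \<le> d" if "degree p \<le> d" for p d
    using that by (intro degree_le) (simp add: R_def coeff_map_poly rhom_0[OF r] coeff_eq_0)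
  have Rp: "poly (R p) (r x) = r (poly p x)" for p x
    by (induct p) (simp_all add: RS rhom_0[OF R] rhom_simps[OF r])
  have lin: "R ([:- zs m j, 1:] ^ N) = [:- r (zs m j), 1:] ^ N" for j N
    by (simp only: rhom_power[OF R] RS rhom_0[OF R] rhom_1[OF r] rhom_uminus[OF r])
  interpret cusp_curve h k "r (pa m)" n "\<lambda>j. r (zs m j)" "\<lambda>j. r (qs m j)" "\<lambda>j. r (fst (Ts m j))" "\<lambda>j. r (snd (Ts m j))" "\<lambda>j. r (ks m j)"
    "\<lambda>j. R (c j)" "R N00" "R N01" "R N10" "R N11" "r \<delta>" "S \<Phi>"
  proof
    show "h \<le> k + 1" by fact
    show "r (pa m) \<noteq> 1" using pa_bounds[OF m] by (simp add: r_def)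
    show "(\<Sum>j<4. n j) = 2 * k + h" by fact
    show "degree (R N00) \<le> k + h" "degree (R N01) \<le> k + h" "degree (R N10) \<le> k" "degree (R N11) \<le> k"
      by (rule Rdeg, fact)+
    show "r \<delta> \<noteq> 0" using \<delta> by (simp add: r_def)
    show "R N00 * R N11 - R N01 * R N10 = Polynomial.smult (r \<delta>) (\<Prod>j<4. [:- r (zs m j), 1:] ^ n j)"
      using arg_cong[OF det, of R] by (simp only: Rs lin rhom_prod[OF R] rhom_diff[OF R] rhom_mult[OF R])
    show "degree (S \<Phi>) \<le> 3" using \<Phi>(1) by (intro degree_le) (simp add: S_def coeff_map_poly rhom_0[OF R] coeff_eq_0)
    show "degree (poly.coeff (S \<Phi>) i) \<le> k + 1 - h + h * i" for i
      using Rdeg[OF \<Phi>(2)[of i]] by (simp add: S_def coeff_map_poly rhom_0[OF R])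
    show "pencil [:[:r (pa m):]:] 1 [:[:0, 1:]:] [:R N11, - R N01:] [:- R N10, R N00:] = [:R N00 * R N11 - R N01 * R N10:] * S \<Phi>"
      using arg_cong[OF \<Phi>(3), of S] unfolding rhom_mult[OF S] rhom_pencil[OF S]
      by (simp only: RS rhom_0[OF R] rhom_0[OF S] rhom_1[OF S] rhom_1[OF r] rhom_0[OF r] rhom_1[OF R] rhom_uminus[OF R] rhom_diff[OF R] rhom_mult[OF R])
  next
    fix j :: nat assume j: "j < 4"
    show "0 < n j" by (rule pos[OF j])
    show "r (ks m j) \<noteq> 0" using ks_nonzero[OF m j] by (simp add: r_def)
    show "r (snd (Ts m j)) \<noteq> r (qs m j) * r (fst (Ts m j))"
      using qs_not_ramified[OF m j] unfolding rhom_mult[OF r, symmetric] by (simp add: r_def del: of_real_mult)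
    show "pencil (r (pa m)) 1 (r (zs m j)) Y0 Y1 = r (ks m j) * (Y1 * r (fst (Ts m j)) - Y0 * r (snd (Ts m j)))\<^sup>2 * (Y1 - r (qs m j) * Y0)" for Y0 Y1
      by (rule pencil_ramified[OF m r j])
    show "poly (R (c j)) (r (zs m j)) = r (qs m j)" unfolding Rp c(1)[OF j] ..
    show "[:- r (zs m j), 1:] ^ n j dvd pencil [:r (pa m):] 1 [:0, 1:] 1 (R (c j))"
      using rhom_dvd[OF R c(2)[OF j]] unfolding lin rhom_pencil[OF R]
      by (simp only: RS rhom_0[OF R] rhom_1[OF R] rhom_0[OF r] rhom_1[OF r])
    show "[:- r (zs m j), 1:] ^ n j dvd R N00 + R N01 * R (c j)" "[:- r (zs m j), 1:] ^ n j dvd R N10 + R N11 * R (c j)"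
      using rhom_dvd[OF R c(3)[OF j]] rhom_dvd[OF R c(4)[OF j]] unfolding lin rhom_add[OF R] rhom_mult[OF R] .
  next
    fix i j :: nat assume "i < 4" "j < 4" "r (zs m i) = r (zs m j)"
    then show "i = j" using zs_inj[OF m] by (simp add: r_def)
  qed
  have "real_curve F" by (rule real_F) (simp add: S_def R_def r_def coeff_map_poly rhom_0[OF R, unfolded R_def r_def])
  moreover have "has_real_coordinates p" if p: "p \<in> cusps h F" for p
  proof -
    obtain j where j: "j < 4" "p = cusp j" using p unfolding cusps_F by auto
    have w: "wz0 j = r (poly (N00 * [:fst (Ts m j):] + N01 * [:snd (Ts m j):]) (zs m j))"
      "wz1 j = r (poly (N10 * [:fst (Ts m j):] + N11 * [:snd (Ts m j):]) (zs m j))"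
      unfolding wz0_def wz1_def wp0_def wp1_def by (simp_all add: Rp rhom_simps[OF r])
    show ?thesis unfolding has_real_coordinates_def j(2)
      by (rule bexI[OF _ cusp_rep_in[OF j(1)]]) (simp add: cusp_rep_def w, simp add: r_def)
  qed
  ultimately show ?thesis using F_curve F_rational cuspidal_F card_cusps configuration_F by blast
qed

theorem proposition5p8:
  fixes h k n1 n2 n3 n4 :: nat
  assumes "h \<in> {0, 1}"
    and "2 \<le> k"
    and "0 < n1" and "0 < n2" and "0 < n3" and "0 < n4"
    and "n1 + n2 + n3 + n4 = 2 * k + h"
  shows "\<exists>F. curve_of_type h (int k + 1 - int h) 3 F \<and> real_curve F \<and>
           rational_curve h F \<and> cuspidal_curve h F \<and> card (cusps h F) = 4 \<and>
           has_cuspidal_configuration h F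
             {#replicate n1 2, replicate n2 2, replicate n3 2, replicate n4 2#} \<and>
           (\<forall>p\<in>cusps h F. has_real_coordinates p)"
proof -
  \<comment> \<open>Only the multiset of exponents matters. Once they are sorted, the two smallest
    have sum at most half of \<open>2 k + h\<close>, hence at most \<open>k\<close> as
    \<open>h\<close> is at most 1.\<close>
  define M where "M = {#n1, n2, n3, n4#}"
  define ns where "ns = sorted_list_of_multiset M"
  have ns: "mset ns = M" "sorted ns" by (simp_all add: ns_def)
  have "length ns = 4" using arg_cong[OF ns(1), of size] by (simp add: M_def)
  then obtain p0 p1 p2 p3 where e: "ns = [p0, p1, p2, p3]"
    by (auto simp: length_Suc_conv numeral_eq_Suc)
  define n where "n j = ns ! j" for j
  have n: "n 0 = p0" "n 1 = p1" "n 2 = p2" "n 3 = p3" by (simp_all add: n_def e numeral_eq_Suc)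
  have Mp: "{#p0, p1, p2, p3#} = {#n1, n2, n3, n4#}" using ns(1) by (simp add: e M_def)
  have sum: "p0 + p1 + p2 + p3 = 2 * k + h" using arg_cong[OF Mp, of sum_mset] assms(7) by simp
  have "\<forall>x\<in>#{#p0, p1, p2, p3#}. 0 < x" unfolding Mp using assms by simp
  then have pos: "0 < p0" "0 < p1" "0 < p2" "0 < p3" by simp_all
  have le: "p0 \<le> p1" "p1 \<le> p2" "p2 \<le> p3" using ns(2) by (simp_all add: e)
  have S: "(\<Sum>j<4. n j) = p0 + p1 + p2 + p3" by (simp add: numeral_eq_Suc lessThan_Suc n_def e)
  have h: "h = 0 \<or> h = 1" and k: "0 < k" using assms(1,2) by auto
  have "0 < n j" if "j < 4" for j using that pos n by (auto simp: less_4)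
  moreover have "(\<Sum>j<4. n j) = 2 * k + h" "n 0 + n 1 \<le> k" using S sum le h n by auto
  moreover have "{#replicate p0 2, replicate p1 2, replicate p2 2, replicate p3 (2 :: nat)#} =
      {#replicate n1 2, replicate n2 2, replicate n3 2, replicate n4 2#}"
    using arg_cong[OF Mp, of "image_mset (\<lambda>n. replicate n (2 :: nat))"] by simp
  ultimately show ?thesis using cusp_curve_exists[OF h k, of n] unfolding n by simp
qed

end
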